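(* For every finite symmetric quiver $Q$, the quadratic algebra $\mathcal A_Q$ is numerically Koszul, that is, the Poincaré series of $\mathcal A_Q$ and of its Koszul dual algebra $\mathcal A_Q^!$ satisfy $$P(\mathcal A_Q,x,q)\,P\bigl((\mathcal A_Q^!)^\vee,q^{-\frac12}x,q\bigr)=1$$ in $\mathbb{Q}((q^{1/2}))[[x_i: i\in Q_0]]$, where $q^{-1/2}x$ means that each $x_i$ is replaced by $q^{-1/2}x_i$.
   Context: All vector spaces are over $\mathbb{Q}$. $Q$ is a finite quiver with vertex set $Q_0$; $m_{i,j}$ is the number of arrows from $i$ to $j$; symmetric means $m_{i,j}=m_{j,i}$. $L=\mathbb{Z}^{Q_0}$ with standard basis $\alpha_i$; $x^{\mathbf d}=\prod_i x_i^{\mathbf d_i}$. Graded spaces are $V=\bigoplus_{(\mathbf d,n)\in L\times\mathbb{Z}}V_{\mathbf d}^n$, with the Koszul sign rule with respect to the $\mathbb{Z}$-degree. Graded dual: $(V^\vee)_{\mathbf d}^n=(V_{\mathbf d}^{-n})^*$. Poincaré series: $P(V,x,q)=\sum_{\mathbf d}\sum_k\dim(V_{\mathbf d}^k)(-q^{1/2})^{-k}x^{\mathbf d}$. The algebra $\mathcal A_Q$ is the associative algebra with generators $a_{i,k}$ ($i\in Q_0$, $k\ge0$) of degree $(\alpha_i,-2k-m_{i,i})$ and relations $a_{i,k_1}a_{j,k_2}=(-1)^{m_{i,i}m_{j,j}}a_{j,k_2}a_{i,k_1}$ for all $i,j,k_1,k_2$, and $\sum_{k_1+k_2=k}\binom{k_2}{p}a_{i,k_1}a_{j,k_2}=0$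 for all $i,j\in Q_0$, $k\ge0$, $0\le p<m_{i,j}$. Let $V_Q$ be the span of the $a_{i,k}$ and $R\subset V_Q^{\otimes2}$ the span of the relations. Koszul dual algebra: $\mathcal A_Q^!=T(W)/(R^\perp)$, where $W$ has basis $b_{i,k}$ (dual to $a_{i,k}$) placed in degree $(\alpha_i,2k+m_{i,i}+1)$, and $R^\perp\subset W^{\otimes2}$ is the annihilator of $R$ under the pairing $\langle b_{i,k}\otimes b_{j,l},a_{i',k'}\otimes a_{j',l'}\rangle=(-1)^{m_{i,i}}\delta_{ii'}\delta_{kk'}\delta_{jj'}\delta_{ll'}$ (the Koszul sign coming from the shift). *)

theory Defs
  imports
    "HOL-Library.Poly_Mapping"
    "HOL-Computational_Algebra.Formal_Laurent_Series"
    "HOL-Algebra.QuotRing"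
    "Jordan_Normal_Form.VS_Connect"
    "Graph_Theory.Digraph"
begin

section \<open>Vector spaces and algebras over the rationals\<close>

text \<open>
  Vector spaces are records of type \<open>(rat, 'a) module\<close> satisfying
  \<^term>\<open>vectorspace class_ring\<close>; an associative algebra is such a record in which the fields
  \<open>mult\<close> and \<open>one\<close> are used as well.
\<close>

definition rat_space :: "(rat, rat) module" where
  "rat_space = \<lparr>carrier = UNIV, mult = (*), one = 1, zero = 0, add = (+), smult = (*)\<rparr>"

text \<open>Functionals are made extensional so that they are determined by their values on the space.
  The fields \<open>mult\<close> and \<open>one\<close> play no role.\<close>

definition dual_space :: "(rat, 'a, 'z) module_scheme \<Rightarrow> (rat, 'a \<Rightarrow> rat) module" where
  "dual_space V =
    \<lparr>carrier = module_hom class_ring V rat_space \<inter> extensional (carrier V),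
     mult = undefined, one = undefined,
     zero = (\<lambda>v\<in>carrier V. 0),
     add = (\<lambda>f g. \<lambda>v\<in>carrier V. f v + g v),
     smult = (\<lambda>c f. \<lambda>v\<in>carrier V. c * f v)\<rparr>"

definition quotient_algebra :: "(rat, 'a) module \<Rightarrow> 'a set \<Rightarrow> (rat, 'a set) module" where
  "quotient_algebra A I =
    \<lparr>carrier = carrier (A Quot I), mult = mult (A Quot I), one = one (A Quot I),
     zero = zero (A Quot I), add = add (A Quot I),
     smult = (\<lambda>c X. \<Union>a\<in>X. I +>\<^bsub>A\<^esub> (c \<odot>\<^bsub>A\<^esub> a))\<rparr>"

section \<open>The tensor algebra on a set of generators\<close>

text \<open>Lists form a monoid under concatenation, so that \<open>'a list \<Rightarrow>\<^sub>0 rat\<close> with the convolution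
  product of \<^theory>\<open>HOL-Library.Poly_Mapping\<close> is the free associative algebra on \<open>'a\<close>.\<close>

instantiation list :: (type) monoid_add
begin

definition zero_list_def: "0 = []"
definition plus_list_def: "xs + ys = xs @ ys"

instance
  by standard (simp_all add: zero_list_def plus_list_def)

end

definition tensor_algebra :: "'a set \<Rightarrow> (rat, 'a list \<Rightarrow>\<^sub>0 rat) module" where
  "tensor_algebra X =
    \<lparr>carrier = {f. Poly_Mapping.keys f \<subseteq> lists X}, mult = (*), one = 1, zero = 0, add = (+),
     smult = (\<lambda>c. Poly_Mapping.map ((*) c))\<rparr>"

definition tensor_square :: "'a set \<Rightarrow> ('a list \<Rightarrow>\<^sub>0 rat) set" where
  "tensor_square X = {f \<in> carrier (tensor_algebra X). \<forall>w\<in>Poly_Mapping.keys f. length w = 2}"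

section \<open>Quivers\<close>

definition num_arrows :: "('v, 'e) pre_digraph \<Rightarrow> 'v \<Rightarrow> 'v \<Rightarrow> nat" where
  "num_arrows Q i j = card {e \<in> arcs Q. tail Q e = i \<and> head Q e = j}"

text \<open>Unlike \<^const>\<open>Digraph.symmetric\<close>, this takes multiplicities into account.\<close>

definition symmetric_quiver :: "('v, 'e) pre_digraph \<Rightarrow> bool" where
  "symmetric_quiver Q \<longleftrightarrow>
    (\<forall>i\<in>verts Q. \<forall>j\<in>verts Q. num_arrows Q i j = num_arrows Q j i)"

section \<open>The algebra of a quiver and its Koszul dual\<close>

text \<open>The pair \<open>(i, k)\<close> stands for the generator \<open>a\<^bsub>i,k\<^esub>\<close> as well as for the dual generator
  \<open>b\<^bsub>i,k\<^esub>\<close>; the two tensor algebras differ only in their cohomological degrees.\<close>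

definition gens :: "('v, 'e) pre_digraph \<Rightarrow> ('v \<times> nat) set" where
  "gens Q = verts Q \<times> UNIV"

abbreviation quiver_tensors :: "('v, 'e) pre_digraph \<Rightarrow> (rat, ('v \<times> nat) list \<Rightarrow>\<^sub>0 rat) module" where
  "quiver_tensors Q \<equiv> tensor_algebra (gens Q)"

definition deg_a :: "('v, 'e) pre_digraph \<Rightarrow> 'v \<times> nat \<Rightarrow> int" where
  "deg_a Q = (\<lambda>(i, k). - 2 * int k - int (num_arrows Q i i))"

definition deg_b :: "('v, 'e) pre_digraph \<Rightarrow> 'v \<times> nat \<Rightarrow> int" where
  "deg_b Q = (\<lambda>(i, k). 2 * int k + int (num_arrows Q i i) + 1)"

definition relations :: "('v, 'e) pre_digraph \<Rightarrow> (('v \<times> nat) list \<Rightarrow>\<^sub>0 rat) set" where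
  "relations Q =
    {Poly_Mapping.single [(i, k1), (j, k2)] 1
       - Poly_Mapping.single [(j, k2), (i, k1)] ((- 1) ^ (num_arrows Q i i * num_arrows Q j j))
      | i j k1 k2. i \<in> verts Q \<and> j \<in> verts Q}
    \<union> {\<Sum>(k1, k2)\<in>{(k1, k2). k1 + k2 = k}.
         Poly_Mapping.single [(i, k1), (j, k2)] (of_nat (k2 choose p))
      | i j k p. i \<in> verts Q \<and> j \<in> verts Q \<and> p < num_arrows Q i j}"

definition relation_space :: "('v, 'e) pre_digraph \<Rightarrow> (('v \<times> nat) list \<Rightarrow>\<^sub>0 rat) set" where
  "relation_space Q = LinearCombinations.module.span class_ring (quiver_tensors Q) (relations Q)"

text \<open>The pairing of \<open>b\<^bsub>i,k\<^esub> \<otimes> b\<^bsub>j,l\<^esub>\<close> with \<open>a\<^bsub>i',k'\<^esub> \<otimes> a\<^bsub>j',l'\<^esub>\<close>, extended bilinearly.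
  The sign is the Koszul sign of the degree shift; its exponent is attached to the first letter.
  Only words of length two matter.\<close>

definition word_pairing ::
  "('v, 'e) pre_digraph \<Rightarrow> ('v \<times> nat) list \<Rightarrow> ('v \<times> nat) list \<Rightarrow> rat" where
  "word_pairing Q u w = (if u = w then (- 1) ^ num_arrows Q (fst (hd u)) (fst (hd u)) else 0)"

definition pairing ::
  "('v, 'e) pre_digraph \<Rightarrow> (('v \<times> nat) list \<Rightarrow>\<^sub>0 rat) \<Rightarrow> (('v \<times> nat) list \<Rightarrow>\<^sub>0 rat) \<Rightarrow> rat" where
  "pairing Q g f =
    (\<Sum>u\<in>Poly_Mapping.keys g. \<Sum>w\<in>Poly_Mapping.keys f.
      Poly_Mapping.lookup g u * Poly_Mapping.lookup f w * word_pairing Q u w)"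

definition annihilator :: "('v, 'e) pre_digraph \<Rightarrow> (('v \<times> nat) list \<Rightarrow>\<^sub>0 rat) set" where
  "annihilator Q = {g \<in> tensor_square (gens Q). \<forall>f\<in>relation_space Q. pairing Q g f = 0}"

definition quiver_algebra ::
  "('v, 'e) pre_digraph \<Rightarrow> (rat, (('v \<times> nat) list \<Rightarrow>\<^sub>0 rat) set) module" where
  "quiver_algebra Q = quotient_algebra (quiver_tensors Q) (Idl\<^bsub>quiver_tensors Q\<^esub> (relation_space Q))"

definition koszul_dual_algebra ::
  "('v, 'e) pre_digraph \<Rightarrow> (rat, (('v \<times> nat) list \<Rightarrow>\<^sub>0 rat) set) module" where
  "koszul_dual_algebra Q = quotient_algebra (quiver_tensors Q) (Idl\<^bsub>quiver_tensors Q\<^esub> (annihilator Q))"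

section \<open>Gradings\<close>

text \<open>
  All weights that occur are sums of standard basis vectors \<open>\<alpha>\<^bsub>i\<^esub>\<close>; they are
  represented by \<open>'v \<Rightarrow>\<^sub>0 nat\<close>, which also serves as the type of exponents of monomials in the
  \<open>x\<^bsub>i\<^esub>\<close>. A graded space is the family of its homogeneous components.
\<close>

type_synonym ('v, 'a) graded_space = "('v \<Rightarrow>\<^sub>0 nat) \<Rightarrow> int \<Rightarrow> (rat, 'a) module"

definition weight :: "('v \<times> nat) list \<Rightarrow> 'v \<Rightarrow>\<^sub>0 nat" where
  "weight w = (\<Sum>(i, k)\<leftarrow>w. Poly_Mapping.single i 1)"

definition tensor_component ::
  "('v, 'e) pre_digraph \<Rightarrow> ('v \<times> nat \<Rightarrow> int) \<Rightarrow> ('v \<Rightarrow>\<^sub>0 nat) \<Rightarrow> int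
    \<Rightarrow> (('v \<times> nat) list \<Rightarrow>\<^sub>0 rat) set" where
  "tensor_component Q \<delta> d n =
    {f \<in> carrier (quiver_tensors Q). \<forall>w\<in>Poly_Mapping.keys f. weight w = d \<and> (\<Sum>x\<leftarrow>w. \<delta> x) = n}"

definition quiver_algebra_graded ::
  "('v, 'e) pre_digraph \<Rightarrow> ('v, (('v \<times> nat) list \<Rightarrow>\<^sub>0 rat) set) graded_space" where
  "quiver_algebra_graded Q d n =
    (quiver_algebra Q)\<lparr>carrier :=
      (\<lambda>f. Idl\<^bsub>quiver_tensors Q\<^esub> (relation_space Q) +>\<^bsub>quiver_tensors Q\<^esub> f) ` tensor_component Q (deg_a Q) d n\<rparr>"

definition koszul_dual_algebra_graded ::
  "('v, 'e) pre_digraph \<Rightarrow> ('v, (('v \<times> nat) list \<Rightarrow>\<^sub>0 rat) set) graded_space" where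
  "koszul_dual_algebra_graded Q d n =
    (koszul_dual_algebra Q)\<lparr>carrier :=
      (\<lambda>f. Idl\<^bsub>quiver_tensors Q\<^esub> (annihilator Q) +>\<^bsub>quiver_tensors Q\<^esub> f) ` tensor_component Q (deg_b Q) d n\<rparr>"

definition graded_dual :: "('v, 'a) graded_space \<Rightarrow> ('v, 'a \<Rightarrow> rat) graded_space" where
  "graded_dual V d n = dual_space (V d (- n))"

section \<open>Power series and Poincare series\<close>

text \<open>
  A power series in the \<open>x\<^bsub>i\<^esub>\<close> is the function sending an exponent to its coefficient; the
  coefficients are Laurent series whose variable \<^const>\<open>fls_X\<close> stands for \<open>q\<^bsup>1/2\<^esup>\<close>.
\<close>

type_synonym 'v power_series = "('v \<Rightarrow>\<^sub>0 nat) \<Rightarrow> rat fls"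

definition ps_mult :: "'v power_series \<Rightarrow> 'v power_series \<Rightarrow> 'v power_series" where
  "ps_mult F G d = (\<Sum>(d1, d2)\<in>{(d1, d2). d1 + d2 = d}. F d1 * G d2)"

definition ps_one :: "'v power_series" where
  "ps_one d = (if d = 0 then 1 else 0)"

definition ps_rescale :: "rat fls \<Rightarrow> 'v power_series \<Rightarrow> 'v power_series" where
  "ps_rescale c F d = c ^ (\<Sum>i\<in>Poly_Mapping.keys d. Poly_Mapping.lookup d i) * F d"

text \<open>The term \<open>(-q\<^bsup>1/2\<^esup>)\<^bsup>-k\<^esup>\<close> contributes to the coefficient of \<open>q\<^bsup>n/2\<^esup>\<close> for \<open>n = -k\<close>.
  \<^const>\<open>Abs_fls\<close> is meaningful when, for each weight, only finitely many components of positive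
  degree are nonzero; here all components of positive degree vanish.\<close>

definition poincare_series :: "('v, 'a) graded_space \<Rightarrow> 'v power_series" where
  "poincare_series V d =
    Abs_fls (\<lambda>n. (- 1) powi n * of_nat (vectorspace.dim class_ring (V d (- n))))"

end

theory Submission
  imports Defs "HOL-Library.Function_Algebras"
begin

text \<open>
  Fix a weight \<open>d\<close> of total size \<open>n\<close> and consider functions on the words of weight \<open>d\<close> in the letters
  \<open>(i, k)\<close>. For \<open>U \<subseteq> {0, \<dots>, n - 2}\<close> let \<open>Y\<^sub>U\<close> be the space of functions that satisfy the quadratic
  relations at all pairs of neighbouring positions \<open>(p, p + 1)\<close> with \<open>p \<notin> U\<close>. Then \<open>Y\<close> at \<open>U = {}\<close> is
  the dual of a component of the algebra, and all functions modulo the sum of the \<open>Y\<^sub>U\<close> with one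
  position missing from \<open>U\<close> is a component of the Koszul dual (up to a sign rule that can be gauged
  away). In terms of generating functions the moment relation of order \<open>m\<close> says divisibility by
  \<open>(z\<^sub>p - z\<^sub>p\<^sub>+\<^sub>1)\<^sup>m\<close>.

  The spaces \<open>Y\<^sub>U\<close> with the simplicial coboundary in \<open>U\<close> form a complex that is exact below the top
  degree. For distinct letters \<open>Y\<^sub>U\<close> consists of cochains on chains of subsets of the set \<open>L\<close> of letters
  whose value on a chain \<open>C\<close> is a polynomial divisible by \<open>(u\<^sub>a - u\<^sub>b)\<^sup>\<mu>\<close> for all \<open>a, b\<close> not separated by
  \<open>C\<close>; exactness follows by raising the multiplicities \<open>\<mu>\<close> one at a time, since the quotient by
  \<open>u\<^sub>a - u\<^sub>b\<close> is the same complex for \<open>L\<close> with \<open>a\<close> and \<open>b\<close> merged. Words with repeated letters are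
  treated by averaging over labellings.

  Hence the dimension of the Koszul dual component is an alternating sum of the \<open>dim Y\<^sub>U\<close>. Splitting
  words at the least element of \<open>U\<close> gives \<open>Y\<^sub>U\<close> as a sum of tensor products of \<open>Y\<close> at \<open>{}\<close> and \<open>Y\<close>
  at the shifted rest of \<open>U\<close>, and the resulting recursion is the claimed identity of Poincare series.
\<close>

text \<open>Cutting words at the positions in \<open>U\<close> makes \<open>Y\<^sub>U\<close> dual
  to a sum of tensor products of components of the algebra, and adding a cut is dual to multiplying
  two neighbouring factors. The complex is thus the dual of the bar complex, and its exactness below
  the top in all weights is the Koszul property itself; the numerical identity is its Euler
  characteristic. The induction starts at multiplicity zero with the augmented cochain complex of
  the chains of proper nonempty subsets of \<open>L\<close>. They triangulate a sphere of dimension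
  \<open>card L - 2\<close>, whose reduced cohomology lives in the top degree. Merging adds up
  multiplicities and so leaves the class given by a quiver, which is why they are arbitrary
  functions on ordered pairs. Repeated letters are the obstacle to working with words directly: an
  exchange of equal colours is invisible in the sequence of colours, so cuts are not subsets of a
  fixed set. Distinct labels repair this, and the average over them divides by their number, which
  uses characteristic zero.\<close>

abbreviation "lookup \<equiv> Poly_Mapping.lookup"
abbreviation "keys \<equiv> Poly_Mapping.keys"
abbreviation "single \<equiv> Poly_Mapping.single"

section \<open>Cochains on chains of subsets\<close>

text \<open>The sign is the position of the deleted element. Any order is allowed because the same
  operator serves for sets of positions in a word and for chains of sets ordered by
  inclusion.\<close>

definition coboundary :: "('x::order set \<Rightarrow> 'r::comm_ring_1) \<Rightarrow> 'x set \<Rightarrow> 'r" where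
  "coboundary X U = (\<Sum>i\<in>U. (- 1) ^ card {j\<in>U. j < i} * X (U - {i}))"

definition totally_ordered :: "'x::order set \<Rightarrow> bool" where
  "totally_ordered U \<longleftrightarrow> (\<forall>i\<in>U. \<forall>j\<in>U. i \<le> j \<or> j \<le> i)"

lemma totally_orderedD:
  "\<lbrakk>totally_ordered U; i \<in> U; j \<in> U\<rbrakk> \<Longrightarrow> i < j \<or> i = j \<or> j < i"
  unfolding totally_ordered_def less_le by blast

lemma totally_ordered_subset: "totally_ordered U \<Longrightarrow> V \<subseteq> U \<Longrightarrow> totally_ordered V"
  unfolding totally_ordered_def by blast

lemma coboundary_cong:
  "(\<And>i. i \<in> U \<Longrightarrow> X (U - {i}) = Y (U - {i})) \<Longrightarrow> coboundary X U = coboundary Y U"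
  unfolding coboundary_def by (intro sum.cong) auto

lemma coboundary_diff: "coboundary (\<lambda>U. X U - Y U) U = coboundary X U - coboundary Y U"
  unfolding coboundary_def by (simp add: algebra_simps sum_subtractf)

lemma coboundary_add: "coboundary (\<lambda>U. X U + Y U) U = coboundary X U + coboundary Y U"
  unfolding coboundary_def by (simp add: algebra_simps sum.distrib)

lemma coboundary_scale: "coboundary (\<lambda>U. c * X U) U = c * coboundary X U"
  unfolding coboundary_def by (simp add: sum_distrib_left algebra_simps)

text \<open>Order embeddings keep positions, hence signs. This moves coboundaries from sets of
  positions to chains of cuts, and from chains in a merged set to chains in
  \<open>L\<close>.\<close>

lemma coboundary_image:
  assumes "inj_on f U" "\<And>i j. i \<in> U \<Longrightarrow> j \<in> U \<Longrightarrow> f i < f j \<longleftrightarrow> i < j"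
  shows "coboundary X (f ` U) = coboundary (\<lambda>V. X (f ` V)) U"
proof -
  have "coboundary X (f ` U) = (\<Sum>i\<in>U. (- 1) ^ card {j\<in>f ` U. j < f i} * X (f ` U - {f i}))"
    unfolding coboundary_def using assms(1) by (simp add: sum.reindex)
  also have "\<dots> = coboundary (\<lambda>V. X (f ` V)) U"
    unfolding coboundary_def
  proof (rule sum.cong)
    fix i assume i: "i \<in> U"
    have "{j\<in>f ` U. j < f i} = f ` {j\<in>U. j < i}" using assms(2) i by auto
    moreover have "card (f ` {j\<in>U. j < i}) = card {j\<in>U. j < i}"
      using assms(1) by (intro card_image) (auto simp: inj_on_def)
    moreover have "f ` U - {f i} = f ` (U - {i})" using assms(1) i by (auto simp: inj_on_def)
    ultimately show "(- 1) ^ card {j\<in>f ` U. j < f i} * X (f ` U - {f i})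
      = (- 1) ^ card {j\<in>U. j < i} * X (f ` (U - {i}))" by simp
  qed simp
  finally show ?thesis .
qed

text \<open>Deleting two elements in either order gives the same face with opposite signs, since
  removing the smaller one lowers the position of the larger one by one.\<close>

lemma coboundary_coboundary:
  fixes X :: "'x::order set \<Rightarrow> 'r::comm_ring_1"
  assumes fin: "finite U" and tot: "totally_ordered U"
  shows "coboundary (coboundary X) U = 0"
proof -
  define s where "s = (\<lambda>V (i::'x). (- 1) ^ card {j\<in>V. j < i} :: 'r)"
  define F where "F = (\<lambda>(i, j). s U i * (s (U - {i}) j * X (U - {i} - {j})))"
  have "coboundary (coboundary X) U = (\<Sum>i\<in>U. \<Sum>j\<in>U - {i}. F (i, j))"
    unfolding coboundary_def F_def s_def by (simp add: sum_distrib_left)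
  also have "\<dots> = (\<Sum>p\<in>(SIGMA i:U. U - {i}). F p)"
    using fin by (subst sum.Sigma) auto
  also have "(SIGMA i:U. U - {i}) = {(i, j). i \<in> U \<and> j \<in> U \<and> j < i} \<union> {(i, j). i \<in> U \<and> j \<in> U \<and> i < j}"
    using totally_orderedD[OF tot] by auto
  also have "(\<Sum>p\<in>\<dots>. F p) = (\<Sum>p\<in>{(i, j). i \<in> U \<and> j \<in> U \<and> j < i}. F p) + (\<Sum>p\<in>{(i, j). i \<in> U \<and> j \<in> U \<and> i < j}. F p)"
    by (intro sum.union_disjoint finite_subset[OF _ finite_cartesian_product[OF fin fin]]) auto
  also have "(\<Sum>p\<in>{(i, j). i \<in> U \<and> j \<in> U \<and> i < j}. F p) = (\<Sum>(i, j)\<in>{(i, j). i \<in> U \<and> j \<in> U \<and> j < i}. F (j, i))"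
    by (rule sum.reindex_bij_witness[of _ "\<lambda>(i, j). (j, i)" "\<lambda>(i, j). (j, i)"]) auto
  also have "\<dots> = (\<Sum>p\<in>{(i, j). i \<in> U \<and> j \<in> U \<and> j < i}. - F p)"
  proof (rule sum.cong, simp, clarify)
    fix i j assume ij: "i \<in> U" "j \<in> U" "j < i"
    have "{l\<in>U - {i}. l < j} = {l\<in>U. l < j}" using ij by auto
    hence 1: "s (U - {i}) j = s U j" unfolding s_def by simp
    have "{l\<in>U. l < i} = insert j {l\<in>U - {j}. l < i}" using ij by auto
    hence "card {l\<in>U. l < i} = Suc (card {l\<in>U - {j}. l < i})" using fin by simp
    hence 2: "s U i = - s (U - {j}) i" unfolding s_def by simp
    have 3: "U - {j} - {i} = U - {i} - {j}" by auto
    show "F (j, i) = - F (i, j)" unfolding F_def using 1 2 3 by simp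
  qed
  also have "(\<Sum>p\<in>{(i, j). i \<in> U \<and> j \<in> U \<and> j < i}. F p) + \<dots> = 0"
    by (simp add: sum_negf)
  finally show ?thesis .
qed

text \<open>Isolates the face opposite the new element, so that a cocycle condition on
  \<open>insert p U\<close> can be solved for \<open>X U\<close>.\<close>

lemma coboundary_insert:
  fixes X :: "'x::order set \<Rightarrow> 'r::comm_ring_1"
  assumes fin: "finite U" and p: "p \<notin> U"
  shows "coboundary X (insert p U) = (- 1) ^ card {j\<in>U. j < p} * X U
     + (\<Sum>i\<in>U. (- 1) ^ (card {j\<in>U. j < i} + (if p < i then 1 else 0)) * X (insert p (U - {i})))"
proof -
  have 1: "{j \<in> insert p U. j < p} = {j\<in>U. j < p}" by auto
  have 2: "insert p U - {p} = U" using p by auto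
  have 3: "card {j \<in> insert p U. j < i} = card {j\<in>U. j < i} + (if p < i then 1 else 0)" for i
  proof (cases "p < i")
    case True
    hence "{j \<in> insert p U. j < i} = insert p {j\<in>U. j < i}" by auto
    thus ?thesis using True fin p by simp
  next
    case False
    hence "{j \<in> insert p U. j < i} = {j\<in>U. j < i}" by auto
    thus ?thesis using False by simp
  qed
  have 4: "insert p U - {i} = insert p (U - {i})" if "i \<in> U" for i using that p by auto
  show ?thesis unfolding coboundary_def using fin p
    by (simp only: sum.insert 1 2 3) (simp add: 4 cong: sum.cong)
qed

text \<open>The simplices of the barycentric subdivision of the boundary of the simplex on
  \<open>L\<close>. The empty chain is included, so the complex is the augmented one.\<close>

definition chain_in :: "'l set \<Rightarrow> 'l set set \<Rightarrow> bool" where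
  "chain_in L C \<longleftrightarrow> (\<forall>A\<in>C. A \<subseteq> L \<and> A \<noteq> {} \<and> A \<noteq> L) \<and> totally_ordered C"

lemma chain_in_subset: "chain_in L C \<Longrightarrow> D \<subseteq> C \<Longrightarrow> chain_in L D"
  unfolding chain_in_def using totally_ordered_subset by blast

lemma chain_in_insert:
  assumes "chain_in L C" "P \<subseteq> L" "P \<noteq> {}" "P \<noteq> L" "\<And>A. A \<in> C \<Longrightarrow> A \<subseteq> P \<or> P \<subseteq> A"
  shows "chain_in L (insert P C)"
  using assms unfolding chain_in_def totally_ordered_def by auto

lemma chain_in_finite: "finite L \<Longrightarrow> chain_in L C \<Longrightarrow> finite C"
  unfolding chain_in_def by (rule finite_subset[of C "Pow L"]) auto

lemma chain_in_cases: "\<lbrakk>chain_in L C; A \<in> C; B \<in> C\<rbrakk> \<Longrightarrow> A \<subset> B \<or> A = B \<or> B \<subset> A"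
  unfolding chain_in_def using totally_orderedD by blast

lemma chain_in_Union:
  assumes "finite C" "chain_in L C" "C \<noteq> {}"
  shows "\<Union>C \<in> C"
proof -
  have "\<Union>C \<in> C" if "finite C" "C \<noteq> {}" "\<forall>A\<in>C. \<forall>B\<in>C. A \<subseteq> B \<or> B \<subseteq> A" for C :: "'a set set"
    using that
  proof (induction C rule: finite_ne_induct)
    case (insert A C)
    hence "\<Union>C \<in> C" by blast
    moreover from this have "A \<subseteq> \<Union>C \<or> \<Union>C \<subseteq> A" using insert by blast
    ultimately show ?case by (auto simp: Un_absorb1 Un_absorb2)
  qed auto
  thus ?thesis using assms unfolding chain_in_def totally_ordered_def by blast
qed

lemma card_delete_filter:
  assumes "finite C" "A \<in> C" "P A"
  shows "card {B\<in>C - {A}. P B} < card {B\<in>C. P B}"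
  using assms by (intro psubset_card_mono) auto

text \<open>For \<open>v = L - {z}\<close> a cocycle is corrected, by induction on the number \<open>j C\<close> of members of \<open>C\<close> that
  avoid \<open>z\<close>, until it vanishes on all chains not through \<open>v\<close>. What remains is a cocycle for the
  smaller set \<open>v\<close>.\<close>

lemma boolean_lattice_exact:
  fixes X :: "'l set set \<Rightarrow> 'r::comm_ring_1"
  assumes "finite L" "Suc k < card L"
    and "\<And>C. chain_in L C \<Longrightarrow> card C = Suc k \<Longrightarrow> coboundary X C = 0"
  shows "\<exists>Y. \<forall>C. chain_in L C \<longrightarrow> card C = k \<longrightarrow> coboundary Y C = X C"
  using assms
proof (induction "card L" arbitrary: L k X)
  case 0
  then show ?case by simp
next
  case (Suc n)
  have finL: "finite L" and k: "Suc k < card L" by fact+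
  note cocyc = Suc.prems(3)
  obtain z where z: "z \<in> L" using k by fastforce
  define v where "v = L - {z}"
  have Lv: "L = insert z v" "z \<notin> v" using z unfolding v_def by auto
  have cv: "card v = n" using Suc.hyps(2) finL z unfolding v_def by simp
  define j where "j = (\<lambda>C :: 'l set set. card {A\<in>C. z \<notin> A})"
  have finC: "finite C" if "chain_in L C" for C using chain_in_finite[OF finL that] .
  have dd: "coboundary (coboundary Y) C = 0" if "chain_in L C" for C and Y :: "'l set set \<Rightarrow> 'r"
    using coboundary_coboundary finC[OF that] that unfolding chain_in_def by blast
  have loop: "\<exists>Y. \<forall>C. chain_in L C \<longrightarrow> card C = k \<longrightarrow> v \<notin> C \<longrightarrow> j C < t \<longrightarrow> X C - coboundary Y C = 0" for t
  proof (induction t)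
    case 0
    then show ?case by simp
  next
    case (Suc t)
    then obtain Y where Y: "\<And>C. chain_in L C \<Longrightarrow> card C = k \<Longrightarrow> v \<notin> C \<Longrightarrow> j C < t \<Longrightarrow> X C - coboundary Y C = 0"
      by blast
    define X' where "X' = (\<lambda>C. X C - coboundary Y C)"
    have X'0: "X' C = 0" if "chain_in L C" "card C = k" "v \<notin> C" "j C < t" for C
      using Y[OF that] unfolding X'_def .
    have X'c: "coboundary X' C = 0" if "chain_in L C" "card C = Suc k" for C
      unfolding X'_def using cocyc[OF that] dd[OF that(1), of Y] by (simp add: coboundary_diff)
    \<comment> \<open>The least set through \<open>z\<close> that contains all members of
      \<open>C\<close> avoiding \<open>z\<close>. It is comparable with every member of the chain
      \<open>C\<close>, and inserting it does not change \<open>j C\<close> because it contains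
      \<open>z\<close>.\<close>
    define p where "p = (\<lambda>C :: 'l set set. insert z (\<Union>{A\<in>C. z \<notin> A}))"
    \<comment> \<open>Chains without \<open>p C\<close> are matched with chains through it. The sign
      of this face is \<open>(- 1) ^ t\<close>, because exactly the \<open>t\<close> members
      avoiding \<open>z\<close> lie below \<open>p C\<close>.\<close>
    define Y' where "Y' = (\<lambda>C. if j C = t \<and> p C \<notin> C then (- 1) ^ t * X' (insert (p C) C) else 0)"
    have "X' C = coboundary Y' C" if C: "chain_in L C" "card C = k" "v \<notin> C" "j C \<le> t" for C
    proof -
      note fC = finC[OF C(1)]
      have jd: "j (C - {A}) < j C" if "A \<in> C" "z \<notin> A" for A
        unfolding j_def by (rule card_delete_filter[OF fC that(1), of "\<lambda>A. z \<notin> A"]) (use that in simp)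
      have jd2: "j (C - {A}) = j C" "p (C - {A}) = p C" if "z \<in> A" for A
      proof -
        have "{B\<in>C - {A}. z \<notin> B} = {B\<in>C. z \<notin> B}" using that by auto
        thus "j (C - {A}) = j C" "p (C - {A}) = p C" unfolding j_def p_def by simp_all
      qed
      have jle: "j (C - {A}) \<le> j C" for A unfolding j_def using fC by (intro card_mono) auto
      show ?thesis
      proof (cases "j C < t")
        case True
        hence "Y' (C - {A}) = 0" for A using jle[of A] unfolding Y'_def by simp
        thus ?thesis using X'0[OF C(1-3) True] by (simp add: coboundary_def)
      next
        case False
        hence jC: "j C = t" using C(4) by simp
        define N where "N = {A\<in>C. z \<notin> A}"
        have N: "N \<subseteq> C" "finite N" unfolding N_def using fC by auto
        \<comment> \<open>This is where \<open>v \<notin> C\<close> enters: the largest member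
          avoiding \<open>z\<close> is then smaller than \<open>v\<close>, so that \<open>P\<close>
          is a proper subset of \<open>L\<close>.\<close>
        have UN: "\<Union>N \<subseteq> v" "\<Union>N \<noteq> v"
        proof -
          show "\<Union>N \<subseteq> v" using C(1) unfolding N_def chain_in_def Lv by blast
          show "\<Union>N \<noteq> v"
          proof (cases "N = {}")
            case True
            have "v \<noteq> {}" using cv k Suc.hyps(2) by auto
            thus ?thesis using True by auto
          next
            case False
            hence "\<Union>N \<in> N" using chain_in_Union chain_in_subset[OF C(1) N(1)] N(2) by blast
            thus ?thesis using C(3) N(1) by auto
          qed
        qed
        define P where "P = p C"
        have P: "P = insert z (\<Union>N)" unfolding P_def p_def N_def by simp
        have sub1: "A \<subset> P" if "A \<in> N" for A using that unfolding P N_def by auto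
        have sub2: "P \<subseteq> B" if B: "B \<in> C" "B \<notin> N" for B
        proof -
          have zB: "z \<in> B" using B unfolding N_def by auto
          have "A \<subseteq> B" if "A \<in> N" for A
            using chain_in_cases[OF C(1), of A B] that B zB unfolding N_def by blast
          thus ?thesis using zB unfolding P by auto
        qed
        have PL: "P \<subseteq> L" "P \<noteq> {}" "P \<noteq> L" using UN Lv unfolding P by auto
        have pos: "card {A\<in>C. A < P} = t"
        proof -
          have "{A\<in>C. A < P} = N" using sub1 sub2 N(1) by blast
          thus ?thesis using jC unfolding j_def N_def by simp
        qed
        have Y'N: "Y' (C - {A}) = 0" if "A \<in> N" for A
          using jd[of A] that jC unfolding Y'_def N_def by auto
        show ?thesis
        proof (cases "P \<in> C")
          case True
          have zP: "z \<in> P" unfolding P by simp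
          \<comment> \<open>Deleting a member of \<open>N\<close> lowers \<open>j\<close> below
            \<open>t\<close>, and deleting any other member except \<open>P\<close> leaves
            \<open>p C\<close> in the chain; either way \<open>Y'\<close> is zero.\<close>
          have Y'B: "Y' (C - {B}) = 0" if "B \<in> C" "B \<noteq> P" for B
          proof (cases "B \<in> N")
            case False
            hence "z \<in> B" using that unfolding N_def by auto
            thus ?thesis using jd2 True that unfolding Y'_def P_def by auto
          qed (use Y'N in simp)
          have "coboundary Y' C = (\<Sum>B\<in>{P}. (- 1) ^ card {A\<in>C. A < B} * Y' (C - {B}))"
            unfolding coboundary_def using Y'B True fC by (intro sum.mono_neutral_right) auto
          also have "\<dots> = (- 1) ^ t * ((- 1) ^ t * X' (insert P (C - {P})))"
            using pos jd2[OF zP] jC unfolding Y'_def P_def by simp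
          also have "\<dots> = X' C" using True by (simp add: insert_absorb mult.assoc[symmetric] power_add[symmetric])
          finally show ?thesis by simp
        next
          case False
          have ch: "chain_in L (insert P C)"
          proof (rule chain_in_insert[OF C(1) PL])
            fix A assume "A \<in> C"
            thus "A \<subseteq> P \<or> P \<subseteq> A" using sub1[of A] sub2[of A] by (cases "A \<in> N") auto
          qed
          have crd: "card (insert P C) = Suc k" using False fC C(2) by simp
          define sg where "sg = (\<lambda>B. (- 1) ^ card {A\<in>C. A < B} :: 'r)"
          \<comment> \<open>The cocycle condition solved for \<open>X' C\<close>. Faces that delete
            a member of \<open>N\<close> vanish by the choice of \<open>Y\<close>; the others are
            values of \<open>Y'\<close>, with an extra minus sign because the deleted set lies above
            \<open>P\<close>.\<close>
          have "0 = coboundary X' (insert P C)" using X'c[OF ch crd] by simp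
          also have "\<dots> = (- 1) ^ t * X' C + (\<Sum>B\<in>C. sg B * (if P < B then - 1 else 1) * X' (insert P (C - {B})))"
            unfolding coboundary_insert[OF fC False] pos sg_def by (intro arg_cong2[where f="(+)"] sum.cong) auto
          also have "(\<Sum>B\<in>C. sg B * (if P < B then - 1 else 1) * X' (insert P (C - {B})))
             = (\<Sum>B\<in>C. - ((-1) ^ t * (sg B * Y' (C - {B}))))"
          proof (rule sum.cong)
            fix B assume B: "B \<in> C"
            show "sg B * (if P < B then - 1 else 1) * X' (insert P (C - {B})) = - ((-1) ^ t * (sg B * Y' (C - {B})))"
            proof (cases "B \<in> N")
              case True
              have "chain_in L (insert P (C - {B}))" by (rule chain_in_subset[OF ch]) auto
              moreover have "card (insert P (C - {B})) = k"
                using False fC C(2) B by (auto simp: card_Diff_singleton) (metis Suc_pred card_gt_0_iff empty_iff)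
              moreover have "v \<notin> insert P (C - {B})" using C(3) Lv P by auto
              moreover have "j (insert P (C - {B})) < t"
              proof -
                have "{A\<in>insert P (C - {B}). z \<notin> A} = {A\<in>C - {B}. z \<notin> A}" unfolding P by auto
                thus ?thesis using jd[of B] True jC unfolding j_def N_def by auto
              qed
              ultimately have "X' (insert P (C - {B})) = 0" using X'0 by blast
              thus ?thesis using Y'N[OF True] by simp
            next
              case nN: False
              hence zB: "z \<in> B" using B unfolding N_def by auto
              have "P < B" using sub2[OF B nN] False B by auto
              moreover have "Y' (C - {B}) = (- 1) ^ t * X' (insert P (C - {B}))"
                using jd2[OF zB] jC False unfolding Y'_def P_def by simp
              ultimately show ?thesis by (simp add: algebra_simps flip: power_add)
            qed
          qed simp
          also have "\<dots> = - ((-1) ^ t * coboundary Y' C)"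
            unfolding coboundary_def sg_def by (simp add: sum_negf sum_distrib_left)
          finally have "(- 1) ^ t * X' C = (-1) ^ t * coboundary Y' C" by simp
          hence "(- 1) ^ t * ((- 1) ^ t * X' C) = (- 1) ^ t * ((-1) ^ t * coboundary Y' C)" by simp
          thus ?thesis by (simp add: mult.assoc[symmetric] power_add[symmetric])
        qed
      qed
    qed
    hence "\<forall>C. chain_in L C \<longrightarrow> card C = k \<longrightarrow> v \<notin> C \<longrightarrow> j C < Suc t \<longrightarrow> X C - coboundary (\<lambda>C. Y C + Y' C) C = 0"
      unfolding X'_def by (force simp: coboundary_add algebra_simps)
    thus ?case by blast
  qed
  obtain Y where Y: "\<And>C. chain_in L C \<Longrightarrow> card C = k \<Longrightarrow> v \<notin> C \<Longrightarrow> X C - coboundary Y C = 0"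
  proof -
    have "j C < Suc k" if "chain_in L C" "card C = k" for C
    proof -
      have "j C \<le> card C" unfolding j_def using finC[OF that(1)] by (intro card_mono) auto
      thus ?thesis using that by simp
    qed
    thus ?thesis using loop[of "Suc k"] that by blast
  qed
  define X' where "X' = (\<lambda>C. X C - coboundary Y C)"
  have X'0: "X' C = 0" if "chain_in L C" "card C = k" "v \<notin> C" for C
    using Y[OF that] unfolding X'_def .
  have X'c: "coboundary X' C = 0" if "chain_in L C" "card C = Suc k" for C
    unfolding X'_def using cocyc[OF that] dd[OF that(1), of Y] by (simp add: coboundary_diff)
  have "\<exists>Z. \<forall>C. chain_in L C \<longrightarrow> card C = k \<longrightarrow> coboundary Z C = X' C"
  proof (cases k)
    case 0
    have "coboundary (\<lambda>_. 0) C = X' C" if "chain_in L C" "card C = k" for C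
    proof -
      have "C = {}" using that 0 finC by auto
      thus ?thesis using X'0[OF that] by (simp add: coboundary_def)
    qed
    thus ?thesis by blast
  next
    case (Suc k')
    \<comment> \<open>Adding \<open>v\<close> on top embeds the chains in \<open>v\<close> into the
      chains in \<open>L\<close>; as a maximal element \<open>v\<close> changes no sign.\<close>
    have up: "chain_in L (insert v C)" "v \<notin> C" "card (insert v C) = Suc (card C)"
       "\<And>A. A \<in> C \<Longrightarrow> \<not> v < A" if "chain_in v C" for C
    proof -
      have vn: "v \<noteq> {}" using cv k Suc.hyps(2) by auto
      show "chain_in L (insert v C)"
        by (rule chain_in_insert) (use that vn Lv in \<open>auto simp: chain_in_def\<close>)
      show "v \<notin> C" using that unfolding chain_in_def by blast
      thus "card (insert v C) = Suc (card C)" using chain_in_finite[OF _ that] finL unfolding v_def by simp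
      show "\<And>A. A \<in> C \<Longrightarrow> \<not> v < A" using that unfolding chain_in_def by blast
    qed
    have ab: "coboundary (\<lambda>C. Z (insert v C)) C = coboundary Z (insert v C)"
      if C: "chain_in v C" and Z: "Z C = 0" for C and Z :: "'l set set \<Rightarrow> 'r"
    proof -
      have fin: "finite C" using chain_in_finite[OF _ C] finL unfolding v_def by simp
      show ?thesis unfolding coboundary_insert[OF fin up(2)[OF C]] Z
        unfolding coboundary_def using up(4)[OF C] by (simp cong: sum.cong)
    qed
    have X2: "coboundary (\<lambda>C. X' (insert v C)) C = 0" if "chain_in v C" "card C = Suc k'" for C
    proof -
      have "chain_in L C" using chain_in_subset[OF up(1)[OF that(1)]] by blast
      thus ?thesis
        using ab[of C X'] that X'0[of C] up[OF that(1)] X'c[of "insert v C"] Suc by simp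
    qed
    have "finite v" using finL unfolding v_def by simp
    moreover have "Suc k' < card v" using cv k Suc.hyps(2) Suc by simp
    ultimately obtain W where W: "\<And>C. chain_in v C \<Longrightarrow> card C = k' \<Longrightarrow> coboundary W C = X' (insert v C)"
      using Suc.hyps(1)[of v k' "\<lambda>C. X' (insert v C)"] cv X2 by blast
    define Z where "Z = (\<lambda>C. if v \<in> C then W (C - {v}) else 0)"
    have "coboundary Z C = X' C" if C: "chain_in L C" "card C = k" for C
    proof (cases "v \<in> C")
      case False
      hence "coboundary Z C = 0" unfolding coboundary_def Z_def by simp
      thus ?thesis using X'0[OF C False] by simp
    next
      case True
      define D where "D = C - {v}"
      have CD: "C = insert v D" using True unfolding D_def by auto
      have D: "chain_in v D"
      proof -
        have "A \<subseteq> v \<and> A \<noteq> v" if "A \<in> D" for A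
        proof -
          have "A \<subset> v \<or> v \<subset> A" using chain_in_cases[OF C(1), of A v] that True unfolding D_def by auto
          moreover have "A \<subset> L" using C(1) that unfolding chain_in_def D_def by auto
          ultimately show ?thesis unfolding Lv by blast
        qed
        thus ?thesis using C(1) chain_in_subset[OF C(1), of D] unfolding chain_in_def D_def by auto
      qed
      have cD: "card D = k'" using up(3)[OF D] C(2) Suc CD by simp
      have vD: "v \<notin> D" unfolding D_def by simp
      have "coboundary Z C = coboundary (\<lambda>C. Z (insert v C)) D"
        unfolding CD by (rule ab[symmetric, OF D]) (simp add: Z_def vD)
      also have "\<dots> = coboundary W D"
        by (rule coboundary_cong) (use vD in \<open>auto simp: Z_def\<close>)
      also have "\<dots> = X' C" using W[OF D cD] CD by simp
      finally show ?thesis .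
    qed
    thus ?thesis by blast
  qed
  then obtain Z where Z: "\<And>C. chain_in L C \<Longrightarrow> card C = k \<Longrightarrow> coboundary Z C = X' C" by blast
  have "coboundary (\<lambda>C. Y C + Z C) C = X C" if "chain_in L C" "card C = k" for C
    using Z[OF that] unfolding X'_def by (simp add: coboundary_add)
  thus ?case by blast
qed

section \<open>Exactness for cochains with prescribed divisibility\<close>

lemma totally_ordered_image:
  assumes "totally_ordered C" "\<And>A B. A \<in> C \<Longrightarrow> B \<in> C \<Longrightarrow> A \<le> B \<Longrightarrow> f A \<le> f B"
  shows "totally_ordered (f ` C)"
  using assms unfolding totally_ordered_def by (metis imageE)

text \<open>The model is a polynomial ring in the variables \<open>u x\<close>, and \<open>\<pi> a b\<close> substitutes \<open>u a\<close> for \<open>u b\<close>.\<close>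

locale difference_ring =
  fixes u :: "'l \<Rightarrow> 'r::idom" and \<pi> :: "'l \<Rightarrow> 'l \<Rightarrow> 'r \<Rightarrow> 'r"
  assumes \<pi>_add: "\<pi> a b (f + g) = \<pi> a b f + \<pi> a b g"
    and \<pi>_mult: "\<pi> a b (f * g) = \<pi> a b f * \<pi> a b g"
    and \<pi>_1: "\<pi> a b 1 = 1"
    and \<pi>_u: "\<pi> a b (u x) = u (if x = b then a else x)"
    and \<pi>_idem: "\<pi> a b (\<pi> a b f) = \<pi> a b f"
    and \<pi>_dvd: "a \<noteq> b \<Longrightarrow> \<pi> a b f = 0 \<Longrightarrow> (u a - u b) dvd f"
    and u_inj: "u a = u b \<Longrightarrow> a = b"
begin

lemma \<pi>_0: "\<pi> a b 0 = 0"
  by (metis \<pi>_add add.right_neutral add_left_cancel)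

lemma \<pi>_minus: "\<pi> a b (- f) = - \<pi> a b f"
  using \<pi>_add[of a b f "- f"] \<pi>_0 by (simp add: eq_neg_iff_add_eq_0 add.commute)

lemma \<pi>_diff: "\<pi> a b (f - g) = \<pi> a b f - \<pi> a b g"
  using \<pi>_add[of a b f "- g"] \<pi>_minus by simp

lemma \<pi>_power: "\<pi> a b (f ^ n) = \<pi> a b f ^ n"
  by (induction n) (simp_all add: \<pi>_1 \<pi>_mult)

lemma \<pi>_sum: "\<pi> a b (sum f A) = (\<Sum>x\<in>A. \<pi> a b (f x))"
  by (induction A rule: infinite_finite_induct) (simp_all add: \<pi>_0 \<pi>_add)

lemma \<pi>_prod: "\<pi> a b (prod f A) = (\<Prod>x\<in>A. \<pi> a b (f x))"
  by (induction A rule: infinite_finite_induct) (simp_all add: \<pi>_1 \<pi>_mult)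

lemma \<pi>_coboundary: "\<pi> a b (coboundary X U) = coboundary (\<lambda>V. \<pi> a b (X V)) U"
  unfolding coboundary_def by (simp add: \<pi>_sum \<pi>_mult \<pi>_power \<pi>_minus \<pi>_1)

lemma dvd_\<pi>_0: "a \<noteq> b \<Longrightarrow> (u a - u b) dvd f \<Longrightarrow> \<pi> a b f = 0"
  by (auto simp: dvd_def \<pi>_mult \<pi>_diff \<pi>_u)

definition unsep :: "'l set \<Rightarrow> 'l set set \<Rightarrow> ('l \<times> 'l) set" where
  "unsep L C = {(a, b). a \<in> L \<and> b \<in> L \<and> a \<noteq> b \<and> (\<forall>A\<in>C. a \<in> A \<longleftrightarrow> b \<in> A)}"

lemma finite_unsep: "finite L \<Longrightarrow> finite (unsep L C)"
  by (rule finite_subset[of _ "L \<times> L"]) (auto simp: unsep_def)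

definition alpha :: "'l set \<Rightarrow> ('l \<times> 'l \<Rightarrow> nat) \<Rightarrow> 'l set set \<Rightarrow> 'r" where
  "alpha L \<mu> C = (\<Prod>(a, b)\<in>unsep L C. (u a - u b) ^ \<mu> (a, b))"

text \<open>For \<open>k = 0\<close> the divisibility demand on \<open>Y\<close> is vacuous and the
  coboundary at the empty chain is zero, so the conclusion reads \<open>X {} = 0\<close>.\<close>

definition exact :: "'l set \<Rightarrow> ('l \<times> 'l \<Rightarrow> nat) \<Rightarrow> bool" where
  "exact L \<mu> \<longleftrightarrow> (\<forall>k X. Suc k < card L \<longrightarrow>
     (\<forall>C. chain_in L C \<longrightarrow> card C = k \<longrightarrow> alpha L \<mu> C dvd X C) \<longrightarrow>
     (\<forall>C. chain_in L C \<longrightarrow> card C = Suc k \<longrightarrow> coboundary X C = 0) \<longrightarrow>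
     (\<exists>Y. (\<forall>C. chain_in L C \<longrightarrow> Suc (card C) = k \<longrightarrow> alpha L \<mu> C dvd Y C) \<and>
          (\<forall>C. chain_in L C \<longrightarrow> card C = k \<longrightarrow> coboundary Y C = X C)))"

lemma exactD:
  assumes "exact L \<mu>" "Suc k < card L"
    and "\<forall>C. chain_in L C \<longrightarrow> card C = k \<longrightarrow> alpha L \<mu> C dvd X C"
    and "\<forall>C. chain_in L C \<longrightarrow> card C = Suc k \<longrightarrow> coboundary X C = 0"
  shows "\<exists>Y. (\<forall>C. chain_in L C \<longrightarrow> Suc (card C) = k \<longrightarrow> alpha L \<mu> C dvd Y C) \<and>
          (\<forall>C. chain_in L C \<longrightarrow> card C = k \<longrightarrow> coboundary Y C = X C)"
  using assms unfolding exact_def by simp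

lemma alpha_nonzero: "alpha L \<mu> C \<noteq> 0"
proof (cases "finite (unsep L C)")
  case True
  thus ?thesis unfolding alpha_def using u_inj by (auto simp: unsep_def)
next
  case False
  thus ?thesis unfolding alpha_def by simp
qed

text \<open>A larger chain separates more pairs and imposes fewer conditions. Hence the coboundary
  respects the divisibility conditions.\<close>

lemma alpha_dvd_subset:
  assumes "finite L" "D \<subseteq> C"
  shows "alpha L \<mu> C dvd alpha L \<mu> D"
  unfolding alpha_def by (rule prod_dvd_prod_subset[OF finite_unsep[OF assms(1)]]) (use assms(2) in \<open>auto simp: unsep_def\<close>)

lemma exact_0:
  assumes "finite L" "\<And>a b. a \<in> L \<Longrightarrow> b \<in> L \<Longrightarrow> a \<noteq> b \<Longrightarrow> \<mu> (a, b) = 0"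
  shows "exact L \<mu>"
proof -
  have "alpha L \<mu> C = 1" for C
    unfolding alpha_def by (rule prod.neutral) (use assms in \<open>auto simp: unsep_def\<close>)
  thus ?thesis unfolding exact_def using boolean_lattice_exact[OF assms(1)] by (metis one_dvd)
qed

definition merge :: "'l \<Rightarrow> 'l \<Rightarrow> 'l \<Rightarrow> 'l" where "merge a b x = (if x = b then a else x)"

text \<open>Multiplicities add along the fibres of \<open>merge\<close>, because substituting
  \<open>u a\<close> for \<open>u b\<close> turns different factors into powers of one. The pairs
  \<open>(a, b)\<close> and \<open>(b, a)\<close> land on the diagonal, which \<open>alpha\<close>
  does not see.\<close>

definition merged :: "'l \<Rightarrow> 'l \<Rightarrow> 'l set \<Rightarrow> ('l \<times> 'l \<Rightarrow> nat) \<Rightarrow> 'l \<times> 'l \<Rightarrow> nat" where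
  "merged a b L \<mu> q = (\<Sum>p\<in>{p\<in>L \<times> L. map_prod (merge a b) (merge a b) p = q}. \<mu> p)"

text \<open>The preimage under \<open>merge a b\<close> of a set avoiding \<open>b\<close>. Chains
  of such preimages are those that do not separate \<open>a\<close> from \<open>b\<close>.\<close>

definition dbl :: "'l \<Rightarrow> 'l \<Rightarrow> 'l set \<Rightarrow> 'l set" where "dbl a b A = (if a \<in> A then insert b A else A)"

text \<open>A primitive \<open>Y\<close> of \<open>X\<close> for \<open>\<mu>\<close> has to be made more divisible on the chains that keep \<open>a\<close> and \<open>b\<close>
  together. Modulo \<open>u a - u b\<close> its values there form a cocycle for \<open>L - {b}\<close> with merged
  multiplicities, and a primitive of this cocycle provides the correction.\<close>

lemma exact_step:
  assumes fin: "finite L" and ab: "a \<in> L" "b \<in> L" "a \<noteq> b"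
    and ex: "exact L \<mu>" and ex': "exact (L - {b}) (merged a b L \<mu>)"
    and \<nu>: "\<nu> = \<mu>((a, b) := Suc (\<mu> (a, b)))"
  shows "exact L \<nu>"
proof -
  define L' where "L' = L - {b}"
  define \<mu>' where "\<mu>' = merged a b L \<mu>"
  define g where "g = merge a b"
  define f where "f = dbl a b"
  define p where "p = \<pi> a b"
  have L': "finite L'" "a \<in> L'" "b \<notin> L'" "L = insert b L'" using fin ab unfolding L'_def by auto
  have cL: "card L = Suc (card L')" using L' by simp
  \<comment> \<open>On chains that keep \<open>a\<close> and \<open>b\<close> together
    \<open>alpha\<close> splits into \<open>\<gamma>\<close>, which is the same for all of them, and
    \<open>\<beta>\<close>, which survives the substitution \<open>p\<close>.\<close>
  define \<gamma> where "\<gamma> = (u a - u b) ^ \<mu> (a, b) * (u b - u a) ^ \<mu> (b, a)"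
  have \<gamma>0: "\<gamma> \<noteq> 0" unfolding \<gamma>_def using u_inj ab by auto
  define \<beta> where "\<beta> = (\<lambda>C. \<Prod>(x, y)\<in>unsep L C - {(a, b), (b, a)}. (u x - u y) ^ \<mu> (x, y))"
  define tog where "tog = (\<lambda>C :: 'l set set. \<forall>A\<in>C. a \<in> A \<longleftrightarrow> b \<in> A)"
  have alpha_tog: "alpha L \<mu> C = \<gamma> * \<beta> C" if "tog C" for C
  proof -
    have sub: "{(a, b), (b, a)} \<subseteq> unsep L C" using that ab unfolding unsep_def tog_def by auto
    have "alpha L \<mu> C = (\<Prod>(x, y)\<in>{(a, b), (b, a)}. (u x - u y) ^ \<mu> (x, y)) * \<beta> C"
      unfolding alpha_def \<beta>_def using prod.subset_diff[OF sub finite_unsep[OF fin]] by (simp add: mult.commute)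
    thus ?thesis unfolding \<gamma>_def using ab by simp
  qed
  have nu_tog: "alpha L \<nu> C = (u a - u b) * alpha L \<mu> C" if "tog C" for C
  proof -
    have mem: "(a, b) \<in> unsep L C" using that ab unfolding unsep_def tog_def by auto
    have "(\<Prod>(x, y)\<in>unsep L C - {(a, b)}. (u x - u y) ^ \<nu> (x, y)) = (\<Prod>(x, y)\<in>unsep L C - {(a, b)}. (u x - u y) ^ \<mu> (x, y))"
      by (rule prod.cong) (auto simp: \<nu> split: if_splits)
    moreover have "\<nu> (a, b) = Suc (\<mu> (a, b))" unfolding \<nu> by simp
    ultimately show ?thesis unfolding alpha_def prod.remove[OF finite_unsep[OF fin] mem]
      by (simp add: mult.assoc)
  qed
  have nu_ntog: "alpha L \<nu> C = alpha L \<mu> C" if "\<not> tog C" for C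
  proof -
    have "(a, b) \<notin> unsep L C" using that unfolding unsep_def tog_def by blast
    hence "\<nu> q = \<mu> q" if "q \<in> unsep L C" for q using that unfolding \<nu> by auto
    thus ?thesis unfolding alpha_def by (intro prod.cong) auto
  qed
  have mu_nu: "alpha L \<mu> C dvd alpha L \<nu> C" for C
    using nu_tog[of C] nu_ntog[of C] by (cases "tog C") simp_all
  have sub': "A \<subseteq> L'" if "chain_in L' C" "A \<in> C" for A C using that unfolding chain_in_def by blast
  have f_mem: "x \<in> f A \<longleftrightarrow> g x \<in> A" if "A \<subseteq> L'" for x A
    using that L'(2,3) unfolding f_def dbl_def g_def merge_def by auto
  \<comment> \<open>Substitution sends the factor of a pair to that of its merged image, and
    grouping pairs by their image adds the exponents.\<close>
  have p\<beta>: "p (\<beta> (f ` C)) = alpha L' \<mu>' C" if C: "chain_in L' C" for C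
  proof -
    define gg where "gg = map_prod g g"
    define S where "S = unsep L (f ` C) - {(a, b), (b, a)}"
    have finS: "finite S" unfolding S_def using finite_unsep[OF fin] by auto
    have gL: "g x \<in> L'" if "x \<in> L" for x using that L' unfolding g_def merge_def by auto
    have neq: "x \<noteq> y \<and> (x, y) \<notin> {(a, b), (b, a)} \<longleftrightarrow> g x \<noteq> g y" for x y
      unfolding g_def merge_def by auto
    have "(\<forall>A\<in>f ` C. x \<in> A \<longleftrightarrow> y \<in> A) \<longleftrightarrow> (\<forall>A\<in>C. g x \<in> A \<longleftrightarrow> g y \<in> A)" for x y
      using f_mem[OF sub'[OF C]] by simp
    hence memS: "q \<in> S \<longleftrightarrow> q \<in> L \<times> L \<and> gg q \<in> unsep L' C" for q
      using neq[of "fst q" "snd q"] gL unfolding S_def unsep_def gg_def by (cases q) auto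
    have "p (\<beta> (f ` C)) = (\<Prod>q\<in>S. (u (fst (gg q)) - u (snd (gg q))) ^ \<mu> q)"
      unfolding \<beta>_def p_def \<pi>_prod S_def
      by (rule prod.cong) (auto simp: \<pi>_power \<pi>_diff \<pi>_u \<pi>_0 gg_def g_def merge_def)
    also have "\<dots> = (\<Prod>r\<in>unsep L' C. \<Prod>q\<in>{q\<in>S. gg q = r}. (u (fst (gg q)) - u (snd (gg q))) ^ \<mu> q)"
      by (rule prod.group[symmetric, OF finS finite_unsep[OF L'(1)]]) (use memS in auto)
    also have "\<dots> = (\<Prod>r\<in>unsep L' C. (u (fst r) - u (snd r)) ^ \<mu>' r)"
    proof (rule prod.cong, simp)
      fix r assume r: "r \<in> unsep L' C"
      have eq: "{q\<in>S. gg q = r} = {q\<in>L \<times> L. gg q = r}"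
        using r memS by auto
      have "(\<Prod>q\<in>{q\<in>S. gg q = r}. (u (fst (gg q)) - u (snd (gg q))) ^ \<mu> q)
         = (\<Prod>q\<in>{q\<in>L \<times> L. gg q = r}. (u (fst r) - u (snd r)) ^ \<mu> q)"
        unfolding eq by (rule prod.cong) auto
      also have "\<dots> = (u (fst r) - u (snd r)) ^ \<mu>' r"
        unfolding \<mu>'_def merged_def gg_def g_def by (simp add: power_sum)
      finally show "(\<Prod>q\<in>{q\<in>S. gg q = r}. (u (fst (gg q)) - u (snd (gg q))) ^ \<mu> q)
         = (u (fst r) - u (snd r)) ^ \<mu>' r" .
    qed
    also have "\<dots> = alpha L' \<mu>' C" unfolding alpha_def by (simp add: case_prod_beta)
    finally show ?thesis .
  qed
  have f_retract: "f A - {b} = A" if "A \<subseteq> L'" for A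
    using that L'(3) unfolding f_def dbl_def by auto
  have f_mono: "f A \<subseteq> f B" if "A \<subseteq> B" for A B
    using that unfolding f_def dbl_def by auto
  have f_le: "f A \<subseteq> f B \<longleftrightarrow> A \<subseteq> B" if "A \<subseteq> L'" "B \<subseteq> L'" for A B
    using f_mono[of A B] f_retract that Diff_mono[of "f A" "f B" "{b}" "{b}"] by auto
  have f_inj: "f A = f B \<longleftrightarrow> A = B" and f_less: "f A < f B \<longleftrightarrow> A < B" if "A \<subseteq> L'" "B \<subseteq> L'" for A B
    using f_le that by (metis subset_antisym subset_refl, metis f_le less_le_not_le that)
  have f_inj_on: "inj_on f C" if "chain_in L' C" for C
    using f_inj sub'[OF that] unfolding inj_on_def by blast
  have f_chain: "chain_in L (f ` C)" "card (f ` C) = card C" "tog (f ` C)" if C: "chain_in L' C" for C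
  proof -
    show "card (f ` C) = card C" by (rule card_image[OF f_inj_on[OF C]])
    have "g a = g b" unfolding g_def merge_def by simp
    thus "tog (f ` C)" using f_mem[OF sub'[OF C]] unfolding tog_def by auto
    have "f A \<subseteq> L \<and> f A \<noteq> {} \<and> f A \<noteq> L" if "A \<in> C" for A
    proof -
      have A: "A \<subseteq> L'" "A \<noteq> {}" "A \<noteq> L'" using that C unfolding chain_in_def by auto
      have "L - {b} = L'" using L'(3,4) by auto
      hence "f A \<noteq> L" using A f_retract[of A] by auto
      moreover have "f A \<subseteq> L" "f A \<noteq> {}" using A(1,2) L'(4) unfolding f_def dbl_def by auto
      ultimately show ?thesis by blast
    qed
    moreover have "totally_ordered (f ` C)"
      using C by (intro totally_ordered_image f_mono) (auto simp: chain_in_def)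
    ultimately show "chain_in L (f ` C)" unfolding chain_in_def by blast
  qed
  have f_cob: "coboundary X (f ` C) = coboundary (\<lambda>D. X (f ` D)) C" if C: "chain_in L' C" for C and X :: "'l set set \<Rightarrow> 'r"
    by (rule coboundary_image[OF f_inj_on[OF C]]) (rule f_less[OF sub'[OF C] sub'[OF C]])
  define e where "e = (\<lambda>C :: 'l set set. (\<lambda>A. A - {b}) ` C)"
  have e_f: "e (f ` C) = C" if C: "chain_in L' C" for C
  proof -
    have "f A - {b} = A" if "A \<in> C" for A using f_retract[OF sub'[OF C that]] .
    thus ?thesis unfolding e_def image_image by simp
  qed
  have f_e: "f ` e C = C" "chain_in L' (e C)" if C: "chain_in L C" "tog C" for C
  proof -
    have AL: "f (A - {b}) = A" if "A \<in> C" for A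
    proof -
      have "a \<in> A \<longleftrightarrow> b \<in> A" using C(2) that unfolding tog_def by blast
      thus ?thesis using ab(3) unfolding f_def dbl_def by auto
    qed
    thus "f ` e C = C" unfolding e_def image_image by simp
    have "A - {b} \<subseteq> L' \<and> A - {b} \<noteq> {} \<and> A - {b} \<noteq> L'" if A: "A \<in> C" for A
    proof -
      have A': "A \<subseteq> L" "A \<noteq> {}" "A \<noteq> L" using C A unfolding chain_in_def by auto
      have ff: "f (A - {b}) = A" using AL[OF A] .
      have "f {} = {}" "f L' = L" unfolding f_def dbl_def using L' by auto
      hence "A - {b} \<noteq> {}" "A - {b} \<noteq> L'" using A' ff by metis+
      thus ?thesis using A'(1) unfolding L'_def by auto
    qed
    moreover have "totally_ordered (e C)"
      using C(1) unfolding e_def by (intro totally_ordered_image) (auto simp: chain_in_def)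
    ultimately show "chain_in L' (e C)" unfolding chain_in_def e_def by blast
  qed
  have dd: "coboundary (coboundary Y) C = 0" if "chain_in L C" for C and Y :: "'l set set \<Rightarrow> 'r"
    using coboundary_coboundary chain_in_finite[OF fin that] that unfolding chain_in_def by blast
  show ?thesis unfolding exact_def
  proof (intro allI impI)
    fix k and X :: "'l set set \<Rightarrow> 'r"
    assume k: "Suc k < card L"
      and dX: "\<forall>C. chain_in L C \<longrightarrow> card C = k \<longrightarrow> alpha L \<nu> C dvd X C"
      and cX: "\<forall>C. chain_in L C \<longrightarrow> card C = Suc k \<longrightarrow> coboundary X C = 0"
    have dX': "\<forall>C. chain_in L C \<longrightarrow> card C = k \<longrightarrow> alpha L \<mu> C dvd X C"
      using dX dvd_trans[OF mu_nu] by simp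
    obtain Y where dY: "\<And>C. chain_in L C \<Longrightarrow> Suc (card C) = k \<Longrightarrow> alpha L \<mu> C dvd Y C"
      and cY: "\<And>C. chain_in L C \<Longrightarrow> card C = k \<Longrightarrow> coboundary Y C = X C"
      using exactD[OF ex k dX' cX] by blast
    show "\<exists>Y. (\<forall>C. chain_in L C \<longrightarrow> Suc (card C) = k \<longrightarrow> alpha L \<nu> C dvd Y C) \<and>
          (\<forall>C. chain_in L C \<longrightarrow> card C = k \<longrightarrow> coboundary Y C = X C)"
    proof (cases k)
      case 0
      thus ?thesis using cY by auto
    next
      case (Suc k')
      have "\<exists>h. Y C = \<gamma> * (\<beta> C * h)" if "chain_in L C" "card C = k'" "tog C" for C
        using dY[OF that(1)] that Suc alpha_tog[OF that(3)] by (auto simp: dvd_def mult.assoc)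
      then obtain h where h: "\<And>C. chain_in L C \<Longrightarrow> card C = k' \<Longrightarrow> tog C \<Longrightarrow> Y C = \<gamma> * (\<beta> C * h C)"
        by metis
      \<comment> \<open>On these chains \<open>Y\<close> is \<open>\<gamma>\<close> times
        \<open>q\<close>. Its coboundary \<open>X\<close> carries one factor
        \<open>u a - u b\<close> beyond \<open>\<gamma>\<close> and \<open>\<beta>\<close>, so the
        coboundary of \<open>q\<close> vanishes after the substitution.\<close>
      define q where "q = (\<lambda>C. \<beta> C * h C)"
      define Y' where "Y' = (\<lambda>C. p (q (f ` C)))"
      have faces: "chain_in L' (C - {A})" "card (C - {A}) = k" if "chain_in L' C" "card C = Suc k" "A \<in> C" for C A and k :: nat
        using chain_in_subset[OF that(1), of "C - {A}"] that chain_in_finite[OF L'(1) that(1)] by auto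
      have dY': "alpha L' \<mu>' C dvd Y' C" if C: "chain_in L' C" for C
        unfolding Y'_def q_def p\<beta>[OF C, symmetric] by (simp add: p_def \<pi>_mult)
      have cY': "coboundary Y' C = 0" if C: "chain_in L' C" "card C = Suc k'" for C
      proof -
        have Yf: "Y (f ` D) = \<gamma> * q (f ` D)" if "chain_in L' D" "card D = k'" for D
          using h[of "f ` D"] f_chain[OF that(1)] that(2) unfolding q_def by simp
        have "alpha L \<nu> (f ` C) dvd X (f ` C)"
          using dX f_chain[OF C(1)] C(2) Suc by simp
        then obtain r where r: "X (f ` C) = alpha L \<nu> (f ` C) * r" by (auto simp: dvd_def)
        have "\<gamma> * ((u a - u b) * (\<beta> (f ` C) * r)) = X (f ` C)"
          unfolding r nu_tog[OF f_chain(3)[OF C(1)]] alpha_tog[OF f_chain(3)[OF C(1)]] by (simp add: mult_ac)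
        also have "\<dots> = coboundary Y (f ` C)" using cY[OF f_chain(1)[OF C(1)]] f_chain(2)[OF C(1)] C(2) Suc by simp
        also have "\<dots> = coboundary (\<lambda>D. Y (f ` D)) C" by (rule f_cob[OF C(1)])
        also have "\<dots> = coboundary (\<lambda>D. \<gamma> * q (f ` D)) C"
          by (rule coboundary_cong) (rule Yf[OF faces[OF C]])
        also have "\<dots> = \<gamma> * coboundary (\<lambda>D. q (f ` D)) C" by (rule coboundary_scale)
        finally have "(u a - u b) * (\<beta> (f ` C) * r) = coboundary (\<lambda>D. q (f ` D)) C" using \<gamma>0 by simp
        hence "p (coboundary (\<lambda>D. q (f ` D)) C) = 0"
          unfolding p_def using dvd_\<pi>_0[OF ab(3)] by (metis dvd_triv_left)
        thus ?thesis unfolding Y'_def p_def \<pi>_coboundary .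
      qed
      \<comment> \<open>The merged set has one element less and the chains one member less, so the
        range of exactness is preserved.\<close>
      have k': "Suc k' < card L'" using k cL Suc by simp
      have "\<forall>C. chain_in L' C \<longrightarrow> card C = k' \<longrightarrow> alpha L' \<mu>' C dvd Y' C"
        "\<forall>C. chain_in L' C \<longrightarrow> card C = Suc k' \<longrightarrow> coboundary Y' C = 0"
        using dY' cY' by simp_all
      note exW = exactD[OF ex'[folded L'_def \<mu>'_def] k' this]
      obtain W' where dW': "\<And>C. chain_in L' C \<Longrightarrow> Suc (card C) = k' \<Longrightarrow> alpha L' \<mu>' C dvd W' C"
        and cW': "\<And>C. chain_in L' C \<Longrightarrow> card C = k' \<Longrightarrow> coboundary W' C = Y' C"
        using exW by blast
      have "\<exists>w. W' C = alpha L' \<mu>' C * w" if "chain_in L' C" "Suc (card C) = k'" for C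
        using dW'[OF that] by (auto simp: dvd_def)
      then obtain w where w: "\<And>C. chain_in L' C \<Longrightarrow> Suc (card C) = k' \<Longrightarrow> W' C = alpha L' \<mu>' C * w C"
        by metis
      \<comment> \<open>A lift of \<open>W'\<close> along the substitution: \<open>W'\<close> is
        \<open>alpha\<close> of the merged set times \<open>w\<close>, and \<open>alpha\<close> is
        the image of \<open>\<beta>\<close>. The factor \<open>\<gamma>\<close> keeps the lift
        divisible as \<open>\<mu>\<close> demands.\<close>
      define W where "W = (\<lambda>C. if tog C then \<gamma> * (\<beta> C * w (e C)) else 0)"
      have dW: "alpha L \<mu> C dvd W C" for C
        unfolding W_def using alpha_tog[of C] by (simp add: mult.assoc[symmetric])
      define Z where "Z = (\<lambda>C. Y C - coboundary W C)"
      have cZ: "coboundary Z C = X C" if "chain_in L C" "card C = k" for C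
        unfolding Z_def coboundary_diff using cY[OF that] dd[OF that(1)] by simp
      have dZ: "alpha L \<mu> C dvd Z C" if C: "chain_in L C" "card C = k'" for C
      proof -
        have "alpha L \<mu> C dvd coboundary W C" unfolding coboundary_def
          by (intro dvd_sum dvd_mult dvd_trans[OF alpha_dvd_subset[OF fin] dW]) auto
        thus ?thesis unfolding Z_def using dY[OF C(1)] C(2) Suc by simp
      qed
      have "alpha L \<nu> C dvd Z C" if C: "chain_in L C" "card C = k'" for C
      proof (cases "tog C")
        case False
        thus ?thesis using nu_ntog dZ[OF C] by simp
      next
        case True
        define D where "D = e C"
        have D: "C = f ` D" "chain_in L' D" using f_e[OF C(1) True] unfolding D_def by auto
        have cD: "card D = k'" using f_chain(2)[OF D(2)] D(1) C(2) by simp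
        obtain H where H: "Z C = \<gamma> * (\<beta> C * H)"
          using dZ[OF C] alpha_tog[OF True] by (auto simp: dvd_def mult.assoc)
        define wf where "wf = (\<lambda>E. \<beta> (f ` E) * w E)"
        have wfp: "p (wf E) = p (W' E)" if "chain_in L' E" "Suc (card E) = k'" for E
        proof -
          have "p (W' E) = p (p (\<beta> (f ` E))) * p (w E)" unfolding w[OF that] p\<beta>[OF that(1), symmetric] by (simp add: p_def \<pi>_mult)
          thus ?thesis unfolding wf_def p_def by (simp add: \<pi>_idem \<pi>_mult)
        qed
        have fcs: "chain_in L' (D - {A})" "Suc (card (D - {A})) = k'" if "A \<in> D" for A
          using chain_in_subset[OF D(2), of "D - {A}"] card_Suc_Diff1[OF chain_in_finite[OF L'(1) D(2)] that] cD
          by auto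
        have "coboundary W C = coboundary (\<lambda>E. W (f ` E)) D" unfolding D(1) by (rule f_cob[OF D(2)])
        also have "\<dots> = coboundary (\<lambda>E. \<gamma> * wf E) D"
        proof (rule coboundary_cong)
          fix A assume "A \<in> D"
          note A = fcs(1)[OF this]
          show "W (f ` (D - {A})) = \<gamma> * wf (D - {A})"
            using f_chain(3)[OF A] e_f[OF A] unfolding W_def wf_def by simp
        qed
        also have "\<dots> = \<gamma> * coboundary wf D" by (rule coboundary_scale)
        finally have "\<gamma> * (\<beta> C * H) = \<gamma> * (q C - coboundary wf D)"
          using H h[OF C True] unfolding Z_def q_def by (simp add: algebra_simps)
        hence "\<beta> C * H = q C - coboundary wf D" using \<gamma>0 by simp
        hence "p (\<beta> C) * p H = p (q C) - coboundary (\<lambda>E. p (wf E)) D"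
          unfolding p_def by (metis \<pi>_coboundary \<pi>_diff \<pi>_mult)
        also have "coboundary (\<lambda>E. p (wf E)) D = coboundary (\<lambda>E. p (W' E)) D"
          by (rule coboundary_cong) (rule wfp[OF fcs])
        also have "\<dots> = p (coboundary W' D)" unfolding p_def \<pi>_coboundary ..
        also have "\<dots> = p (q C)" unfolding cW'[OF D(2) cD] Y'_def D(1) by (simp add: p_def \<pi>_idem)
        finally have "p (\<beta> C) * p H = 0" by simp
        \<comment> \<open>\<open>p (\<beta> C)\<close> is \<open>alpha\<close> of the merged set and
          nonzero, so it cancels; \<open>p H = 0\<close> then supplies the additional factor
          \<open>u a - u b\<close>.\<close>
        hence "p H = 0" unfolding D(1) p\<beta>[OF D(2)] using alpha_nonzero by simp
        hence "(u a - u b) dvd H" unfolding p_def by (rule \<pi>_dvd[OF ab(3)])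
        hence "\<gamma> * \<beta> C * (u a - u b) dvd \<gamma> * \<beta> C * H" by (rule mult_dvd_mono[OF dvd_refl])
        thus ?thesis unfolding nu_tog[OF True] alpha_tog[OF True] H by (simp add: mult_ac)
      qed
      thus ?thesis using cZ Suc by auto
    qed
  qed
qed

theorem exact:
  assumes "finite L"
  shows "exact L \<mu>"
  using assms
proof (induction "card L" arbitrary: L \<mu> rule: less_induct)
  case (less L \<mu>)
  note IH = less.hyps and fin = less.prems
  \<comment> \<open>Merging puts multiplicity on the diagonal, where \<open>alpha\<close> ignores
    it. The inner induction therefore counts off-diagonal pairs only.\<close>
  define P where "P = {p \<in> L \<times> L. fst p \<noteq> snd p}"
  have finP: "finite P" unfolding P_def using fin by simp
  show ?case
  proof (induction "\<Sum>p\<in>P. \<mu> p" arbitrary: \<mu>)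
    case (0 \<mu>)
    hence "\<And>p. p \<in> P \<Longrightarrow> \<mu> p = 0" using finP by simp
    thus ?case by (intro exact_0[OF fin]) (auto simp: P_def)
  next
    case (Suc n \<mu>)
    then obtain p where p: "p \<in> P" "\<mu> p \<noteq> 0" by (metis nat.distinct(1) sum.neutral)
    obtain a b where pab: "p = (a, b)" by fastforce
    define \<mu>0 where "\<mu>0 = \<mu>(p := \<mu> p - 1)"
    have "(\<Sum>q\<in>P. \<mu> q) = \<mu> p + (\<Sum>q\<in>P - {p}. \<mu> q)" using sum.remove[OF finP p(1)] .
    moreover have "(\<Sum>q\<in>P. \<mu>0 q) = \<mu>0 p + (\<Sum>q\<in>P - {p}. \<mu>0 q)" using sum.remove[OF finP p(1)] .
    moreover have "(\<Sum>q\<in>P - {p}. \<mu>0 q) = (\<Sum>q\<in>P - {p}. \<mu> q)" unfolding \<mu>0_def by (rule sum.cong) auto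
    ultimately have "n = (\<Sum>q\<in>P. \<mu>0 q)" using Suc.hyps(2) p unfolding \<mu>0_def by simp
    hence ex0: "exact L \<mu>0" by (rule Suc.hyps(1))
    have ab: "a \<in> L" "b \<in> L" "a \<noteq> b" using p pab unfolding P_def by auto
    have ex1: "exact (L - {b}) (merged a b L \<mu>0)"
      using ab fin by (intro IH) (auto simp only: card_Diff1_less finite_Diff)
    have eq: "\<mu> = \<mu>0((a, b) := Suc (\<mu>0 (a, b)))" unfolding \<mu>0_def pab[symmetric] using p by auto
    show ?case by (rule exact_step[OF fin ab ex0 ex1 eq])
  qed
qed

end

section \<open>Dimensions of spaces of functions\<close>

definition fscale :: "'k::field \<Rightarrow> ('x \<Rightarrow> 'k) \<Rightarrow> 'x \<Rightarrow> 'k" where "fscale c f = (\<lambda>x. c * f x)"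

interpretation fs: vector_space "fscale :: 'k::field \<Rightarrow> ('x \<Rightarrow> 'k) \<Rightarrow> 'x \<Rightarrow> 'k"
  by unfold_locales (auto simp: fscale_def fun_eq_iff algebra_simps)

lemma fscale_apply: "fscale c f x = c * f x"
  by (simp add: fscale_def)

lemma sum_fun_apply: "(\<Sum>i\<in>A. f i) x = (\<Sum>i\<in>A. f i x)"
  by (induction A rule: infinite_finite_induct) auto

definition funs_on :: "'x set \<Rightarrow> ('x \<Rightarrow> 'k::zero) set" where
  "funs_on X = {f. \<forall>x. x \<notin> X \<longrightarrow> f x = 0}"

lemma funs_onD: "f \<in> funs_on X \<Longrightarrow> x \<notin> X \<Longrightarrow> f x = 0"
  by (simp add: funs_on_def)

lemma subspace_funs_on: "fs.subspace (funs_on X)"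
  by (auto simp: fs.subspace_def funs_on_def fscale_apply)

text \<open>\<open>B\<close> is a set of pivots: restriction to \<open>B\<close> is an isomorphism
  from \<open>P\<close> onto all functions on \<open>B\<close>, and \<open>e\<close> is the basis
  dual to the evaluations. With pivots, complements and tensor products are read off from sets of
  points.\<close>

definition frame :: "('x \<Rightarrow> 'k::field) set \<Rightarrow> 'x set \<Rightarrow> bool" where
  "frame P B \<longleftrightarrow> fs.subspace P \<and> finite B \<and> (\<forall>f\<in>P. (\<forall>b\<in>B. f b = 0) \<longrightarrow> f = 0) \<and>
     (\<exists>e. \<forall>b\<in>B. e b \<in> P \<and> (\<forall>c\<in>B. e b c = (if c = b then 1 else 0)))"

lemma frameE:
  assumes "frame P B"
  obtains e where "fs.subspace P" "finite B" "\<And>b. b \<in> B \<Longrightarrow> e b \<in> P"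
    "\<And>b c. b \<in> B \<Longrightarrow> c \<in> B \<Longrightarrow> e b c = (if c = b then 1 else 0)"
    "\<And>f. f \<in> P \<Longrightarrow> (\<And>b. b \<in> B \<Longrightarrow> f b = 0) \<Longrightarrow> f = 0"
    "\<And>f. f \<in> P \<Longrightarrow> f = (\<Sum>b\<in>B. fscale (f b) (e b))"
proof -
  obtain e where e: "\<And>b. b \<in> B \<Longrightarrow> e b \<in> P" "\<And>b c. b \<in> B \<Longrightarrow> c \<in> B \<Longrightarrow> e b c = (if c = b then 1 else 0)"
    using assms unfolding frame_def by metis
  have P: "fs.subspace P" "finite B" and z: "\<And>f. f \<in> P \<Longrightarrow> (\<And>b. b \<in> B \<Longrightarrow> f b = 0) \<Longrightarrow> f = 0"
    using assms unfolding frame_def by metis+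
  have "f = (\<Sum>b\<in>B. fscale (f b) (e b))" if f: "f \<in> P" for f
  proof -
    have "(\<Sum>b\<in>B. fscale (f b) (e b)) \<in> P"
      using P e by (intro fs.subspace_sum fs.subspace_scale) auto
    hence "f - (\<Sum>b\<in>B. fscale (f b) (e b)) \<in> P" using P f by (intro fs.subspace_diff) auto
    moreover have "(f - (\<Sum>b\<in>B. fscale (f b) (e b))) c = 0" if c: "c \<in> B" for c
    proof -
      have "(\<Sum>b\<in>B. f b * e b c) = (\<Sum>b\<in>B. if b = c then f b else 0)"
        using e(2) c by (intro sum.cong) auto
      thus ?thesis using P(2) c by (simp add: fscale_apply sum_fun_apply)
    qed
    ultimately have "f - (\<Sum>b\<in>B. fscale (f b) (e b)) = 0" by (rule z)
    thus ?thesis by simp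
  qed
  thus ?thesis using that e P z by blast
qed

lemma frame_dim:
  assumes "frame P B"
  shows "fs.dim P = card B"
proof -
  obtain e where P: "fs.subspace P" "finite B" and e: "\<And>b. b \<in> B \<Longrightarrow> e b \<in> P"
    "\<And>b c. b \<in> B \<Longrightarrow> c \<in> B \<Longrightarrow> e b c = (if c = b then 1 else 0)"
    and ex: "\<And>f. f \<in> P \<Longrightarrow> f = (\<Sum>b\<in>B. fscale (f b) (e b))"
    by (rule frameE[OF assms]) blast
  have inj: "inj_on e B"
    by (rule inj_onI) (metis e(2) zero_neq_one)
  have "fs.independent (e ` B)"
  proof (rule fs.independent_if_scalars_zero)
    fix g x assume s: "(\<Sum>x\<in>e ` B. fscale (g x) x) = 0" and x: "x \<in> e ` B"
    then obtain c where c: "c \<in> B" "x = e c" by auto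
    have "(\<Sum>b\<in>B. fscale (g (e b)) (e b)) = 0" using s by (simp add: sum.reindex[OF inj])
    hence "(\<Sum>b\<in>B. fscale (g (e b)) (e b)) c = 0" by simp
    hence "(\<Sum>b\<in>B. g (e b) * e b c) = 0" by (simp add: fscale_apply sum_fun_apply)
    moreover have "(\<Sum>b\<in>B. g (e b) * e b c) = (\<Sum>b\<in>B. if b = c then g (e b) else 0)"
      using e(2) c by (intro sum.cong) auto
    ultimately show "g x = 0" using P(2) c by simp
  qed (use P in simp)
  moreover have "P \<subseteq> fs.span (e ` B)"
  proof
    fix f assume "f \<in> P"
    hence "f = (\<Sum>b\<in>B. fscale (f b) (e b))" by (rule ex)
    also have "\<dots> \<in> fs.span (e ` B)" by (intro fs.span_sum fs.span_scale fs.span_base) auto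
    finally show "f \<in> fs.span (e ` B)" .
  qed
  moreover have "e ` B \<subseteq> P" using e by auto
  ultimately have "card (e ` B) = fs.dim P" by (intro fs.basis_card_eq_dim)
  thus ?thesis using card_image[OF inj] by simp
qed

text \<open>Gaussian elimination, one point at a time: the functions vanishing at \<open>x\<close>
  have pivots in \<open>X\<close>, and \<open>x\<close> is a further pivot unless all of
  \<open>P\<close> vanishes there.\<close>

lemma frame_exists:
  assumes "finite X" "fs.subspace P" "P \<subseteq> funs_on X"
  shows "\<exists>B\<subseteq>X. frame P B"
  using assms
proof (induction X arbitrary: P rule: finite_induct)
  case empty
  have "f = 0" if "f \<in> P" for f
    using empty.prems(2) that by (intro ext) (auto simp: funs_on_def)
  hence "frame P {}" using empty.prems(1) unfolding frame_def by simp
  thus ?case by blast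
next
  case (insert x X)
  define P0 where "P0 = {f \<in> P. f x = 0}"
  have P0: "fs.subspace P0" using insert.prems(1) unfolding P0_def fs.subspace_def by (auto simp: fscale_apply)
  have "P0 \<subseteq> funs_on X" using insert.prems(2) unfolding P0_def funs_on_def by auto
  then obtain B where B: "B \<subseteq> X" "frame P0 B" using insert.IH P0 by blast
  obtain e where e: "finite B" "\<And>b. b \<in> B \<Longrightarrow> e b \<in> P0"
    "\<And>b c. b \<in> B \<Longrightarrow> c \<in> B \<Longrightarrow> e b c = (if c = b then 1 else 0)"
    and z: "\<And>f. f \<in> P0 \<Longrightarrow> (\<And>b. b \<in> B \<Longrightarrow> f b = 0) \<Longrightarrow> f = 0"
    by (rule frameE[OF B(2)]) blast
  show ?case
  proof (cases "P = P0")
    case True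
    thus ?thesis using B by blast
  next
    case False
    then obtain h where h: "h \<in> P" "h x \<noteq> 0" unfolding P0_def by auto
    define g0 where "g0 = fscale (1 / h x) h"
    define g where "g = g0 - (\<Sum>b\<in>B. fscale (g0 b) (e b))"
    have eP: "e b \<in> P" "e b x = 0" if "b \<in> B" for b using e(2)[OF that] unfolding P0_def by auto
    have g0: "g0 \<in> P" unfolding g0_def using h insert.prems(1) by (intro fs.subspace_scale)
    have gP: "g \<in> P" unfolding g_def using g0 eP insert.prems(1)
      by (intro fs.subspace_diff fs.subspace_sum fs.subspace_scale) auto
    have gx: "g x = 1" unfolding g_def using eP h by (simp add: fscale_apply sum_fun_apply g0_def)
    have gb: "g c = 0" if c: "c \<in> B" for c
    proof -
      have "(\<Sum>b\<in>B. g0 b * e b c) = (\<Sum>b\<in>B. if b = c then g0 b else 0)"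
        using e(3) c by (intro sum.cong) auto
      thus ?thesis unfolding g_def using e(1) c by (simp add: fscale_apply sum_fun_apply)
    qed
    have xB: "x \<notin> B" using B insert.hyps by auto
    define e' where "e' = (\<lambda>b. if b = x then g else e b)"
    have "frame P (insert x B)"
      unfolding frame_def
    proof (intro conjI exI[of _ e'] ballI impI)
      show "f = 0" if "f \<in> P" "\<forall>b\<in>insert x B. f b = 0" for f
        using that z[of f] unfolding P0_def by auto
      show "e' b \<in> P" if "b \<in> insert x B" for b using that gP eP unfolding e'_def by auto
      show "e' b c = (if c = b then 1 else 0)" if "b \<in> insert x B" "c \<in> insert x B" for b c
        using that gx gb eP e(3) xB unfolding e'_def by auto
    qed (use insert.prems e in auto)
    thus ?thesis using B(1) by blast
  qed
qed

text \<open>The functions in \<open>P\<close> that vanish at the pivots of the kernel form a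
  complement of the kernel, and \<open>\<phi>\<close> is injective on it.\<close>

lemma rank_nullity:
  fixes \<phi> :: "('x \<Rightarrow> 'k::field) \<Rightarrow> 'y \<Rightarrow> 'k"
  assumes X: "finite X" and P: "fs.subspace P" "P \<subseteq> funs_on X"
    and add: "\<And>f g. f \<in> P \<Longrightarrow> g \<in> P \<Longrightarrow> \<phi> (f + g) = \<phi> f + \<phi> g"
    and scale: "\<And>c f. f \<in> P \<Longrightarrow> \<phi> (fscale c f) = fscale c (\<phi> f)"
  shows "fs.dim P = fs.dim {f \<in> P. \<phi> f = 0} + fs.dim (\<phi> ` P)"
proof -
  have \<phi>0: "\<phi> 0 = 0" using scale[of 0 0] fs.subspace_0[OF P(1)] by simp
  have \<phi>sum: "\<phi> (\<Sum>i\<in>A. fscale (c i) (h i)) = (\<Sum>i\<in>A. fscale (c i) (\<phi> (h i)))"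
    if "\<And>i. i \<in> A \<Longrightarrow> h i \<in> P" for A :: "'x set" and c h
    using that
  proof (induction A rule: infinite_finite_induct)
    case (insert i A)
    have "fscale (c i) (h i) \<in> P" "(\<Sum>i\<in>A. fscale (c i) (h i)) \<in> P"
      using insert.prems P(1) by (auto intro!: fs.subspace_scale fs.subspace_sum)
    hence "\<phi> (fscale (c i) (h i) + (\<Sum>i\<in>A. fscale (c i) (h i))) = fscale (c i) (\<phi> (h i)) + \<phi> (\<Sum>i\<in>A. fscale (c i) (h i))"
      using insert.prems by (simp only: add scale insertI1)
    moreover have "\<phi> (\<Sum>i\<in>A. fscale (c i) (h i)) = (\<Sum>i\<in>A. fscale (c i) (\<phi> (h i)))"
      using insert.prems by (intro insert.IH) simp
    ultimately show ?case by (simp only: sum.insert[OF insert.hyps(1,2)])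
  qed (use \<phi>0 in auto)
  define K where "K = {f \<in> P. \<phi> f = 0}"
  have K: "fs.subspace K"
  proof (rule fs.subspaceI)
    show "0 \<in> K" using \<phi>0 fs.subspace_0[OF P(1)] unfolding K_def by simp
    show "f + g \<in> K" if "f \<in> K" "g \<in> K" for f g
      using that fs.subspace_add[OF P(1), of f g] unfolding K_def by (simp add: add)
    show "fscale c f \<in> K" if "f \<in> K" for c f
      using that fs.subspace_scale[OF P(1), of f c] unfolding K_def by (simp add: scale)
  qed
  obtain B where B: "frame K B" using frame_exists[OF X K] P(2) unfolding K_def by blast
  obtain k where kf: "finite B" "\<And>b. b \<in> B \<Longrightarrow> k b \<in> K"
    "\<And>b c. b \<in> B \<Longrightarrow> c \<in> B \<Longrightarrow> k b c = (if c = b then 1 else 0)"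
    and kz: "\<And>f. f \<in> K \<Longrightarrow> (\<And>b. b \<in> B \<Longrightarrow> f b = 0) \<Longrightarrow> f = 0"
    by (rule frameE[OF B]) blast
  have kP: "k b \<in> P" "\<phi> (k b) = 0" if "b \<in> B" for b using kf(2)[OF that] unfolding K_def by auto
  define P' where "P' = {f \<in> P. \<forall>b\<in>B. f b = 0}"
  have P': "fs.subspace P'" using P(1) unfolding fs.subspace_def P'_def by (auto simp: fscale_apply)
  obtain C where C: "frame P' C" using frame_exists[OF X P'] P(2) unfolding P'_def by blast
  obtain e where ef: "finite C" "\<And>b. b \<in> C \<Longrightarrow> e b \<in> P'"
    "\<And>b c. b \<in> C \<Longrightarrow> c \<in> C \<Longrightarrow> e b c = (if c = b then 1 else 0)"
    and ez: "\<And>f. f \<in> P' \<Longrightarrow> (\<And>b. b \<in> C \<Longrightarrow> f b = 0) \<Longrightarrow> f = 0"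
    and eex: "\<And>f. f \<in> P' \<Longrightarrow> f = (\<Sum>b\<in>C. fscale (f b) (e b))"
    by (rule frameE[OF C]) blast
  have eP: "e c \<in> P" "\<And>b. b \<in> B \<Longrightarrow> e c b = 0" if "c \<in> C" for c using ef(2)[OF that] unfolding P'_def by auto
  have BC: "B \<inter> C = {}" using eP ef(3) by force
  \<comment> \<open>The kernel basis is corrected to vanish on \<open>C\<close>; together with
    \<open>e\<close> it is then dual to the evaluations at \<open>B \<union> C\<close>.\<close>
  define k' where "k' = (\<lambda>b. k b - (\<Sum>c\<in>C. fscale (k b c) (e c)))"
  define e' where "e' = (\<lambda>b. if b \<in> B then k' b else e b)"
  have k'P: "k' b \<in> P" if "b \<in> B" for b
    unfolding k'_def using kP[OF that] eP P(1) by (intro fs.subspace_diff fs.subspace_sum fs.subspace_scale) auto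
  have k'c: "k' b c = 0" if "b \<in> B" "c \<in> C" for b c
  proof -
    have "(\<Sum>d\<in>C. k b d * e d c) = (\<Sum>d\<in>C. if d = c then k b d else 0)"
      using ef(3) that by (intro sum.cong) auto
    thus ?thesis unfolding k'_def using ef(1) that by (simp add: fscale_apply sum_fun_apply)
  qed
  have k'b: "k' b c = (if c = b then 1 else 0)" if "b \<in> B" "c \<in> B" for b c
    unfolding k'_def using that kf(3) eP by (simp add: fscale_apply sum_fun_apply)
  have "frame P (B \<union> C)"
    unfolding frame_def
  proof (intro conjI exI[of _ e'] ballI impI)
    show "f = 0" if "f \<in> P" "\<forall>b\<in>B \<union> C. f b = 0" for f
      using that ez[of f] unfolding P'_def by auto
    show "e' b \<in> P" if "b \<in> B \<union> C" for b using that k'P eP unfolding e'_def by auto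
    show "e' b c = (if c = b then 1 else 0)" if "b \<in> B \<union> C" "c \<in> B \<union> C" for b c
      using that k'c k'b eP ef(3) BC unfolding e'_def by auto
  qed (use P kf ef in auto)
  hence dP: "fs.dim P = card B + card C" using frame_dim BC kf(1) ef(1) by (metis card_Un_disjoint)
  have zero: "f = 0" if "f \<in> P'" "\<phi> f = 0" for f
    using kz[of f] that unfolding K_def P'_def by auto
  have inj: "inj_on (\<lambda>c. \<phi> (e c)) C"
  proof (rule inj_onI)
    fix c d assume cd: "c \<in> C" "d \<in> C" "\<phi> (e c) = \<phi> (e d)"
    have neg: "fscale (- 1) (e d) \<in> P" using eP(1)[OF cd(2)] P(1) by (rule fs.subspace_scale[rotated])
    have "\<phi> (e c - e d) = \<phi> (e c + fscale (- 1) (e d))" by simp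
    also have "\<dots> = \<phi> (e c) + fscale (- 1) (\<phi> (e d))"
      unfolding add[OF eP(1)[OF cd(1)] neg] scale[OF eP(1)[OF cd(2)]] ..
    also have "\<dots> = 0" using cd(3) by simp
    finally have "\<phi> (e c - e d) = 0" .
    moreover have "e c - e d \<in> P'" using ef(2) cd(1,2) P' by (intro fs.subspace_diff)
    ultimately have "e c - e d = 0" by (intro zero)
    hence "e c c = e d c" by (simp add: fun_eq_iff)
    thus "c = d" using ef(3) cd by (auto split: if_splits)
  qed
  have "fs.independent ((\<lambda>c. \<phi> (e c)) ` C)"
  proof (rule fs.independent_if_scalars_zero)
    fix g y assume s: "(\<Sum>y\<in>(\<lambda>c. \<phi> (e c)) ` C. fscale (g y) y) = 0" and y: "y \<in> (\<lambda>c. \<phi> (e c)) ` C"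
    then obtain c where c: "c \<in> C" "y = \<phi> (e c)" by auto
    define f where "f = (\<Sum>c\<in>C. fscale (g (\<phi> (e c))) (e c))"
    have "\<phi> f = (\<Sum>c\<in>C. fscale (g (\<phi> (e c))) (\<phi> (e c)))" unfolding f_def using eP by (intro \<phi>sum) auto
    also have "\<dots> = 0" using s by (simp add: sum.reindex[OF inj])
    finally have "f = 0" using P' ef(2) unfolding f_def
      by (intro zero fs.subspace_sum fs.subspace_scale) auto
    hence "f c = 0" by simp
    moreover have "f c = (\<Sum>b\<in>C. if b = c then g (\<phi> (e b)) else 0)"
      unfolding f_def sum_fun_apply fscale_apply using ef(3) c by (intro sum.cong) auto
    ultimately show "g y = 0" using c ef(1) by simp
  qed (use ef in simp)
  moreover have "\<phi> ` P \<subseteq> fs.span ((\<lambda>c. \<phi> (e c)) ` C)"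
  proof (rule image_subsetI)
    fix f assume f: "f \<in> P"
    define f' where "f' = f - (\<Sum>b\<in>B. fscale (f b) (k b))"
    have sP: "(\<Sum>b\<in>B. fscale (f b) (k b)) \<in> P" using kP P(1) by (intro fs.subspace_sum fs.subspace_scale) auto
    have f'0: "f' c = 0" if c: "c \<in> B" for c
    proof -
      have "(\<Sum>b\<in>B. f b * k b c) = (\<Sum>b\<in>B. if b = c then f b else 0)"
        using kf(3) c by (intro sum.cong) auto
      thus ?thesis unfolding f'_def using kf(1) c by (simp add: fscale_apply sum_fun_apply)
    qed
    have f'P: "f' \<in> P" unfolding f'_def using f sP P(1) by (intro fs.subspace_diff) auto
    hence f'P': "f' \<in> P'" using f'0 unfolding P'_def by auto
    have "f = f' + (\<Sum>b\<in>B. fscale (f b) (k b))" unfolding f'_def by simp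
    hence "\<phi> f = \<phi> f' + \<phi> (\<Sum>b\<in>B. fscale (f b) (k b))" using add[OF f'P sP] by simp
    also have "\<phi> (\<Sum>b\<in>B. fscale (f b) (k b)) = 0" using kP by (subst \<phi>sum) auto
    also have "\<phi> f' = \<phi> (\<Sum>c\<in>C. fscale (f' c) (e c))" using eex[OF f'P'] by simp
    also have "\<dots> = (\<Sum>c\<in>C. fscale (f' c) (\<phi> (e c)))" using eP by (intro \<phi>sum) auto
    finally have "\<phi> f = (\<Sum>c\<in>C. fscale (f' c) (\<phi> (e c)))" by simp
    also have "\<dots> \<in> fs.span ((\<lambda>c. \<phi> (e c)) ` C)" by (intro fs.span_sum fs.span_scale fs.span_base) auto
    finally show "\<phi> f \<in> fs.span ((\<lambda>c. \<phi> (e c)) ` C)" .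
  qed
  moreover have "(\<lambda>c. \<phi> (e c)) ` C \<subseteq> \<phi> ` P" using eP by auto
  ultimately have "card ((\<lambda>c. \<phi> (e c)) ` C) = fs.dim (\<phi> ` P)" by (intro fs.basis_card_eq_dim)
  hence "fs.dim (\<phi> ` P) = card C" using card_image[OF inj] by simp
  thus ?thesis using dP frame_dim[OF B] unfolding K_def by simp
qed

section \<open>Orthogonal complements and tensor products of function spaces\<close>

definition perp :: "'x set \<Rightarrow> ('x \<Rightarrow> 'k::field) set \<Rightarrow> ('x \<Rightarrow> 'k) set" where
  "perp X P = {g \<in> funs_on X. \<forall>f\<in>P. (\<Sum>x\<in>X. f x * g x) = 0}"

lemma subspace_perp: "fs.subspace (perp X P)"
  unfolding fs.subspace_def perp_def funs_on_def
  by (auto simp: fscale_apply algebra_simps sum.distrib mult.left_commute simp flip: sum_distrib_left)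

text \<open>Pairing with the dual basis of \<open>P\<close> forces the values on \<open>B\<close>,
  while the values outside \<open>B\<close> are free. The functions \<open>d\<close> have the
  negated and transposed coefficients of \<open>e\<close>.\<close>

lemma frame_perp:
  assumes X: "finite X" and B: "frame P B" "B \<subseteq> X" and PX: "P \<subseteq> funs_on X"
  shows "frame (perp X P) (X - B)"
proof -
  obtain e where P: "fs.subspace P" "finite B" and e: "\<And>b. b \<in> B \<Longrightarrow> e b \<in> P"
    "\<And>b c. b \<in> B \<Longrightarrow> c \<in> B \<Longrightarrow> e b c = (if c = b then 1 else 0)"
    and ex: "\<And>f. f \<in> P \<Longrightarrow> f = (\<Sum>b\<in>B. fscale (f b) (e b))"
    by (rule frameE[OF B(1)]) blast
  have split: "(\<Sum>x\<in>X. e b x * g x) = g b + (\<Sum>x\<in>X - B. e b x * g x)" if b: "b \<in> B" for g b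
  proof -
    have "(\<Sum>x\<in>X. e b x * g x) = (\<Sum>x\<in>X - B. e b x * g x) + (\<Sum>x\<in>B. e b x * g x)"
      by (rule sum.subset_diff[OF B(2) X])
    also have "(\<Sum>x\<in>B. e b x * g x) = (\<Sum>x\<in>B. if x = b then g x else 0)"
      using e(2) b by (intro sum.cong) auto
    also have "\<dots> = g b" using P(2) b by simp
    finally show ?thesis by simp
  qed
  define d where "d = (\<lambda>x y. if y = x then 1 else if y \<in> B then - e y x else 0)"
  show ?thesis unfolding frame_def
  proof (intro conjI exI[of _ d] ballI impI)
    show "g = 0" if g: "g \<in> perp X P" "\<forall>x\<in>X - B. g x = 0" for g
    proof
      fix x
      show "g x = 0 x"
      proof (cases "x \<in> B")
        case True
        have "(\<Sum>y\<in>X. e x y * g y) = 0" using g(1) e(1)[OF True] unfolding perp_def by auto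
        thus ?thesis using split[OF True, of g] g(2) by simp
      next
        case False
        thus ?thesis using g unfolding perp_def funs_on_def by (cases "x \<in> X") auto
      qed
    qed
    show "d x \<in> perp X P" if x: "x \<in> X - B" for x
    proof -
      have dx: "d x \<in> funs_on X" using x B(2) unfolding funs_on_def d_def by auto
      have eb: "(\<Sum>y\<in>X. e b y * d x y) = 0" if b: "b \<in> B" for b
      proof -
        have "(\<Sum>y\<in>X - B. e b y * d x y) = (\<Sum>y\<in>X - B. if y = x then e b y else 0)"
          unfolding d_def by (intro sum.cong) auto
        also have "\<dots> = e b x" using X x by simp
        finally have "(\<Sum>y\<in>X. e b y * d x y) = d x b + e b x" using split[OF b, of "d x"] by simp
        thus ?thesis using b x unfolding d_def by auto
      qed
      have "(\<Sum>y\<in>X. f y * d x y) = 0" if f: "f \<in> P" for f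
      proof -
        have "f y = (\<Sum>b\<in>B. f b * e b y)" for y
          using fun_cong[OF ex[OF f], of y] by (simp add: fscale_apply sum_fun_apply)
        from arg_cong[OF this, of "\<lambda>c. c * d x y" for y]
        have "(\<Sum>y\<in>X. f y * d x y) = (\<Sum>y\<in>X. \<Sum>b\<in>B. f b * e b y * d x y)"
          unfolding sum_distrib_right by (rule sum.cong[OF refl])
        also have "\<dots> = (\<Sum>b\<in>B. f b * (\<Sum>y\<in>X. e b y * d x y))"
          by (subst sum.swap) (simp add: sum_distrib_left mult.assoc)
        finally show ?thesis using eb by simp
      qed
      thus ?thesis using dx unfolding perp_def by auto
    qed
    show "d x y = (if y = x then 1 else 0)" if "x \<in> X - B" "y \<in> X - B" for x y
      using that unfolding d_def by auto
  qed (use X subspace_perp in auto)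
qed

lemma dim_perp:
  assumes "finite X" "fs.subspace P" "P \<subseteq> funs_on X"
  shows "fs.dim P + fs.dim (perp X P) = card X"
proof -
  obtain B where B: "B \<subseteq> X" "frame P B" using frame_exists[OF assms] by blast
  show ?thesis
    using frame_dim[OF B(2)] frame_dim[OF frame_perp[OF assms(1) B(2,1) assms(3)]]
      card_mono[OF assms(1) B(1)] card_Diff_subset[OF finite_subset[OF B(1) assms(1)] B(1)] by simp
qed

text \<open>Subtracting the element of \<open>P\<close> with the same values at the pivots leaves a
  function that is orthogonal to every \<open>d x\<close>, and this forces it to vanish at each
  remaining point.\<close>

lemma perp_perp:
  assumes "finite X" "fs.subspace P" "P \<subseteq> funs_on X"
  shows "perp X (perp X P) = P"
proof
  show "P \<subseteq> perp X (perp X P)" using assms(3) unfolding perp_def by (auto simp: mult.commute)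
  obtain B where B: "B \<subseteq> X" "frame P B" using frame_exists[OF assms] by blast
  obtain e where e: "\<And>b. b \<in> B \<Longrightarrow> e b \<in> P"
    "\<And>b c. b \<in> B \<Longrightarrow> c \<in> B \<Longrightarrow> e b c = (if c = b then 1 else 0)"
    by (rule frameE[OF B(2)]) blast
  have finB: "finite B" using finite_subset[OF B(1) assms(1)] .
  obtain d where d: "\<And>b. b \<in> X - B \<Longrightarrow> d b \<in> perp X P"
    "\<And>b c. b \<in> X - B \<Longrightarrow> c \<in> X - B \<Longrightarrow> d b c = (if c = b then 1 else 0)"
    by (rule frameE[OF frame_perp[OF assms(1) B(2,1) assms(3)]]) blast
  show "perp X (perp X P) \<subseteq> P"
  proof
    fix f assume f: "f \<in> perp X (perp X P)"
    define s where "s = (\<Sum>b\<in>B. fscale (f b) (e b))"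
    have s: "s \<in> P" unfolding s_def using e assms(2) by (intro fs.subspace_sum fs.subspace_scale) auto
    hence "s \<in> perp X (perp X P)" using \<open>P \<subseteq> perp X (perp X P)\<close> by auto
    hence fs: "f - s \<in> perp X (perp X P)" using f by (intro fs.subspace_diff subspace_perp)
    have B0: "(f - s) c = 0" if c: "c \<in> B" for c
    proof -
      have "(\<Sum>b\<in>B. f b * e b c) = (\<Sum>b\<in>B. if b = c then f b else 0)"
        using e(2) c by (intro sum.cong) auto
      thus ?thesis unfolding s_def using finB c by (simp add: fscale_apply sum_fun_apply)
    qed
    have "(f - s) x = 0" for x
    proof (cases "x \<in> X - B")
      case True
      have "(\<Sum>y\<in>X. d x y * (f - s) y) = 0" using fs d(1)[OF True] unfolding perp_def by blast
      also have "(\<Sum>y\<in>X. d x y * (f - s) y) = (\<Sum>y\<in>X. if y = x then (f - s) y else 0)"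
      proof (rule sum.cong)
        fix y assume "y \<in> X"
        thus "d x y * (f - s) y = (if y = x then (f - s) y else 0)"
          using B0[of y] d(2)[OF True, of y] True by (cases "y \<in> B") auto
      qed simp
      finally show ?thesis using True assms(1) by simp
    next
      case False
      thus ?thesis using B0[of x] fs unfolding perp_def funs_on_def by (cases "x \<in> B") auto
    qed
    hence "f = s" by (auto simp: fun_eq_iff)
    thus "f \<in> P" using s by simp
  qed
qed

lemma dim_funs_on:
  assumes "finite X"
  shows "fs.dim (funs_on X :: ('x \<Rightarrow> 'k::field) set) = card X"
proof -
  have "frame (funs_on X :: ('x \<Rightarrow> 'k) set) X"
    unfolding frame_def using assms subspace_funs_on
    by (auto simp: funs_on_def fun_eq_iff intro!: exI[of _ "\<lambda>b c. if c = b then 1 else 0"])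
  thus ?thesis by (rule frame_dim)
qed

lemma dim_zero: "fs.dim {0 :: 'x \<Rightarrow> 'k::field} = 0"
proof -
  have "frame {0 :: 'x \<Rightarrow> 'k} {}" unfolding frame_def fs.subspace_def by auto
  thus ?thesis using frame_dim by fastforce
qed

text \<open>In frames for \<open>P t\<close> and \<open>Q t\<close> it becomes visible that \<open>(P \<otimes> all) \<inter> (all \<otimes> Q) = P \<otimes> Q\<close>.\<close>

lemma dim_tensor_sum:
  fixes P :: "'t \<Rightarrow> ('x \<Rightarrow> 'k::field) set" and Q :: "'t \<Rightarrow> ('y \<Rightarrow> 'k) set"
    and c :: "'x \<Rightarrow> 'y \<Rightarrow> 'z"
  assumes T: "finite T"
    and X: "\<And>t. t \<in> T \<Longrightarrow> finite (X t)" and Y: "\<And>t. t \<in> T \<Longrightarrow> finite (Y t)"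
    and P: "\<And>t. t \<in> T \<Longrightarrow> fs.subspace (P t)" "\<And>t. t \<in> T \<Longrightarrow> P t \<subseteq> funs_on (X t)"
    and Q: "\<And>t. t \<in> T \<Longrightarrow> fs.subspace (Q t)" "\<And>t. t \<in> T \<Longrightarrow> Q t \<subseteq> funs_on (Y t)"
    and inj: "inj_on (\<lambda>(t, x, y). c x y) (SIGMA t:T. X t \<times> Y t)"
    and S: "S = {f \<in> funs_on ((\<lambda>(t, x, y). c x y) ` (SIGMA t:T. X t \<times> Y t)).
        \<forall>t\<in>T. (\<forall>y\<in>Y t. (\<lambda>x. if x \<in> X t then f (c x y) else 0) \<in> P t) \<and>
              (\<forall>x\<in>X t. (\<lambda>y. if y \<in> Y t then f (c x y) else 0) \<in> Q t)}"
  shows "fs.subspace S" "fs.dim S = (\<Sum>t\<in>T. fs.dim (P t) * fs.dim (Q t))"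
proof -
  define A where "A = (SIGMA t:T. X t \<times> Y t)"
  define cc where "cc = (\<lambda>(t :: 't, x, y). c x y)"
  have injA: "inj_on cc A" using inj unfolding A_def cc_def .
  show subS: "fs.subspace S"
  proof (rule fs.subspaceI)
    show "0 \<in> S" unfolding S using fs.subspace_0[OF P(1)] fs.subspace_0[OF Q(1)]
      by (auto simp: funs_on_def zero_fun_def)
  next
    fix f g assume fg: "f \<in> S" "g \<in> S"
    have "(\<lambda>x. if x \<in> X t then (f + g) (c x y) else 0) = (\<lambda>x. if x \<in> X t then f (c x y) else 0) + (\<lambda>x. if x \<in> X t then g (c x y) else 0)"
      "(\<lambda>y. if y \<in> Y t then (f + g) (c x y) else 0) = (\<lambda>y. if y \<in> Y t then f (c x y) else 0) + (\<lambda>y. if y \<in> Y t then g (c x y) else 0)"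
      for x y t by (auto simp: fun_eq_iff)
    note sums = this
    show "f + g \<in> S" unfolding S mem_Collect_eq sums
      using fg unfolding S by (auto intro!: fs.subspace_add[OF P(1)] fs.subspace_add[OF Q(1)] fs.subspace_add[OF subspace_funs_on])
  next
    fix a f assume f: "f \<in> S"
    have "(\<lambda>x. if x \<in> X t then fscale a f (c x y) else 0) = fscale a (\<lambda>x. if x \<in> X t then f (c x y) else 0)"
      "(\<lambda>y. if y \<in> Y t then fscale a f (c x y) else 0) = fscale a (\<lambda>y. if y \<in> Y t then f (c x y) else 0)"
      for x y t by (auto simp: fun_eq_iff fscale_apply)
    note scales = this
    show "fscale a f \<in> S" unfolding S mem_Collect_eq scales
      using f unfolding S by (auto intro!: fs.subspace_scale[OF P(1)] fs.subspace_scale[OF Q(1)] fs.subspace_scale[OF subspace_funs_on])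
  qed
  have "\<forall>t. \<exists>B. t \<in> T \<longrightarrow> B \<subseteq> X t \<and> frame (P t) B" using frame_exists[OF X P] by blast
  then obtain B where B: "\<And>t. t \<in> T \<Longrightarrow> B t \<subseteq> X t" "\<And>t. t \<in> T \<Longrightarrow> frame (P t) (B t)" by metis
  have "\<forall>t. \<exists>C. t \<in> T \<longrightarrow> C \<subseteq> Y t \<and> frame (Q t) C" using frame_exists[OF Y Q] by blast
  then obtain C where C: "\<And>t. t \<in> T \<Longrightarrow> C t \<subseteq> Y t" "\<And>t. t \<in> T \<Longrightarrow> frame (Q t) (C t)" by metis
  have "\<forall>t. \<exists>e. t \<in> T \<longrightarrow> (\<forall>b\<in>B t. e b \<in> P t \<and> (\<forall>c\<in>B t. e b c = (if c = b then 1 else 0)))"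
    using B(2) unfolding frame_def by blast
  then obtain e where e: "\<And>t b. t \<in> T \<Longrightarrow> b \<in> B t \<Longrightarrow> e t b \<in> P t"
    "\<And>t b c. t \<in> T \<Longrightarrow> b \<in> B t \<Longrightarrow> c \<in> B t \<Longrightarrow> e t b c = (if c = b then 1 else 0)" by metis
  have "\<forall>t. \<exists>e. t \<in> T \<longrightarrow> (\<forall>b\<in>C t. e b \<in> Q t \<and> (\<forall>c\<in>C t. e b c = (if c = b then 1 else 0)))"
    using C(2) unfolding frame_def by blast
  then obtain e' where e': "\<And>t b. t \<in> T \<Longrightarrow> b \<in> C t \<Longrightarrow> e' t b \<in> Q t"
    "\<And>t b c. t \<in> T \<Longrightarrow> b \<in> C t \<Longrightarrow> c \<in> C t \<Longrightarrow> e' t b c = (if c = b then 1 else 0)" by metis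
  have zB: "f = 0" if "t \<in> T" "f \<in> P t" "\<And>b. b \<in> B t \<Longrightarrow> f b = 0" for t f
    using B(2)[OF that(1)] that unfolding frame_def by blast
  have zC: "f = 0" if "t \<in> T" "f \<in> Q t" "\<And>b. b \<in> C t \<Longrightarrow> f b = 0" for t f
    using C(2)[OF that(1)] that unfolding frame_def by blast
  define D where "D = (SIGMA t:T. B t \<times> C t)"
  have DA: "D \<subseteq> A" unfolding D_def A_def using B(1) C(1) by blast
  have finB: "finite (B t)" "finite (C t)" if "t \<in> T" for t
    using B(1) C(1) X Y that by (meson finite_subset)+
  have finD: "finite D" unfolding D_def using T finB by auto
  have ccinv: "inv_into A cc (c x y) = (t, x, y)" if "t \<in> T" "x \<in> X t" "y \<in> Y t" for t x y
    using inv_into_f_f[OF injA, of "(t, x, y)"] that unfolding A_def cc_def by auto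
  \<comment> \<open>The products of the dual bases of \<open>P t\<close> and \<open>Q t\<close>,
    moved along \<open>c\<close>; they are dual to the evaluations at the points of
    \<open>D\<close>.\<close>
  define E where "E = (\<lambda>d z. if z \<in> cc ` A then
     (let (t, b, b') = inv_into A cc d; (s, x, y) = inv_into A cc z in if s = t then e t b x * e' t b' y else 0) else 0)"
  have Eval: "E (c b b') (c x y) = (if s = t then e t b x * e' t b' y else 0)"
    if "t \<in> T" "b \<in> B t" "b' \<in> C t" "s \<in> T" "x \<in> X s" "y \<in> Y s" for t b b' s x y
  proof -
    have "c x y \<in> cc ` A" unfolding A_def cc_def using that by force
    moreover have "b \<in> X t" "b' \<in> Y t" using that B(1) C(1) by blast+
    ultimately show ?thesis unfolding E_def using ccinv[of t b b'] ccinv[of s x y] that by simp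
  qed
  have fr: "frame S (cc ` D)"
    unfolding frame_def
  proof (intro conjI exI[of _ E] ballI impI)
    show "fs.subspace S" by fact
    show "finite (cc ` D)" using finD by simp
    show "f = 0" if f: "f \<in> S" "\<forall>d\<in>cc ` D. f d = 0" for f
    proof
      fix z
      show "f z = 0 z"
      proof (cases "z \<in> cc ` A")
        case False
        thus ?thesis using f(1) unfolding S A_def cc_def funs_on_def by auto
      next
        case True
        then obtain t x y where t: "t \<in> T" "x \<in> X t" "y \<in> Y t" "z = c x y" unfolding A_def cc_def by auto
        \<comment> \<open>For fixed \<open>b'\<close> the pivots in \<open>B t\<close> force the
          whole slice in the first variable to vanish; the pivots in \<open>C t\<close> then do the
          same in the second variable.\<close>
        have 1: "f (c x b') = 0" if b': "b' \<in> C t" and x: "x \<in> X t" for b' x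
        proof -
          have "b' \<in> Y t" using b' C(1) t by auto
          hence "(\<lambda>x. if x \<in> X t then f (c x b') else 0) \<in> P t" using f(1) t(1) unfolding S by auto
          moreover have "f (c b b') = 0" if "b \<in> B t" for b
            using f(2) that b' t(1) unfolding D_def cc_def by force
          ultimately have "(\<lambda>x. if x \<in> X t then f (c x b') else 0) = 0" using zB[OF t(1)] by simp
          from fun_cong[OF this, of x] show ?thesis using x by simp
        qed
        have "(\<lambda>y. if y \<in> Y t then f (c x y) else 0) \<in> Q t" using f(1) t unfolding S by auto
        hence "(\<lambda>y. if y \<in> Y t then f (c x y) else 0) = 0" using zC[OF t(1)] 1 t(2) by simp
        from fun_cong[OF this, of y] show ?thesis using t by simp
      qed
    qed
    fix d assume "d \<in> cc ` D"
    then obtain t b b' where t: "t \<in> T" "b \<in> B t" "b' \<in> C t" "d = c b b'" unfolding D_def cc_def by auto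
    show "E d \<in> S" unfolding S mem_Collect_eq
    proof (intro conjI ballI)
      show "E d \<in> funs_on ((\<lambda>(t, x, y). c x y) ` (SIGMA t:T. X t \<times> Y t))"
        unfolding funs_on_def E_def A_def cc_def by auto
      fix s assume s: "s \<in> T"
      show "(\<lambda>x. if x \<in> X s then E d (c x y) else 0) \<in> P s" if y: "y \<in> Y s" for y
      proof (cases "s = t")
        case True
        have "e t b x = 0" if "x \<notin> X t" for x by (rule funs_onD[OF subsetD[OF P(2)[OF t(1)] e(1)[OF t(1,2)]] that])
        hence "(\<lambda>x. if x \<in> X s then E d (c x y) else 0) = fscale (e' t b' y) (e t b)"
          using Eval[OF t(1-3) s _ y] t(4) True by (auto simp: fun_eq_iff fscale_apply)
        thus ?thesis using fs.subspace_scale[OF P(1)[OF t(1)] e(1)[OF t(1,2)]] True by simp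
      next
        case False
        hence "(\<lambda>x. if x \<in> X s then E d (c x y) else 0) = 0"
          using Eval[OF t(1-3) s _ y] t(4) by (auto simp: fun_eq_iff)
        thus ?thesis using fs.subspace_0[OF P(1)[OF s]] by simp
      qed
      show "(\<lambda>y. if y \<in> Y s then E d (c x y) else 0) \<in> Q s" if x: "x \<in> X s" for x
      proof (cases "s = t")
        case True
        have "e' t b' y = 0" if "y \<notin> Y t" for y by (rule funs_onD[OF subsetD[OF Q(2)[OF t(1)] e'(1)[OF t(1,3)]] that])
        hence "(\<lambda>y. if y \<in> Y s then E d (c x y) else 0) = fscale (e t b x) (e' t b')"
          using Eval[OF t(1-3) s x] t(4) True by (auto simp: fun_eq_iff fscale_apply)
        thus ?thesis using fs.subspace_scale[OF Q(1)[OF t(1)] e'(1)[OF t(1,3)]] True by simp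
      next
        case False
        hence "(\<lambda>y. if y \<in> Y s then E d (c x y) else 0) = 0"
          using Eval[OF t(1-3) s x] t(4) by (auto simp: fun_eq_iff)
        thus ?thesis using fs.subspace_0[OF Q(1)[OF s]] by simp
      qed
    qed
    fix z assume "z \<in> cc ` D"
    then obtain s x y where s: "s \<in> T" "x \<in> B s" "y \<in> C s" "z = c x y" unfolding D_def cc_def by auto
    have sXY: "x \<in> X s" "y \<in> Y s" "b \<in> X t" "b' \<in> Y t" using s t B(1) C(1) by auto
    have "inv_into A cc z = (s, x, y)" "inv_into A cc d = (t, b, b')"
      using ccinv[OF s(1) sXY(1,2)] ccinv[OF t(1) sXY(3,4)] s(4) t(4) by simp_all
    hence zd: "z = d \<longleftrightarrow> s = t \<and> x = b \<and> y = b'" using s(4) t(4) by (metis Pair_inject)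
    have E: "E d z = (if s = t then e t b x * e' t b' y else 0)"
      unfolding s(4) t(4) by (rule Eval[OF t(1-3) s(1) sXY(1,2)])
    show "E d z = (if z = d then 1 else 0)"
    proof (cases "s = t")
      case True
      hence "x \<in> B t" "y \<in> C t" using s by simp_all
      thus ?thesis unfolding E zd using True e(2)[OF t(1,2)] e'(2)[OF t(1,3)] by simp
    qed (simp add: E zd)
  qed
  have "card (cc ` D) = card D" by (rule card_image[OF inj_on_subset[OF injA DA]])
  also have "\<dots> = (\<Sum>t\<in>T. card (B t \<times> C t))" unfolding D_def using T finB by (intro card_SigmaI) auto
  also have "\<dots> = (\<Sum>t\<in>T. fs.dim (P t) * fs.dim (Q t))"
    using frame_dim[OF B(2)] frame_dim[OF C(2)] by (intro sum.cong) (auto simp: card_cartesian_product)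
  finally show "fs.dim S = (\<Sum>t\<in>T. fs.dim (P t) * fs.dim (Q t))" using frame_dim[OF fr] by simp
qed

section \<open>Polynomials and moments\<close>

context difference_ring begin

text \<open>\<open>u a - u b\<close> generates the kernel of a substitution into an integral domain
  and is therefore prime; a factor \<open>q\<close> outside the kernel contributes nothing.\<close>

lemma power_dvd_cancel:
  assumes ab: "a \<noteq> b" and q: "\<pi> a b q \<noteq> 0" and dvd: "(u a - u b) ^ k dvd q * h"
  shows "(u a - u b) ^ k dvd h"
  using dvd
proof (induction k arbitrary: h)
  case (Suc k)
  have "(u a - u b) dvd q * h" using Suc.prems by (rule dvd_trans[rotated]) simp
  hence "\<pi> a b q * \<pi> a b h = 0" using dvd_\<pi>_0[OF ab] \<pi>_mult by metis
  hence "(u a - u b) dvd h" using q by (intro \<pi>_dvd[OF ab]) simp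
  then obtain h' where h': "h = (u a - u b) * h'" by (auto simp: dvd_def)
  have ne: "u a - u b \<noteq> 0" using u_inj ab by auto
  have "(u a - u b) * (u a - u b) ^ k dvd (u a - u b) * (q * h')"
    using Suc.prems unfolding h' by (simp add: mult_ac)
  hence "(u a - u b) ^ k dvd q * h'" using ne by (simp only: dvd_mult_cancel_left) simp
  hence "(u a - u b) ^ k dvd h'" by (rule Suc.IH)
  thus ?case unfolding h' by simp
qed simp

text \<open>Factors of different unordered pairs are primes that are not associated, so divisibility
  may be tested pair by pair. Hypothesis \<open>one\<close> keeps a pair from contributing in both
  orders, where its two factors would be associated.\<close>

lemma alpha_dvdI:
  assumes fin: "finite L" and one: "\<And>a b. \<mu> (a, b) = 0 \<or> \<mu> (b, a) = 0"
    and dvd: "\<And>a b. (a, b) \<in> unsep L C \<Longrightarrow> (u a - u b) ^ \<mu> (a, b) dvd f"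
  shows "alpha L \<mu> C dvd f"
proof -
  have "(\<Prod>(a, b)\<in>S. (u a - u b) ^ \<mu> (a, b)) dvd f" if "S \<subseteq> unsep L C" "finite S" for S
    using that(2,1)
  proof (induction S rule: finite_induct)
    case (insert p S)
    obtain a b where p: "p = (a, b)" by fastforce
    define q where "q = (\<Prod>(a, b)\<in>S. (u a - u b) ^ \<mu> (a, b))"
    have ab: "a \<noteq> b" "(a, b) \<in> unsep L C" using insert.prems unfolding p unsep_def by auto
    obtain h where h: "f = q * h" using insert unfolding q_def by (auto simp: dvd_def)
    have "(u a - u b) ^ \<mu> (a, b) dvd h"
    proof (cases "\<mu> (a, b) = 0")
      case False
      have "\<pi> a b q = (\<Prod>(c, d)\<in>S. (u (merge a b c) - u (merge a b d)) ^ \<mu> (c, d))"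
        unfolding q_def \<pi>_prod merge_def by (rule prod.cong) (auto simp: \<pi>_power \<pi>_diff \<pi>_u simp del: if_split)
      also have "\<dots> \<noteq> 0"
      proof
        assume "(\<Prod>(c, d)\<in>S. (u (merge a b c) - u (merge a b d)) ^ \<mu> (c, d)) = 0"
        then obtain c d where cd: "(c, d) \<in> S" "\<mu> (c, d) \<noteq> 0" "u (merge a b c) = u (merge a b d)"
          using insert.hyps(1) by (auto split: if_splits)
        have "c \<noteq> d" using cd(1) insert.prems unfolding unsep_def by auto
        moreover have "merge a b c = merge a b d" using u_inj cd(3) by blast
        ultimately have "(c, d) = (a, b) \<or> (c, d) = (b, a)" unfolding merge_def by (auto split: if_splits)
        moreover have "(c, d) \<noteq> (a, b)" using cd(1) insert.hyps(2) p by auto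
        ultimately show False using one[of a b] False cd(2) by auto
      qed
      finally have nz: "\<pi> a b q \<noteq> 0" .
      have "(u a - u b) ^ \<mu> (a, b) dvd q * h" using dvd[OF ab(2)] h by simp
      thus ?thesis by (rule power_dvd_cancel[OF ab(1) nz])
    qed simp
    hence "q * (u a - u b) ^ \<mu> (a, b) dvd q * h" by (rule mult_dvd_mono[OF dvd_refl])
    thus ?case unfolding h prod.insert[OF insert.hyps] unfolding p q_def[symmetric]
      by (simp only: prod.case mult.commute)
  qed simp
  thus ?thesis unfolding alpha_def using finite_unsep[OF fin] by simp
qed

end

section \<open>Polynomials as finitely supported functions, and substitution of variables\<close>

lemma poly_mapping_eq_sum: "f = (\<Sum>x\<in>keys f. single x (lookup f x))"
proof (rule poly_mapping_eqI)
  fix z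
  show "lookup f z = lookup (\<Sum>x\<in>keys f. single x (lookup f x)) z"
    by (simp add: lookup_sum lookup_single when_def not_in_keys_iff_lookup_eq_zero)
qed

definition pushforward :: "('x \<Rightarrow> 'y) \<Rightarrow> ('x \<Rightarrow>\<^sub>0 'k::comm_monoid_add) \<Rightarrow> 'y \<Rightarrow>\<^sub>0 'k" where
  "pushforward h f = (\<Sum>x\<in>keys f. single (h x) (lookup f x))"

lemma pushforward_superset:
  "\<lbrakk>finite A; keys f \<subseteq> A\<rbrakk> \<Longrightarrow>
    pushforward h f = (\<Sum>x\<in>A. single (h x) (lookup f x))"
  unfolding pushforward_def by (rule sum.mono_neutral_left) (auto simp: in_keys_iff)

lemma pushforward_add: "pushforward h (f + g) = pushforward h f + pushforward h g"
proof -
  define A where "A = keys f \<union> keys g"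
  have A: "finite A" "keys f \<subseteq> A" "keys g \<subseteq> A" "keys (f + g) \<subseteq> A"
    using keys_add[of f g] unfolding A_def by auto
  show ?thesis
    unfolding pushforward_superset[OF A(1,2)] pushforward_superset[OF A(1,3)] pushforward_superset[OF A(1,4)]
    by (simp add: lookup_add single_add sum.distrib)
qed

lemma pushforward_0 [simp]: "pushforward h 0 = 0"
  by (simp add: pushforward_def)

lemma pushforward_single [simp]: "pushforward h (single x c) = single (h x) c"
  by (subst pushforward_superset[of "{x}"]) auto

lemma pushforward_sum: "pushforward h (sum f A) = (\<Sum>x\<in>A. pushforward h (f x))"
  by (induction A rule: infinite_finite_induct) (simp_all add: pushforward_add)

lemma pushforward_mult:
  fixes f g :: "'x::monoid_add \<Rightarrow>\<^sub>0 'k::semiring_0"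
  assumes "\<And>x y. h (x + y) = h x + h y"
  shows "pushforward h (f * g) = pushforward h f * pushforward h g"
proof -
  have "f * g = (\<Sum>x\<in>keys f. single x (lookup f x))
      * (\<Sum>y\<in>keys g. single y (lookup g y))"
    by (simp flip: poly_mapping_eq_sum)
  also have "pushforward h \<dots> = pushforward h f * pushforward h g"
    unfolding pushforward_def[of h f] pushforward_def[of h g]
    by (simp add: sum_product pushforward_sum mult_single assms)
  finally show ?thesis .
qed

lemma lookup_pushforward:
  "lookup (pushforward h f) z = (\<Sum>x\<in>{x\<in>keys f. h x = z}. lookup f x)"
  unfolding pushforward_def lookup_sum
  by (simp add: lookup_single when_def sum.inter_filter flip: sum.inter_filter)

lemma lookup_single_mult:
  fixes f :: "'x::cancel_comm_monoid_add \<Rightarrow>\<^sub>0 'k::comm_semiring_1"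
  shows "lookup (single s 1 * f) (s + e) = lookup f e"
    and "(\<And>e'. e \<noteq> s + e') \<Longrightarrow> lookup (single s 1 * f) e = 0"
proof -
  have *: "lookup (single s 1 * f) z
      = (\<Sum>x\<in>keys f. lookup f x when s + x = z)" for z
  proof -
    have "single s 1 * f
        = (\<Sum>x\<in>keys f. single (s + x) (lookup f x))"
      by (subst poly_mapping_eq_sum[of f]) (simp add: sum_distrib_left mult_single)
    thus ?thesis by (simp add: lookup_sum lookup_single)
  qed
  show "lookup (single s 1 * f) (s + e) = lookup f e"
    unfolding * by (simp add: when_def not_in_keys_iff_lookup_eq_zero)
  show "lookup (single s 1 * f) e = 0" if "\<And>e'. e \<noteq> s + e'"
    unfolding * by (intro sum.neutral ballI) (simp add: when_def that[symmetric])
qed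

type_synonym mpol = "(nat \<Rightarrow>\<^sub>0 nat) \<Rightarrow>\<^sub>0 rat"

definition var :: "nat \<Rightarrow> mpol" where "var a = single (single a 1) 1"

text \<open>The effect on exponent vectors of substituting \<open>var a\<close> for
  \<open>var b\<close>.\<close>

definition move :: "nat \<Rightarrow> nat \<Rightarrow> (nat \<Rightarrow>\<^sub>0 nat) \<Rightarrow> nat \<Rightarrow>\<^sub>0 nat" where
  "move a b e = (if a = b then e else Poly_Mapping.update b 0 e + single a (lookup e b))"

lemma lookup_move:
  "a \<noteq> b \<Longrightarrow> lookup (move a b e) x =
    (if x = a then lookup e a + lookup e b else if x = b then 0 else lookup e x)"
  by (simp add: move_def lookup_add lookup_update lookup_single)

lemma move_add: "move a b (e + e') = move a b e + move a b e'"
proof (cases "a = b")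
  case False
  show ?thesis by (rule poly_mapping_eqI) (simp add: lookup_move[OF False] lookup_add)
qed (simp add: move_def)

lemma move_idem: "move a b (move a b e) = move a b e"
proof (cases "a = b")
  case False
  show ?thesis by (rule poly_mapping_eqI) (use False in \<open>simp add: lookup_move\<close>)
qed (simp add: move_def)

lemma move_single: "move a b (single x k) = single (if x = b then a else x) k"
proof (cases "a = b")
  case False
  show ?thesis by (rule poly_mapping_eqI) (use False in \<open>auto simp: lookup_move lookup_single when_def\<close>)
qed (simp add: move_def)

lemma var_power: "var a ^ k = single (single a k) 1"
  by (induction k) (simp_all add: var_def mult_single flip: single_add)

text \<open>On a monomial this is the factorization of a difference of \<open>k\<close>-th powers.
  It shows that the kernel of the substitution consists of multiples of
  \<open>var a - var b\<close>.\<close>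

lemma pushforward_move_dvd:
  assumes "a \<noteq> b"
  shows "(var a - var b) dvd f - pushforward (move a b) f"
proof -
  have 1: "(var a - var b) dvd single e c - single (move a b e) c" for e :: "nat \<Rightarrow>\<^sub>0 nat" and c :: rat
  proof -
    define k where "k = lookup e b"
    define e' where "e' = Poly_Mapping.update b 0 e"
    have e: "e = e' + single b k"
      by (rule poly_mapping_eqI) (auto simp: e'_def k_def lookup_add lookup_update lookup_single when_def)
    have m: "move a b e = e' + single a k"
      using assms by (simp add: move_def e'_def k_def)
    have "single e c - single (move a b e) c = single e' c * (var b ^ k - var a ^ k)"
      by (subst e, subst m) (simp add: var_power right_diff_distrib mult_single)
    moreover have "(var b - var a) dvd (var b ^ k - var a ^ k)"
      by (simp add: power_diff_sumr2)
    hence "(var a - var b) dvd (var b ^ k - var a ^ k)" by (metis minus_diff_eq minus_dvd_iff)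
    ultimately show ?thesis by simp
  qed
  have "f - pushforward (move a b) f
      = (\<Sum>e\<in>keys f. single e (lookup f e) - single (move a b e) (lookup f e))"
    unfolding sum_subtractf pushforward_def by (simp flip: poly_mapping_eq_sum)
  thus ?thesis using 1 by (simp add: dvd_sum)
qed

interpretation mp: difference_ring var "\<lambda>a b. pushforward (move a b) :: mpol \<Rightarrow> mpol"
proof
  fix a b x :: nat and f g :: mpol
  show "pushforward (move a b) (f + g) = pushforward (move a b) f + pushforward (move a b) g"
    by (rule pushforward_add)
  show "pushforward (move a b) (f * g) = pushforward (move a b) f * pushforward (move a b) g"
    by (rule pushforward_mult) (rule move_add)
  have "move a b 0 = 0" using move_single[of a b 0 0] by simp
  thus "pushforward (move a b) 1 = (1 :: mpol)"
    using pushforward_single[of "move a b" 0 "1 :: rat"] by simp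
  show "pushforward (move a b) (var x) = var (if x = b then a else x)"
    unfolding var_def by (simp add: move_single del: One_nat_def)
  have "pushforward (move a b) (pushforward (move a b) f)
      = (\<Sum>e\<in>keys f. single (move a b (move a b e)) (lookup f e))"
    unfolding pushforward_def[of "move a b" f] by (simp add: pushforward_sum)
  thus "pushforward (move a b) (pushforward (move a b) f) = pushforward (move a b) f"
    unfolding pushforward_def[of "move a b" f] move_idem .
  show "(var a - var b) dvd f" if "a \<noteq> b" "pushforward (move a b) f = 0"
    using pushforward_move_dvd[OF that(1), of f] that(2) by simp
  show "a = b" if "var a = var b"
    using that unfolding var_def by (metis lookup_single_eq lookup_single_not_eq one_neq_zero)
qed

text \<open>Up to a shift of \<open>k\<close>, a coefficient of the \<open>q\<close>-th divided
  derivative of \<open>f\<close> in \<open>var b\<close>, restricted to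
  \<open>var a = var b\<close>. Here \<open>e\<close> records the other variables and
  \<open>k\<close> is the total exponent of \<open>a\<close> and \<open>b\<close>.\<close>

definition moment :: "nat \<Rightarrow> nat \<Rightarrow> nat \<Rightarrow> mpol \<Rightarrow> (nat \<Rightarrow>\<^sub>0 nat) \<Rightarrow> nat \<Rightarrow> rat" where
  "moment a b q f e k = (\<Sum>j\<le>k. of_nat ((k - j) choose q) *
     lookup f (e + single a j + single b (k - j)))"

lemma moment_0_iff:
  assumes ab: "a \<noteq> b"
  shows "(\<forall>e k. lookup e a = 0 \<longrightarrow> lookup e b = 0 \<longrightarrow> moment a b 0 f e k = 0)
    \<longleftrightarrow> pushforward (move a b) f = 0"
proof -
  have *: "lookup (pushforward (move a b) f) (e + single a k) = moment a b 0 f e k"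
    if e: "lookup e a = 0" "lookup e b = 0" for e k
  proof -
    define g where "g = (\<lambda>j. e + single a j + single b (k - j))"
    have inj: "inj_on g {..k}"
    proof (rule inj_onI)
      fix i j assume "g i = g j"
      hence "lookup (g i) a = lookup (g j) a" by simp
      thus "i = j" using ab unfolding g_def by (simp add: lookup_add lookup_single when_def)
    qed
    have "move a b x = e + single a k \<longleftrightarrow> x \<in> g ` {..k}" for x
    proof
      assume m: "move a b x = e + single a k"
      have lk: "lookup (move a b x) y = lookup (e + single a k) y" for y
        using m by simp
      have k: "lookup x a + lookup x b = k"
        using lk[of a] e ab by (simp add: lookup_move lookup_add)
      have "x = g (lookup x a)"
      proof (rule poly_mapping_eqI)
        fix y
        show "lookup x y = lookup (g (lookup x a)) y"
          using lk[of y] e ab k unfolding g_def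
          by (cases "y = a"; cases "y = b") (auto simp: lookup_move lookup_add lookup_single when_def)
      qed
      thus "x \<in> g ` {..k}" using k by auto
    next
      assume "x \<in> g ` {..k}"
      then obtain j where j: "j \<le> k" "x = g j" by auto
      show "move a b x = e + single a k"
        by (rule poly_mapping_eqI)
          (use j e ab in \<open>auto simp: g_def lookup_move lookup_add lookup_single when_def\<close>)
    qed
    hence "lookup (pushforward (move a b) f) (e + single a k)
        = (\<Sum>x\<in>{x\<in>keys f. x \<in> g ` {..k}}. lookup f x)"
      unfolding lookup_pushforward by simp
    also have "\<dots> = (\<Sum>x\<in>g ` {..k}. lookup f x)"
      by (rule sum.mono_neutral_left) (auto simp: in_keys_iff)
    also have "\<dots> = moment a b 0 f e k" unfolding moment_def using inj by (simp add: sum.reindex g_def)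
    finally show ?thesis .
  qed
  show ?thesis
  proof
    assume m: "\<forall>e k. lookup e a = 0 \<longrightarrow> lookup e b = 0 \<longrightarrow> moment a b 0 f e k = 0"
    show "pushforward (move a b) f = 0"
    proof (rule poly_mapping_eqI)
      fix z :: "nat \<Rightarrow>\<^sub>0 nat"
      show "lookup (pushforward (move a b) f) z = lookup 0 z"
      proof (cases "lookup z b = 0")
        case True
        define e where "e = Poly_Mapping.update a 0 z"
        have z: "z = e + single a (lookup z a)"
          by (rule poly_mapping_eqI) (auto simp: e_def lookup_add lookup_update lookup_single when_def)
        have e: "lookup e a = 0" "lookup e b = 0"
          using True ab by (auto simp: e_def lookup_update)
        show ?thesis by (subst z, subst *[OF e]) (use m e in simp)
      next
        case False
        hence "move a b x \<noteq> z" for x using lookup_move[OF ab, of x b] ab by auto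
        thus ?thesis by (simp add: lookup_pushforward)
      qed
    qed
  qed (use * in \<open>metis lookup_zero\<close>)
qed

text \<open>Multiplication by \<open>var a\<close> and by \<open>var b\<close> gives the same sum
  with binomials at \<open>k - j\<close> and at \<open>k - j + 1\<close>; Pascal's rule leaves the
  binomial of order \<open>q\<close>.\<close>

lemma moment_mult:
  assumes ab: "a \<noteq> b" and e: "lookup e a = 0" "lookup e b = 0"
  shows "moment a b (Suc q) ((var a - var b) * f) e (Suc k) = - moment a b q f e k"
    and "moment a b (Suc q) g e 0 = 0"
proof -
  define z where "z = (\<lambda>i j. e + single a i + single b j)"
  have lz: "lookup (z i j) a = i" "lookup (z i j) b = j" for i j
    using ab e by (simp_all add: z_def lookup_add lookup_single when_def)
  have A1: "lookup (var a * f) (z (Suc i) j) = lookup f (z i j)" for i j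
  proof -
    have "z (Suc i) j = single a 1 + z i j"
      unfolding z_def by (rule poly_mapping_eqI) (simp add: lookup_add lookup_single when_def)
    thus ?thesis unfolding var_def by (simp only: lookup_single_mult(1))
  qed
  have A0: "lookup (var a * f) (z 0 j) = 0" for j
    unfolding var_def
  proof (rule lookup_single_mult(2))
    fix e' show "z 0 j \<noteq> single a 1 + e'"
      using lz(1)[of 0 j] by (auto simp: lookup_add)
  qed
  have B1: "lookup (var b * f) (z i (Suc j)) = lookup f (z i j)" for i j
  proof -
    have "z i (Suc j) = single b 1 + z i j"
      unfolding z_def by (rule poly_mapping_eqI) (simp add: lookup_add lookup_single when_def)
    thus ?thesis unfolding var_def by (simp only: lookup_single_mult(1))
  qed
  have B0: "lookup (var b * f) (z i 0) = 0" for i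
    unfolding var_def
  proof (rule lookup_single_mult(2))
    fix e' show "z i 0 \<noteq> single b 1 + e'"
      using lz(2)[of i 0] by (auto simp: lookup_add)
  qed
  have "moment a b (Suc q) ((var a - var b) * f) e (Suc k)
     = (\<Sum>j\<le>Suc k. of_nat ((Suc k - j) choose Suc q) * lookup (var a * f) (z j (Suc k - j)))
     - (\<Sum>j\<le>Suc k. of_nat ((Suc k - j) choose Suc q) * lookup (var b * f) (z j (Suc k - j)))"
    unfolding moment_def z_def by (simp add: left_diff_distrib lookup_minus right_diff_distrib sum_subtractf del: sum.atMost_Suc)
  also have "(\<Sum>j\<le>Suc k. of_nat ((Suc k - j) choose Suc q) * lookup (var a * f) (z j (Suc k - j)))
     = (\<Sum>j\<le>k. of_nat ((k - j) choose Suc q) * lookup f (z j (k - j)))"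
    by (subst sum.atMost_Suc_shift) (simp add: A0 A1)
  also have "(\<Sum>j\<le>Suc k. of_nat ((Suc k - j) choose Suc q) * lookup (var b * f) (z j (Suc k - j)))
     = (\<Sum>j\<le>k. of_nat ((Suc k - j) choose Suc q) * lookup f (z j (k - j)))"
    by (simp add: B0) (rule sum.cong, simp, simp add: Suc_diff_le B1)
  also have "(\<Sum>j\<le>k. of_nat ((k - j) choose Suc q) * lookup f (z j (k - j))) -
     (\<Sum>j\<le>k. of_nat ((Suc k - j) choose Suc q) * lookup f (z j (k - j)))
     = (\<Sum>j\<le>k. - (of_nat ((k - j) choose q) * lookup f (z j (k - j))))"
    unfolding sum_subtractf[symmetric] by (rule sum.cong) (simp_all add: Suc_diff_le algebra_simps)
  also have "\<dots> = - moment a b q f e k" unfolding moment_def z_def by (simp add: sum_negf)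
  finally show "moment a b (Suc q) ((var a - var b) * f) e (Suc k) = - moment a b q f e k" .
  show "moment a b (Suc q) g e 0 = 0" by (simp add: moment_def)
qed

text \<open>The bridge from the moment relations of the algebra to divisibility. Order zero detects
  one factor \<open>var a - var b\<close>, and dividing by it lowers the order of all remaining
  moments by one.\<close>

lemma power_dvd_iff_moments:
  assumes ab: "a \<noteq> b"
  shows "(var a - var b) ^ m dvd f \<longleftrightarrow>
    (\<forall>q<m. \<forall>e k. lookup e a = 0 \<longrightarrow> lookup e b = 0 \<longrightarrow> moment a b q f e k = 0)"
proof (induction m arbitrary: f)
  case (Suc m f)
  define M where "M = (\<lambda>q f. \<forall>e k. lookup e a = 0 \<longrightarrow> lookup e b = 0 \<longrightarrow> moment a b q f e k = 0)"
  have M0: "M 0 f \<longleftrightarrow> (var a - var b) dvd f" for f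
    unfolding M_def moment_0_iff[OF ab] using mp.\<pi>_dvd[OF ab] mp.dvd_\<pi>_0[OF ab] by blast
  have MS: "M (Suc q) ((var a - var b) * g) \<longleftrightarrow> M q g" for q g
  proof
    assume "M (Suc q) ((var a - var b) * g)"
    thus "M q g" unfolding M_def using moment_mult(1)[OF ab] by (metis neg_equal_0_iff_equal)
  next
    assume M: "M q g"
    show "M (Suc q) ((var a - var b) * g)" unfolding M_def
    proof (intro allI impI)
      fix e :: "nat \<Rightarrow>\<^sub>0 nat" and k assume e: "lookup e a = 0" "lookup e b = 0"
      show "moment a b (Suc q) ((var a - var b) * g) e k = 0"
        using moment_mult[OF ab e] M e unfolding M_def by (cases k) simp_all
    qed
  qed
  have ne: "var a - var b \<noteq> 0" using mp.u_inj ab by auto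
  have "(var a - var b) ^ Suc m dvd f \<longleftrightarrow> (\<forall>q<Suc m. M q f)"
  proof
    assume d: "(var a - var b) ^ Suc m dvd f"
    hence "(var a - var b) dvd f" by (metis dvd_mult_left power_Suc)
    then obtain g where g: "f = (var a - var b) * g" by (auto simp: dvd_def)
    have "(var a - var b) ^ m dvd g" using d ne unfolding g by simp
    hence "\<forall>q<m. M q g" using Suc.IH unfolding M_def by simp
    thus "\<forall>q<Suc m. M q f" using MS[of _ g] M0[of f] unfolding g
      by (metis dvd_triv_left less_Suc_eq_0_disj)
  next
    assume m: "\<forall>q<Suc m. M q f"
    hence "(var a - var b) dvd f" using M0 by blast
    then obtain g where g: "f = (var a - var b) * g" by (auto simp: dvd_def)
    have "\<forall>q<m. M q g" using m MS[of _ g] unfolding g by auto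
    hence "(var a - var b) ^ m dvd g" using Suc.IH unfolding M_def by simp
    thus "(var a - var b) ^ Suc m dvd f" unfolding g by simp
  qed
  thus ?case unfolding M_def .
qed simp

section \<open>Words and arrangements\<close>

text \<open>Order the largest member of the chain recursively, then append the elements outside
  it.\<close>

lemma chain_in_linearization:
  assumes "finite L" "chain_in L C"
  shows "\<exists>s. distinct s \<and> set s = L \<and> (\<forall>A\<in>C. set (take (card A) s) = A)"
  using assms
proof (induction "card C" arbitrary: L C)
  case 0
  hence "C = {}" using chain_in_finite by fastforce
  thus ?case using finite_distinct_list[OF 0(2)] by auto
next
  case (Suc n)
  have fin: "finite C" using chain_in_finite Suc.prems by blast
  have ne: "C \<noteq> {}" using Suc.hyps(2) by auto
  define B where "B = \<Union>C"
  have B: "B \<in> C" unfolding B_def by (rule chain_in_Union[OF fin Suc.prems(2) ne])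
  have BL: "B \<subseteq> L" using B Suc.prems(2) unfolding chain_in_def by blast
  have "chain_in B (C - {B})"
    using Suc.prems(2) unfolding chain_in_def B_def by (auto intro: totally_ordered_subset)
  moreover have "n = card (C - {B})" using Suc.hyps(2) B fin by simp
  moreover have "finite B" using BL Suc.prems(1) by (rule finite_subset)
  ultimately obtain s where s: "distinct s" "set s = B" "\<And>A. A \<in> C - {B} \<Longrightarrow> set (take (card A) s) = A"
    using Suc.hyps(1)[of "C - {B}" B] by blast
  obtain t where t: "distinct t" "set t = L - B" using finite_distinct_list[of "L - B"] Suc.prems(1) by auto
  have len: "length s = card B" using s distinct_card by fastforce
  have "set (take (card A) (s @ t)) = A" if A: "A \<in> C" for A
  proof (cases "A = B")
    case False
    have "card A \<le> card B" using A \<open>finite B\<close> unfolding B_def by (intro card_mono) auto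
    thus ?thesis using s(3) A False len by simp
  qed (use len s in simp)
  moreover have "distinct (s @ t)" "set (s @ t) = L" using s t BL by auto
  ultimately show ?case by blast
qed

section \<open>Orderings of a finite set and their initial segments\<close>

definition arrangement :: "'a set \<Rightarrow> 'a list \<Rightarrow> bool" where
  "arrangement L s \<longleftrightarrow> distinct s \<and> set s = L"

text \<open>The cut at \<open>p\<close> lies between positions \<open>p\<close> and
  \<open>p + 1\<close>, hence \<open>Suc p\<close>. In a list of length \<open>n\<close> the proper
  cuts have \<open>p < n - 1\<close>, which is the index set \<open>{..<n - 1}\<close> used
  throughout.\<close>

definition cut :: "'a list \<Rightarrow> nat \<Rightarrow> 'a set" where "cut s p = set (take (Suc p) s)"

lemma arrangement_length: "arrangement L s \<Longrightarrow> length s = card L"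
  unfolding arrangement_def using distinct_card by fastforce

lemma arrangement_swap: "arrangement L (s @ a # b # t) \<Longrightarrow> arrangement L (s @ b # a # t)"
  unfolding arrangement_def by auto

lemma cut_swap: "length s \<noteq> p \<Longrightarrow> cut (s @ a # b # t) p = cut (s @ b # a # t) p"
proof -
  assume "length s \<noteq> p"
  then consider "Suc p \<le> length s" | "length s + 2 \<le> Suc p" by linarith
  thus ?thesis
  proof cases
    case 2
    then obtain k where "Suc p - length s = Suc (Suc k)" by (metis add_2_eq_Suc le_Suc_ex add_diff_cancel_left' add.assoc)
    thus ?thesis unfolding cut_def using 2 by auto
  qed (simp add: cut_def)
qed

context
  fixes L :: "'a set" and U :: "nat set" and T :: "'a list \<Rightarrow> 'b"
  assumes T: "\<And>s a b t. arrangement L (s @ a # b # t) \<Longrightarrow> length s \<notin> U \<Longrightarrow> T (s @ a # b # t) = T (s @ b # a # t)"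
begin

lemma bubble:
  assumes "arrangement L (s @ ys @ a # t)" "\<And>p. length s \<le> p \<Longrightarrow> p < length s + length ys \<Longrightarrow> p \<notin> U"
  shows "T (s @ ys @ a # t) = T (s @ a # ys @ t)"
  using assms
proof (induction ys arbitrary: t rule: rev_induct)
  case (snoc y ys)
  have "T ((s @ ys) @ y # a # t) = T ((s @ ys) @ a # y # t)"
    using snoc.prems by (intro T) simp_all
  moreover have "T (s @ ys @ a # y # t) = T (s @ a # ys @ y # t)"
    using snoc.prems arrangement_swap[of L "s @ ys" y a t] by (intro snoc.IH) simp_all
  ultimately show ?case by simp
qed simp

text \<open>Orderings with the same cuts at \<open>U\<close> differ by exchanges inside blocks, so
  \<open>T\<close> depends on these cuts only. The first entry of one ordering is moved to the front
  of the other; a cut of \<open>U\<close> on its way would distinguish the two.\<close>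

lemma same_cuts:
  assumes "arrangement L (s @ xs)" "arrangement L (s @ zs)" "\<And>p. p \<in> U \<Longrightarrow> cut (s @ xs) p = cut (s @ zs) p"
  shows "T (s @ xs) = T (s @ zs)"
  using assms
proof (induction xs arbitrary: s zs)
  case Nil
  hence "length (s @ []) = length (s @ zs)" using arrangement_length by metis
  thus ?case by simp
next
  case (Cons a xs)
  have "a \<in> set zs" using Cons.prems(1,2) unfolding arrangement_def by auto
  then obtain ys ts where zs: "zs = ys @ a # ts" by (meson split_list)
  have nU: "p \<notin> U" if p: "length s \<le> p" "p < length s + length ys" for p
  proof
    assume "p \<in> U"
    hence eq: "cut (s @ a # xs) p = cut (s @ zs) p" by (rule Cons.prems(3))
    have "a \<in> cut (s @ a # xs) p" unfolding cut_def using p(1) by (auto simp: Suc_diff_le)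
    moreover have "a \<notin> cut (s @ zs) p"
    proof -
      have "set (take (Suc p) (s @ zs)) \<subseteq> set s \<union> set ys"
        unfolding zs using p by (auto dest: in_set_takeD)
      thus ?thesis using Cons.prems(2) unfolding cut_def arrangement_def zs by auto
    qed
    ultimately show False using eq by simp
  qed
  have ar: "arrangement L (s @ ys @ a # ts)" using Cons.prems(2) unfolding zs .
  hence ar': "arrangement L ((s @ [a]) @ ys @ ts)" unfolding arrangement_def by auto
  have "T (s @ ys @ a # ts) = T (s @ a # ys @ ts)" by (rule bubble[OF ar nU])
  moreover have "T ((s @ [a]) @ xs) = T ((s @ [a]) @ ys @ ts)"
  proof (rule Cons.IH[OF _ ar'])
    show "arrangement L ((s @ [a]) @ xs)" using Cons.prems(1) by simp
    fix p assume p: "p \<in> U"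
    have "cut (s @ ys @ a # ts) p = cut (s @ a # ys @ ts) p"
    proof (cases "p < length s")
      case False
      hence "length s + length ys \<le> p" using nU[of p] p by force
      then obtain k where "p = length s + length ys + k" by (metis le_Suc_ex)
      thus ?thesis unfolding cut_def by (auto simp: take_Cons')
    qed (simp add: cut_def)
    thus "cut ((s @ [a]) @ xs) p = cut ((s @ [a]) @ ys @ ts) p" using Cons.prems(3)[OF p] unfolding zs by simp
  qed
  ultimately show ?case unfolding zs by simp
qed

end

lemma cut_props:
  assumes s: "arrangement L s" and n: "card L = n"
  shows "p < n \<Longrightarrow> card (cut s p) = Suc p"
    and "p < q \<Longrightarrow> q < n \<Longrightarrow> cut s p \<subset> cut s q"
    and "cut s p \<subseteq> L"
proof -
  have len: "length s = n" using arrangement_length[OF s] n by simp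
  have d: "distinct s" using s unfolding arrangement_def by simp
  show c: "card (cut s p) = Suc p" if "p < n" for p
    unfolding cut_def using distinct_card[OF distinct_take[OF d]] that len by simp
  show "cut s p \<subset> cut s q" if "p < q" "q < n"
  proof -
    have "cut s p \<subseteq> cut s q" unfolding cut_def using that by (intro set_take_subset_set_take) simp
    moreover have "card (cut s p) \<noteq> card (cut s q)" using c that by simp
    ultimately show ?thesis by auto
  qed
  show "cut s p \<subseteq> L" using s unfolding cut_def arrangement_def by (auto dest: in_set_takeD)
qed

text \<open>The size of a cut minus one is its position. Along a fixed ordering, sets of positions
  and chains of cuts therefore determine each other, with the same order.\<close>

lemma cut_chain:
  assumes s: "arrangement L s" and n: "card L = n" and V: "V \<subseteq> {..<n - 1}"
  shows "inj_on (cut s) V" "\<And>p q. p \<in> V \<Longrightarrow> q \<in> V \<Longrightarrow> cut s p < cut s q \<longleftrightarrow> p < q"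
    "chain_in L (cut s ` V)" "card (cut s ` V) = card V" "(\<lambda>A. card A - 1) ` cut s ` V = V"
proof -
  have Vn: "p < n" if "p \<in> V" for p using that V by auto
  show less: "cut s p < cut s q \<longleftrightarrow> p < q" if "p \<in> V" "q \<in> V" for p q
    using cut_props(2)[OF s n] Vn that by (metis less_asym' nat_neq_iff psubset_eq less_irrefl)
  show inj: "inj_on (cut s) V" using cut_props(1)[OF s n] Vn by (metis inj_onI nat.inject)
  show "card (cut s ` V) = card V" by (rule card_image[OF inj])
  show "(\<lambda>A. card A - 1) ` cut s ` V = V" unfolding image_image using cut_props(1)[OF s n] Vn by simp
  have "cut s p \<subseteq> L \<and> cut s p \<noteq> {} \<and> cut s p \<noteq> L" if "p \<in> V" for p
  proof -
    have "card (cut s p) = Suc p" "p < n - 1" using cut_props(1)[OF s n Vn[OF that]] V that by auto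
    thus ?thesis using cut_props(3)[OF s n] n by auto
  qed
  moreover have "totally_ordered (cut s ` V)"
  proof (rule totally_ordered_image)
    show "totally_ordered V" unfolding totally_ordered_def by (auto simp: linear)
    show "cut s p \<le> cut s q" if "p \<le> q" for p q
      unfolding cut_def using that by (intro set_take_subset_set_take) simp
  qed
  ultimately show "chain_in L (cut s ` V)" unfolding chain_in_def by blast
qed

lemma chain_cuts:
  assumes L: "finite L" "card L = n" and C: "chain_in L C"
  obtains s where "arrangement L s" "cut s ` ((\<lambda>A. card A - 1) ` C) = C" "(\<lambda>A. card A - 1) ` C \<subseteq> {..<n - 1}"
    "card ((\<lambda>A. card A - 1) ` C) = card C"
proof -
  obtain s where s: "distinct s" "set s = L" "\<And>A. A \<in> C \<Longrightarrow> set (take (card A) s) = A"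
    using chain_in_linearization[OF L(1) C] by blast
  have A: "card A \<noteq> 0" "card A < n" if "A \<in> C" for A
  proof -
    have "A \<subset> L" "A \<noteq> {}" using C that unfolding chain_in_def by auto
    thus "card A \<noteq> 0" "card A < n" using psubset_card_mono[OF L(1), of A] L finite_subset[of A L] by auto
  qed
  have c: "cut s (card A - 1) = A" if "A \<in> C" for A unfolding cut_def using s(3) A that by simp
  have "cut s ` ((\<lambda>A. card A - 1) ` C) = C" unfolding image_image using c by simp
  moreover have "(\<lambda>A. card A - 1) ` C \<subseteq> {..<n - 1}" using A by force
  moreover have "card ((\<lambda>A. card A - 1) ` C) = card C"
    by (rule card_image, rule inj_onI) (metis c)
  ultimately show ?thesis using that s unfolding arrangement_def by blast
qed

lemma lookup_sign_mult: "lookup ((- 1) ^ k * f :: 'x::comm_monoid_add \<Rightarrow>\<^sub>0 'k::comm_ring_1) e = (- 1) ^ k * lookup f e"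
  by (cases "even k") simp_all

lemma lookup_coboundary:
  fixes X :: "'y::order set \<Rightarrow> 'x::comm_monoid_add \<Rightarrow>\<^sub>0 'k::comm_ring_1"
  shows "lookup (coboundary X U) e = coboundary (\<lambda>V. lookup (X V) e) U"
  unfolding coboundary_def by (simp add: lookup_sum lookup_sign_mult)

section \<open>Exponent vectors, weights and functions on coloured words\<close>

definition exponent :: "nat list \<Rightarrow> nat list \<Rightarrow> nat \<Rightarrow>\<^sub>0 nat" where
  "exponent s ks = sum_list (map2 single s ks)"

lemma exponent_append:
  "length s = length ks \<Longrightarrow> exponent (s @ t) (ks @ ls) = exponent s ks + exponent t ls"
  unfolding exponent_def by simp

lemma exponent_Cons: "exponent (a # s) (k # ks) = single a k + exponent s ks"
  unfolding exponent_def by simp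

lemma lookup_exponent_notin: "a \<notin> set s \<Longrightarrow> length s = length ks \<Longrightarrow> lookup (exponent s ks) a = 0"
proof (induction s ks rule: list_induct2')
  case (4 b s k ks)
  thus ?case by (simp add: exponent_Cons lookup_add lookup_single when_def)
qed (simp_all add: exponent_def)

lemma map_lookup_exponent:
  "length s = length ks \<Longrightarrow> distinct s \<Longrightarrow> map (lookup (exponent s ks)) s = ks"
proof (induction s ks rule: list_induct2)
  case (Cons a s k ks)
  have eq: "map (lookup (exponent (a # s) (k # ks))) s = map (lookup (exponent s ks)) s"
    using Cons by (intro map_cong) (auto simp: exponent_Cons lookup_add lookup_single when_def)
  have "map (lookup (exponent (a # s) (k # ks))) s = ks" unfolding eq using Cons by simp
  moreover have "lookup (exponent (a # s) (k # ks)) a = k"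
    using Cons lookup_exponent_notin[of a s ks] by (simp add: exponent_Cons lookup_add)
  ultimately show ?case by (simp only: list.map)
qed simp

lemma sum_lookup_eq_sum_list:
  "arrangement L s \<Longrightarrow> (\<Sum>a\<in>L. lookup e a) = sum_list (map (lookup e) s)"
  unfolding arrangement_def by (metis sum.distinct_set_conv_list)

definition len :: "('v \<Rightarrow>\<^sub>0 nat) \<Rightarrow> nat" where
  "len d = (\<Sum>i\<in>keys d. lookup d i)"

lemma len_superset: "finite A \<Longrightarrow> keys d \<subseteq> A \<Longrightarrow> len d = (\<Sum>i\<in>A. lookup d i)"
  unfolding len_def by (rule sum.mono_neutral_left) (auto simp: in_keys_iff)

lemma len_add: "len (d + e) = len d + len e"
proof -
  define A where "A = keys d \<union> keys e"
  have A: "finite A" "keys d \<subseteq> A" "keys e \<subseteq> A" "keys (d + e) \<subseteq> A"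
    using keys_add[of d e] unfolding A_def by auto
  show ?thesis unfolding len_superset[OF A(1,2)] len_superset[OF A(1,3)] len_superset[OF A(1,4)]
    by (simp add: lookup_add sum.distrib)
qed

lemma weight_Nil [simp]: "weight [] = 0"
  and weight_Cons: "weight (x # w) = single (fst x) 1 + weight w"
  and weight_append: "weight (u @ w) = weight u + weight w"
  by (auto simp: weight_def case_prod_beta)

lemma len_weight: "len (weight w) = length w"
proof (induction w)
  case (Cons x w)
  have "len (single (fst x) 1) = 1" by (simp add: len_def)
  thus ?case using Cons by (simp add: weight_Cons len_add)
qed (simp add: len_def)

lemma lookup_weight: "lookup (weight w) i = count (mset (map fst w)) i"
  by (induction w) (auto simp: weight_Cons lookup_add lookup_single when_def)

definition swap_at :: "nat \<Rightarrow> 'a list \<Rightarrow> 'a list" where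
  "swap_at p s = take p s @ s ! Suc p # s ! p # drop (Suc (Suc p)) s"

lemma swap_at_append: "length s = p \<Longrightarrow> swap_at p (s @ a # b # t) = s @ b # a # t"
  unfolding swap_at_def by (simp add: nth_append)

lemma split_at: "Suc p < length s \<Longrightarrow> \<exists>u a b t. s = u @ a # b # t \<and> length u = p"
  by (metis Cons_nth_drop_Suc Suc_lessD id_take_nth_drop length_take min.absorb4)

text \<open>The commutation signs stay abstract because the theory is applied twice, to the algebra
  and to its Koszul dual, with different sign rules.\<close>

locale coloured =
  fixes V :: "'v set" and m :: "'v \<Rightarrow> 'v \<Rightarrow> nat" and \<epsilon> :: "'v \<Rightarrow> 'v \<Rightarrow> rat"
  assumes finite_V: "finite V"
    and m_sym: "i \<in> V \<Longrightarrow> j \<in> V \<Longrightarrow> m i j = m j i"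
    and \<epsilon>_sym: "i \<in> V \<Longrightarrow> j \<in> V \<Longrightarrow> \<epsilon> i j = \<epsilon> j i"
    and \<epsilon>_sq: "i \<in> V \<Longrightarrow> j \<in> V \<Longrightarrow> \<epsilon> i j * \<epsilon> i j = 1"
begin

text \<open>For a given weight the cohomological degree of a word is an affine function of
  \<open>D\<close>, so these finite sets index the homogeneous components.\<close>

definition words :: "('v \<Rightarrow>\<^sub>0 nat) \<Rightarrow> nat \<Rightarrow> ('v \<times> nat) list set" where
  "words d D = {w \<in> lists (V \<times> UNIV). weight w = d \<and> sum_list (map snd w) = D}"

lemma length_words: "w \<in> words d D \<Longrightarrow> length w = len d"
  unfolding words_def by (auto simp: len_weight)

lemma finite_words: "finite (words d D)"
proof (rule finite_subset)
  show "words d D \<subseteq> {w. set w \<subseteq> V \<times> {..D} \<and> length w = len d}"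
  proof
    fix w assume w: "w \<in> words d D"
    have "k \<le> D" if "(i, k) \<in> set w" for i k
    proof -
      have "k \<in> set (map snd w)" using that by force
      thus ?thesis using member_le_sum_list[of k "map snd w"] w unfolding words_def by simp
    qed
    moreover have "set w \<subseteq> V \<times> UNIV" using w unfolding words_def by auto
    ultimately show "w \<in> {w. set w \<subseteq> V \<times> {..D} \<and> length w = len d}"
      using length_words[OF w] by auto
  qed
qed (rule finite_lists_length_eq, use finite_V in simp)

text \<open>The defining relations, read as linear conditions on a function at the letters in
  positions \<open>p\<close> and \<open>p + 1\<close>; everything before and after these letters is
  held fixed.\<close>

definition good :: "nat \<Rightarrow> (('v \<times> nat) list \<Rightarrow> rat) \<Rightarrow> bool" where
  "good p x \<longleftrightarrow>
    (\<forall>s i j k l t. length s = p \<longrightarrow> i \<in> V \<longrightarrow> j \<in> V \<longrightarrow>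
       x (s @ (i, k) # (j, l) # t) = \<epsilon> i j * x (s @ (j, l) # (i, k) # t)) \<and>
    (\<forall>s i j k q t. length s = p \<longrightarrow> i \<in> V \<longrightarrow> j \<in> V \<longrightarrow> q < m i j \<longrightarrow>
       (\<Sum>l\<le>k. of_nat ((k - l) choose q) * x (s @ (i, l) # (j, k - l) # t)) = 0)"

text \<open>\<open>U\<close> is the set of positions at which no condition is imposed.\<close>

definition Yspace :: "('v \<Rightarrow>\<^sub>0 nat) \<Rightarrow> nat \<Rightarrow> nat set \<Rightarrow> (('v \<times> nat) list \<Rightarrow> rat) set" where
  "Yspace d D U = {x \<in> funs_on (words d D). \<forall>p. p \<notin> U \<longrightarrow> good p x}"

end

lemma diff_power_dvd_swap:
  fixes x y :: "'a::comm_ring_1"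
  assumes "(x - y) ^ k dvd f"
  shows "(y - x) ^ k dvd f"
proof -
  have "(y - x) ^ k = (- 1) ^ k * (x - y) ^ k" by (simp flip: power_mult_distrib)
  moreover have "(- 1) ^ k * (x - y) ^ k dvd (- 1) ^ k * ((- 1) ^ k * f)"
    using assms by (intro mult_dvd_mono dvd_refl dvd_mult)
  ultimately show ?thesis by (simp add: mult.assoc[symmetric] flip: power_mult_distrib)
qed

context coloured
begin

lemma Yspace_goodD: "x \<in> Yspace d D U \<Longrightarrow> p \<notin> U \<Longrightarrow> good p x"
  unfolding Yspace_def by simp

lemma Yspace_funs: "Yspace d D U \<subseteq> funs_on (words d D)"
  unfolding Yspace_def by auto

lemma good_swap: "\<lbrakk>good p x; length s = p; i \<in> V; j \<in> V\<rbrakk> \<Longrightarrow>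
    x (s @ (i, k) # (j, l) # t) = \<epsilon> i j * x (s @ (j, l) # (i, k) # t)"
  unfolding good_def by blast

lemma good_moment: "\<lbrakk>good p x; length s = p; i \<in> V; j \<in> V; q < m i j\<rbrakk> \<Longrightarrow>
    (\<Sum>l\<le>k. of_nat ((k - l) choose q) * x (s @ (i, l) # (j, k - l) # t)) = 0"
  unfolding good_def by blast

lemma goodI:
  assumes "\<And>s i j k l t. length s = p \<Longrightarrow> i \<in> V \<Longrightarrow> j \<in> V \<Longrightarrow>
      x (s @ (i, k) # (j, l) # t) = \<epsilon> i j * x (s @ (j, l) # (i, k) # t)"
    and "\<And>s i j k q t. length s = p \<Longrightarrow> i \<in> V \<Longrightarrow> j \<in> V \<Longrightarrow> q < m i j \<Longrightarrow>
      (\<Sum>l\<le>k. of_nat ((k - l) choose q) * x (s @ (i, l) # (j, k - l) # t)) = 0"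
  shows "good p x"
  using assms unfolding good_def by blast

lemma subspace_Yspace: "fs.subspace (Yspace d D U)"
proof (rule fs.subspaceI)
  show "0 \<in> Yspace d D U"
    unfolding Yspace_def good_def by (simp add: fs.subspace_0[OF subspace_funs_on])
  fix x y assume xy: "x \<in> Yspace d D U" "y \<in> Yspace d D U"
  have "good p (x + y)" if p: "p \<notin> U" for p
  proof (rule goodI, goal_cases)
    case (1 s i j k l t)
    thus ?case using good_swap[OF Yspace_goodD[OF xy(1) p] 1] good_swap[OF Yspace_goodD[OF xy(2) p] 1]
      by (simp add: distrib_left)
  next
    case (2 s i j k q t)
    show ?case using good_moment[OF Yspace_goodD[OF xy(1) p] 2] good_moment[OF Yspace_goodD[OF xy(2) p] 2]
      by (simp add: distrib_left sum.distrib)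
  qed
  thus "x + y \<in> Yspace d D U" using xy fs.subspace_add[OF subspace_funs_on] unfolding Yspace_def by blast
next
  fix c x assume x: "x \<in> Yspace d D U"
  have "good p (fscale c x)" if p: "p \<notin> U" for p
  proof (rule goodI, goal_cases)
    case (1 s i j k l t)
    thus ?case using good_swap[OF Yspace_goodD[OF x p] 1] by (simp add: fscale_apply)
  next
    case (2 s i j k q t)
    show ?case using good_moment[OF Yspace_goodD[OF x p] 2]
      by (simp add: fscale_apply mult.left_commute flip: sum_distrib_left)
  qed
  thus "fscale c x \<in> Yspace d D U" using x fs.subspace_scale[OF subspace_funs_on] unfolding Yspace_def by blast
qed

context
  fixes \<kappa> :: "nat \<Rightarrow> 'v" and n D :: nat
  assumes labels: "\<forall>a<n. \<kappa> a \<in> V"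
begin

lemma \<kappa>: "a < n \<Longrightarrow> \<kappa> a \<in> V"
  using labels by simp

text \<open>The sign of a labelling of a word; it turns the commutation signs \<open>\<epsilon>\<close> into \<open>1\<close> on words in
  distinct labels.\<close>

fun theta :: "nat list \<Rightarrow> rat" where
  "theta [] = 1"
| "theta (a # s) = (\<Prod>b\<leftarrow>s. if b < a then \<epsilon> (\<kappa> a) (\<kappa> b) else 1) * theta s"

text \<open>\<open>theta\<close> has one factor for each inversion, and the exchange affects only
  the inversion formed by \<open>a\<close> and \<open>b\<close>.\<close>

lemma theta_swap:
  assumes "a \<noteq> b" "a < n" "b < n"
  shows "theta (s @ a # b # t) = \<epsilon> (\<kappa> a) (\<kappa> b) * theta (s @ b # a # t)"
proof (induction s)
  case Nil
  show ?case using assms \<kappa> \<epsilon>_sq[of "\<kappa> a" "\<kappa> b"] \<epsilon>_sym[of "\<kappa> a" "\<kappa> b"]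
    by (auto simp: mult_ac)
next
  case (Cons c s)
  have perm: "(\<Prod>x\<leftarrow>s @ a # b # t. if x < c then \<epsilon> (\<kappa> c) (\<kappa> x) else 1)
      = (\<Prod>x\<leftarrow>s @ b # a # t. if x < c then \<epsilon> (\<kappa> c) (\<kappa> x) else 1)"
    by simp
  show ?case unfolding append_Cons theta.simps perm Cons.IH by (rule mult.left_commute)
qed

lemma theta_sq: "set s \<subseteq> {..<n} \<Longrightarrow> theta s * theta s = 1"
proof (induction s)
  case (Cons a s)
  have "(\<Prod>b\<leftarrow>t. if b < a then \<epsilon> (\<kappa> a) (\<kappa> b) else 1) * (\<Prod>b\<leftarrow>t. if b < a then \<epsilon> (\<kappa> a) (\<kappa> b) else 1) = 1"
    if "set t \<subseteq> {..<n}" for t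
    using that
  proof (induction t)
    case (Cons b t)
    define e where "e = (if b < a then \<epsilon> (\<kappa> a) (\<kappa> b) else 1)"
    have "e * e = 1" unfolding e_def using \<epsilon>_sq \<kappa> Cons.prems \<open>set (a # s) \<subseteq> {..<n}\<close> by auto
    moreover define P where "P = (\<Prod>b\<leftarrow>t. if b < a then \<epsilon> (\<kappa> a) (\<kappa> b) else 1)"
    have "P * P = 1" unfolding P_def using Cons by simp
    ultimately have "(e * P) * (e * P) = 1" by (metis mult.assoc mult.left_commute mult_1)
    thus ?case unfolding e_def P_def by simp
  qed simp
  from this[of s] Cons show ?case by (auto simp: mult_ac)
qed simp

definition labelled :: "nat list \<Rightarrow> (nat \<Rightarrow>\<^sub>0 nat) \<Rightarrow> ('v \<times> nat) list" where
  "labelled s e = map (\<lambda>a. (\<kappa> a, lookup e a)) s"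

definition exps :: "(nat \<Rightarrow>\<^sub>0 nat) set" where
  "exps = {e. keys e \<subseteq> {..<n} \<and> (\<Sum>a<n. lookup e a) = D}"

lemma finite_exps: "finite exps"
proof (rule finite_imageD)
  show "inj_on (\<lambda>e. map (lookup e) [0..<n]) exps"
  proof (rule inj_onI)
    fix e e' assume e: "e \<in> exps" "e' \<in> exps" "map (lookup e) [0..<n] = map (lookup e') [0..<n]"
    show "e = e'"
    proof (rule poly_mapping_eqI)
      fix a
      show "lookup e a = lookup e' a"
      proof (cases "a < n")
        case True
        thus ?thesis using e(3) by simp
      next
        case False
        hence "a \<notin> keys e" "a \<notin> keys e'" using e(1,2) unfolding exps_def by auto
        thus ?thesis by (simp add: not_in_keys_iff_lookup_eq_zero)
      qed
    qed
  qed
  have "(\<lambda>e. map (lookup e) [0..<n]) ` exps \<subseteq> {l. set l \<subseteq> {..D} \<and> length l = n}"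
  proof (rule image_subsetI)
    fix e assume e: "e \<in> exps"
    have "lookup e a \<le> D" if "a < n" for a
      using e that member_le_sum[of a "{..<n}" "lookup e"] unfolding exps_def by auto
    thus "map (lookup e) [0..<n] \<in> {l. set l \<subseteq> {..D} \<and> length l = n}" by auto
  qed
  thus "finite ((\<lambda>e. map (lookup e) [0..<n]) ` exps)"
    by (rule finite_subset) (rule finite_lists_length_eq, simp)
qed

text \<open>For a fixed ordering of the labels the coloured words correspond to monomials. The
  factor \<open>theta\<close> makes the polynomials of orderings that differ by an admissible
  exchange equal.\<close>

definition topoly :: "(('v \<times> nat) list \<Rightarrow> rat) \<Rightarrow> nat list \<Rightarrow> mpol" where
  "topoly x s = (\<Sum>e\<in>exps. single e (theta s * x (labelled s e)))"

lemma lookup_topoly: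
  "lookup (topoly x s) e = (if e \<in> exps then theta s * x (labelled s e) else 0)"
  unfolding topoly_def by (simp add: lookup_sum lookup_single when_def finite_exps)

lemma topoly_swap:
  assumes s: "arrangement {..<n} (s @ a # b # t)" and x: "good (length s) x"
  shows "topoly x (s @ a # b # t) = topoly x (s @ b # a # t)"
proof (rule poly_mapping_eqI)
  fix e
  have ab: "a \<noteq> b" "a < n" "b < n" using s unfolding arrangement_def by auto
  have "x (labelled (s @ a # b # t) e) = \<epsilon> (\<kappa> a) (\<kappa> b) * x (labelled (s @ b # a # t) e)"
    using good_swap[OF x, of "labelled s e" "\<kappa> a" "\<kappa> b" "lookup e a" "lookup e b" "labelled t e"]
      ab \<kappa> unfolding labelled_def by simp
  hence "theta (s @ a # b # t) * x (labelled (s @ a # b # t) e)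
     = (\<epsilon> (\<kappa> a) (\<kappa> b) * \<epsilon> (\<kappa> a) (\<kappa> b)) * (theta (s @ b # a # t) * x (labelled (s @ b # a # t) e))"
    unfolding theta_swap[OF ab] by (simp add: mult_ac)
  thus "lookup (topoly x (s @ a # b # t)) e = lookup (topoly x (s @ b # a # t)) e"
    using \<epsilon>_sq \<kappa> ab by (simp add: lookup_topoly)
qed

lemma topoly_dvd:
  assumes s: "arrangement {..<n} (s @ a # b # t)" and x: "good (length s) x"
  shows "(var a - var b) ^ m (\<kappa> a) (\<kappa> b) dvd topoly x (s @ a # b # t)"
proof -
  have ab: "a \<noteq> b" "a < n" "b < n" "a \<notin> set s" "b \<notin> set s" "a \<notin> set t" "b \<notin> set t"
    using s unfolding arrangement_def by auto
  show ?thesis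
    unfolding power_dvd_iff_moments[OF ab(1)]
  proof (intro allI impI)
    fix q k and e :: "nat \<Rightarrow>\<^sub>0 nat"
    assume q: "q < m (\<kappa> a) (\<kappa> b)" and e: "lookup e a = 0" "lookup e b = 0"
    define z where "z = (\<lambda>j. e + single a j + single b (k - j))"
    have lz: "lookup (z j) c = (if c = a then j else if c = b then k - j else lookup e c)" for j c
      using ab(1) e by (auto simp: z_def lookup_add lookup_single when_def)
    have "(\<Sum>c<n. lookup (z j) c) = (\<Sum>c<n. lookup e c) + k" if "j \<le> k" for j
      using that ab by (simp add: z_def lookup_add sum.distrib lookup_single when_def)
    moreover have "keys (z j) \<subseteq> {..<n} \<longleftrightarrow> keys e \<subseteq> {..<n}" for j
    proof -
      have "c \<notin> {..<n} \<Longrightarrow> lookup (z j) c = lookup e c" for c using lz[of j c] ab by auto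
      moreover have "keys y \<subseteq> {..<n} \<longleftrightarrow> (\<forall>c. c \<notin> {..<n} \<longrightarrow> lookup y c = 0)" for y :: "nat \<Rightarrow>\<^sub>0 nat"
        by (auto simp: in_keys_iff)
      ultimately show ?thesis by simp
    qed
    \<comment> \<open>Moving exponent from \<open>b\<close> to \<open>a\<close> keeps the total, so
      either all monomials of this moment lie in \<open>exps\<close> or none does.\<close>
    ultimately have zE: "z j \<in> exps \<longleftrightarrow> z 0 \<in> exps" if "j \<le> k" for j
      unfolding exps_def using that by simp
    define s' where "s' = labelled s e" define t' where "t' = labelled t e"
    have lab: "labelled (s @ a # b # t) (z j) = s' @ (\<kappa> a, j) # (\<kappa> b, k - j) # t'" for j
      unfolding s'_def t'_def labelled_def using ab lz by (auto intro!: map_cong)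
    have len: "length s' = length s" unfolding s'_def labelled_def by simp
    have "moment a b q (topoly x (s @ a # b # t)) e k
      = (\<Sum>j\<le>k. of_nat ((k - j) choose q) * lookup (topoly x (s @ a # b # t)) (z j))"
      unfolding moment_def z_def by simp
    also have "\<dots> = (\<Sum>j\<le>k. (if z 0 \<in> exps then theta (s @ a # b # t) else 0) *
        (of_nat ((k - j) choose q) * x (s' @ (\<kappa> a, j) # (\<kappa> b, k - j) # t')))"
    proof (rule sum.cong[OF refl])
      fix j assume "j \<in> {..k}"
      hence "z j \<in> exps \<longleftrightarrow> z 0 \<in> exps" by (intro zE) simp
      thus "of_nat ((k - j) choose q) * lookup (topoly x (s @ a # b # t)) (z j)
        = (if z 0 \<in> exps then theta (s @ a # b # t) else 0) *
          (of_nat ((k - j) choose q) * x (s' @ (\<kappa> a, j) # (\<kappa> b, k - j) # t'))"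
        unfolding lookup_topoly lab by (cases "z 0 \<in> exps") simp_all
    qed
    also have "\<dots> = 0"
      using good_moment[OF x len \<kappa> \<kappa> q] ab unfolding sum_distrib_left[symmetric] by simp
    finally show "moment a b q (topoly x (s @ a # b # t)) e k = 0" .
  qed
qed

text \<open>Restricted to \<open>a < b\<close> so that \<open>alpha\<close>, a product over ordered
  pairs, takes every unordered pair once.\<close>

definition \<mu> :: "nat \<times> nat \<Rightarrow> nat" where
  "\<mu> = (\<lambda>(a, b). if a < b then m (\<kappa> a) (\<kappa> b) else 0)"

text \<open>Labels that no cut separates can be made neighbours by exchanges that leave the
  polynomial unchanged, and for neighbours the moment relations give the divisibility.\<close>

lemma topoly_alpha_dvd:
  assumes s: "arrangement {..<n} s" and x: "\<And>p. p \<notin> U \<Longrightarrow> good p x"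
  shows "mp.alpha {..<n} \<mu> (cut s ` U) dvd topoly x s"
proof (rule mp.alpha_dvdI)
  have sw: "topoly x (s @ a # b # t) = topoly x (s @ b # a # t)"
    if "arrangement {..<n} (s @ a # b # t)" "length s \<notin> U" for s a b t
    using topoly_swap[OF that(1) x[OF that(2)]] .
  have main: "(var a - var b) ^ m (\<kappa> a) (\<kappa> b) dvd topoly x s"
    if sab: "s = s0 @ a # ys @ b # t" and un: "(a, b) \<in> mp.unsep {..<n} (cut s ` U)" for s0 ys t a b
  proof -
    have ar: "arrangement {..<n} ((s0 @ [a]) @ ys @ b # t)" using s unfolding sab by simp
    have nU: "p \<notin> U" if p: "length s0 \<le> p" "p \<le> length s0 + length ys" for p
    proof
      assume "p \<in> U"
      hence "a \<in> cut s p \<longleftrightarrow> b \<in> cut s p" using un unfolding mp.unsep_def by auto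
      moreover have "a \<in> cut s p" unfolding cut_def sab using p by (auto simp: Suc_diff_le)
      moreover have "b \<notin> cut s p"
      proof -
        have "take (Suc p) s = s0 @ a # take (p - length s0) ys"
          unfolding sab using p by (simp add: Suc_diff_le)
        hence "cut s p \<subseteq> set s0 \<union> {a} \<union> set ys" unfolding cut_def by (auto dest: in_set_takeD)
        thus ?thesis using s unfolding sab arrangement_def by auto
      qed
      ultimately show False by blast
    qed
    have "topoly x s = topoly x ((s0 @ [a]) @ b # ys @ t)"
      using bubble[where T = "topoly x" and L = "{..<n}" and U = U, OF sw ar] nU unfolding sab by simp
    moreover have "arrangement {..<n} (s0 @ a # b # ys @ t)" using ar unfolding arrangement_def by auto
    ultimately show ?thesis using topoly_dvd[of s0 a b "ys @ t" x] x nU by simp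
  qed
  fix a b assume un: "(a, b) \<in> mp.unsep {..<n} (cut s ` U)"
  show "(var a - var b) ^ \<mu> (a, b) dvd topoly x s"
  proof (cases "a < b")
    case True
    have ab: "a \<in> set s" "b \<in> set s" "a \<noteq> b" "a < n" "b < n"
      using un s unfolding mp.unsep_def arrangement_def by auto
    obtain s0 s1 where s01: "s = s0 @ a # s1" using ab(1) by (meson split_list)
    have "b \<in> set s0 \<or> b \<in> set s1" using ab unfolding s01 by auto
    thus ?thesis
    proof
      assume "b \<in> set s1"
      then obtain ys t where "s1 = ys @ b # t" by (meson split_list)
      thus ?thesis using main[OF _ un] s01 True unfolding \<mu>_def by auto
    next
      assume "b \<in> set s0"
      then obtain r ys where "s0 = r @ b # ys" by (meson split_list)
      hence "s = r @ b # ys @ a # s1" using s01 by simp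
      moreover have "(b, a) \<in> mp.unsep {..<n} (cut s ` U)" using un unfolding mp.unsep_def by auto
      ultimately have "(var b - var a) ^ m (\<kappa> b) (\<kappa> a) dvd topoly x s" by (rule main)
      hence "(var a - var b) ^ m (\<kappa> b) (\<kappa> a) dvd topoly x s" by (rule diff_power_dvd_swap)
      thus ?thesis using True m_sym[OF \<kappa> \<kappa>] ab unfolding \<mu>_def by simp
    qed
  qed (simp add: \<mu>_def)
qed (auto simp: \<mu>_def)

lemma alpha_dvd_power:
  assumes "mp.alpha {..<n} \<mu> C dvd f" "(a, b) \<in> mp.unsep {..<n} C"
  shows "(var a - var b) ^ m (\<kappa> a) (\<kappa> b) dvd f"
proof -
  have ab: "a < n" "b < n" "a \<noteq> b" "(b, a) \<in> mp.unsep {..<n} C" using assms(2) unfolding mp.unsep_def by auto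
  have *: "(var a - var b) ^ \<mu> (a, b) dvd f" if "(a, b) \<in> mp.unsep {..<n} C" for a b
  proof -
    have "(\<lambda>(a, b). (var a - var b) ^ \<mu> (a, b)) (a, b) dvd mp.alpha {..<n} \<mu> C"
      unfolding mp.alpha_def by (rule dvd_prodI[OF mp.finite_unsep that]) simp
    thus ?thesis using assms(1) by (simp add: dvd_trans)
  qed
  show ?thesis
  proof (cases "a < b")
    case True
    thus ?thesis using *[OF assms(2)] unfolding \<mu>_def by simp
  next
    case False
    hence "(var b - var a) ^ m (\<kappa> b) (\<kappa> a) dvd f" using *[OF ab(4)] ab(3) unfolding \<mu>_def by simp
    thus ?thesis using m_sym[OF \<kappa> \<kappa>] ab by (metis diff_power_dvd_swap)
  qed
qed

lemma labelled_exponent: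
  assumes "arrangement {..<n} s" "map \<kappa> s = map fst w"
  shows "labelled s (exponent s (map snd w)) = w"
proof -
  have "length s = length (map snd w)" using assms(2) by (metis length_map)
  hence "map (lookup (exponent s (map snd w))) s = map snd w"
    using assms(1) unfolding arrangement_def by (intro map_lookup_exponent) auto
  moreover have "labelled s e = zip (map \<kappa> s) (map (lookup e) s)" for e
    unfolding labelled_def by (simp add: zip_map_map zip_same_conv_map)
  ultimately show ?thesis using assms(2) by (simp add: zip_map_fst_snd)
qed

lemma exponent_in_exps:
  assumes s: "arrangement {..<n} s" and w: "map \<kappa> s = map fst w" "sum_list (map snd w) = D"
  shows "exponent s (map snd w) \<in> exps"
proof -
  have len: "length s = length (map snd w)" using w(1) by (metis length_map)
  have "(\<Sum>a<n. lookup (exponent s (map snd w)) a) = sum_list (map (lookup (exponent s (map snd w))) s)"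
    by (rule sum_lookup_eq_sum_list[OF s])
  also have "\<dots> = D" using map_lookup_exponent[OF len] s w(2) unfolding arrangement_def by simp
  moreover have "keys (exponent s (map snd w)) \<subseteq> {..<n}"
    using lookup_exponent_notin[OF _ len] s unfolding arrangement_def by (force simp: in_keys_iff)
  ultimately show ?thesis unfolding exps_def by simp
qed

end

end

text \<open>Lifts a rearrangement of the colours to a rearrangement of the labels; this makes the
  set of labellings of a word nonempty.\<close>

lemma mset_eq_map_lift:
  "mset l = mset (map f xs) \<Longrightarrow> \<exists>ys. mset ys = mset xs \<and> map f ys = l"
proof (induction l arbitrary: xs)
  case (Cons y l)
  have "y \<in># mset (map f xs)" using Cons.prems by (metis list.set_intros(1) set_mset_mset)
  then obtain x where x: "x \<in> set xs" "f x = y" by auto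
  then obtain u v where xs: "xs = u @ x # v" by (meson split_list)
  have "mset l = mset (map f (u @ v))" using Cons.prems x(2) unfolding xs by simp
  then obtain ys where "mset ys = mset (u @ v)" "map f ys = l" using Cons.IH by blast
  hence "mset (x # ys) = mset xs" "map f (x # ys) = y # l" using x(2) xs by auto
  thus ?case by (intro exI[of _ "x # ys"] conjI)
qed simp

context coloured
begin

lemma words_swap: "s @ (i, k) # (j, l) # t \<in> words d D \<longleftrightarrow> s @ (j, l) # (i, k) # t \<in> words d D"
  unfolding words_def by (auto simp: weight_append weight_Cons add_ac)

lemma words_transfer:
  "k + l = k' + l' \<Longrightarrow> s @ (i, k) # (j, l) # t \<in> words d D \<longleftrightarrow> s @ (i, k') # (j, l') # t \<in> words d D"
  unfolding words_def by (auto simp: weight_append weight_Cons)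

text \<open>A cochain on coloured words is turned into one on chains of sets of labels, with \<open>\<kappa>\<close> as
  colouring of the labels; a primitive \<open>Y\<close> of it is carried back by averaging over all labellings
  of a word.\<close>

lemma words_exact_labelled:
  assumes \<kappa>: "\<forall>a<n. \<kappa> a \<in> V"
    and d: "weight (map (\<lambda>a. (\<kappa> a, 0)) [0..<n]) = d" and k: "Suc k < n"
    and x: "\<And>U. U \<subseteq> {..<n - 1} \<Longrightarrow> card U = k \<Longrightarrow> x U \<in> Yspace d D U"
    and dx: "\<And>U w. U \<subseteq> {..<n - 1} \<Longrightarrow> card U = Suc k \<Longrightarrow> coboundary (\<lambda>U. x U w) U = 0"
  shows "\<exists>y. (\<forall>U\<subseteq>{..<n - 1}. Suc (card U) = k \<longrightarrow> y U \<in> Yspace d D U) \<and>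
      (\<forall>U\<subseteq>{..<n - 1}. card U = k \<longrightarrow> (\<forall>w. coboundary (\<lambda>U. y U w) U = x U w))"
proof -
  define L where "L = {..<n}"
  have L: "finite L" "card L = n" unfolding L_def by auto
  define rk where "rk = (\<lambda>C :: nat set set. (\<lambda>A. card A - 1) ` C)"
  define \<theta> where "\<theta> = theta \<kappa>"
  define T where "T = (\<lambda>U s. topoly \<kappa> n D (x U) s)"
  define M where "M = \<mu> \<kappa>"
  have finU: "finite U" if "U \<subseteq> {..<n - 1}" for U using that finite_subset by blast
  have Tcut: "T U s = T U s'" if U: "U \<subseteq> {..<n - 1}" "card U = k"
    and s: "arrangement L s" "arrangement L s'" "\<And>p. p \<in> U \<Longrightarrow> cut s p = cut s' p" for U s s'
  proof -
    have sw: "T U (s @ a # b # t) = T U (s @ b # a # t)"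
      if "arrangement L (s @ a # b # t)" "length s \<notin> U" for s a b t
      unfolding T_def using topoly_swap[OF \<kappa> that(1)[unfolded L_def]] Yspace_goodD[OF x[OF U] that(2)] by blast
    show ?thesis
      using same_cuts[where T = "T U" and L = L and U = U, OF sw, of "[]" s s'] s by simp
  qed
  \<comment> \<open>Any ordering passing through the chain serves, since by \<open>Tcut\<close> the
    polynomial depends on the cuts only.\<close>
  define \<sigma> where "\<sigma> = (\<lambda>C. SOME s. arrangement L s \<and> cut s ` rk C = C)"
  have \<sigma>: "arrangement L (\<sigma> C)" "cut (\<sigma> C) ` rk C = C" "rk C \<subseteq> {..<n - 1}" "card (rk C) = card C"
    if C: "chain_in L C" for C
  proof -
    obtain s where s: "arrangement L s" "cut s ` rk C = C" "rk C \<subseteq> {..<n - 1}" "card (rk C) = card C"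
      using chain_cuts[OF L C] unfolding rk_def by blast
    have "arrangement L (\<sigma> C) \<and> cut (\<sigma> C) ` rk C = C"
      unfolding \<sigma>_def by (rule someI[of _ s]) (use s in simp)
    thus "arrangement L (\<sigma> C)" "cut (\<sigma> C) ` rk C = C" by auto
    show "rk C \<subseteq> {..<n - 1}" "card (rk C) = card C" by fact+
  qed
  define X where "X = (\<lambda>C. T (rk C) (\<sigma> C))"
  have Xcut: "X (cut s ` U) = T U s" if s: "arrangement L s" and U: "U \<subseteq> {..<n - 1}" "card U = k" for s U
  proof -
    note cc = cut_chain[OF s L(2) U(1)]
    have rkU: "rk (cut s ` U) = U" using cc(5) unfolding rk_def .
    have ceq: "cut (\<sigma> (cut s ` U)) p = cut s p" if p: "p \<in> U" for p
    proof -
      have "cut (\<sigma> (cut s ` U)) p \<in> cut s ` U" using \<sigma>(2)[OF cc(3)] rkU p by blast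
      then obtain q where q: "q \<in> U" "cut (\<sigma> (cut s ` U)) p = cut s q" by auto
      have "p < n" "q < n" using U(1) p q(1) by auto
      hence "card (cut (\<sigma> (cut s ` U)) p) = Suc p" "card (cut s q) = Suc q"
        using cut_props(1)[OF \<sigma>(1)[OF cc(3)] L(2)] cut_props(1)[OF s L(2)] by blast+
      thus ?thesis using q by simp
    qed
    have "T U (\<sigma> (cut s ` U)) = T U s" by (rule Tcut[OF U \<sigma>(1)[OF cc(3)] s ceq])
    thus ?thesis unfolding X_def rkU .
  qed
  have cob_cut: "coboundary Z (cut s ` U) = coboundary (\<lambda>V. Z (cut s ` V)) U"
    if "arrangement L s" "U \<subseteq> {..<n - 1}" for Z :: "nat set set \<Rightarrow> mpol" and s U
    by (rule coboundary_image[OF cut_chain(1,2)[OF that(1) L(2) that(2)]])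
  have X_alpha: "mp.alpha L M C dvd X C" if C: "chain_in L C" "card C = k" for C
  proof -
    have "mp.alpha {..<n} (\<mu> \<kappa>) (cut (\<sigma> C) ` rk C) dvd topoly \<kappa> n D (x (rk C)) (\<sigma> C)"
    proof (rule topoly_alpha_dvd[OF \<kappa>])
      show "arrangement {..<n} (\<sigma> C)" using \<sigma>(1)[OF C(1)] unfolding L_def .
      show "good p (x (rk C))" if "p \<notin> rk C" for p
        by (rule Yspace_goodD[OF x that]) (use \<sigma>[OF C(1)] C(2) in auto)
    qed
    thus ?thesis using \<sigma>(2)[OF C(1)] unfolding X_def T_def M_def L_def by simp
  qed
  have X_coc: "coboundary X C = 0" if C: "chain_in L C" "card C = Suc k" for C
  proof -
    define U where "U = rk C"
    define s where "s = \<sigma> C"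
    have U: "U \<subseteq> {..<n - 1}" "card U = Suc k" and s: "arrangement L s" "cut s ` U = C"
      using \<sigma>[OF C(1)] C(2) unfolding U_def s_def by auto
    have "coboundary X C = coboundary (\<lambda>V. X (cut s ` V)) U"
      using cob_cut[OF s(1) U(1), of X] s(2) by simp
    also have "\<dots> = coboundary (\<lambda>V. T V s) U"
      by (rule coboundary_cong, rule Xcut[OF s(1)]) (use U finU[OF U(1)] in auto)
    also have "\<dots> = 0"
    proof (rule poly_mapping_eqI)
      fix e
      have "lookup (coboundary (\<lambda>V. T V s) U) e
        = coboundary (\<lambda>V. (if e \<in> exps n D then \<theta> s else 0) * x V (labelled \<kappa> s e)) U"
        unfolding lookup_coboundary T_def \<theta>_def by (rule coboundary_cong) (simp add: lookup_topoly[OF \<kappa>])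
      also have "\<dots> = 0" unfolding coboundary_scale dx[OF U] by simp
      finally show "lookup (coboundary (\<lambda>V. T V s) U) e = lookup 0 e" by simp
    qed
    finally show ?thesis .
  qed
  have "Suc k < card L" using k L by simp
  moreover have "\<forall>C. chain_in L C \<longrightarrow> card C = k \<longrightarrow> mp.alpha L M C dvd X C" using X_alpha by blast
  moreover have "\<forall>C. chain_in L C \<longrightarrow> card C = Suc k \<longrightarrow> coboundary X C = 0" using X_coc by blast
  ultimately obtain Y where Y: "\<And>C. chain_in L C \<Longrightarrow> Suc (card C) = k \<Longrightarrow> mp.alpha L M C dvd Y C"
    and cY: "\<And>C. chain_in L C \<Longrightarrow> card C = k \<Longrightarrow> coboundary Y C = X C"
    using mp.exactD[OF mp.exact[OF L(1)]] by blast
  \<comment> \<open>The labellings of \<open>w\<close> that respect colours. There are several as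
    soon as a colour repeats, and none is distinguished, hence the average in
    \<open>y\<close>.\<close>
  define arr where "arr = (\<lambda>w :: ('v \<times> nat) list. {s. arrangement L s \<and> map \<kappa> s = map fst w})"
  have fin_arr: "finite (arr w)" for w
  proof (rule finite_subset)
    show "arr w \<subseteq> {s. set s \<subseteq> L \<and> length s = n}"
      unfolding arr_def using arrangement_length L(2) by (auto simp: arrangement_def)
  qed (rule finite_lists_length_eq[OF L(1)])
  have arr_ne: "arr w \<noteq> {}" if w: "w \<in> words d D" for w
  proof -
    have "count (mset (map fst w)) i = count (mset (map \<kappa> [0..<n])) i" for i
    proof -
      have "count (mset (map fst w)) i = lookup (weight (map (\<lambda>a. (\<kappa> a, 0)) [0..<n])) i"
        using w unfolding words_def d by (auto simp: lookup_weight)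
      thus ?thesis unfolding lookup_weight by (simp add: comp_def)
    qed
    hence "mset (map fst w) = mset (map \<kappa> [0..<n])" by (rule multiset_eqI)
    then obtain s where s: "mset s = mset [0..<n]" "map \<kappa> s = map fst w" using mset_eq_map_lift by blast
    have "arrangement L s" unfolding arrangement_def L_def
      using s(1) by (metis atLeast_upt distinct_upt mset_eq_setD mset_eq_imp_distinct_iff)
    thus ?thesis using s(2) unfolding arr_def by blast
  qed
  \<comment> \<open>This inverts \<open>topoly\<close>: the coefficient at the monomial of
    \<open>w\<close>, with the same sign again because \<open>\<theta> s\<close> squares to
    one.\<close>
  define c where "c = (\<lambda>U (w :: ('v \<times> nat) list) s. \<theta> s * lookup (Y (cut s ` U)) (exponent s (map snd w)))"
  define y where "y = (\<lambda>U w. if w \<in> words d D then (\<Sum>s\<in>arr w. c U w s) / of_nat (card (arr w)) else 0)"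
  have \<theta>sq: "\<theta> s * \<theta> s = 1" if "arrangement L s" for s
    unfolding \<theta>_def by (rule theta_sq[OF \<kappa>]) (use that in \<open>simp add: arrangement_def L_def\<close>)
  have y_cob: "coboundary (\<lambda>V. y V w) U = x U w" if U: "U \<subseteq> {..<n - 1}" "card U = k" for U w
  proof (cases "w \<in> words d D")
    case False
    have "x U w = 0" by (rule funs_onD[OF subsetD[OF Yspace_funs x[OF U]] False])
    moreover have "coboundary (\<lambda>V. y V w) U = 0" unfolding y_def coboundary_def using False by simp
    ultimately show ?thesis by simp
  next
    case True
    define N where "N = (of_nat (card (arr w)) :: rat)"
    have N: "N \<noteq> 0" unfolding N_def using arr_ne[OF True] fin_arr by simp
    have cc: "coboundary (\<lambda>V. c V w s) U = x U w" if s: "s \<in> arr w" for s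
    proof -
      have ar: "arrangement L s" "map \<kappa> s = map fst w" using s unfolding arr_def by auto
      define e where "e = exponent s (map snd w)"
      have eE: "e \<in> exps n D" unfolding e_def
        by (rule exponent_in_exps[OF \<kappa>]) (use ar True in \<open>auto simp: L_def words_def\<close>)
      have le: "labelled \<kappa> s e = w" unfolding e_def
        by (rule labelled_exponent[OF \<kappa>]) (use ar in \<open>auto simp: L_def\<close>)
      have "coboundary (\<lambda>V. c V w s) U = \<theta> s * lookup (coboundary (\<lambda>V. Y (cut s ` V)) U) e"
        unfolding c_def coboundary_scale lookup_coboundary e_def ..
      also have "coboundary (\<lambda>V. Y (cut s ` V)) U = coboundary Y (cut s ` U)"
        by (rule cob_cut[OF ar(1) U(1), symmetric])
      also have "\<dots> = X (cut s ` U)"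
        using cut_chain(3,4)[OF ar(1) L(2) U(1)] U(2) by (intro cY) auto
      also have "\<dots> = T U s" by (rule Xcut[OF ar(1) U])
      also have "\<theta> s * lookup (T U s) e = (\<theta> s * \<theta> s) * x U w"
        unfolding T_def \<theta>_def using eE le by (simp add: lookup_topoly[OF \<kappa>])
      finally show ?thesis using \<theta>sq[OF ar(1)] by simp
    qed
    have "coboundary (\<lambda>V. y V w) U = coboundary (\<lambda>V. (1 / N) * (\<Sum>s\<in>arr w. c V w s)) U"
      unfolding y_def N_def using True by simp
    also have "\<dots> = (1 / N) * coboundary (\<lambda>V. \<Sum>s\<in>arr w. c V w s) U" by (rule coboundary_scale)
    also have "coboundary (\<lambda>V. \<Sum>s\<in>arr w. c V w s) U = (\<Sum>s\<in>arr w. coboundary (\<lambda>V. c V w s) U)"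
      unfolding coboundary_def sum_distrib_left by (rule sum.swap)
    also have "\<dots> = N * x U w" unfolding N_def using cc by simp
    finally show ?thesis using N by simp
  qed
  have y_Y: "y U \<in> Yspace d D U" if U: "U \<subseteq> {..<n - 1}" "Suc (card U) = k" for U
    unfolding Yspace_def mem_Collect_eq
  proof (intro conjI allI impI)
    show "y U \<in> funs_on (words d D)" unfolding funs_on_def y_def by simp
    fix p assume p: "p \<notin> U"
    show "good p (y U)"
    proof (rule goodI, goal_cases)
      case (1 s0 i j k l t0)
      define w where "w = s0 @ (i, k) # (j, l) # t0"
      define w' where "w' = s0 @ (j, l) # (i, k) # t0"
      have W: "w \<in> words d D \<longleftrightarrow> w' \<in> words d D" unfolding w_def w'_def by (rule words_swap)
      \<comment> \<open>Exchanging the labels at \<open>p\<close> and \<open>p + 1\<close> matches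
        the labellings of \<open>w\<close> with those of \<open>w'\<close>. Only the cut at
        \<open>p\<close> changes, and \<open>p\<close> is not in \<open>U\<close>, so
        \<open>Y\<close> is evaluated at the same chain.\<close>
      have sw: "swap_at p s \<in> arr w'" "swap_at p (swap_at p s) = s" "c U w s = \<epsilon> i j * c U w' (swap_at p s)"
        if s: "s \<in> arr w" for s
      proof -
        have ar: "arrangement L s" "map \<kappa> s = map fst w" using s unfolding arr_def by auto
        have lw: "length s = length w" using ar(2) by (metis length_map)
        hence "Suc p < length s" using 1(1) unfolding w_def by simp
        then obtain u a b t where sp: "s = u @ a # b # t" "length u = p" using split_at by blast
        have lu: "length (map \<kappa> u) = length (map fst s0)" using sp(2) 1(1) by simp
        have mp: "map \<kappa> u = map fst s0" "\<kappa> a = i" "\<kappa> b = j" "map \<kappa> t = map fst t0"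
          using ar(2) lu unfolding sp(1) w_def by auto
        have l2: "length u = length (map snd s0)" using mp(1) by (metis length_map)
        have ss: "swap_at p s = u @ b # a # t" unfolding sp(1) by (rule swap_at_append[OF sp(2)])
        have ar': "arrangement L (u @ b # a # t)" using ar(1) unfolding sp(1) by (rule arrangement_swap)
        show "swap_at p s \<in> arr w'" unfolding ss arr_def w'_def using ar' mp by simp
        show "swap_at p (swap_at p s) = s" unfolding sp(1) by (simp only: swap_at_append[OF sp(2)])
        have "cut s ` U = cut (u @ b # a # t) ` U"
          unfolding sp(1) by (rule image_cong[OF refl], rule cut_swap) (use p sp(2) in auto)
        moreover have "exponent s (map snd w) = exponent (u @ b # a # t) (map snd w')"
          unfolding sp(1) w_def w'_def map_append exponent_append[OF l2] by (simp add: exponent_Cons add_ac)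
        moreover have "\<theta> s = \<epsilon> i j * \<theta> (u @ b # a # t)"
          unfolding \<theta>_def sp(1) mp(2,3)[symmetric]
          using ar(1) unfolding sp(1) arrangement_def L_def by (intro theta_swap[OF \<kappa>]) auto
        ultimately show "c U w s = \<epsilon> i j * c U w' (swap_at p s)" unfolding c_def ss by simp
      qed
      have sw': "swap_at p s \<in> arr w" "swap_at p (swap_at p s) = s" if s: "s \<in> arr w'" for s
      proof -
        have ar: "arrangement L s" "map \<kappa> s = map fst w'" using s unfolding arr_def by auto
        have lw: "length s = length w'" using ar(2) by (metis length_map)
        hence "Suc p < length s" using 1(1) unfolding w'_def by simp
        then obtain u a b t where sp: "s = u @ a # b # t" "length u = p" using split_at by blast
        have lu: "length (map \<kappa> u) = length (map fst s0)" using sp(2) 1(1) by simp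
        have mp: "map \<kappa> u = map fst s0" "\<kappa> a = j" "\<kappa> b = i" "map \<kappa> t = map fst t0"
          using ar(2) lu unfolding sp(1) w'_def by auto
        have ss: "swap_at p s = u @ b # a # t" unfolding sp(1) by (rule swap_at_append[OF sp(2)])
        have ar': "arrangement L (u @ b # a # t)" using ar(1) unfolding sp(1) by (rule arrangement_swap)
        show "swap_at p s \<in> arr w" unfolding ss arr_def w_def using ar' mp by simp
        show "swap_at p (swap_at p s) = s" unfolding sp(1) by (simp only: swap_at_append[OF sp(2)])
      qed
      have "bij_betw (swap_at p) (arr w) (arr w')"
        by (rule bij_betw_byWitness[where f' = "swap_at p"]) (use sw sw' in auto)
      hence "card (arr w) = card (arr w')" "(\<Sum>s\<in>arr w'. c U w' s) = (\<Sum>s\<in>arr w. c U w' (swap_at p s))"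
        by (rule bij_betw_same_card, rule sum.reindex_bij_betw[symmetric])
      moreover have "(\<Sum>s\<in>arr w. c U w s) = \<epsilon> i j * (\<Sum>s\<in>arr w. c U w' (swap_at p s))"
        unfolding sum_distrib_left by (rule sum.cong[OF refl]) (rule sw(3))
      ultimately show ?case unfolding w_def[symmetric] w'_def[symmetric] unfolding y_def using W by simp
    next
      case (2 s0 i j k q t0)
      define w where "w = (\<lambda>l. s0 @ (i, l) # (j, k - l) # t0)"
      have W: "w l \<in> words d D \<longleftrightarrow> w 0 \<in> words d D" if "l \<le> k" for l
        unfolding w_def by (rule words_transfer) (use that in simp)
      have A: "arr (w l) = arr (w 0)" for l unfolding arr_def w_def by simp
      have cs: "(\<Sum>l\<le>k. of_nat ((k - l) choose q) * c U (w l) s) = 0" if s: "s \<in> arr (w 0)" for s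
      proof -
        have ar: "arrangement L s" "map \<kappa> s = map fst (w 0)" using s unfolding arr_def by auto
        have lw: "length s = length (w 0)" using ar(2) by (metis length_map)
        hence "Suc p < length s" using 2(1) unfolding w_def by simp
        then obtain u a b t where sp: "s = u @ a # b # t" "length u = p" using split_at by blast
        have lu: "length (map \<kappa> u) = length (map fst s0)" using sp(2) 2(1) by simp
        have mp: "map \<kappa> u = map fst s0" "\<kappa> a = i" "\<kappa> b = j" "map \<kappa> t = map fst t0"
          using ar(2) lu unfolding sp(1) w_def by auto
        have l2: "length u = length (map snd s0)" "length t = length (map snd t0)" using mp(1,4) by (metis length_map)+
        have ab: "a \<noteq> b" "a < n" "b < n" "a \<notin> set u \<union> set t" "b \<notin> set u \<union> set t"
          using ar(1) unfolding sp(1) arrangement_def L_def by auto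
        define e where "e = exponent u (map snd s0) + exponent t (map snd t0)"
        have e0: "lookup e a = 0" "lookup e b = 0"
          unfolding e_def lookup_add using lookup_exponent_notin[OF _ l2(1)] lookup_exponent_notin[OF _ l2(2)] ab by auto
        have ex: "exponent s (map snd (w l)) = e + single a l + single b (k - l)" for l
          unfolding sp(1) w_def map_append exponent_append[OF l2(1)] e_def by (simp add: exponent_Cons add_ac)
        \<comment> \<open>\<open>U\<close> has no cut at \<open>p\<close>, so the labels at
          \<open>p\<close> and \<open>p + 1\<close> stay together. Divisibility of \<open>Y\<close>
          thus yields the moment relation for each labelling separately, before averaging.\<close>
        have "(a, b) \<in> mp.unsep L (cut s ` U)"
        proof -
          have "a \<in> cut s r \<longleftrightarrow> b \<in> cut s r" if "r \<in> U" for r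
          proof (cases "r < p")
            case True
            hence "cut s r \<subseteq> set u" unfolding cut_def sp(1) using sp(2) by (auto dest: in_set_takeD)
            thus ?thesis using ab by auto
          next
            case False
            hence "p < r" using that p by (metis nat_neq_iff)
            hence "Suc r - length u = Suc (Suc (r - Suc p))" using sp(2) by simp
            thus ?thesis unfolding cut_def sp(1) by simp
          qed
          thus ?thesis unfolding mp.unsep_def using ab L_def by auto
        qed
        moreover have "mp.alpha L M (cut s ` U) dvd Y (cut s ` U)"
          using cut_chain(3,4)[OF ar(1) L(2) U(1)] U(2) by (intro Y) auto
        ultimately have "(var a - var b) ^ m i j dvd Y (cut s ` U)"
          using alpha_dvd_power[OF \<kappa>] mp(2,3) unfolding L_def M_def by blast
        hence "moment a b q (Y (cut s ` U)) e k = 0"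
          unfolding power_dvd_iff_moments[OF ab(1)] using 2(4) e0 by blast
        thus ?thesis unfolding c_def ex moment_def
          by (simp add: mult.left_commute[of _ "\<theta> s"] flip: sum_distrib_left)
      qed
      have "(\<Sum>l\<le>k. of_nat ((k - l) choose q) * y U (w l)) = 0"
      proof (cases "w 0 \<in> words d D")
        case True
        have "(\<Sum>l\<le>k. of_nat ((k - l) choose q) * y U (w l))
          = (\<Sum>l\<le>k. (1 / of_nat (card (arr (w 0)))) * (\<Sum>s\<in>arr (w 0). of_nat ((k - l) choose q) * c U (w l) s))"
        proof (rule sum.cong[OF refl])
          fix l assume "l \<in> {..k}"
          hence "w l \<in> words d D" using W True by simp
          thus "of_nat ((k - l) choose q) * y U (w l) =
            (1 / of_nat (card (arr (w 0)))) * (\<Sum>s\<in>arr (w 0). of_nat ((k - l) choose q) * c U (w l) s)"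
            unfolding y_def A[of l] by (simp add: sum_distrib_left sum_divide_distrib)
        qed
        also have "\<dots> = (1 / of_nat (card (arr (w 0)))) * (\<Sum>s\<in>arr (w 0). \<Sum>l\<le>k. of_nat ((k - l) choose q) * c U (w l) s)"
          unfolding sum_distrib_left[symmetric, of "1 / of_nat (card (arr (w 0)))"] by (subst sum.swap) (rule refl)
        also have "\<dots> = 0" using cs by simp
        finally show ?thesis .
      next
        case False
        have "y U (w l) = 0" if "l \<le> k" for l unfolding y_def using W[OF that] False by simp
        thus ?thesis by simp
      qed
      thus ?case unfolding w_def .
    qed
  qed
  show ?thesis using y_Y y_cob by blast
qed

text \<open>Any word of weight \<open>d\<close> provides the colouring of the labels; if there is
  none, all the spaces are zero.\<close>

lemma words_exact:
  assumes n: "n = len d" and k: "Suc k < n"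
    and x: "\<And>U. U \<subseteq> {..<n - 1} \<Longrightarrow> card U = k \<Longrightarrow> x U \<in> Yspace d D U"
    and dx: "\<And>U w. U \<subseteq> {..<n - 1} \<Longrightarrow> card U = Suc k \<Longrightarrow> coboundary (\<lambda>U. x U w) U = 0"
  shows "\<exists>y. (\<forall>U\<subseteq>{..<n - 1}. Suc (card U) = k \<longrightarrow> y U \<in> Yspace d D U) \<and>
      (\<forall>U\<subseteq>{..<n - 1}. card U = k \<longrightarrow> (\<forall>w. coboundary (\<lambda>U. y U w) U = x U w))"
proof (cases "words d D = {}")
  case True
  have "x U w = 0" if "U \<subseteq> {..<n - 1}" "card U = k" for U w
    using funs_onD[OF subsetD[OF Yspace_funs x[OF that]], of w] True by simp
  moreover have "(0 :: ('v \<times> nat) list \<Rightarrow> rat) \<in> Yspace d D U" for U by (rule fs.subspace_0[OF subspace_Yspace])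
  moreover have "coboundary (\<lambda>U. (0 :: ('v \<times> nat) list \<Rightarrow> rat) w) U = 0" for U :: "nat set" and w
    unfolding coboundary_def by simp
  ultimately show ?thesis by (intro exI[of _ "\<lambda>U. 0"]) auto
next
  case False
  then obtain w0 where w0: "w0 \<in> words d D" by blast
  have len0: "length w0 = n" using length_words[OF w0] n by simp
  define \<kappa> where "\<kappa> = (\<lambda>a. fst (w0 ! a))"
  have "\<kappa> a \<in> V" if "a < n" for a
  proof -
    have "w0 ! a \<in> V \<times> UNIV" using w0 that len0 unfolding words_def by auto
    thus ?thesis unfolding \<kappa>_def by auto
  qed
  hence "\<forall>a<n. \<kappa> a \<in> V" by blast
  moreover have "weight (map (\<lambda>a. (\<kappa> a, 0)) [0..<n]) = d"
  proof (rule poly_mapping_eqI)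
    fix i
    have "map \<kappa> [0..<n] = map fst w0" unfolding \<kappa>_def using len0 by (intro nth_equalityI) auto
    hence "map fst (map (\<lambda>a. (\<kappa> a, 0 :: nat)) [0..<n]) = map fst w0" by (simp add: comp_def)
    hence "lookup (weight (map (\<lambda>a. (\<kappa> a, 0)) [0..<n])) i = lookup (weight w0) i"
      unfolding lookup_weight by (simp only:)
    thus "lookup (weight (map (\<lambda>a. (\<kappa> a, 0)) [0..<n])) i = lookup d i"
      using w0 unfolding words_def by simp
  qed
  ultimately show ?thesis using k x dx by (rule words_exact_labelled)
qed

end

section \<open>The Euler characteristic and the recursion\<close>

lemma finite_add_decompositions:
  fixes d :: "'v \<Rightarrow>\<^sub>0 nat"
  shows "finite {(d1, d2). d1 + d2 = d}"
proof -
  define h where "h = (\<lambda>e :: 'v \<Rightarrow>\<^sub>0 nat. restrict (lookup e) (keys d))"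
  have le: "lookup d1 i \<le> lookup d i" if "d1 + d2 = d" for d1 d2 :: "'v \<Rightarrow>\<^sub>0 nat" and i
    using that by (auto simp: lookup_add)
  have "finite {d1. \<exists>d2. d1 + d2 = d}"
  proof (rule inj_on_finite)
    show "inj_on h {d1. \<exists>d2. d1 + d2 = d}"
    proof (rule inj_onI)
      fix e e' assume e: "e \<in> {d1. \<exists>d2. d1 + d2 = d}" "e' \<in> {d1. \<exists>d2. d1 + d2 = d}" "h e = h e'"
      show "e = e'"
      proof (rule poly_mapping_eqI)
        fix i
        show "lookup e i = lookup e' i"
        proof (cases "i \<in> keys d")
          case True
          thus ?thesis using fun_cong[OF e(3), of i] unfolding h_def by simp
        next
          case False
          hence "lookup d i = 0" by (simp add: in_keys_iff)
          thus ?thesis using e(1,2) le[of _ _ i] by fastforce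
        qed
      qed
    qed
    show "h ` {d1. \<exists>d2. d1 + d2 = d} \<subseteq> keys d \<rightarrow>\<^sub>E {..len d}"
    proof (rule image_subsetI)
      fix e assume "e \<in> {d1. \<exists>d2. d1 + d2 = d}"
      then obtain d2 where e: "e + d2 = d" by blast
      have "lookup e i \<le> len d" if "i \<in> keys d" for i
        using le[OF e, of i] member_le_sum[OF that, of "lookup d"] unfolding len_def by simp
      thus "h e \<in> keys d \<rightarrow>\<^sub>E {..len d}" unfolding h_def by auto
    qed
    show "finite (keys d \<rightarrow>\<^sub>E {..len d})" by (rule finite_PiE) auto
  qed
  hence "finite ((\<lambda>d1. (d1, d - d1)) ` {d1. \<exists>d2. d1 + d2 = d})" by (rule finite_imageI)
  thus ?thesis by (rule finite_subset[rotated]) (force simp: image_iff)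
qed

lemma len_0_iff: "len d = 0 \<longleftrightarrow> d = 0"
  unfolding len_def by (auto simp: in_keys_iff intro: poly_mapping_eqI)

lemma dim_inj_image:
  fixes \<phi> :: "('x \<Rightarrow> 'k::field) \<Rightarrow> 'y \<Rightarrow> 'k"
  assumes "finite X" "fs.subspace P" "P \<subseteq> funs_on X"
    and "\<And>f g. f \<in> P \<Longrightarrow> g \<in> P \<Longrightarrow> \<phi> (f + g) = \<phi> f + \<phi> g"
    and "\<And>c f. f \<in> P \<Longrightarrow> \<phi> (fscale c f) = fscale c (\<phi> f)"
    and inj: "\<And>f. f \<in> P \<Longrightarrow> \<phi> f = 0 \<Longrightarrow> f = 0"
  shows "fs.dim (\<phi> ` P) = fs.dim P"
proof -
  have "\<phi> 0 = 0" using assms(5)[of 0 0] fs.subspace_0[OF assms(2)] by simp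
  hence "{f \<in> P. \<phi> f = 0} = {0}" using inj fs.subspace_0[OF assms(2)] by auto
  thus ?thesis using rank_nullity[OF assms(1-5)] dim_zero by simp
qed

lemma subspace_linear_image:
  fixes \<phi> :: "('x \<Rightarrow> 'k::field) \<Rightarrow> 'y \<Rightarrow> 'k"
  assumes P: "fs.subspace P"
    and add: "\<And>f g. \<phi> (f + g) = \<phi> f + \<phi> g" and scale: "\<And>c f. \<phi> (fscale c f) = fscale c (\<phi> f)"
  shows "fs.subspace (\<phi> ` P)"
proof (rule fs.subspaceI)
  have "\<phi> 0 = 0" using scale[of 0 0] by simp
  thus "0 \<in> \<phi> ` P" using fs.subspace_0[OF P] by (intro image_eqI[of _ _ 0]) simp_all
next
  fix x y assume "x \<in> \<phi> ` P" "y \<in> \<phi> ` P"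
  then obtain f g where "f \<in> P" "g \<in> P" "x = \<phi> f" "y = \<phi> g" by blast
  thus "x + y \<in> \<phi> ` P" using fs.subspace_add[OF P] by (intro image_eqI[of _ _ "f + g"]) (simp_all add: add)
next
  fix c x assume "x \<in> \<phi> ` P"
  then obtain f where "f \<in> P" "x = \<phi> f" by blast
  thus "fscale c x \<in> \<phi> ` P" using fs.subspace_scale[OF P] by (intro image_eqI[of _ _ "fscale c f"]) (simp_all add: scale)
qed

lemma subset_lessThan_card: "U \<subseteq> {..<n} \<Longrightarrow> card U = n \<Longrightarrow> U = {..<n}"
  by (intro card_subset_eq) auto

context coloured
begin

text \<open>The words in one relation all have the same weight and total, so a relation lies
  entirely inside the support or entirely outside.\<close>

lemma goodI_words:
  assumes x: "x \<in> funs_on (words d D)"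
    and "\<And>s i j k l t. length s = p \<Longrightarrow> i \<in> V \<Longrightarrow> j \<in> V \<Longrightarrow> s @ (i, k) # (j, l) # t \<in> words d D \<Longrightarrow>
      x (s @ (i, k) # (j, l) # t) = \<epsilon> i j * x (s @ (j, l) # (i, k) # t)"
    and "\<And>s i j k q t. length s = p \<Longrightarrow> i \<in> V \<Longrightarrow> j \<in> V \<Longrightarrow> q < m i j \<Longrightarrow> s @ (i, 0) # (j, k) # t \<in> words d D \<Longrightarrow>
      (\<Sum>l\<le>k. of_nat ((k - l) choose q) * x (s @ (i, l) # (j, k - l) # t)) = 0"
  shows "good p x"
proof (rule goodI, goal_cases)
  case (1 s i j k l t)
  show ?case
  proof (cases "s @ (i, k) # (j, l) # t \<in> words d D")
    case False
    thus ?thesis using funs_onD[OF x] words_swap[of s i k j l t] by simp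
  qed (use assms(2) 1 in blast)
next
  case (2 s i j k q t)
  show ?case
  proof (cases "s @ (i, 0) # (j, k) # t \<in> words d D")
    case False
    have "x (s @ (i, l) # (j, k - l) # t) = 0" if "l \<le> k" for l
      using False words_transfer[of 0 k l "k - l" s i j t d D] that funs_onD[OF x] by simp
    thus ?thesis by simp
  qed (use assms(3) 2 in blast)
qed

lemma good_beyond:
  assumes "x \<in> funs_on (words d D)" "len d \<le> Suc p"
  shows "good p x"
proof (rule goodI_words[OF assms(1)], goal_cases)
  case (1 s i j k l t)
  thus ?case using length_words[OF 1(4)] assms(2) by simp
next
  case (2 s i j k q t)
  thus ?case using length_words[OF 2(5)] assms(2) by simp
qed

lemma Yspace_mono: "U \<subseteq> U' \<Longrightarrow> Yspace d D U \<subseteq> Yspace d D U'"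
  unfolding Yspace_def by blast

lemma Yspace_top: "{..<len d - 1} \<subseteq> U \<Longrightarrow> Yspace d D U = funs_on (words d D)"
  unfolding Yspace_def using good_beyond by force

text \<open>A component of the ideal generated by the quadratic relations of the Koszul dual: the
  sum, over the positions \<open>p\<close>, of the functions that are good at
  \<open>p\<close>.\<close>

definition Ispace :: "('v \<Rightarrow>\<^sub>0 nat) \<Rightarrow> nat \<Rightarrow> (('v \<times> nat) list \<Rightarrow> rat) set" where
  "Ispace d D = fs.span (\<Union>p<len d - 1. Yspace d D ({..<len d - 1} - {p}))"

lemma Ispace_funs: "Ispace d D \<subseteq> funs_on (words d D)"
  unfolding Ispace_def by (rule fs.span_minimal) (use Yspace_funs subspace_funs_on in auto)

definition lev :: "nat \<Rightarrow> nat \<Rightarrow> nat set set" where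
  "lev n k = {U. U \<subseteq> {..<n - 1} \<and> card U = k}"

text \<open>The direct sum of the \<open>Y\<^sub>U\<close> with \<open>card U = k\<close>, encoded
  as functions on pairs so that the dimension results for function spaces apply.\<close>

definition cochains :: "('v \<Rightarrow>\<^sub>0 nat) \<Rightarrow> nat \<Rightarrow> nat \<Rightarrow> (nat set \<times> ('v \<times> nat) list \<Rightarrow> rat) set" where
  "cochains d D k = {x \<in> funs_on (lev (len d) k \<times> words d D). \<forall>U\<in>lev (len d) k. (\<lambda>w. x (U, w)) \<in> Yspace d D U}"

definition cob :: "nat \<Rightarrow> nat \<Rightarrow> (nat set \<times> ('v \<times> nat) list \<Rightarrow> rat) \<Rightarrow> nat set \<times> ('v \<times> nat) list \<Rightarrow> rat" where
  "cob n k x = (\<lambda>(U, w). if U \<in> lev n (Suc k) then coboundary (\<lambda>V. x (V, w)) U else 0)"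

lemma finite_lev: "finite (lev n k)"
  unfolding lev_def by (rule finite_subset[of _ "Pow {..<n - 1}"]) auto

text \<open>A direct sum is the instance of \<open>dim_tensor_sum\<close> whose second factors are
  the one-dimensional spaces of functions on the single point \<open>t\<close>.\<close>

lemma cochains_dim: "fs.subspace (cochains d D k)"
    "fs.dim (cochains d D k) = (\<Sum>U\<in>lev (len d) k. fs.dim (Yspace d D U))"
proof -
  let ?T = "lev (len d) k" and ?c = "\<lambda>w U. (U :: nat set, w :: ('v \<times> nat) list)"
  have im: "(\<lambda>(t, x, y). ?c x y) ` (SIGMA t:?T. words d D \<times> {t}) = ?T \<times> words d D"
    by force
  have inj: "inj_on (\<lambda>(t, x, y). ?c x y) (SIGMA t:?T. words d D \<times> {t})"
    by (auto simp: inj_on_def)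
  have S: "cochains d D k = {f \<in> funs_on ((\<lambda>(t, x, y). ?c x y) ` (SIGMA t:?T. words d D \<times> {t})).
        \<forall>t\<in>?T. (\<forall>y\<in>{t}. (\<lambda>x. if x \<in> words d D then f (?c x y) else 0) \<in> Yspace d D t) \<and>
              (\<forall>x\<in>words d D. (\<lambda>y. if y \<in> {t} then f (?c x y) else 0) \<in> funs_on {t})}"
  proof -
    have "(\<lambda>w. if w \<in> words d D then f (t, w) else 0) = (\<lambda>w. f (t, w))" if "f \<in> funs_on (?T \<times> words d D)" for f :: "_ \<Rightarrow> rat" and t
      using that unfolding funs_on_def by (auto simp: fun_eq_iff)
    moreover have "(\<lambda>y. if y \<in> {t} then f (y, x) else 0) \<in> funs_on {t}" for f :: "_ \<Rightarrow> rat" and t :: "nat set" and x :: "('v \<times> nat) list"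
      unfolding funs_on_def by simp
    ultimately show ?thesis unfolding cochains_def im by auto
  qed
  note dts = dim_tensor_sum[OF finite_lev finite_words _ subspace_Yspace Yspace_funs subspace_funs_on order_refl inj S]
  show "fs.subspace (cochains d D k)" by (rule dts) auto
  show "fs.dim (cochains d D k) = (\<Sum>U\<in>?T. fs.dim (Yspace d D U))"
    using dts(2) by (simp add: dim_funs_on)
qed

lemma cob_linear: "cob n k (x + y) = cob n k x + cob n k y" "cob n k (fscale c x) = fscale c (cob n k x)"
  unfolding cob_def by (auto simp: fun_eq_iff fscale_apply coboundary_add coboundary_scale)

lemma cochains_funs: "cochains d D k \<subseteq> funs_on (lev (len d) k \<times> words d D)"
  unfolding cochains_def by auto

lemma subspace_cob: "fs.subspace (cob n k ` cochains d D k)"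
  by (rule subspace_linear_image[OF cochains_dim(1)]) (rule cob_linear)+

lemma lev_remove: "U \<in> lev n (Suc k) \<Longrightarrow> i \<in> U \<Longrightarrow> U - {i} \<in> lev n k"
  unfolding lev_def using finite_subset by fastforce

lemma cob_cochains:
  assumes x: "x \<in> cochains d D k" and n: "n = len d"
  shows "cob n k x \<in> cochains d D (Suc k)"
  unfolding cochains_def mem_Collect_eq
proof (intro conjI ballI)
  have x0: "x (V, w) = 0" if "w \<notin> words d D" for V w using funs_onD[OF subsetD[OF cochains_funs x], of "(V, w)"] that by simp
  show "cob n k x \<in> funs_on (lev (len d) (Suc k) \<times> words d D)"
    unfolding funs_on_def cob_def n using x0 by (auto simp: coboundary_def)
  fix U assume U: "U \<in> lev (len d) (Suc k)"
  have "(\<lambda>w. cob n k x (U, w)) = (\<Sum>i\<in>U. fscale ((- 1) ^ card {j\<in>U. j < i}) (\<lambda>w. x (U - {i}, w)))"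
    unfolding cob_def n using U by (auto simp: fun_eq_iff coboundary_def sum_fun_apply fscale_apply)
  also have "\<dots> \<in> Yspace d D U"
  proof (intro fs.subspace_sum fs.subspace_scale subspace_Yspace)
    fix i assume i: "i \<in> U"
    have "(\<lambda>w. x (U - {i}, w)) \<in> Yspace d D (U - {i})"
      using x lev_remove[OF U i] unfolding cochains_def by blast
    thus "(\<lambda>w. x (U - {i}, w)) \<in> Yspace d D U" using Yspace_mono[of "U - {i}" U] by blast
  qed
  finally show "(\<lambda>w. cob n k x (U, w)) \<in> Yspace d D U" .
qed

lemma cob_exact:
  assumes n: "n = len d" and k: "Suc k < n"
  shows "{x \<in> cochains d D k. cob n k x = 0} = (case k of 0 \<Rightarrow> {0} | Suc j \<Rightarrow> cob n j ` cochains d D j)"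
proof (intro equalityI subsetI)
  fix x assume "x \<in> {x \<in> cochains d D k. cob n k x = 0}"
  hence x: "x \<in> cochains d D k" "cob n k x = 0" by auto
  have 1: "(\<lambda>w. x (U, w)) \<in> Yspace d D U" if "U \<subseteq> {..<n - 1}" "card U = k" for U
    using x(1) that unfolding cochains_def lev_def n by simp
  have 2: "coboundary (\<lambda>U. x (U, w)) U = 0" if "U \<subseteq> {..<n - 1}" "card U = Suc k" for U w
    using fun_cong[OF x(2), of "(U, w)"] that unfolding cob_def lev_def by simp
  have "\<exists>y. (\<forall>U\<subseteq>{..<n - 1}. Suc (card U) = k \<longrightarrow> y U \<in> Yspace d D U) \<and>
      (\<forall>U\<subseteq>{..<n - 1}. card U = k \<longrightarrow> (\<forall>w. coboundary (\<lambda>U. y U w) U = x (U, w)))"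
    by (rule words_exact[OF n k, of "\<lambda>U w. x (U, w)" D, OF 1 2])
  then obtain y where y': "(\<forall>U\<subseteq>{..<n - 1}. Suc (card U) = k \<longrightarrow> y U \<in> Yspace d D U) \<and>
      (\<forall>U\<subseteq>{..<n - 1}. card U = k \<longrightarrow> (\<forall>w. coboundary (\<lambda>U. y U w) U = x (U, w)))"
    by (rule exE)
  have y: "\<And>U. U \<subseteq> {..<n - 1} \<Longrightarrow> Suc (card U) = k \<Longrightarrow> y U \<in> Yspace d D U"
    "\<And>U w. U \<subseteq> {..<n - 1} \<Longrightarrow> card U = k \<Longrightarrow> coboundary (\<lambda>U. y U w) U = x (U, w)"
    using y' by simp_all
  have x0: "x (U, w) = 0" if "U \<notin> lev n k" for U w
    using funs_onD[OF subsetD[OF cochains_funs x(1)], of "(U, w)"] that n by simp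
  show "x \<in> (case k of 0 \<Rightarrow> {0} | Suc j \<Rightarrow> cob n j ` cochains d D j)"
  proof (cases k)
    case 0
    have "x (U, w) = 0" for U w
    proof (cases "U \<in> lev n k")
      case True
      hence "U = {}" unfolding lev_def 0 using finite_subset by fastforce
      thus ?thesis using y(2)[of U w] True unfolding lev_def by (simp add: coboundary_def)
    qed (rule x0)
    thus ?thesis using 0 by (auto simp: fun_eq_iff)
  next
    case (Suc j)
    define z where "z = (\<lambda>(U, w). if U \<in> lev n j then y U w else 0)"
    have zY: "(\<lambda>w. z (U, w)) = y U" if "U \<in> lev n j" for U using that unfolding z_def by simp
    have yY: "y U \<in> Yspace d D U" if "U \<in> lev n j" for U using y(1)[of U] that Suc unfolding lev_def by simp
    have "z (U, w) = 0" if "(U, w) \<notin> lev n j \<times> words d D" for U w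
      using that funs_onD[OF subsetD[OF Yspace_funs yY], of U w] unfolding z_def by auto
    hence "z \<in> funs_on (lev n j \<times> words d D)" unfolding funs_on_def by auto
    hence "z \<in> cochains d D j" unfolding cochains_def n[symmetric] using zY yY by simp
    moreover have "cob n j z = x"
    proof (rule ext, clarify)
      fix U w
      show "cob n j z (U, w) = x (U, w)"
      proof (cases "U \<in> lev n k")
        case True
        have "coboundary (\<lambda>V. z (V, w)) U = coboundary (\<lambda>V. y V w) U"
          by (rule coboundary_cong) (use lev_remove[of U n j] True Suc in \<open>simp add: z_def\<close>)
        thus ?thesis using y(2)[of U w] True Suc unfolding cob_def lev_def by simp
      next
        case False
        thus ?thesis using x0 Suc unfolding cob_def by simp
      qed
    qed
    ultimately show ?thesis using Suc by auto
  qed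
next
  fix x assume x: "x \<in> (case k of 0 \<Rightarrow> {0} | Suc j \<Rightarrow> cob n j ` cochains d D j)"
  show "x \<in> {x \<in> cochains d D k. cob n k x = 0}"
  proof (cases k)
    case 0
    hence "x = 0" using x by simp
    moreover have "cob n k 0 = 0" unfolding cob_def coboundary_def by (auto simp: fun_eq_iff)
    ultimately show ?thesis using fs.subspace_0[OF cochains_dim(1)] by simp
  next
    case (Suc j)
    then obtain y where y: "y \<in> cochains d D j" "x = cob n j y" using x by auto
    have "cob n k x (U, w) = 0" for U w
    proof (cases "U \<in> lev n (Suc k)")
      case True
      have "coboundary (\<lambda>V. x (V, w)) U = coboundary (coboundary (\<lambda>V. y (V, w))) U"
        by (rule coboundary_cong) (use lev_remove[OF True] Suc y(2) in \<open>simp add: cob_def\<close>)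
      also have "\<dots> = 0"
        by (rule coboundary_coboundary) (use True finite_subset in \<open>auto simp: lev_def totally_ordered_def linear\<close>)
      finally show ?thesis unfolding cob_def by simp
    qed (simp add: cob_def)
    hence "cob n k x = 0" by (auto simp: fun_eq_iff)
    thus ?thesis using cob_cochains[OF y(1) n] y(2) Suc by simp
  qed
qed

lemma finite_index: "finite (lev n k \<times> words d D)"
  using finite_lev finite_words by simp

text \<open>Rank and nullity in each degree, with the kernel replaced by the preceding
  image.\<close>

lemma cob_dim:
  assumes n: "n = len d" and k: "Suc k < n"
  shows "int (fs.dim (cob n k ` cochains d D k)) = (\<Sum>j\<le>k. (- 1) ^ (k - j) * int (fs.dim (cochains d D j)))"
  using k
proof (induction k)
  case 0
  have "fs.dim (cochains d D 0) = fs.dim {x \<in> cochains d D 0. cob n 0 x = 0} + fs.dim (cob n 0 ` cochains d D 0)"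
    by (rule rank_nullity[OF finite_index cochains_dim(1) cochains_funs]) (rule cob_linear)+
  thus ?case using cob_exact[OF n 0] dim_zero by simp
next
  case (Suc k)
  have "fs.dim (cochains d D (Suc k)) = fs.dim {x \<in> cochains d D (Suc k). cob n (Suc k) x = 0} + fs.dim (cob n (Suc k) ` cochains d D (Suc k))"
    by (rule rank_nullity[OF finite_index cochains_dim(1) cochains_funs]) (rule cob_linear)+
  hence "int (fs.dim (cob n (Suc k) ` cochains d D (Suc k))) = int (fs.dim (cochains d D (Suc k))) - int (fs.dim (cob n k ` cochains d D k))"
    using cob_exact[OF n Suc.prems] by simp
  also have "\<dots> = int (fs.dim (cochains d D (Suc k))) - (\<Sum>j\<le>k. (- 1) ^ (k - j) * int (fs.dim (cochains d D j)))"
    using Suc by simp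
  also have "\<dots> = (\<Sum>j\<le>Suc k. (- 1) ^ (Suc k - j) * int (fs.dim (cochains d D j)))"
    by (simp add: Suc_diff_le sum_negf)
  finally show ?case .
qed

text \<open>In the top degree there is a single set \<open>U\<close>, and the last coboundary adds
  up, with signs, arbitrary elements of the spaces with one position missing. Its image is therefore
  their sum.\<close>

lemma Ispace_dim:
  assumes n: "n = len d" and n2: "n = Suc (Suc k)"
  shows "fs.dim (Ispace d D) = fs.dim (cob n k ` cochains d D k)"
proof -
  define top where "top = {..<n - 1}"
  have levtop: "lev n (Suc k) = {top}"
  proof
    show "lev n (Suc k) \<subseteq> {top}" unfolding lev_def top_def n2 using subset_lessThan_card by auto
  qed (simp add: lev_def top_def n2)
  define \<phi> where "\<phi> = (\<lambda>f :: nat set \<times> ('v \<times> nat) list \<Rightarrow> rat. \<lambda>w. f (top, w))"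
  define A where "A = cob n k ` cochains d D k"
  have Asub: "A \<subseteq> funs_on (lev n (Suc k) \<times> words d D)"
    unfolding A_def using cob_cochains[OF _ n] cochains_funs[of d D "Suc k"] n by blast
  have inj: "f = 0" if f: "f \<in> A" "\<phi> f = 0" for f
  proof (rule ext, clarify)
    fix U w
    show "f (U, w) = 0 (U, w)"
    proof (cases "U = top")
      case True
      thus ?thesis using fun_cong[OF f(2), of w] unfolding \<phi>_def by simp
    next
      case False
      thus ?thesis using funs_onD[OF subsetD[OF Asub f(1)], of "(U, w)"] levtop by simp
    qed
  qed
  have \<phi>lin: "\<phi> (f + g) = \<phi> f + \<phi> g" "\<phi> (fscale c f) = fscale c (\<phi> f)" for f g c
    unfolding \<phi>_def by (auto simp: fun_eq_iff fscale_apply)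
  have dA: "fs.dim (\<phi> ` A) = fs.dim A"
    by (rule dim_inj_image[OF finite_index _ Asub \<phi>lin(1) \<phi>lin(2) inj]) (simp_all add: A_def subspace_cob)
  have "\<phi> ` A = Ispace d D"
  proof
    show "\<phi> ` A \<subseteq> Ispace d D"
    proof (clarsimp simp: A_def)
      fix x assume x: "x \<in> cochains d D k"
      have "\<phi> (cob n k x) = (\<Sum>p\<in>top. fscale ((- 1) ^ card {j\<in>top. j < p}) (\<lambda>w. x (top - {p}, w)))"
        unfolding \<phi>_def cob_def levtop by (auto simp: fun_eq_iff coboundary_def sum_fun_apply fscale_apply)
      also have "\<dots> \<in> Ispace d D" unfolding Ispace_def
      proof (intro fs.span_sum fs.span_scale fs.span_base)
        fix p assume p: "p \<in> top"
        have "(\<lambda>w. x (top - {p}, w)) \<in> Yspace d D (top - {p})"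
          using x lev_remove[of top n k p] p levtop n unfolding cochains_def by blast
        thus "(\<lambda>w. x (top - {p}, w)) \<in> (\<Union>p<len d - 1. Yspace d D ({..<len d - 1} - {p}))"
          using p unfolding top_def n by blast
      qed
      finally show "\<phi> (cob n k x) \<in> Ispace d D" .
    qed
    show "Ispace d D \<subseteq> \<phi> ` A"
      unfolding Ispace_def
    proof (rule fs.span_minimal)
      show "fs.subspace (\<phi> ` A)"
        unfolding A_def by (rule subspace_linear_image[OF subspace_cob]) (rule \<phi>lin)+
      show "(\<Union>p<len d - 1. Yspace d D ({..<len d - 1} - {p})) \<subseteq> \<phi> ` A"
      proof clarify
        fix p z assume p: "p < len d - 1" and z: "z \<in> Yspace d D ({..<len d - 1} - {p})"
        define sg where "sg = (- 1 :: rat) ^ card {j\<in>top. j < p}"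
        have sg2: "sg * sg = 1" unfolding sg_def by (simp flip: power_mult_distrib)
        have pt: "p \<in> top" using p n unfolding top_def by simp
        have z': "fscale sg z \<in> Yspace d D (top - {p})"
          using z n by (intro fs.subspace_scale subspace_Yspace) (simp add: top_def)
        define x where "x = (\<lambda>(U, w). if U = top - {p} then sg * z w else 0)"
        have lv: "top - {p} \<in> lev n k" using lev_remove[of top n k p] pt levtop by simp
        have xU: "(\<lambda>w. x (U, w)) = (if U = top - {p} then fscale sg z else 0)" for U
          unfolding x_def by (auto simp: fun_eq_iff fscale_apply)
        have "z w = 0" if "w \<notin> words d D" for w using funs_onD[OF subsetD[OF Yspace_funs z] that] .
        hence "x \<in> funs_on (lev n k \<times> words d D)" unfolding funs_on_def x_def using lv by auto
        moreover have "(\<lambda>w. x (U, w)) \<in> Yspace d D U" for U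
          unfolding xU[of U] using z' fs.subspace_0[OF subspace_Yspace] by (cases "U = top - {p}") simp_all
        ultimately have x: "x \<in> cochains d D k" unfolding cochains_def n[symmetric] by blast
        have "\<phi> (cob n k x) = z"
        proof
          fix w
          have "\<phi> (cob n k x) w = (\<Sum>i\<in>top. (- 1) ^ card {j\<in>top. j < i} * x (top - {i}, w))"
            unfolding \<phi>_def cob_def levtop by (simp add: coboundary_def)
          also have "\<dots> = (\<Sum>i\<in>top. if i = p then sg * (sg * z w) else 0)"
          proof (rule sum.cong[OF refl])
            fix i assume "i \<in> top"
            hence "top - {i} = top - {p} \<longleftrightarrow> i = p" using pt by blast
            thus "(- 1) ^ card {j\<in>top. j < i} * x (top - {i}, w) = (if i = p then sg * (sg * z w) else 0)"
              unfolding x_def sg_def by simp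
          qed
          also have "\<dots> = sg * sg * z w" using pt unfolding top_def by simp
          finally show "\<phi> (cob n k x) w = z w" using sg2 by simp
        qed
        thus "z \<in> \<phi> ` A" unfolding A_def using x by blast
      qed
    qed
  qed
  thus ?thesis using dA unfolding A_def by simp
qed

definition HA :: "('v \<Rightarrow>\<^sub>0 nat) \<Rightarrow> nat \<Rightarrow> nat" where "HA d D = fs.dim (Yspace d D {})"

text \<open>Taken as an integer because it enters alternating sums.\<close>

definition HK :: "('v \<Rightarrow>\<^sub>0 nat) \<Rightarrow> nat \<Rightarrow> int" where
  "HK d D = int (card (words d D)) - int (fs.dim (Ispace d D))"

text \<open>The cohomology is concentrated in the top degree, where it is all functions modulo
  \<open>Ispace\<close>.\<close>

lemma HK_euler:
  assumes n: "len d = Suc n"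
  shows "HK d D = (\<Sum>U\<in>Pow {..<n}. (- 1) ^ (n - card U) * int (fs.dim (Yspace d D U)))"
proof -
  have cU: "card U \<le> n" if "U \<in> Pow {..<n}" for U using that card_mono[of "{..<n}" U] by simp
  have lv: "lev (len d) k = {U \<in> Pow {..<n}. card U = k}" for k unfolding lev_def n by auto
  have "(\<Sum>U\<in>Pow {..<n}. (- 1) ^ (n - card U) * int (fs.dim (Yspace d D U)))
    = (\<Sum>k\<le>n. \<Sum>U\<in>{U \<in> Pow {..<n}. card U = k}. (- 1) ^ (n - card U) * int (fs.dim (Yspace d D U)))"
    by (rule sum.group[symmetric]) (use cU in auto)
  also have "\<dots> = (\<Sum>k\<le>n. (- 1) ^ (n - k) * int (fs.dim (cochains d D k)))"
    unfolding cochains_dim(2) lv by (intro sum.cong refl) (simp add: sum_distrib_left)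
  also have "\<dots> = (\<Sum>k<n. (- 1) ^ (n - k) * int (fs.dim (cochains d D k))) + int (fs.dim (cochains d D n))"
    by (simp add: lessThan_Suc_atMost[symmetric])
  also have "int (fs.dim (cochains d D n)) = int (card (words d D))"
  proof -
    have "lev (len d) n = {{..<n}}" unfolding lv using subset_lessThan_card by auto
    thus ?thesis unfolding cochains_dim(2) using Yspace_top[of d "{..<n}" D] n by (simp add: dim_funs_on finite_words)
  qed
  also have "(\<Sum>k<n. (- 1) ^ (n - k) * int (fs.dim (cochains d D k))) = - int (fs.dim (Ispace d D))"
  proof (cases n)
    case 0
    have "Ispace d D = {0}" unfolding Ispace_def n 0 by simp
    thus ?thesis using 0 dim_zero by simp
  next
    case (Suc k)
    have "int (fs.dim (Ispace d D)) = (\<Sum>j\<le>k. (- 1) ^ (k - j) * int (fs.dim (cochains d D j)))"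
      using Ispace_dim[of "len d" d k D] cob_dim[of "len d" d k D] n Suc by simp
    thus ?thesis unfolding Suc lessThan_Suc_atMost by (simp add: Suc_diff_le sum_negf)
  qed
  finally show ?thesis unfolding HK_def by simp
qed

end

section \<open>Splitting words and the recursion between the two families of dimensions\<close>

type_synonym 'v degree = "('v \<Rightarrow>\<^sub>0 nat) \<times> nat"

definition splittings :: "('v \<Rightarrow>\<^sub>0 nat) \<Rightarrow> nat \<Rightarrow> ('v degree \<times> 'v degree) set" where
  "splittings d D = {((d1, D1), (d2, D2)). d1 + d2 = d \<and> D1 + D2 = D}"

lemma finite_splittings: "finite (splittings d D)"
proof (rule finite_subset)
  show "splittings d D \<subseteq> (\<lambda>((d1, d2), (D1, D2)). ((d1, D1), (d2, D2))) ` ({(d1, d2). d1 + d2 = d} \<times> ({..D} \<times> {..D}))"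
    unfolding splittings_def by force
qed (intro finite_imageI finite_cartesian_product finite_add_decompositions finite_atMost)

definition splittings_at :: "nat \<Rightarrow> ('v \<Rightarrow>\<^sub>0 nat) \<Rightarrow> nat \<Rightarrow> ('v degree \<times> 'v degree) set" where
  "splittings_at r d D = {t \<in> splittings d D. len (fst (fst t)) = r}"

lemma finite_splittings_at: "finite (splittings_at r d D)"
  by (rule finite_subset[OF _ finite_splittings]) (auto simp: splittings_at_def)

definition shift :: "nat \<Rightarrow> nat set \<Rightarrow> nat set" where
  "shift r U = {p. p + r \<in> U}"

context coloured
begin

text \<open>\<open>r - 1\<close> is the least element of \<open>U\<close>. Relations at smaller
  positions involve the first \<open>r\<close> letters only, those at larger positions only the
  remaining letters, and none is imposed across the cut.\<close>

lemma dim_split: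
  assumes r: "r < len d" and U: "r - 1 \<in> U" "r \<noteq> 0" "\<And>p. p \<in> U \<Longrightarrow> r \<le> Suc p"
  shows "fs.dim (Yspace d D U) = (\<Sum>t\<in>splittings_at r d D.
      HA (fst (fst t)) (snd (fst t)) * fs.dim (Yspace (fst (snd t)) (snd (snd t)) (shift r U)))"
proof -
  define T where "T = (splittings_at r d D :: ('v degree \<times> 'v degree) set)"
  define X where "X = (\<lambda>t :: 'v degree \<times> 'v degree. words (fst (fst t)) (snd (fst t)))"
  define Y where "Y = (\<lambda>t :: 'v degree \<times> 'v degree. words (fst (snd t)) (snd (snd t)))"
  define P where "P = (\<lambda>t :: 'v degree \<times> 'v degree. Yspace (fst (fst t)) (snd (fst t)) {})"
  define Q where "Q = (\<lambda>t :: 'v degree \<times> 'v degree. Yspace (fst (snd t)) (snd (snd t)) (shift r U))"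
  have finT: "finite T" unfolding T_def by (rule finite_splittings_at)
  have lenX: "length x = r" if "t \<in> T" "x \<in> X t" for t x
    using that length_words unfolding T_def X_def splittings_at_def by auto
  have tdef: "t = ((weight x, sum_list (map snd x)), (weight y, sum_list (map snd y)))" if "x \<in> X t" "y \<in> Y t" for t x y
    using that unfolding X_def Y_def words_def by (cases t) auto
  have inj: "inj_on (\<lambda>(t, x, y). x @ y) (SIGMA t:T. X t \<times> Y t)"
  proof (rule inj_onI)
    fix p q assume p: "p \<in> (SIGMA t:T. X t \<times> Y t)" and q: "q \<in> (SIGMA t:T. X t \<times> Y t)"
      and eq: "(\<lambda>(t, x, y). x @ y) p = (\<lambda>(t, x, y). x @ y) q"
    obtain t x y where p': "p = (t, x, y)" "t \<in> T" "x \<in> X t" "y \<in> Y t" using p by auto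
    obtain t' x' y' where q': "q = (t', x', y')" "t' \<in> T" "x' \<in> X t'" "y' \<in> Y t'" using q by auto
    have "x = x'" "y = y'" using lenX[OF p'(2,3)] lenX[OF q'(2,3)] eq unfolding p'(1) q'(1) by auto
    moreover have "t = t'" using tdef[OF p'(3,4)] tdef[OF q'(3,4)] calculation by simp
    ultimately show "p = q" unfolding p'(1) q'(1) by simp
  qed
  have mem: "x \<in> X t" "y \<in> Y t" "t \<in> T" if "x @ y \<in> words d D" "length x = r"
    "t = ((weight x, sum_list (map snd x)), (weight y, sum_list (map snd y)))" for x y t
  proof -
    have xy: "set x \<subseteq> V \<times> UNIV" "set y \<subseteq> V \<times> UNIV" "weight x + weight y = d" "sum_list (map snd x) + sum_list (map snd y) = D"
      using that(1) unfolding words_def by (auto simp: weight_append)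
    show "x \<in> X t" "y \<in> Y t" unfolding that(3) X_def Y_def words_def using xy by auto
    show "t \<in> T" unfolding that(3) T_def splittings_at_def splittings_def using xy that(2) by (simp add: len_weight)
  qed
  have app: "x @ y \<in> words d D" if "t \<in> T" "x \<in> X t" "y \<in> Y t" for t x y
    using that unfolding T_def splittings_at_def splittings_def X_def Y_def words_def
    by (cases t) (auto simp: weight_append)
  have im: "(\<lambda>(t, x, y). x @ y) ` (SIGMA t:T. X t \<times> Y t) = words d D"
  proof
    show "(\<lambda>(t, x, y). x @ y) ` (SIGMA t:T. X t \<times> Y t) \<subseteq> words d D" using app by auto
    show "words d D \<subseteq> (\<lambda>(t, x, y). x @ y) ` (SIGMA t:T. X t \<times> Y t)"
    proof
      fix w assume w: "w \<in> words d D"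
      define x where "x = take r w" define y where "y = drop r w"
      have xy: "x @ y \<in> words d D" "length x = r" using w length_words[OF w] r unfolding x_def y_def by auto
      define t where "t = ((weight x, sum_list (map snd x)), (weight y, sum_list (map snd y)))"
      have "w = (\<lambda>(t, x, y). x @ y) (t, x, y)" unfolding x_def y_def by simp
      thus "w \<in> (\<lambda>(t, x, y). x @ y) ` (SIGMA t:T. X t \<times> Y t)" using mem[OF xy t_def] by blast
    qed
  qed
  have S: "Yspace d D U = {f \<in> funs_on ((\<lambda>(t, x, y). x @ y) ` (SIGMA t:T. X t \<times> Y t)).
        \<forall>t\<in>T. (\<forall>y\<in>Y t. (\<lambda>x. if x \<in> X t then f (x @ y) else 0) \<in> P t) \<and>
              (\<forall>x\<in>X t. (\<lambda>y. if y \<in> Y t then f (x @ y) else 0) \<in> Q t)}"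
    unfolding im
  proof (intro equalityI subsetI)
    fix f assume f: "f \<in> Yspace d D U"
    have g: "good p f" if "p \<notin> U" for p using Yspace_goodD[OF f that] .
    show "f \<in> {f \<in> funs_on (words d D).
        \<forall>t\<in>T. (\<forall>y\<in>Y t. (\<lambda>x. if x \<in> X t then f (x @ y) else 0) \<in> P t) \<and>
              (\<forall>x\<in>X t. (\<lambda>y. if y \<in> Y t then f (x @ y) else 0) \<in> Q t)}"
    proof (intro CollectI conjI ballI)
      show "f \<in> funs_on (words d D)" using Yspace_funs f by blast
    next
      fix t y assume t: "t \<in> T" and y: "y \<in> Y t"
      let ?g = "\<lambda>x. if x \<in> X t then f (x @ y) else 0"
      have fn: "?g \<in> funs_on (words (fst (fst t)) (snd (fst t)))" unfolding funs_on_def X_def by simp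
      have "good p ?g" for p
      proof (rule goodI_words[OF fn], goal_cases)
        case (1 s i j k l u)
        have sX: "s @ (i, k) # (j, l) # u \<in> X t" "s @ (j, l) # (i, k) # u \<in> X t"
          using 1(4) words_swap[of s i k j l u] unfolding X_def by auto
        have "Suc (Suc p) \<le> r" using lenX[OF t sX(1)] 1(1) by simp
        hence "good p f" using U(3)[of p] by (intro g) auto
        from good_swap[OF this 1(1-3), of k l "u @ y"] show ?case using sX by simp
      next
        case (2 s i j k q u)
        have sX: "s @ (i, l) # (j, k - l) # u \<in> X t" if "l \<le> k" for l
          using 2(5) words_transfer[of 0 k l "k - l" s i j u] that unfolding X_def by auto
        have "Suc (Suc p) \<le> r" using lenX[OF t sX[of 0]] 2(1) by simp
        hence "good p f" using U(3)[of p] by (intro g) auto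
        from good_moment[OF this 2(1-4), of k "u @ y"] show ?case using sX by simp
      qed
      thus "?g \<in> P t" unfolding P_def Yspace_def using fn by simp
    next
      fix t x assume t: "t \<in> T" and x: "x \<in> X t"
      let ?h = "\<lambda>y. if y \<in> Y t then f (x @ y) else 0"
      have fn: "?h \<in> funs_on (words (fst (snd t)) (snd (snd t)))" unfolding funs_on_def Y_def by simp
      have "good p ?h" if p: "p \<notin> shift r U" for p
      proof -
        have gf: "good (p + r) f" using p unfolding shift_def by (intro g) simp
        show ?thesis
        proof (rule goodI_words[OF fn], goal_cases)
          case (1 s i j k l u)
          have sX: "s @ (i, k) # (j, l) # u \<in> Y t" "s @ (j, l) # (i, k) # u \<in> Y t"
            using 1(4) words_swap[of s i k j l u] unfolding Y_def by auto
          have "length (x @ s) = p + r" using lenX[OF t x] 1(1) by simp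
          from good_swap[OF gf this 1(2,3), of k l u] show ?case using sX by simp
        next
          case (2 s i j k q u)
          have sX: "s @ (i, l) # (j, k - l) # u \<in> Y t" if "l \<le> k" for l
            using 2(5) words_transfer[of 0 k l "k - l" s i j u] that unfolding Y_def by auto
          have "length (x @ s) = p + r" using lenX[OF t x] 2(1) by simp
          from good_moment[OF gf this 2(2-4), of k u] show ?case using sX by simp
        qed
      qed
      thus "?h \<in> Q t" unfolding Q_def Yspace_def using fn by simp
    qed
  next
    fix f assume "f \<in> {f \<in> funs_on (words d D).
        \<forall>t\<in>T. (\<forall>y\<in>Y t. (\<lambda>x. if x \<in> X t then f (x @ y) else 0) \<in> P t) \<and>
              (\<forall>x\<in>X t. (\<lambda>y. if y \<in> Y t then f (x @ y) else 0) \<in> Q t)}"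
    hence fn: "f \<in> funs_on (words d D)"
      and fP: "\<And>t y. t \<in> T \<Longrightarrow> y \<in> Y t \<Longrightarrow> (\<lambda>x. if x \<in> X t then f (x @ y) else 0) \<in> P t"
      and fQ: "\<And>t x. t \<in> T \<Longrightarrow> x \<in> X t \<Longrightarrow> (\<lambda>y. if y \<in> Y t then f (x @ y) else 0) \<in> Q t" by auto
    have gP: "good p (\<lambda>x. if x \<in> X t then f (x @ y) else 0)" if "t \<in> T" "y \<in> Y t" for t y p
      using Yspace_goodD[of _ _ _ "{}"] fP[OF that] unfolding P_def by simp
    have gQ: "good p (\<lambda>y. if y \<in> Y t then f (x @ y) else 0)" if "t \<in> T" "x \<in> X t" "p \<notin> shift r U" for t x p
      using Yspace_goodD[OF _ that(3)] fQ[OF that(1,2)] unfolding Q_def by blast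
    have "good p f" if p: "p \<notin> U" for p
    proof (cases "Suc p < r")
      case True
      show ?thesis
      proof (rule goodI_words[OF fn], goal_cases)
        case (1 s i j k l u)
        \<comment> \<open>The number of letters after the exchanged pair that still belong to the
          first part of the word.\<close>
        define a where "a = r - Suc (Suc p)"
        define x where "x = (\<lambda>i k j l. s @ (i, k) # (j, l) # take a u)" define y where "y = drop a u"
        have eq: "s @ (i, k) # (j, l) # u = x i k j l @ y" for i j k l unfolding x_def y_def by simp
        have "a \<le> length u" using length_words[OF 1(4)] 1(1) r True unfolding a_def by simp
        hence lx: "length (x i k j l) = r" for i k j l unfolding x_def a_def using 1(1) True by simp
        define t where "t = ((weight (x i k j l), sum_list (map snd (x i k j l))), (weight y, sum_list (map snd y)))"
        note mm = mem[OF _ lx t_def, unfolded eq[symmetric], OF 1(4)]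
        have m2: "x j l i k \<in> X t" using mm(1) words_swap[of s i k j l "take a u"] unfolding x_def X_def by simp
        from good_swap[OF gP[OF mm(3,2)] 1(1-3), of k l "take a u"] show ?case
          unfolding eq using mm(1) m2 unfolding x_def by simp
      next
        case (2 s i j k q u)
        define a where "a = r - Suc (Suc p)"
        define x where "x = (\<lambda>l. s @ (i, l) # (j, k - l) # take a u)" define y where "y = drop a u"
        have eq: "s @ (i, l) # (j, k - l) # u = x l @ y" for l unfolding x_def y_def by simp
        have "a \<le> length u" using length_words[OF 2(5)] 2(1) r True unfolding a_def by simp
        hence lx: "length (x l) = r" for l unfolding x_def a_def using 2(1) True by simp
        define t where "t = ((weight (x 0), sum_list (map snd (x 0))), (weight y, sum_list (map snd y)))"
        have "x 0 @ y \<in> words d D" using 2(5) eq[of 0] by simp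
        note mm = mem[OF this lx t_def]
        have m2: "x l \<in> X t" if "l \<le> k" for l
          using mm(1) words_transfer[of 0 k l "k - l" s i j "take a u"] that unfolding x_def X_def by simp
        have "(\<Sum>l\<le>k. of_nat ((k - l) choose q) * (if x l \<in> X t then f (x l @ y) else 0)) = 0"
          using good_moment[OF gP[OF mm(3,2)] 2(1-4), of k "take a u"] unfolding x_def .
        thus ?case unfolding eq using m2 by simp
      qed
    next
      case False
      have "p \<noteq> r - 1" using p U(1) by auto
      hence pr: "r \<le> p" using False U(2) by simp
      hence ps: "p - r \<notin> shift r U" using p unfolding shift_def by simp
      show ?thesis
      proof (rule goodI_words[OF fn], goal_cases)
        case (1 s i j k l u)
        define x where "x = take r s" define s' where "s' = drop r s"
        define y where "y = (\<lambda>i k j l. s' @ (i, k) # (j, l) # u)"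
        have eq: "s @ (i, k) # (j, l) # u = x @ y i k j l" for i j k l unfolding x_def y_def s'_def by simp
        have lx: "length x = r" and ls: "length s' = p - r" unfolding x_def s'_def using 1(1) pr by auto
        define t where "t = ((weight x, sum_list (map snd x)), (weight (y i k j l), sum_list (map snd (y i k j l))))"
        have "x @ y i k j l \<in> words d D" using 1(4) eq by simp
        note mm = mem[OF this lx t_def]
        have m2: "y j l i k \<in> Y t" using mm(2) words_swap[of s' i k j l u] unfolding y_def Y_def by simp
        from good_swap[OF gQ[OF mm(3,1) ps] ls 1(2,3), of k l u] show ?case
          unfolding eq using mm(2) m2 unfolding y_def by simp
      next
        case (2 s i j k q u)
        define x where "x = take r s" define s' where "s' = drop r s"
        define y where "y = (\<lambda>l. s' @ (i, l) # (j, k - l) # u)"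
        have eq: "s @ (i, l) # (j, k - l) # u = x @ y l" for l unfolding x_def y_def s'_def by simp
        have lx: "length x = r" and ls: "length s' = p - r" unfolding x_def s'_def using 2(1) pr by auto
        define t where "t = ((weight x, sum_list (map snd x)), (weight (y 0), sum_list (map snd (y 0))))"
        have "x @ y 0 \<in> words d D" using 2(5) eq[of 0] by simp
        note mm = mem[OF this lx t_def]
        have m2: "y l \<in> Y t" if "l \<le> k" for l
          using mm(2) words_transfer[of 0 k l "k - l" s' i j u] that unfolding y_def Y_def by simp
        have "(\<Sum>l\<le>k. of_nat ((k - l) choose q) * (if y l \<in> Y t then f (x @ y l) else 0)) = 0"
          using good_moment[OF gQ[OF mm(3,1) ps] ls 2(2-4), of k u] unfolding y_def .
        thus ?case unfolding eq using m2 by simp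
      qed
    qed
    thus "f \<in> Yspace d D U" unfolding Yspace_def using fn by simp
  qed
  have "fs.dim (Yspace d D U) = (\<Sum>t\<in>T. fs.dim (P t) * fs.dim (Q t))"
    by (rule dim_tensor_sum(2)[OF finT _ _ _ _ _ _ inj S])
      (auto simp: X_def Y_def P_def Q_def finite_words subspace_Yspace intro: subsetD[OF Yspace_funs])
  thus ?thesis unfolding T_def P_def Q_def HA_def .
qed

text \<open>The sign comes from the degree shift: each letter of the dual contributes an extra
  \<open>- fls_X\<close>, and the rescaling by \<open>fls_X_inv\<close> leaves only the
  sign.\<close>

definition G :: "('v \<Rightarrow>\<^sub>0 nat) \<Rightarrow> nat \<Rightarrow> int" where
  "G d D = (- 1) ^ len d * HK d D"

lemma words_0: "words 0 D = (if D = 0 then {[]} else {})"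
proof -
  have "w = []" if "w \<in> words 0 D" for w using length_words[OF that] by (simp add: len_def)
  moreover have "[] \<in> words 0 0" unfolding words_def by simp
  moreover have "[] \<notin> words 0 D" if "D \<noteq> 0" using that unfolding words_def by simp
  ultimately show ?thesis by auto
qed

lemma HA_0: "HA 0 D = (if D = 0 then 1 else 0)"
  unfolding HA_def using Yspace_top[of 0 "{}" D] words_0[of D] by (simp add: len_def dim_funs_on)

lemma G_0: "G 0 D = (if D = 0 then 1 else 0)"
proof -
  have "Ispace 0 D = {0}" unfolding Ispace_def by (simp add: len_def)
  thus ?thesis unfolding G_def HK_def using words_0[of D] by (simp add: len_def dim_zero)
qed

lemma G_euler:
  assumes "len d = Suc n"
  shows "G d D = - (\<Sum>U\<in>Pow {..<n}. (- 1) ^ card U * int (fs.dim (Yspace d D U)))"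
proof -
  have sgn: "(- 1) ^ Suc n * (- 1) ^ (n - card U) = - ((- 1) ^ card U :: int)" if "U \<in> Pow {..<n}" for U
  proof -
    have "card U \<le> n" using that card_mono[of "{..<n}" U] by simp
    then obtain c where c: "n = card U + c" by (metis le_Suc_ex)
    show ?thesis unfolding c by (simp add: power_add mult.assoc[symmetric] flip: power_mult_distrib)
  qed
  show ?thesis unfolding G_def HK_euler[OF assms] assms sum_distrib_left sum_negf[symmetric]
    by (intro sum.cong refl) (simp only: mult.assoc[symmetric] sgn mult_minus_left)
qed

text \<open>Nonempty sets are sorted by their least element \<open>j\<close>, and the rest is
  translated to start at zero, as in \<open>dim_split\<close>.\<close>

lemma sum_Pow_first:
  fixes h :: "nat set \<Rightarrow> 'a::comm_monoid_add"
  shows "(\<Sum>U\<in>Pow {..<n}. h U) = h {} + (\<Sum>j<n. \<Sum>U'\<in>Pow {..<n - Suc j}. h (insert j ((+) (Suc j) ` U')))"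
proof -
  define A where "A = (SIGMA j:{..<n}. Pow {..<n - Suc j})"
  define F where "F = (\<lambda>(j, U'). insert j ((+) (Suc j) ` U'))"
  have min: "(LEAST i. i \<in> F (j, U')) = j" for j U'
    unfolding F_def by (rule Least_equality) auto
  have rest: "shift (Suc j) (F (j, U')) = U'" for j U'
    unfolding F_def shift_def by auto
  have inj: "inj_on F A"
    by (rule inj_onI) (metis min rest surj_pair)
  have "F ` A = Pow {..<n} - {{}}"
  proof
    show "F ` A \<subseteq> Pow {..<n} - {{}}" unfolding A_def F_def by auto
    show "Pow {..<n} - {{}} \<subseteq> F ` A"
    proof
      fix U assume U: "U \<in> Pow {..<n} - {{}}"
      define j where "j = (LEAST i. i \<in> U)"
      have jU: "j \<in> U" unfolding j_def using U by (auto intro: LeastI)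
      have le: "j \<le> i" if "i \<in> U" for i unfolding j_def using that by (rule Least_le)
      have "F (j, shift (Suc j) U) = U"
      proof
        show "F (j, shift (Suc j) U) \<subseteq> U" unfolding F_def shift_def using jU by (auto simp: add.commute)
        show "U \<subseteq> F (j, shift (Suc j) U)"
        proof
          fix i assume i: "i \<in> U"
          show "i \<in> F (j, shift (Suc j) U)"
          proof (cases "i = j")
            case False
            hence "i = Suc j + (i - Suc j)" using le[OF i] by simp
            moreover have "i - Suc j \<in> shift (Suc j) U" unfolding shift_def using i le[OF i] False by simp
            ultimately show ?thesis unfolding F_def by blast
          qed (simp add: F_def)
        qed
      qed
      moreover have "(j, shift (Suc j) U) \<in> A" unfolding A_def shift_def using jU U by auto
      ultimately show "U \<in> F ` A" by (metis imageI)
    qed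
  qed
  hence "(\<Sum>U\<in>Pow {..<n} - {{}}. h U) = (\<Sum>p\<in>A. h (F p))" using sum.reindex[OF inj, of h] by simp
  also have "\<dots> = (\<Sum>j<n. \<Sum>U'\<in>Pow {..<n - Suc j}. h (insert j ((+) (Suc j) ` U')))"
    unfolding A_def F_def by (subst sum.Sigma) (auto intro: sum.cong)
  finally show ?thesis by (subst sum.remove[of _ "{}"]) auto
qed

text \<open>Sort the splittings by the length \<open>r\<close> of the first part. The term
  \<open>r = 0\<close> is \<open>G d D\<close> and \<open>r = len d\<close> is
  \<open>HA d D\<close>; by \<open>dim_split\<close> the terms between are the summands of the Euler
  characteristic whose sets have least element \<open>r - 1\<close>. With the empty set they add up
  to \<open>- G d D\<close>.\<close>

theorem recursion:
  "(\<Sum>t\<in>splittings d D. int (HA (fst (fst t)) (snd (fst t))) * G (fst (snd t)) (snd (snd t)))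
    = (if d = 0 \<and> D = 0 then 1 else 0)"
proof -
  define \<Phi> where "\<Phi> = (\<lambda>t. int (HA (fst (fst t)) (snd (fst t))) * G (fst (snd t)) (snd (snd t)))"
  have lenT: "len (fst (fst t)) + len (fst (snd t)) = len d" if "t \<in> splittings d D" for t
    using that unfolding splittings_def by (auto simp: len_add[symmetric])
  have group: "(\<Sum>t\<in>splittings d D. \<Phi> t) = (\<Sum>r\<le>len d. \<Sum>t\<in>splittings_at r d D. \<Phi> t)"
    unfolding splittings_at_def
    by (rule sum.group[symmetric, OF finite_splittings]) (use lenT in force)+
  have first: "(\<Sum>t\<in>splittings_at 0 d D. \<Phi> t) = G d D"
  proof -
    have "(\<Sum>t\<in>splittings_at 0 d D. \<Phi> t) = (\<Sum>t\<in>{((0, 0), (d, D))}. \<Phi> t)"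
    proof (rule sum.mono_neutral_right)
      show "finite (splittings_at 0 d D)" by (rule finite_splittings_at)
      show "{((0, 0), (d, D))} \<subseteq> splittings_at 0 d D" unfolding splittings_at_def splittings_def by (simp add: len_def)
      show "\<forall>t\<in>splittings_at 0 d D - {((0, 0), (d, D))}. \<Phi> t = 0"
        unfolding splittings_at_def splittings_def \<Phi>_def by (auto simp: len_0_iff HA_0)
    qed
    thus ?thesis unfolding \<Phi>_def by (simp add: HA_0)
  qed
  have last: "(\<Sum>t\<in>splittings_at (len d) d D. \<Phi> t) = int (HA d D)"
  proof -
    have "(\<Sum>t\<in>splittings_at (len d) d D. \<Phi> t) = (\<Sum>t\<in>{((d, D), (0, 0))}. \<Phi> t)"
    proof (rule sum.mono_neutral_right)
      show "finite (splittings_at (len d) d D)" by (rule finite_splittings_at)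
      show "{((d, D), (0, 0))} \<subseteq> splittings_at (len d) d D" unfolding splittings_at_def splittings_def by simp
      show "\<forall>t\<in>splittings_at (len d) d D - {((d, D), (0, 0))}. \<Phi> t = 0"
        unfolding splittings_at_def splittings_def \<Phi>_def
        by (auto simp: len_add len_0_iff G_0 split: if_splits)
    qed
    thus ?thesis unfolding \<Phi>_def by (simp add: G_0)
  qed
  show ?thesis
  proof (cases "len d")
    case 0
    hence "d = 0" by (simp add: len_0_iff)
    thus ?thesis using group first 0 G_0[of D] unfolding \<Phi>_def by simp
  next
    case (Suc n)
    have mid: "(\<Sum>U'\<in>Pow {..<n - Suc j}. (- 1) ^ card (insert j ((+) (Suc j) ` U')) * int (fs.dim (Yspace d D (insert j ((+) (Suc j) ` U')))))
      = (\<Sum>t\<in>splittings_at (Suc j) d D. \<Phi> t)" if j: "j < n" for j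
    proof -
      define Z where "Z = (\<lambda>(t :: 'v degree \<times> 'v degree) U'. int (fs.dim (Yspace (fst (snd t)) (snd (snd t)) U')))"
      have "(\<Sum>U'\<in>Pow {..<n - Suc j}. (- 1) ^ card (insert j ((+) (Suc j) ` U')) * int (fs.dim (Yspace d D (insert j ((+) (Suc j) ` U')))))
        = (\<Sum>U'\<in>Pow {..<n - Suc j}. \<Sum>t\<in>splittings_at (Suc j) d D. int (HA (fst (fst t)) (snd (fst t))) * - ((- 1) ^ card U' * Z t U'))"
      proof (rule sum.cong[OF refl])
        fix U' assume U': "U' \<in> Pow {..<n - Suc j}"
        define U where "U = insert j ((+) (Suc j) ` U')"
        have "finite U'" using U' finite_subset by blast
        hence cU: "card U = Suc (card U')" unfolding U_def by (subst card_insert_disjoint) (auto intro!: card_image simp: inj_on_def)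
        have sh: "shift (Suc j) U = U'" unfolding U_def shift_def by auto
        have "fs.dim (Yspace d D U) = (\<Sum>t\<in>splittings_at (Suc j) d D.
          HA (fst (fst t)) (snd (fst t)) * fs.dim (Yspace (fst (snd t)) (snd (snd t)) (shift (Suc j) U)))"
          by (rule dim_split) (use j Suc in \<open>auto simp: U_def\<close>)
        thus "(- 1) ^ card (insert j ((+) (Suc j) ` U')) * int (fs.dim (Yspace d D (insert j ((+) (Suc j) ` U'))))
          = (\<Sum>t\<in>splittings_at (Suc j) d D. int (HA (fst (fst t)) (snd (fst t))) * - ((- 1) ^ card U' * Z t U'))"
          unfolding U_def[symmetric] cU sh Z_def by (simp add: sum_distrib_left sum_negf mult_ac)
      qed
      also have "\<dots> = (\<Sum>t\<in>splittings_at (Suc j) d D. int (HA (fst (fst t)) (snd (fst t))) * - (\<Sum>U'\<in>Pow {..<n - Suc j}. (- 1) ^ card U' * Z t U'))"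
        unfolding sum_distrib_left sum_negf[symmetric] by (rule sum.swap)
      also have "\<dots> = (\<Sum>t\<in>splittings_at (Suc j) d D. \<Phi> t)"
      proof (rule sum.cong[OF refl])
        fix t assume t: "t \<in> splittings_at (Suc j) d D"
        have lt: "len (fst (snd t)) = Suc (n - Suc j)" using lenT[of t] t j Suc unfolding splittings_at_def by simp
        show "int (HA (fst (fst t)) (snd (fst t))) * - (\<Sum>U'\<in>Pow {..<n - Suc j}. (- 1) ^ card U' * Z t U') = \<Phi> t"
          unfolding \<Phi>_def Z_def G_euler[OF lt] ..
      qed
      finally show ?thesis .
    qed
    have "- G d D = (\<Sum>U\<in>Pow {..<n}. (- 1) ^ card U * int (fs.dim (Yspace d D U)))"
      using G_euler[OF Suc] by simp
    also have "\<dots> = int (HA d D) + (\<Sum>j<n. \<Sum>t\<in>splittings_at (Suc j) d D. \<Phi> t)"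
    proof -
      have "(\<Sum>j<n. \<Sum>U'\<in>Pow {..<n - Suc j}. (- 1) ^ card (insert j ((+) (Suc j) ` U')) *
          int (fs.dim (Yspace d D (insert j ((+) (Suc j) ` U')))))
        = (\<Sum>j<n. \<Sum>t\<in>splittings_at (Suc j) d D. \<Phi> t)"
        by (rule sum.cong[OF refl], rule mid) simp
      thus ?thesis by (subst sum_Pow_first) (simp add: HA_def)
    qed
    finally have *: "G d D + int (HA d D) + (\<Sum>j<n. \<Sum>t\<in>splittings_at (Suc j) d D. \<Phi> t) = 0" by simp
    have "(\<Sum>r\<le>len d. \<Sum>t\<in>splittings_at r d D. \<Phi> t)
      = (\<Sum>t\<in>splittings_at 0 d D. \<Phi> t) + (\<Sum>j<n. \<Sum>t\<in>splittings_at (Suc j) d D. \<Phi> t) + (\<Sum>t\<in>splittings_at (len d) d D. \<Phi> t)"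
      unfolding Suc sum.atMost_Suc_shift by (simp add: lessThan_Suc_atMost[symmetric] add.assoc)
    hence "(\<Sum>t\<in>splittings d D. \<Phi> t) = 0" using * group first last by simp
    moreover have "d \<noteq> 0" using Suc by (auto simp: len_def)
    ultimately show ?thesis unfolding \<Phi>_def by simp
  qed
qed

end

section \<open>Homogeneous quotients of the tensor algebra\<close>

definition delta :: "'c \<Rightarrow> 'c \<Rightarrow> 'k::zero_neq_one" where "delta c = (\<lambda>x. if x = c then 1 else 0)"

lemma delta_in_funs_on: "c \<in> C \<Longrightarrow> delta c \<in> funs_on C"
  unfolding delta_def funs_on_def by auto

lemma funs_on_expand: "finite C \<Longrightarrow> f \<in> funs_on C \<Longrightarrow> f = (\<Sum>c\<in>C. fscale (f c) (delta c :: 'c \<Rightarrow> 'k::field))"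
  by (auto simp: fun_eq_iff sum_fun_apply fscale_apply delta_def funs_on_def if_distrib cong: if_cong)

lemma linear_functional_expand:
  fixes l :: "('c \<Rightarrow> 'k::field) \<Rightarrow> 'k"
  assumes C: "finite C" and f: "f \<in> funs_on C"
    and add: "\<And>f g. f \<in> funs_on C \<Longrightarrow> g \<in> funs_on C \<Longrightarrow> l (f + g) = l f + l g"
    and scale: "\<And>c f. f \<in> funs_on C \<Longrightarrow> l (fscale c f) = c * l f"
  shows "l f = (\<Sum>c\<in>C. f c * l (delta c))"
proof -
  have z: "(0 :: 'c \<Rightarrow> 'k) \<in> funs_on C" by (rule fs.subspace_0[OF subspace_funs_on])
  have "l 0 = 0" using scale[OF z, of 0] by simp
  have "l (\<Sum>c\<in>D. fscale (f c) (delta c)) = (\<Sum>c\<in>D. f c * l (delta c))" if "D \<subseteq> C" for D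
    using finite_subset[OF that C] that
  proof (induction D rule: finite_induct)
    case (insert c D)
    have 1: "delta c \<in> funs_on C" using insert.prems by (simp add: delta_in_funs_on)
    have 2: "(\<Sum>c\<in>D. fscale (f c) (delta c)) \<in> funs_on C"
      using insert.prems by (intro fs.subspace_sum fs.subspace_scale subspace_funs_on) (auto simp: delta_in_funs_on)
    have "l (fscale (f c) (delta c) + (\<Sum>c\<in>D. fscale (f c) (delta c))) = f c * l (delta c) + (\<Sum>c\<in>D. f c * l (delta c))"
      using add[OF fs.subspace_scale[OF subspace_funs_on 1] 2] scale[OF 1] insert by simp
    thus ?case by (simp only: sum.insert[OF insert.hyps])
  qed (simp add: \<open>l 0 = 0\<close>)
  from this[of C] show ?thesis using funs_on_expand[OF C f] by simp
qed

text \<open>The components are records of cosets or of functionals. An explicit linear bijection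
  with the functions on a finite set yields the vector space laws and the dimension at once, for a
  component and for its dual.\<close>

locale coordinates =
  fixes V :: "(rat, 'a, 'z) module_scheme" and C :: "'c set" and \<psi> :: "('c \<Rightarrow> rat) \<Rightarrow> 'a"
  assumes finite_C: "finite C"
    and bij: "bij_betw \<psi> (funs_on C) (carrier V)"
    and \<psi>_add: "f \<in> funs_on C \<Longrightarrow> g \<in> funs_on C \<Longrightarrow> \<psi> (f + g) = \<psi> f \<oplus>\<^bsub>V\<^esub> \<psi> g"
    and \<psi>_scale: "f \<in> funs_on C \<Longrightarrow> \<psi> (fscale a f) = a \<odot>\<^bsub>V\<^esub> \<psi> f"
    and \<psi>_zero: "\<psi> 0 = \<zero>\<^bsub>V\<^esub>"
begin

lemma carrier_eq: "carrier V = \<psi> ` funs_on C"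
  using bij unfolding bij_betw_def by simp

lemma \<psi>_inj: "f \<in> funs_on C \<Longrightarrow> g \<in> funs_on C \<Longrightarrow> \<psi> f = \<psi> g \<Longrightarrow> f = g"
  using bij unfolding bij_betw_def by (auto dest: inj_onD)

lemma funs_add: "f \<in> funs_on C \<Longrightarrow> g \<in> funs_on C \<Longrightarrow> f + g \<in> (funs_on C :: ('c \<Rightarrow> rat) set)"
  by (rule fs.subspace_add[OF subspace_funs_on])

lemma funs_scale: "f \<in> funs_on C \<Longrightarrow> fscale a f \<in> (funs_on C :: ('c \<Rightarrow> rat) set)"
  by (rule fs.subspace_scale[OF subspace_funs_on])

lemma funs_zero: "0 \<in> (funs_on C :: ('c \<Rightarrow> rat) set)"
  by (rule fs.subspace_0[OF subspace_funs_on])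

lemma is_vectorspace: "vectorspace class_ring V"
proof (rule vs_criteria)
  note add = funs_add note scale = funs_scale note zero = funs_zero
  show "field (class_ring :: rat ring)" by (rule class_field)
  show "\<zero>\<^bsub>V\<^esub> \<in> carrier V" unfolding carrier_eq using zero \<psi>_zero by (metis imageI)
  show "\<forall>v w. v \<in> carrier V \<and> w \<in> carrier V \<longrightarrow> v \<oplus>\<^bsub>V\<^esub> w \<in> carrier V"
    unfolding carrier_eq by (auto simp flip: \<psi>_add intro!: imageI add)
  show "\<forall>v\<in>carrier V. \<exists>neg_v\<in>carrier V. v \<oplus>\<^bsub>V\<^esub> neg_v = \<zero>\<^bsub>V\<^esub>"
  proof
    fix v assume "v \<in> carrier V"
    then obtain f where f: "f \<in> funs_on C" "v = \<psi> f" unfolding carrier_eq by auto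
    have nf: "fscale (- 1) f \<in> funs_on C" using f by (intro scale)
    have "f + fscale (- 1) f = 0" by simp
    hence "v \<oplus>\<^bsub>V\<^esub> \<psi> (fscale (- 1) f) = \<zero>\<^bsub>V\<^esub>"
      unfolding f(2) \<psi>_add[OF f(1) nf, symmetric] by (simp only: \<psi>_zero)
    thus "\<exists>neg_v\<in>carrier V. v \<oplus>\<^bsub>V\<^esub> neg_v = \<zero>\<^bsub>V\<^esub>" using nf unfolding carrier_eq by blast
  qed
  show "\<forall>c v. c \<in> carrier class_ring \<and> v \<in> carrier V \<longrightarrow> c \<odot>\<^bsub>V\<^esub> v \<in> carrier V"
    unfolding carrier_eq by (auto simp flip: \<psi>_scale intro!: imageI scale)
  show "\<forall>v w. v \<in> carrier V \<and> w \<in> carrier V \<longrightarrow> v \<oplus>\<^bsub>V\<^esub> w = w \<oplus>\<^bsub>V\<^esub> v"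
    unfolding carrier_eq by (auto simp add: add.commute simp flip: \<psi>_add)
  show "\<forall>v w x. v \<in> carrier V \<and> w \<in> carrier V \<and> x \<in> carrier V \<longrightarrow>
      v \<oplus>\<^bsub>V\<^esub> w \<oplus>\<^bsub>V\<^esub> x = v \<oplus>\<^bsub>V\<^esub> (w \<oplus>\<^bsub>V\<^esub> x)"
    unfolding carrier_eq using add by (auto simp add: add.assoc simp flip: \<psi>_add)
  show "\<forall>v\<in>carrier V. v \<oplus>\<^bsub>V\<^esub> \<zero>\<^bsub>V\<^esub> = v"
    unfolding carrier_eq using zero by (auto simp flip: \<psi>_add \<psi>_zero)
  show "\<forall>a b v. a \<in> carrier class_ring \<and> b \<in> carrier class_ring \<and> v \<in> carrier V \<longrightarrow>
      (a \<otimes>\<^bsub>class_ring\<^esub> b) \<odot>\<^bsub>V\<^esub> v = a \<odot>\<^bsub>V\<^esub> (b \<odot>\<^bsub>V\<^esub> v)"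
    unfolding carrier_eq using scale by (auto simp flip: \<psi>_scale)
  show "\<forall>v\<in>carrier V. \<one>\<^bsub>class_ring\<^esub> \<odot>\<^bsub>V\<^esub> v = v"
    unfolding carrier_eq by (auto simp flip: \<psi>_scale)
  show "\<forall>a b v. a \<in> carrier class_ring \<and> b \<in> carrier class_ring \<and> v \<in> carrier V \<longrightarrow>
      (a \<oplus>\<^bsub>class_ring\<^esub> b) \<odot>\<^bsub>V\<^esub> v = a \<odot>\<^bsub>V\<^esub> v \<oplus>\<^bsub>V\<^esub> b \<odot>\<^bsub>V\<^esub> v"
    unfolding carrier_eq using scale
    by (auto simp add: fs.scale_left_distrib simp flip: \<psi>_scale \<psi>_add)
  show "\<forall>a v w. a \<in> carrier class_ring \<and> v \<in> carrier V \<and> w \<in> carrier V \<longrightarrow>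
      a \<odot>\<^bsub>V\<^esub> (v \<oplus>\<^bsub>V\<^esub> w) = a \<odot>\<^bsub>V\<^esub> v \<oplus>\<^bsub>V\<^esub> a \<odot>\<^bsub>V\<^esub> w"
  proof (intro allI impI)
    fix a :: rat and v w assume "a \<in> carrier class_ring \<and> v \<in> carrier V \<and> w \<in> carrier V"
    then obtain f g where f: "f \<in> funs_on C" "v = \<psi> f" and g: "g \<in> funs_on C" "w = \<psi> g"
      unfolding carrier_eq by auto
    show "a \<odot>\<^bsub>V\<^esub> (v \<oplus>\<^bsub>V\<^esub> w) = a \<odot>\<^bsub>V\<^esub> v \<oplus>\<^bsub>V\<^esub> a \<odot>\<^bsub>V\<^esub> w"
      unfolding f(2) g(2) \<psi>_add[OF f(1) g(1), symmetric] \<psi>_scale[OF f(1), symmetric] \<psi>_scale[OF g(1), symmetric]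
        \<psi>_scale[OF add[OF f(1) g(1)], symmetric] \<psi>_add[OF scale[OF f(1)] scale[OF g(1)], symmetric]
      by (simp only: fs.scale_right_distrib)
  qed
qed

lemma dim_eq: "vectorspace.dim class_ring V = card C"
proof -
  interpret V: vectorspace class_ring V by (rule is_vectorspace)
  define e where "e = (\<lambda>c. \<psi> (delta c))"
  have ein: "inj_on e C"
  proof (rule inj_onI)
    fix c d assume cd: "c \<in> C" "d \<in> C" "e c = e d"
    hence "delta c = (delta d :: 'c \<Rightarrow> rat)" unfolding e_def by (intro \<psi>_inj) (auto simp: delta_in_funs_on)
    hence "delta c c = (delta d c :: rat)" by simp
    thus "c = d" unfolding delta_def by (auto split: if_splits)
  qed
  have ecar: "e c \<in> carrier V" if "c \<in> C" for c
    unfolding e_def carrier_eq using delta_in_funs_on[OF that] by blast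
  have lc: "V.lincomb a (e ` D) = \<psi> (\<lambda>c. if c \<in> D then a (e c) else 0)" if "D \<subseteq> C" for a D
    using finite_subset[OF that finite_C] that
  proof (induction D rule: finite_induct)
    case empty
    have "(\<lambda>c. if c \<in> {} then a (e c) else 0) = 0" by (simp add: fun_eq_iff)
    thus ?case unfolding V.lincomb_def using \<psi>_zero by simp
  next
    case (insert c D)
    have eD: "e c \<notin> e ` D" using insert ein by (auto simp: inj_on_def)
    have 1: "delta c \<in> funs_on C" using insert.prems by (simp add: delta_in_funs_on)
    have 2: "(\<lambda>c. if c \<in> D then a (e c) else 0) \<in> funs_on C" using insert.prems unfolding funs_on_def by auto
    have "V.lincomb a (e ` insert c D) = a (e c) \<odot>\<^bsub>V\<^esub> e c \<oplus>\<^bsub>V\<^esub> V.lincomb a (e ` D)"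
      unfolding V.lincomb_def image_insert
      by (rule V.finsum_insert) (use insert eD ecar in \<open>auto intro!: V.smult_closed\<close>)
    also have "\<dots> = \<psi> (fscale (a (e c)) (delta c)) \<oplus>\<^bsub>V\<^esub> \<psi> (\<lambda>c. if c \<in> D then a (e c) else 0)"
      using insert \<psi>_scale[OF 1] unfolding e_def by simp
    also have "\<dots> = \<psi> (fscale (a (e c)) (delta c) + (\<lambda>c. if c \<in> D then a (e c) else 0))"
      by (rule \<psi>_add[symmetric, OF fs.subspace_scale[OF subspace_funs_on 1] 2])
    also have "fscale (a (e c)) (delta c) + (\<lambda>c. if c \<in> D then a (e c) else 0) = (\<lambda>d. if d \<in> insert c D then a (e d) else 0)"
      using insert.hyps by (auto simp: fun_eq_iff fscale_apply delta_def)
    finally show ?case .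
  qed
  have "V.basis (e ` C)"
  proof (subst V.basis_criterion)
    show "finite (e ` C)" using finite_C by simp
    show "e ` C \<subseteq> carrier V" using ecar by auto
    show "\<forall>v. v \<in> carrier V \<longrightarrow> (\<exists>!a. a \<in> e ` C \<rightarrow>\<^sub>E carrier class_ring \<and> V.lincomb a (e ` C) = v)"
    proof (intro allI impI)
      fix v assume "v \<in> carrier V"
      then obtain f where f: "f \<in> funs_on C" "v = \<psi> f" unfolding carrier_eq by auto
      define a where "a = restrict (\<lambda>v. f (inv_into C e v)) (e ` C)"
      have ae: "a (e c) = f c" if "c \<in> C" for c unfolding a_def using that ein by simp
      have fe: "(\<lambda>c. if c \<in> C then a (e c) else 0) = f"
        using ae funs_onD[OF f(1)] by (auto simp: fun_eq_iff)
      show "\<exists>!a. a \<in> e ` C \<rightarrow>\<^sub>E carrier class_ring \<and> V.lincomb a (e ` C) = v"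
      proof (rule ex1I[of _ a])
        show "a \<in> e ` C \<rightarrow>\<^sub>E carrier class_ring \<and> V.lincomb a (e ` C) = v"
          using lc[of C a] fe f(2) unfolding a_def by simp
        fix b assume b: "b \<in> e ` C \<rightarrow>\<^sub>E carrier class_ring \<and> V.lincomb b (e ` C) = v"
        have "(\<lambda>c. if c \<in> C then b (e c) else 0) = f"
          by (rule \<psi>_inj) (use b lc[of C b] f in \<open>auto simp: funs_on_def\<close>)
        from fun_cong[OF this] have "b (e c) = f c" if "c \<in> C" for c using that by metis
        moreover have "a \<in> extensional (e ` C)" unfolding a_def by simp
        ultimately show "b = a" using b ae by (intro extensionalityI[of _ "e ` C"]) (auto simp: PiE_def)
      qed
    qed
  qed
  hence "V.dim = card (e ` C)" by (intro V.dim_basis) (use finite_C in simp)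
  thus ?thesis using card_image[OF ein] by simp
qed

text \<open>A functional is determined by its values on the images of the \<open>delta c\<close>,
  which are arbitrary; so \<open>C\<close> also gives coordinates on the dual.\<close>

lemma dual_coordinates:
  "coordinates (dual_space V) C (\<lambda>g. \<lambda>v\<in>carrier V. \<Sum>c\<in>C. g c * inv_into (funs_on C) \<psi> v c)"
    (is "coordinates _ _ ?\<chi>")
proof
  have inv: "inv_into (funs_on C) \<psi> (\<psi> f) = f" if "f \<in> funs_on C" for f
    using bij that unfolding bij_betw_def by simp
  have \<chi>: "?\<chi> g (\<psi> f) = (\<Sum>c\<in>C. g c * f c)" if "f \<in> funs_on C" for f g
    using inv[OF that] that unfolding carrier_eq by simp
  have \<chi>d: "?\<chi> g (\<psi> (delta c)) = g c" if "c \<in> C" for g c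
    unfolding \<chi>[OF delta_in_funs_on[OF that]] using that finite_C
    by (simp add: delta_def if_distrib cong: if_cong)
  note add = funs_add note scale = funs_scale
  show "finite C" by (rule finite_C)
  show "?\<chi> (f + g) = ?\<chi> f \<oplus>\<^bsub>dual_space V\<^esub> ?\<chi> g" for f g
    unfolding dual_space_def by (auto simp: fun_eq_iff restrict_def distrib_right sum.distrib)
  show "?\<chi> (fscale a f) = a \<odot>\<^bsub>dual_space V\<^esub> ?\<chi> f" for a f
    unfolding dual_space_def by (auto simp: fun_eq_iff restrict_def fscale_apply sum_distrib_left mult.assoc)
  show "?\<chi> 0 = \<zero>\<^bsub>dual_space V\<^esub>"
    unfolding dual_space_def by (auto simp: fun_eq_iff)
  show "bij_betw ?\<chi> (funs_on C) (carrier (dual_space V))"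
    unfolding bij_betw_def
  proof
    show "inj_on ?\<chi> (funs_on C)"
    proof (rule inj_onI)
      fix f g assume fg: "f \<in> funs_on C" "g \<in> funs_on C" "?\<chi> f = ?\<chi> g"
      have "f c = g c" if "c \<in> C" for c using \<chi>d[OF that, of f] \<chi>d[OF that, of g] fg(3) by simp
      moreover have "f c = g c" if "c \<notin> C" for c using fg(1,2) that funs_onD by metis
      ultimately show "f = g" by blast
    qed
    show "?\<chi> ` funs_on C = carrier (dual_space V)"
    proof
      show "?\<chi> ` funs_on C \<subseteq> carrier (dual_space V)"
      proof (rule image_subsetI)
        fix g :: "'c \<Rightarrow> rat"
        have "?\<chi> g (v \<oplus>\<^bsub>V\<^esub> w) = ?\<chi> g v + ?\<chi> g w" if vw: "v \<in> carrier V" "w \<in> carrier V" for v w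
        proof -
          obtain f h where f: "f \<in> funs_on C" "v = \<psi> f" and h: "h \<in> funs_on C" "w = \<psi> h"
            using vw unfolding carrier_eq by auto
          show ?thesis unfolding f(2) h(2) \<psi>_add[OF f(1) h(1), symmetric] \<chi>[OF f(1)] \<chi>[OF h(1)] \<chi>[OF add[OF f(1) h(1)]]
            by (simp add: distrib_left sum.distrib)
        qed
        moreover have "?\<chi> g (a \<odot>\<^bsub>V\<^esub> v) = a * ?\<chi> g v" if v: "v \<in> carrier V" for v a
        proof -
          obtain f where f: "f \<in> funs_on C" "v = \<psi> f" using v unfolding carrier_eq by auto
          show ?thesis unfolding f(2) \<psi>_scale[OF f(1), symmetric] \<chi>[OF f(1)] \<chi>[OF scale[OF f(1)]]
            by (simp add: fscale_apply sum_distrib_left mult.left_commute)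
        qed
        ultimately show "?\<chi> g \<in> carrier (dual_space V)"
          unfolding dual_space_def module_hom_def rat_space_def by auto
      qed
      show "carrier (dual_space V) \<subseteq> ?\<chi> ` funs_on C"
      proof
        fix h assume h: "h \<in> carrier (dual_space V)"
        have hadd: "h (v \<oplus>\<^bsub>V\<^esub> w) = h v + h w" if "v \<in> carrier V" "w \<in> carrier V" for v w
          using h that unfolding dual_space_def module_hom_def rat_space_def by auto
        have hscale: "h (a \<odot>\<^bsub>V\<^esub> v) = a * h v" if "v \<in> carrier V" for v a
          using h that unfolding dual_space_def module_hom_def rat_space_def by auto
        have hext: "h \<in> extensional (carrier V)" using h unfolding dual_space_def by auto
        define g where "g = (\<lambda>c. if c \<in> C then h (\<psi> (delta c)) else 0)"
        have "h v = ?\<chi> g v" if v: "v \<in> carrier V" for v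
        proof -
          obtain f where f: "f \<in> funs_on C" "v = \<psi> f" using v unfolding carrier_eq by auto
          have "h (\<psi> f) = (\<Sum>c\<in>C. f c * h (\<psi> (delta c)))"
          proof (rule linear_functional_expand[OF finite_C f(1), of "\<lambda>f. h (\<psi> f)"])
            show "h (\<psi> (f + g)) = h (\<psi> f) + h (\<psi> g)" if "f \<in> funs_on C" "g \<in> funs_on C" for f g
              unfolding \<psi>_add[OF that] using that carrier_eq by (intro hadd) auto
            show "h (\<psi> (fscale c f)) = c * h (\<psi> f)" if "f \<in> funs_on C" for f c
              unfolding \<psi>_scale[OF that] using that carrier_eq by (intro hscale) auto
          qed
          also have "\<dots> = ?\<chi> g v" unfolding f(2) \<chi>[OF f(1)] g_def
            by (rule sum.cong) (auto simp: mult.commute)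
          finally show ?thesis unfolding f(2) .
        qed
        hence "h = ?\<chi> g" using hext by (intro extensionalityI[of h "carrier V"]) auto
        moreover have "g \<in> funs_on C" unfolding g_def funs_on_def by simp
        ultimately show "h \<in> ?\<chi> ` funs_on C" by blast
      qed
    qed
  qed
qed

lemma dim_dual: "vectorspace.dim class_ring (dual_space V) = card C"
  by (rule coordinates.dim_eq[OF dual_coordinates])

end

definition poly_of :: "'w set \<Rightarrow> ('w \<Rightarrow> rat) \<Rightarrow> 'w \<Rightarrow>\<^sub>0 rat" where
  "poly_of W x = (\<Sum>w\<in>W. single w (x w))"

lemma lookup_poly_of: "finite W \<Longrightarrow> lookup (poly_of W x) w = (if w \<in> W then x w else 0)"
  unfolding poly_of_def by (simp add: lookup_sum lookup_single when_def)

lemma poly_of_add: "poly_of W (x + y) = poly_of W x + poly_of W y"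
  unfolding poly_of_def by (simp add: single_add sum.distrib)

lemma poly_of_diff: "poly_of W (x - y) = poly_of W x - poly_of W y"
  unfolding poly_of_def by (simp add: single_diff sum_subtractf)

lemma poly_of_0: "poly_of W 0 = 0"
  unfolding poly_of_def by simp

lemma poly_of_scale: "finite W \<Longrightarrow> poly_of W (fscale c x) = Poly_Mapping.map ((*) c) (poly_of W x)"
  by (rule poly_mapping_eqI) (simp add: lookup_poly_of fscale_apply map.rep_eq when_def)

lemma poly_of_sum: "poly_of W (\<Sum>i\<in>A. f i) = (\<Sum>i\<in>A. poly_of W (f i))"
proof (induction A rule: infinite_finite_induct)
  case (insert i A)
  thus ?case by (simp only: sum.insert[OF insert.hyps] poly_of_add)
next
  case (infinite A)
  show ?case unfolding sum.infinite[OF infinite] by (rule poly_of_0)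
qed (simp only: sum.empty poly_of_0)

lemma keys_poly_of: "finite W \<Longrightarrow> keys (poly_of W x) \<subseteq> W"
  by (auto simp: in_keys_iff lookup_poly_of split: if_splits)

lemma tensor_algebra_simps [simp]:
  "carrier (tensor_algebra X) = {f. keys f \<subseteq> lists X}"
  "f \<otimes>\<^bsub>tensor_algebra X\<^esub> g = f * g" "f \<oplus>\<^bsub>tensor_algebra X\<^esub> g = f + g"
  "\<one>\<^bsub>tensor_algebra X\<^esub> = 1" "\<zero>\<^bsub>tensor_algebra X\<^esub> = 0"
  "c \<odot>\<^bsub>tensor_algebra X\<^esub> f = Poly_Mapping.map ((*) c) f"
  by (simp_all add: tensor_algebra_def)

lemma keys_map_scale: "keys (Poly_Mapping.map ((*) (c :: rat)) f) \<subseteq> keys f"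
  by (auto simp: in_keys_iff map.rep_eq when_def)

lemma map_scale_eq_mult: "Poly_Mapping.map ((*) (c :: rat)) f = single 0 c * f"
  by (rule mult_map_scale_conv_mult)

lemma tensor_algebra_ring: "ring (tensor_algebra X)"
proof (rule ringI)
  have mult: "keys (f * g) \<subseteq> lists X" if "keys f \<subseteq> lists X" "keys g \<subseteq> lists X" for f g :: "'a list \<Rightarrow>\<^sub>0 rat"
  proof
    fix w assume "w \<in> keys (f * g)"
    then obtain u v where "w = u + v" "u \<in> keys f" "v \<in> keys g" using keys_mult[of f g] by blast
    thus "w \<in> lists X" using that by (auto simp: plus_list_def)
  qed
  have add: "keys (f + g) \<subseteq> lists X" if "keys f \<subseteq> lists X" "keys g \<subseteq> lists X" for f g :: "'a list \<Rightarrow>\<^sub>0 rat"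
    using keys_add[of f g] that by blast
  have neg: "keys (- f) = keys f" for f :: "'a list \<Rightarrow>\<^sub>0 rat"
    by (auto simp: in_keys_iff)
  show "abelian_group (tensor_algebra X)"
  proof (rule abelian_groupI)
    fix f assume "f \<in> carrier (tensor_algebra X)"
    thus "\<exists>g\<in>carrier (tensor_algebra X). g \<oplus>\<^bsub>tensor_algebra X\<^esub> f = \<zero>\<^bsub>tensor_algebra X\<^esub>"
      by (intro bexI[of _ "- f"]) (simp_all add: neg)
  qed (use add in \<open>auto simp: add_ac\<close>)
  show "Group.monoid (tensor_algebra X)"
    by (rule monoidI) (use mult in \<open>auto simp: mult.assoc zero_list_def\<close>)
qed (auto simp: algebra_simps)

lemma tensor_algebra_module: "module class_ring (tensor_algebra X)"
proof -
  interpret ring "tensor_algebra X" by (rule tensor_algebra_ring)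
  interpret A: abelian_group "tensor_algebra X" by unfold_locales
  show ?thesis
  proof (intro module.intro)
    show "cring (class_ring :: rat ring)" by unfold_locales
    show "abelian_group (tensor_algebra X)" by unfold_locales
    show "module_axioms class_ring (tensor_algebra X)"
    proof
      fix a b :: rat and f g :: "'a list \<Rightarrow>\<^sub>0 rat"
      show "a \<odot>\<^bsub>tensor_algebra X\<^esub> f \<in> carrier (tensor_algebra X)" if "f \<in> carrier (tensor_algebra X)"
        using that keys_map_scale[of a f] by auto
    qed (auto simp: map_scale_eq_mult single_add distrib_right distrib_left mult_single mult.assoc[symmetric] single_one)
  qed
qed

lemma ideal_scale_closed:
  assumes "ideal J (tensor_algebra X)" "f \<in> J"
  shows "Poly_Mapping.map ((*) (c :: rat)) f \<in> J"
proof -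
  interpret ideal J "tensor_algebra X" by fact
  have "single 0 c \<in> carrier (tensor_algebra X)" by (auto simp: zero_list_def)
  from I_l_closed[OF assms(2) this] show ?thesis by (simp add: map_scale_eq_mult)
qed

text \<open>The words that are not pivots of \<open>K\<close> form a basis of the quotient:
  subtracting the element of \<open>K\<close> with the same values at the pivots gives the unique
  representative supported on them.\<close>

lemma quotient_coordinates:
  fixes X :: "'a set"
  defines "A \<equiv> tensor_algebra X"
  assumes J: "ideal J A" and W: "finite W" "W \<subseteq> lists X"
    and T: "T = poly_of W ` funs_on W"
  defines "K \<equiv> {x \<in> funs_on W. poly_of W x \<in> J}"
  shows "fs.subspace K"
    and "\<exists>C \<psi>. coordinates ((quotient_algebra A J)\<lparr>carrier := (\<lambda>f. J +>\<^bsub>A\<^esub> f) ` T\<rparr>) (C :: 'a list set) \<psi> \<and>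
      card C + fs.dim K = card W"
proof -
  interpret J: ideal J A by fact
  have car: "poly_of W x \<in> carrier A" for x using keys_poly_of[OF W(1), of x] W(2) unfolding A_def by auto
  have Jadd: "f + g \<in> J" if "f \<in> J" "g \<in> J" for f g using additive_subgroup.a_closed[OF J.is_additive_subgroup that] unfolding A_def by simp
  have Jscale: "Poly_Mapping.map ((*) c) f \<in> J" if "f \<in> J" for f and c :: rat
    using ideal_scale_closed[OF J[unfolded A_def] that] .
  have J0: "0 \<in> J" using additive_subgroup.zero_closed[OF J.is_additive_subgroup] unfolding A_def by simp
  show subK: "fs.subspace K"
  proof (rule fs.subspaceI)
    show "0 \<in> K" unfolding K_def using fs.subspace_0[OF subspace_funs_on] J0 by (simp add: poly_of_0)
    show "x + y \<in> K" if "x \<in> K" "y \<in> K" for x y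
      using that Jadd fs.subspace_add[OF subspace_funs_on, of x W y] unfolding K_def by (simp add: poly_of_add)
    show "fscale c x \<in> K" if "x \<in> K" for c x
      using that Jscale fs.subspace_scale[OF subspace_funs_on, of x W c] unfolding K_def by (simp add: poly_of_scale[OF W(1)])
  qed
  have eq_iff: "J +>\<^bsub>A\<^esub> poly_of W x = J +>\<^bsub>A\<^esub> poly_of W y \<longleftrightarrow> x - y \<in> K" if "x \<in> funs_on W" "y \<in> funs_on W" for x y
  proof -
    have neg: "\<ominus>\<^bsub>A\<^esub> f = - f" if f: "f \<in> carrier A" for f
    proof (rule J.minus_equality)
      show "- f \<oplus>\<^bsub>A\<^esub> f = \<zero>\<^bsub>A\<^esub>" unfolding A_def by simp
      show "f \<in> carrier A" by fact
      show "- f \<in> carrier A" using f unfolding A_def by (auto simp: in_keys_iff subset_iff)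
    qed
    have "poly_of W x \<ominus>\<^bsub>A\<^esub> poly_of W y = poly_of W (x - y)"
      unfolding a_minus_def neg[OF car] poly_of_diff unfolding A_def by simp
    thus ?thesis using J.quotient_eq_iff_same_a_r_cos[OF J car car, of x y] fs.subspace_diff[OF subspace_funs_on that]
      unfolding K_def by simp
  qed
  obtain B where B: "B \<subseteq> W" "frame K B" using frame_exists[OF W(1) subK] unfolding K_def by blast
  obtain e where e: "finite B" "\<And>b. b \<in> B \<Longrightarrow> e b \<in> K"
    "\<And>b c. b \<in> B \<Longrightarrow> c \<in> B \<Longrightarrow> e b c = (if c = b then 1 else 0)"
    and z: "\<And>f. f \<in> K \<Longrightarrow> (\<And>b. b \<in> B \<Longrightarrow> f b = 0) \<Longrightarrow> f = 0"
    by (rule frameE[OF B(2)]) blast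
  define C where "C = W - B"
  define \<psi> where "\<psi> = (\<lambda>x. J +>\<^bsub>A\<^esub> poly_of W x)"
  define V where "V = (quotient_algebra A J)\<lparr>carrier := (\<lambda>f. J +>\<^bsub>A\<^esub> f) ` T\<rparr>"
  have CW: "funs_on C \<subseteq> (funs_on W :: ('a list \<Rightarrow> rat) set)" unfolding funs_on_def C_def by auto
  have Vadd: "v \<oplus>\<^bsub>V\<^esub> w = v <+>\<^bsub>A\<^esub> w" for v w unfolding V_def quotient_algebra_def FactRing_def by simp
  have "coordinates V C \<psi>"
  proof
    show "finite C" unfolding C_def using W by simp
    show "bij_betw \<psi> (funs_on C) (carrier V)"
      unfolding bij_betw_def
    proof
      show "inj_on \<psi> (funs_on C)"
      proof (rule inj_onI)
        fix x y assume xy: "x \<in> funs_on C" "y \<in> funs_on C" "\<psi> x = \<psi> y"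
        have "x - y \<in> K" using eq_iff[of x y] xy CW unfolding \<psi>_def by auto
        moreover have "(x - y) b = 0" if "b \<in> B" for b
          using funs_onD[OF xy(1), of b] funs_onD[OF xy(2), of b] that unfolding C_def by simp
        ultimately have "x - y = 0" by (rule z)
        thus "x = y" by simp
      qed
      show "\<psi> ` funs_on C = carrier V"
      proof
        show "\<psi> ` funs_on C \<subseteq> carrier V" unfolding V_def \<psi>_def T using CW by auto
        show "carrier V \<subseteq> \<psi> ` funs_on C"
        proof
          fix v assume "v \<in> carrier V"
          then obtain x where x: "x \<in> funs_on W" "v = \<psi> x" unfolding V_def \<psi>_def T by auto
          define k where "k = (\<Sum>b\<in>B. fscale (x b) (e b))"
          have kK: "k \<in> K" unfolding k_def using e(2) subK by (intro fs.subspace_sum fs.subspace_scale)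
          hence kW: "k \<in> funs_on W" unfolding K_def by simp
          have xk: "x - k \<in> funs_on W" by (rule fs.subspace_diff[OF subspace_funs_on x(1) kW])
          have "(x - k) c = 0" if c: "c \<in> B" for c
          proof -
            have "(\<Sum>b\<in>B. x b * e b c) = (\<Sum>b\<in>B. if b = c then x b else 0)"
              using e(3) c by (intro sum.cong) auto
            thus ?thesis unfolding k_def using e(1) c by (simp add: sum_fun_apply fscale_apply)
          qed
          hence "x - k \<in> funs_on C" using xk unfolding funs_on_def C_def by auto
          moreover have "\<psi> (x - k) = v"
          proof -
            have "x - (x - k) = k" by simp
            hence "\<psi> x = \<psi> (x - k)" unfolding \<psi>_def eq_iff[OF x(1) xk] using kK by (simp only:)
            thus ?thesis using x(2) by simp
          qed
          ultimately show "v \<in> \<psi> ` funs_on C" by blast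
        qed
      qed
    qed
    show "\<psi> (x + y) = \<psi> x \<oplus>\<^bsub>V\<^esub> \<psi> y" for x y
      unfolding Vadd \<psi>_def J.a_rcos_sum[OF car car] poly_of_add unfolding A_def by simp
    \<comment> \<open>The scalar multiple of a coset is a union over its representatives; they all
      give the same coset because \<open>J\<close> is closed under scalars.\<close>
    show "\<psi> (fscale a x) = a \<odot>\<^bsub>V\<^esub> \<psi> x" for a x
    proof -
      have sm: "a \<odot>\<^bsub>V\<^esub> \<psi> x = (\<Union>g\<in>\<psi> x. J +>\<^bsub>A\<^esub> Poly_Mapping.map ((*) a) g)"
        unfolding V_def quotient_algebra_def A_def by simp
      have "J +>\<^bsub>A\<^esub> Poly_Mapping.map ((*) a) g = \<psi> (fscale a x)" if g: "g \<in> \<psi> x" for g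
      proof -
        obtain h where h: "h \<in> J" "g = h + poly_of W x"
          using g unfolding \<psi>_def a_r_coset_def' A_def by auto
        have "Poly_Mapping.map ((*) a) g = Poly_Mapping.map ((*) a) h \<oplus>\<^bsub>A\<^esub> poly_of W (fscale a x)"
          unfolding h(2) poly_of_scale[OF W(1)] A_def by (simp add: map_scale_eq_mult distrib_left)
        also have "\<dots> \<in> \<psi> (fscale a x)"
          unfolding \<psi>_def by (rule J.a_rcosI[OF Jscale[OF h(1)] J.a_subset car])
        finally show ?thesis unfolding \<psi>_def using J.a_repr_independence'[OF _ car] by simp
      qed
      moreover have "\<psi> x \<noteq> {}" using J.a_rcos_self[OF car] unfolding \<psi>_def by blast
      ultimately show ?thesis unfolding sm by auto
    qed
    show "\<psi> 0 = \<zero>\<^bsub>V\<^esub>"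
      unfolding \<psi>_def V_def quotient_algebra_def FactRing_def poly_of_0 using J.a_rcos_const[OF J0] by simp
  qed
  moreover have "card C + fs.dim K = card W"
    unfolding C_def frame_dim[OF B(2)] using card_Diff_subset[OF e(1) B(1)] card_mono[OF W(1) B(1)] by simp
  ultimately show "\<exists>C \<psi>. coordinates ((quotient_algebra A J)\<lparr>carrier := (\<lambda>f. J +>\<^bsub>A\<^esub> f) ` T\<rparr>) (C :: 'a list set) \<psi> \<and>
      card C + fs.dim K = card W" unfolding V_def by blast
qed

lemma poly_of_delta: "finite W \<Longrightarrow> w \<in> W \<Longrightarrow> poly_of W (delta w) = single w 1"
  by (rule poly_mapping_eqI) (auto simp: lookup_poly_of delta_def lookup_single when_def)

lemma lookup_prepend:
  fixes f :: "'a list \<Rightarrow>\<^sub>0 rat"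
  shows "lookup (single u c * f) (u @ v) = c * lookup f v"
    and "(\<And>v. w \<noteq> u @ v) \<Longrightarrow> lookup (single u c * f) w = 0"
    and "lookup (f * single u c) (v @ u) = lookup f v * c"
    and "(\<And>v. w \<noteq> v @ u) \<Longrightarrow> lookup (f * single u c) w = 0"
proof -
  have L: "lookup (single u c * f) z
      = (\<Sum>x\<in>keys f. c * lookup f x when u @ x = z)" for z
    by (subst poly_mapping_eq_sum[of f])
      (simp add: sum_distrib_left mult_single lookup_sum lookup_single plus_list_def)
  have R: "lookup (f * single u c) z
      = (\<Sum>x\<in>keys f. lookup f x * c when x @ u = z)" for z
    by (subst poly_mapping_eq_sum[of f])
      (simp add: sum_distrib_right mult_single lookup_sum lookup_single plus_list_def)
  show "lookup (single u c * f) (u @ v) = c * lookup f v"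
    unfolding L by (simp add: when_def not_in_keys_iff_lookup_eq_zero)
  show "lookup (single u c * f) w = 0" if "\<And>v. w \<noteq> u @ v"
    unfolding L by (intro sum.neutral ballI) (simp add: when_def that[symmetric])
  show "lookup (f * single u c) (v @ u) = lookup f v * c"
    unfolding R by (simp add: when_def not_in_keys_iff_lookup_eq_zero)
  show "lookup (f * single u c) w = 0" if "\<And>v. w \<noteq> v @ u"
    unfolding R by (intro sum.neutral ballI) (simp add: when_def that[symmetric])
qed

text \<open>\<open>lshift\<close> and \<open>rshift\<close> are left and right multiplication by the
  word \<open>u\<close>, expressed on coefficient functions.\<close>

definition lshift :: "'a list \<Rightarrow> ('a list \<Rightarrow> rat) \<Rightarrow> 'a list \<Rightarrow> rat" where
  "lshift u x w = (if take (length u) w = u then x (drop (length u) w) else 0)"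

definition rshift :: "'a list \<Rightarrow> ('a list \<Rightarrow> rat) \<Rightarrow> 'a list \<Rightarrow> rat" where
  "rshift u x w = (if drop (length w - length u) w = u then x (take (length w - length u) w) else 0)"

lemma lshift_append: "lshift u x (u @ v) = x v"
  unfolding lshift_def by simp

lemma rshift_append: "rshift u x (v @ u) = x v"
  unfolding rshift_def by simp

lemma lshift_0: "(\<And>v. w \<noteq> u @ v) \<Longrightarrow> lshift u x w = 0"
  unfolding lshift_def by (metis append_take_drop_id)

lemma rshift_0: "(\<And>v. w \<noteq> v @ u) \<Longrightarrow> rshift u x w = 0"
  unfolding rshift_def by (metis append_take_drop_id)

lemma lshift_linear: "lshift u (x + y) = lshift u x + lshift u y" "lshift u (fscale c x) = fscale c (lshift u x)"
    "lshift u 0 = 0"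
  and rshift_linear: "rshift u (x + y) = rshift u x + rshift u y" "rshift u (fscale c x) = fscale c (rshift u x)"
    "rshift u 0 = 0"
  by (auto simp: fun_eq_iff lshift_def rshift_def fscale_apply)

abbreviation total :: "('v \<times> nat) list \<Rightarrow> nat" where "total w \<equiv> sum_list (map snd w)"

context coloured
begin

abbreviation TA :: "(rat, ('v \<times> nat) list \<Rightarrow>\<^sub>0 rat) module" where "TA \<equiv> tensor_algebra (V \<times> UNIV)"

definition homog :: "('v \<Rightarrow>\<^sub>0 nat) \<Rightarrow> nat \<Rightarrow> (('v \<times> nat) list \<Rightarrow>\<^sub>0 rat) \<Rightarrow> ('v \<times> nat) list \<Rightarrow> rat" where
  "homog d D f = (\<lambda>w. if w \<in> words d D then lookup f w else 0)"

lemma homog_linear: "homog d D (f + g) = homog d D f + homog d D g" "homog d D (- f) = fscale (- 1) (homog d D f)"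
    "homog d D 0 = 0" "homog d D (Poly_Mapping.map ((*) c) f) = fscale c (homog d D f)"
  unfolding homog_def by (auto simp: fun_eq_iff lookup_add fscale_apply map.rep_eq when_def)

lemma homog_sum: "homog d D (\<Sum>i\<in>A. f i) = (\<Sum>i\<in>A. homog d D (f i))"
proof (induction A rule: infinite_finite_induct)
  case (insert i A)
  thus ?case by (simp only: sum.insert[OF insert.hyps] homog_linear)
next
  case (infinite A)
  show ?case unfolding sum.infinite[OF infinite] by (rule homog_linear)
qed (simp only: sum.empty homog_linear)

lemma homog_poly_of: "x \<in> funs_on (words d D) \<Longrightarrow> homog d D (poly_of (words d D) x) = x"
  unfolding homog_def by (auto simp: fun_eq_iff lookup_poly_of finite_words funs_on_def)

lemma homog_funs: "homog d D f \<in> funs_on (words d D)"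
  unfolding homog_def funs_on_def by simp

lemma words_append: "u \<in> lists (V \<times> UNIV) \<Longrightarrow> u @ v \<in> words d D \<longleftrightarrow>
    (\<exists>d' D'. v \<in> words d' D' \<and> d = weight u + d' \<and> D = total u + D')"
  "u \<in> lists (V \<times> UNIV) \<Longrightarrow> v @ u \<in> words d D \<longleftrightarrow>
    (\<exists>d' D'. v \<in> words d' D' \<and> d = weight u + d' \<and> D = total u + D')"
  unfolding words_def by (auto simp: weight_append add.commute)

lemma words_append_iff:
  assumes "u \<in> lists (V \<times> UNIV)"
  shows "u @ v \<in> words (weight u + d) (total u + D) \<longleftrightarrow> v \<in> words d D"
    "v @ u \<in> words (weight u + d) (total u + D) \<longleftrightarrow> v \<in> words d D"
  using assms unfolding words_def by (simp_all add: weight_append add.commute[of _ "weight u"] add.commute[of _ "total u"])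

lemma homog_prepend:
  assumes u: "u \<in> lists (V \<times> UNIV)"
  shows "homog d D (single u c * f) = 0 \<or>
    (\<exists>d' D'. d = weight u + d' \<and> D = total u + D' \<and> homog d D (single u c * f) = fscale c (lshift u (homog d' D' f)))"
proof (cases "\<exists>d' D'. d = weight u + d' \<and> D = total u + D'")
  case False
  have "homog d D (single u c * f) w = 0" for w
  proof (cases "\<exists>v. w = u @ v")
    case True
    hence "w \<notin> words d D" using False words_append(1)[OF u] by auto
    thus ?thesis unfolding homog_def by simp
  qed (simp add: homog_def lookup_prepend(2))
  thus ?thesis by (auto simp: fun_eq_iff)
next
  case True
  then obtain d' D' where d: "d = weight u + d'" "D = total u + D'" by blast
  have "homog d D (single u c * f) w = fscale c (lshift u (homog d' D' f)) w" for w
  proof (cases "\<exists>v. w = u @ v")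
    case True
    then obtain v where w: "w = u @ v" by blast
    show ?thesis unfolding w homog_def fscale_apply lshift_append lookup_prepend(1) d words_append_iff(1)[OF u] by simp
  next
    case False
    hence "w \<noteq> u @ v" for v by blast
    thus ?thesis by (simp add: homog_def lookup_prepend(2) lshift_0 fscale_apply)
  qed
  thus ?thesis using d by blast
qed

lemma homog_append:
  assumes u: "u \<in> lists (V \<times> UNIV)"
  shows "homog d D (f * single u c) = 0 \<or>
    (\<exists>d' D'. d = weight u + d' \<and> D = total u + D' \<and> homog d D (f * single u c) = fscale c (rshift u (homog d' D' f)))"
proof (cases "\<exists>d' D'. d = weight u + d' \<and> D = total u + D'")
  case False
  have "homog d D (f * single u c) w = 0" for w
  proof (cases "\<exists>v. w = v @ u")
    case True
    hence "w \<notin> words d D" using False words_append(2)[OF u] by auto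
    thus ?thesis unfolding homog_def by simp
  qed (simp add: homog_def lookup_prepend(4))
  thus ?thesis by (auto simp: fun_eq_iff)
next
  case True
  then obtain d' D' where d: "d = weight u + d'" "D = total u + D'" by blast
  have "homog d D (f * single u c) w = fscale c (rshift u (homog d' D' f)) w" for w
  proof (cases "\<exists>v. w = v @ u")
    case True
    then obtain v where w: "w = v @ u" by blast
    show ?thesis unfolding w homog_def fscale_apply rshift_append lookup_prepend(3) d words_append_iff(2)[OF u] by simp
  next
    case False
    hence "w \<noteq> v @ u" for v by blast
    thus ?thesis by (simp add: homog_def lookup_prepend(4) rshift_0 fscale_apply)
  qed
  thus ?thesis using d by blast
qed

text \<open>A family of subspaces of the homogeneous components which is stable under multiplication by
  words from both sides is the family of components of a two-sided ideal.\<close>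

definition stable :: "(('v \<Rightarrow>\<^sub>0 nat) \<Rightarrow> nat \<Rightarrow> (('v \<times> nat) list \<Rightarrow> rat) set) \<Rightarrow> bool" where
  "stable K \<longleftrightarrow> (\<forall>d D. fs.subspace (K d D)) \<and> (\<forall>d D. K d D \<subseteq> funs_on (words d D)) \<and>
     (\<forall>d D. \<forall>x\<in>K d D. \<forall>u\<in>lists (V \<times> UNIV). lshift u x \<in> K (weight u + d) (total u + D) \<and>
        rshift u x \<in> K (weight u + d) (total u + D))"

definition ideal_of :: "(('v \<Rightarrow>\<^sub>0 nat) \<Rightarrow> nat \<Rightarrow> (('v \<times> nat) list \<Rightarrow> rat) set) \<Rightarrow> (('v \<times> nat) list \<Rightarrow>\<^sub>0 rat) set" where
  "ideal_of K = {f \<in> carrier TA. \<forall>d D. homog d D f \<in> K d D}"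

lemma ideal_ideal_of:
  assumes K: "stable K"
  shows "ideal (ideal_of K) TA"
proof (rule idealI)
  interpret ring TA by (rule tensor_algebra_ring)
  have sub: "fs.subspace (K d D)" for d D using K unfolding stable_def by blast
  have l: "lshift u x \<in> K (weight u + d) (total u + D)" "rshift u x \<in> K (weight u + d) (total u + D)"
    if "x \<in> K d D" "u \<in> lists (V \<times> UNIV)" for u x d D using K that unfolding stable_def by blast+
  show "ring TA" by (rule tensor_algebra_ring)
  show "subgroup (ideal_of K) (add_monoid TA)"
  proof (rule add.subgroupI)
    show "ideal_of K \<subseteq> carrier TA" unfolding ideal_of_def by blast
    have "0 \<in> ideal_of K" unfolding ideal_of_def using fs.subspace_0[OF sub] by (simp add: homog_linear)
    thus "ideal_of K \<noteq> {}" by blast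
  next
    fix f g assume f: "f \<in> ideal_of K" and g: "g \<in> ideal_of K"
    have "f + g \<in> carrier TA" using f g a_closed[of f g] unfolding ideal_of_def by simp
    thus "f \<oplus>\<^bsub>TA\<^esub> g \<in> ideal_of K"
      using f g fs.subspace_add[OF sub] unfolding ideal_of_def by (simp add: homog_linear)
  next
    fix f assume f: "f \<in> ideal_of K"
    have "- f \<in> carrier TA" using f unfolding ideal_of_def by (auto simp: in_keys_iff subset_iff)
    moreover have "\<ominus>\<^bsub>TA\<^esub> f = - f"
      by (rule minus_equality) (use f calculation in \<open>auto simp: ideal_of_def\<close>)
    ultimately show "\<ominus>\<^bsub>TA\<^esub> f \<in> ideal_of K"
      using f fs.subspace_scale[OF sub, of _ _ _ "- 1"] unfolding ideal_of_def mem_Collect_eq homog_linear(2)[symmetric]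
      by (metis (no_types, lifting) homog_linear(2))
  qed
next
  have sub: "fs.subspace (K d D)" for d D using K unfolding stable_def by blast
  interpret ring TA by (rule tensor_algebra_ring)
  fix f a assume f: "f \<in> ideal_of K" and a: "a \<in> carrier TA"
  have fc: "f \<in> carrier TA" and fK: "\<And>d D. homog d D f \<in> K d D" using f unfolding ideal_of_def by auto
  have au: "u \<in> lists (V \<times> UNIV)" if "u \<in> keys a" for u using a that by auto
  have "homog d D (a * f) \<in> K d D" for d D
  proof -
    have "a * f = (\<Sum>u\<in>keys a. single u (lookup a u) * f)"
      by (subst poly_mapping_eq_sum[of a]) (rule sum_distrib_right)
    hence "homog d D (a * f) = (\<Sum>u\<in>keys a. homog d D (single u (lookup a u) * f))"
      by (simp only: homog_sum)
    also have "\<dots> \<in> K d D"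
    proof (rule fs.subspace_sum[OF sub])
      fix u assume u: "u \<in> keys a"
      show "homog d D (single u (lookup a u) * f) \<in> K d D"
        using homog_prepend[OF au[OF u], of d D "lookup a u" f]
      proof (elim disjE exE conjE)
        assume "homog d D (single u (lookup a u) * f) = 0"
        thus ?thesis using fs.subspace_0[OF sub] by simp
      next
        fix d' D' assume d: "d = weight u + d'" "D = total u + D'"
          and e: "homog d D (single u (lookup a u) * f) = fscale (lookup a u) (lshift u (homog d' D' f))"
        show ?thesis unfolding e using K fK[of d' D'] au[OF u] unfolding stable_def d
          by (intro fs.subspace_scale sub) blast
      qed
    qed
    finally show ?thesis .
  qed
  moreover have "a * f \<in> carrier TA" using m_closed[OF a fc] by simp
  ultimately show "a \<otimes>\<^bsub>TA\<^esub> f \<in> ideal_of K" unfolding ideal_of_def by simp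
  have "homog d D (f * a) \<in> K d D" for d D
  proof -
    have "f * a = (\<Sum>u\<in>keys a. f * single u (lookup a u))"
      by (subst poly_mapping_eq_sum[of a]) (rule sum_distrib_left)
    hence "homog d D (f * a) = (\<Sum>u\<in>keys a. homog d D (f * single u (lookup a u)))"
      by (simp only: homog_sum)
    also have "\<dots> \<in> K d D"
    proof (rule fs.subspace_sum[OF sub])
      fix u assume u: "u \<in> keys a"
      show "homog d D (f * single u (lookup a u)) \<in> K d D"
        using homog_append[OF au[OF u], of d D f "lookup a u"]
      proof (elim disjE exE conjE)
        assume "homog d D (f * single u (lookup a u)) = 0"
        thus ?thesis using fs.subspace_0[OF sub] by simp
      next
        fix d' D' assume d: "d = weight u + d'" "D = total u + D'"
          and e: "homog d D (f * single u (lookup a u)) = fscale (lookup a u) (rshift u (homog d' D' f))"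
        show ?thesis unfolding e using K fK[of d' D'] au[OF u] unfolding stable_def d
          by (intro fs.subspace_scale sub) blast
      qed
    qed
    finally show ?thesis .
  qed
  moreover have "f * a \<in> carrier TA" using m_closed[OF fc a] by simp
  ultimately show "f \<otimes>\<^bsub>TA\<^esub> a \<in> ideal_of K" unfolding ideal_of_def by simp
qed

text \<open>The generated ideal is the least one, hence inside \<open>ideal_of K\<close>, whose
  components lie in \<open>K\<close>. Elements of a generated ideal never have to be written
  out.\<close>

lemma ideal_component:
  assumes K: "stable K" and S: "S \<subseteq> ideal_of K"
    and K_Idl: "\<And>x. x \<in> K d D \<Longrightarrow> poly_of (words d D) x \<in> Idl\<^bsub>TA\<^esub> S"
  shows "{x \<in> funs_on (words d D). poly_of (words d D) x \<in> Idl\<^bsub>TA\<^esub> S} = K d D"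
proof -
  interpret ring TA by (rule tensor_algebra_ring)
  have "Idl\<^bsub>TA\<^esub> S \<subseteq> ideal_of K" by (rule genideal_minimal[OF ideal_ideal_of[OF K] S])
  moreover have "x \<in> K d D" if "x \<in> funs_on (words d D)" "poly_of (words d D) x \<in> ideal_of K" for x
    using that homog_poly_of[OF that(1)] unfolding ideal_of_def by (metis (mono_tags, lifting) mem_Collect_eq)
  moreover have "K d D \<subseteq> funs_on (words d D)" using K unfolding stable_def by blast
  ultimately show ?thesis using K_Idl by blast
qed

lemma shift_funs:
  assumes "x \<in> funs_on (words d D)" "u \<in> lists (V \<times> UNIV)"
  shows "lshift u x \<in> funs_on (words (weight u + d) (total u + D))"
    "rshift u x \<in> funs_on (words (weight u + d) (total u + D))"
proof -
  have "lshift u x w = 0" if "w \<notin> words (weight u + d) (total u + D)" for w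
    using that words_append_iff(1)[OF assms(2)] funs_onD[OF assms(1)] lshift_append[of u x] lshift_0[of w u x] by metis
  thus "lshift u x \<in> funs_on (words (weight u + d) (total u + D))" unfolding funs_on_def by blast
  have "rshift u x w = 0" if "w \<notin> words (weight u + d) (total u + D)" for w
    using that words_append_iff(2)[OF assms(2)] funs_onD[OF assms(1)] rshift_append[of u x] rshift_0[of w u x] by metis
  thus "rshift u x \<in> funs_on (words (weight u + d) (total u + D))" unfolding funs_on_def by blast
qed

lemma good_lshift:
  assumes x: "good p x"
  shows "good (length u + p) (lshift u x)"
proof (rule goodI, goal_cases)
  case (1 s i j k l t)
  define s1 where "s1 = take (length u) s" define s2 where "s2 = drop (length u) s"
  have s: "s = s1 @ s2" "length s1 = length u" "length s2 = p" unfolding s1_def s2_def using 1(1) by auto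
  have l: "lshift u x (s1 @ r) = (if s1 = u then x r else 0)" for r unfolding lshift_def s(2)[symmetric] by simp
  show ?case using good_swap[OF x s(3) 1(2,3), of k l t] unfolding s(1) append_assoc l by simp
next
  case (2 s i j k q t)
  define s1 where "s1 = take (length u) s" define s2 where "s2 = drop (length u) s"
  have s: "s = s1 @ s2" "length s1 = length u" "length s2 = p" unfolding s1_def s2_def using 2(1) by auto
  have l: "lshift u x (s1 @ r) = (if s1 = u then x r else 0)" for r unfolding lshift_def s(2)[symmetric] by simp
  show ?case using good_moment[OF x s(3) 2(2-4), of k t] unfolding s(1) append_assoc l by (cases "s1 = u") simp_all
qed

text \<open>\<open>x\<close> lives on words of weight \<open>d\<close>, and
  \<open>Suc p < len d\<close> places both letters of the relation before the suffix
  \<open>u\<close>.\<close>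

lemma good_rshift:
  assumes x: "good p x" "x \<in> funs_on (words d D)" and u: "u \<in> lists (V \<times> UNIV)" and p: "Suc p < len d"
  shows "good p (rshift u x)"
proof -
  have len: "length t \<ge> length u" if "s @ a # b # t \<in> words (weight u + d) (total u + D)" "length s = p" for s a b t
    using length_words[OF that(1)] that(2) p by (simp add: len_add len_weight)
  have rs: "rshift u x (s @ a # b # t) = (if drop (length t - length u) t = u then x (s @ a # b # take (length t - length u) t) else 0)"
    if "length u \<le> length t" for s a b t
    unfolding rshift_def using that by (simp add: Suc_diff_le)
  show ?thesis
  proof (rule goodI_words[OF shift_funs(2)[OF x(2) u]], goal_cases)
    case (1 s i j k l t)
    show ?case using good_swap[OF x(1) 1(1-3)] unfolding rs[OF len[OF 1(4,1)]] by simp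
  next
    case (2 s i j k q t)
    show ?case using good_moment[OF x(1) 2(1-4), of k "take (length t - length u) t"] unfolding rs[OF len[OF 2(5,1)]]
      by (cases "drop (length t - length u) t = u") simp_all
  qed
qed

lemma Yspace_single:
  assumes "Suc p < len d"
  shows "Yspace d D ({..<len d - 1} - {p}) = {x \<in> funs_on (words d D). good p x}"
proof -
  have "good q x" if "x \<in> funs_on (words d D)" "good p x" "q \<notin> {..<len d - 1} - {p}" for x q
    using good_beyond[OF that(1), of q] that by (cases "q = p") auto
  thus ?thesis unfolding Yspace_def by auto
qed

lemma Ispace_gen: "Suc p < len d \<Longrightarrow> x \<in> funs_on (words d D) \<Longrightarrow> good p x \<Longrightarrow> x \<in> Ispace d D"
  unfolding Ispace_def using Yspace_single[of p d D] by (intro fs.span_base) force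

lemma Ispace_minimal:
  assumes "fs.subspace P" "\<And>p x. Suc p < len d \<Longrightarrow> x \<in> funs_on (words d D) \<Longrightarrow> good p x \<Longrightarrow> x \<in> P"
  shows "Ispace d D \<subseteq> P"
  unfolding Ispace_def
proof (rule fs.span_minimal[OF _ assms(1)], clarify)
  fix p x assume p: "p < len d - 1" and x: "x \<in> Yspace d D ({..<len d - 1} - {p})"
  have "Suc p < len d" using p by simp
  thus "x \<in> P" using x assms(2) unfolding Yspace_single[OF \<open>Suc p < len d\<close>] by blast
qed

lemma stable_Ispace: "stable Ispace"
  unfolding stable_def
proof (intro conjI allI ballI)
  fix d D
  show "fs.subspace (Ispace d D)" unfolding Ispace_def by (rule fs.subspace_span)
  show "Ispace d D \<subseteq> funs_on (words d D)" by (rule Ispace_funs)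
  fix x and u :: "('v \<times> nat) list" assume x: "x \<in> Ispace d D" and u: "u \<in> lists (V \<times> UNIV)"
  let ?I = "Ispace (weight u + d) (total u + D)"
  have sub: "fs.subspace ?I" unfolding Ispace_def by (rule fs.subspace_span)
  have lenu: "len (weight u + d) = length u + len d" by (simp add: len_add len_weight)
  have "Ispace d D \<subseteq> {x. lshift u x \<in> ?I}"
  proof (rule Ispace_minimal)
    show "fs.subspace {x. lshift u x \<in> ?I}"
      by (rule fs.subspaceI) (simp_all only: mem_Collect_eq lshift_linear fs.subspace_0[OF sub] fs.subspace_add[OF sub] fs.subspace_scale[OF sub])
    show "x \<in> {x. lshift u x \<in> ?I}" if "Suc p < len d" "x \<in> funs_on (words d D)" "good p x" for p x
      using Ispace_gen[of "length u + p" "weight u + d" "lshift u x" "total u + D"] shift_funs(1)[OF that(2) u] good_lshift[OF that(3), of u] that(1) lenu by simp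
  qed
  thus "lshift u x \<in> ?I" using x by blast
  have "Ispace d D \<subseteq> {x. rshift u x \<in> ?I}"
  proof (rule Ispace_minimal)
    show "fs.subspace {x. rshift u x \<in> ?I}"
      by (rule fs.subspaceI) (simp_all only: mem_Collect_eq rshift_linear fs.subspace_0[OF sub] fs.subspace_add[OF sub] fs.subspace_scale[OF sub])
    show "x \<in> {x. rshift u x \<in> ?I}" if "Suc p < len d" "x \<in> funs_on (words d D)" "good p x" for p x
      using Ispace_gen[of p "weight u + d" "rshift u x" "total u + D"] shift_funs(2)[OF that(2) u] good_rshift[OF that(3,2) u that(1)] that(1) lenu by simp
  qed
  thus "rshift u x \<in> ?I" using x by blast
qed

text \<open>A component of the ideal of relations, described by duality as the coefficient functions
  orthogonal to all solutions of the relations.\<close>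

definition Kspace :: "('v \<Rightarrow>\<^sub>0 nat) \<Rightarrow> nat \<Rightarrow> (('v \<times> nat) list \<Rightarrow> rat) set" where
  "Kspace d D = perp (words d D) (Yspace d D {})"

text \<open>Freezing a prefix or a suffix keeps the relations in the remaining letters. This is dual
  to the closure of an ideal under multiplication by words.\<close>

lemma Yspace_restrict:
  assumes y: "y \<in> Yspace (weight u + d) (total u + D) {}" and u: "u \<in> lists (V \<times> UNIV)"
  shows "(\<lambda>v. if v \<in> words d D then y (u @ v) else 0) \<in> Yspace d D {}" (is "?l \<in> _")
    and "(\<lambda>v. if v \<in> words d D then y (v @ u) else 0) \<in> Yspace d D {}" (is "?r \<in> _")
proof -
  have g: "good p y" for p using Yspace_goodD[OF y] by simp
  have fl: "?l \<in> funs_on (words d D)" "?r \<in> funs_on (words d D)" unfolding funs_on_def by auto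
  have "good p ?l" for p
  proof (rule goodI_words[OF fl(1)], goal_cases)
    case (1 s i j k l t)
    have "length (u @ s) = length u + p" using 1(1) by simp
    from good_swap[OF g this 1(2,3), of k l t] show ?case using 1(4) words_swap[of s i k j l t] by simp
  next
    case (2 s i j k q t)
    have "length (u @ s) = length u + p" using 2(1) by simp
    moreover have "s @ (i, l) # (j, k - l) # t \<in> words d D" if "l \<le> k" for l
      using 2(5) words_transfer[of 0 k l "k - l" s i j t] that by simp
    ultimately show ?case using good_moment[OF g _ 2(2-4), of "u @ s" _ k t] by simp
  qed
  thus "?l \<in> Yspace d D {}" unfolding Yspace_def using fl by simp
  have "good p ?r" for p
  proof (rule goodI_words[OF fl(2)], goal_cases)
    case (1 s i j k l t)
    from good_swap[OF g 1(1-3), of k l "t @ u"] show ?case using 1(4) words_swap[of s i k j l t] by simp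
  next
    case (2 s i j k q t)
    have "s @ (i, l) # (j, k - l) # t \<in> words d D" if "l \<le> k" for l
      using 2(5) words_transfer[of 0 k l "k - l" s i j t] that by simp
    thus ?case using good_moment[OF g 2(1-4), of k "t @ u"] by simp
  qed
  thus "?r \<in> Yspace d D {}" unfolding Yspace_def using fl by simp
qed

lemma stable_Kspace: "stable Kspace"
  unfolding stable_def Kspace_def
proof (intro conjI allI ballI)
  fix d D
  show "fs.subspace (perp (words d D) (Yspace d D {}))" by (rule subspace_perp)
  show "perp (words d D) (Yspace d D {}) \<subseteq> funs_on (words d D)" unfolding perp_def by blast
  fix x and u :: "('v \<times> nat) list" assume x: "x \<in> perp (words d D) (Yspace d D {})" and u: "u \<in> lists (V \<times> UNIV)"
  have xf: "x \<in> funs_on (words d D)" and x0: "\<And>y. y \<in> Yspace d D {} \<Longrightarrow> (\<Sum>w\<in>words d D. y w * x w) = 0"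
    using x unfolding perp_def by auto
  let ?W = "words (weight u + d) (total u + D)"
  have "(\<Sum>w\<in>?W. y w * lshift u x w) = 0" if y: "y \<in> Yspace (weight u + d) (total u + D) {}" for y
  proof -
    have "(\<Sum>w\<in>?W. y w * lshift u x w) = (\<Sum>w\<in>(@) u ` words d D. y w * lshift u x w)"
    proof (rule sum.mono_neutral_right[OF finite_words])
      show "(@) u ` words d D \<subseteq> ?W" using words_append_iff(1)[OF u] by auto
      show "\<forall>w\<in>?W - (@) u ` words d D. y w * lshift u x w = 0"
      proof
        fix w assume w: "w \<in> ?W - (@) u ` words d D"
        have "w \<noteq> u @ v" for v using w words_append_iff(1)[OF u, of v d D] by auto
        thus "y w * lshift u x w = 0" by (simp add: lshift_0)
      qed
    qed
    also have "\<dots> = (\<Sum>v\<in>words d D. y (u @ v) * x v)"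
      by (simp add: sum.reindex inj_on_def lshift_append)
    also have "\<dots> = (\<Sum>v\<in>words d D. (if v \<in> words d D then y (u @ v) else 0) * x v)" by (rule sum.cong) auto
    also have "\<dots> = 0" by (rule x0[OF Yspace_restrict(1)[OF y u]])
    finally show ?thesis .
  qed
  thus "lshift u x \<in> perp ?W (Yspace (weight u + d) (total u + D) {})"
    unfolding perp_def using shift_funs(1)[OF xf u] by simp
  have "(\<Sum>w\<in>?W. y w * rshift u x w) = 0" if y: "y \<in> Yspace (weight u + d) (total u + D) {}" for y
  proof -
    have "(\<Sum>w\<in>?W. y w * rshift u x w) = (\<Sum>w\<in>(\<lambda>v. v @ u) ` words d D. y w * rshift u x w)"
    proof (rule sum.mono_neutral_right[OF finite_words])
      show "(\<lambda>v. v @ u) ` words d D \<subseteq> ?W" using words_append_iff(2)[OF u] by auto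
      show "\<forall>w\<in>?W - (\<lambda>v. v @ u) ` words d D. y w * rshift u x w = 0"
      proof
        fix w assume w: "w \<in> ?W - (\<lambda>v. v @ u) ` words d D"
        have "w \<noteq> v @ u" for v using w words_append_iff(2)[OF u, of v d D] by auto
        thus "y w * rshift u x w = 0" by (simp add: rshift_0)
      qed
    qed
    also have "\<dots> = (\<Sum>v\<in>words d D. y (v @ u) * x v)"
      by (simp add: sum.reindex inj_on_def rshift_append)
    also have "\<dots> = (\<Sum>v\<in>words d D. (if v \<in> words d D then y (v @ u) else 0) * x v)" by (rule sum.cong) auto
    also have "\<dots> = 0" by (rule x0[OF Yspace_restrict(2)[OF y u]])
    finally show ?thesis .
  qed
  thus "rshift u x \<in> perp ?W (Yspace (weight u + d) (total u + D) {})"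
    unfolding perp_def using shift_funs(2)[OF xf u] by simp
qed

definition quadratic_relations :: "(('v \<times> nat) list \<Rightarrow>\<^sub>0 rat) set" where
  "quadratic_relations =
    {single [(i, k), (j, l)] 1 - single [(j, l), (i, k)] (\<epsilon> i j) | i j k l. i \<in> V \<and> j \<in> V}
    \<union> {\<Sum>l\<le>k. single [(i, l), (j, k - l)] (of_nat ((k - l) choose q)) | i j k q. i \<in> V \<and> j \<in> V \<and> q < m i j}"

definition quadratic_annihilator :: "(('v \<times> nat) list \<Rightarrow>\<^sub>0 rat) set" where
  "quadratic_annihilator = {g \<in> carrier TA. (\<forall>w\<in>keys g. length w = 2) \<and> good 0 (lookup g)}"

lemma sum_words_delta:
  assumes "y \<in> funs_on (words d D)"
  shows "(\<Sum>w\<in>words d D. y w * homog d D (single z c) w) = y z * c"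
proof -
  have "(\<Sum>w\<in>words d D. y w * homog d D (single z c) w) = (\<Sum>w\<in>words d D. if w = z then y w * c else 0)"
    by (rule sum.cong) (auto simp: homog_def lookup_single when_def)
  thus ?thesis using finite_words funs_onD[OF assms, of z] by auto
qed

lemma quadratic_relations_carrier: "quadratic_relations \<subseteq> carrier TA"
proof
  interpret ring TA by (rule tensor_algebra_ring)
  have s: "single [(i, k), (j, l)] (c :: rat) \<in> carrier TA" if "i \<in> V" "j \<in> V" for i j k l c
    using that by auto
  fix f assume "f \<in> quadratic_relations"
  then consider i j k l where "i \<in> V" "j \<in> V" "f = single [(i, k), (j, l)] 1 - single [(j, l), (i, k)] (\<epsilon> i j)"
    | i j k q where "i \<in> V" "j \<in> V" "f = (\<Sum>l\<le>k. single [(i, l), (j, k - l)] (of_nat ((k - l) choose q)))"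
    unfolding quadratic_relations_def by blast
  thus "f \<in> carrier TA"
  proof cases
    case 1
    have "f = single [(i, k), (j, l)] 1 + single [(j, l), (i, k)] (- \<epsilon> i j)"
      unfolding 1(3) by (simp add: single_uminus)
    thus ?thesis using a_closed[OF s[OF 1(1,2)] s[OF 1(2,1)]] by simp
  next
    case 2
    have "(\<Sum>l\<in>A. single [(i, l), (j, k - l)] (of_nat ((k - l) choose q) :: rat)) \<in> carrier TA" for A :: "nat set"
    proof (induction A rule: infinite_finite_induct)
      case (insert l A)
      thus ?case using a_closed[OF s[OF 2(1,2)] insert.IH] by simp
    qed auto
    thus ?thesis unfolding 2(3) .
  qed
qed

lemma quadratic_relations_ideal: "quadratic_relations \<subseteq> ideal_of Kspace"
proof
  fix f assume f: "f \<in> quadratic_relations"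
  have "(\<Sum>w\<in>words d D. y w * homog d D f w) = 0" if y: "y \<in> Yspace d D {}" for d D y
  proof -
    have g: "good 0 y" using Yspace_goodD[OF y] by simp
    note S = sum_words_delta[OF subsetD[OF Yspace_funs y]]
    consider i j k l where "i \<in> V" "j \<in> V" "f = single [(i, k), (j, l)] 1 - single [(j, l), (i, k)] (\<epsilon> i j)"
      | i j k q where "i \<in> V" "j \<in> V" "q < m i j" "f = (\<Sum>l\<le>k. single [(i, l), (j, k - l)] (of_nat ((k - l) choose q)))"
      using f unfolding quadratic_relations_def by blast
    thus ?thesis
    proof cases
      case 1
      have "f = single [(i, k), (j, l)] 1 + single [(j, l), (i, k)] (- \<epsilon> i j)"
        unfolding 1(3) by (simp add: single_uminus)
      hence "homog d D f = homog d D (single [(i, k), (j, l)] 1) + homog d D (single [(j, l), (i, k)] (- \<epsilon> i j))"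
        by (simp only: homog_linear)
      hence "(\<Sum>w\<in>words d D. y w * homog d D f w) = y [(i, k), (j, l)] * 1 + y [(j, l), (i, k)] * (- \<epsilon> i j)"
        by (simp only: plus_fun_apply distrib_left sum.distrib S)
      also have "\<dots> = 0" using good_swap[OF g, of "[]" i j k l "[]"] 1 by simp
      finally show ?thesis .
    next
      case 2
      have "(\<Sum>w\<in>words d D. y w * homog d D f w)
        = (\<Sum>l\<le>k. \<Sum>w\<in>words d D. y w * homog d D (single [(i, l), (j, k - l)] (of_nat ((k - l) choose q))) w)"
        unfolding 2(4) homog_sum sum_fun_apply sum_distrib_left by (rule sum.swap)
      also have "\<dots> = (\<Sum>l\<le>k. of_nat ((k - l) choose q) * y [(i, l), (j, k - l)])" unfolding S by (simp add: mult.commute)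
      also have "\<dots> = 0" using good_moment[OF g, of "[]" i j q k "[]"] 2 by simp
      finally show ?thesis .
    qed
  qed
  thus "f \<in> ideal_of Kspace"
    unfolding ideal_of_def Kspace_def perp_def using homog_funs quadratic_relations_carrier f by blast
qed

lemma Idl_context:
  assumes J: "ideal J TA" and f: "f \<in> J" and s: "s \<in> lists (V \<times> UNIV)" "t \<in> lists (V \<times> UNIV)"
  shows "single s 1 * f * single t 1 \<in> J"
proof -
  interpret ideal J TA by fact
  have c: "single s (1::rat) \<in> carrier TA" "single t (1::rat) \<in> carrier TA"
    using s by auto
  show ?thesis using I_r_closed[OF I_l_closed[OF f c(1)] c(2)] by simp
qed

lemma words_context:
  assumes "s @ a # b # t \<in> words d D"
  shows "s \<in> lists (V \<times> UNIV)" "t \<in> lists (V \<times> UNIV)" "fst a \<in> V" "fst b \<in> V"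
  using assms unfolding words_def by auto

text \<open>By double orthogonality it suffices that a function orthogonal to the component of
  \<open>J\<close> solves the relations. This is tested on the generating relations placed between
  two words, which belong to \<open>J\<close>.\<close>

lemma Kspace_Idl:
  assumes J: "ideal J TA" and R: "quadratic_relations \<subseteq> J" and x: "x \<in> Kspace d D"
  shows "poly_of (words d D) x \<in> J"
proof -
  define KJ where "KJ = {x \<in> funs_on (words d D). poly_of (words d D) x \<in> J}"
  have Wl: "words d D \<subseteq> lists (V \<times> UNIV)" unfolding words_def by auto
  have sub: "fs.subspace KJ" unfolding KJ_def
    by (rule quotient_coordinates(1)[OF J finite_words Wl refl])
  have "perp (words d D) KJ \<subseteq> Yspace d D {}"
  proof
    fix y assume y: "y \<in> perp (words d D) KJ"
    have yf: "y \<in> funs_on (words d D)" and y0: "\<And>x. x \<in> KJ \<Longrightarrow> (\<Sum>w\<in>words d D. x w * y w) = 0"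
      using y unfolding perp_def by auto
    have dl: "(\<Sum>w\<in>words d D. delta z w * y w) = y z" if "z \<in> words d D" for z
    proof -
      have "(\<Sum>w\<in>words d D. delta z w * y w) = (\<Sum>w\<in>words d D. if w = z then y w else 0)"
        by (rule sum.cong) (auto simp: delta_def)
      thus ?thesis using that finite_words by simp
    qed
    have "good p y" for p
    proof (rule goodI_words[OF yf], goal_cases)
      case (1 s i j k l t)
      define w where "w = s @ (i, k) # (j, l) # t" define w' where "w' = s @ (j, l) # (i, k) # t"
      have W: "w \<in> words d D" "w' \<in> words d D" using 1(4) words_swap[of s i k j l t] unfolding w_def w'_def by auto
      note st = words_context(1,2)[OF 1(4)]
      define x0 where "x0 = (delta w + fscale (- \<epsilon> i j) (delta w') :: ('v \<times> nat) list \<Rightarrow> rat)"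
      have xf: "x0 \<in> funs_on (words d D)" unfolding x0_def
        by (intro fs.subspace_add fs.subspace_scale subspace_funs_on delta_in_funs_on W)
      have "single [(i, k), (j, l)] 1 - single [(j, l), (i, k)] (\<epsilon> i j) \<in> J"
        using R 1(2,3) unfolding quadratic_relations_def by blast
      from Idl_context[OF J this st]
      have "single w 1 - single w' (\<epsilon> i j) \<in> J"
        unfolding w_def w'_def by (simp add: right_diff_distrib left_diff_distrib mult_single plus_list_def)
      moreover have "poly_of (words d D) x0 = single w 1 - single w' (\<epsilon> i j)"
        unfolding x0_def poly_of_add poly_of_scale[OF finite_words] poly_of_delta[OF finite_words W(1)] poly_of_delta[OF finite_words W(2)]
        by (simp add: single_uminus)
      ultimately have "x0 \<in> KJ" using xf unfolding KJ_def by simp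
      have "(\<Sum>v\<in>words d D. x0 v * y v) = (\<Sum>v\<in>words d D. delta w v * y v) + (- \<epsilon> i j) * (\<Sum>v\<in>words d D. delta w' v * y v)"
        unfolding x0_def plus_fun_apply fscale_apply distrib_right sum.distrib sum_distrib_left mult.assoc ..
      hence "y w + (- \<epsilon> i j) * y w' = 0" using y0[OF \<open>x0 \<in> KJ\<close>] dl[OF W(1)] dl[OF W(2)] by simp
      thus ?case unfolding w_def w'_def by simp
    next
      case (2 s i j k q t)
      define w where "w = (\<lambda>l. s @ (i, l) # (j, k - l) # t)"
      have W: "w l \<in> words d D" if "l \<le> k" for l
        unfolding w_def using 2(5) words_transfer[of 0 k l "k - l" s i j t] that by simp
      note st = words_context(1,2)[OF 2(5)]
      define x0 where "x0 = (\<Sum>l\<le>k. fscale (of_nat ((k - l) choose q)) (delta (w l)) :: ('v \<times> nat) list \<Rightarrow> rat)"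
      have xf: "x0 \<in> funs_on (words d D)" unfolding x0_def
        by (intro fs.subspace_sum fs.subspace_scale subspace_funs_on delta_in_funs_on W) simp
      have "(\<Sum>l\<le>k. single [(i, l), (j, k - l)] (of_nat ((k - l) choose q))) \<in> J"
        using R 2(2-4) unfolding quadratic_relations_def by blast
      from Idl_context[OF J this st]
      have "(\<Sum>l\<le>k. single (w l) (of_nat ((k - l) choose q))) \<in> J"
        unfolding w_def by (simp add: sum_distrib_left sum_distrib_right mult_single plus_list_def)
      moreover have "poly_of (words d D) x0 = (\<Sum>l\<le>k. single (w l) (of_nat ((k - l) choose q)))"
        unfolding x0_def poly_of_sum
        by (rule sum.cong) (simp_all add: poly_of_scale[OF finite_words] poly_of_delta[OF finite_words W])
      ultimately have "x0 \<in> KJ" using xf unfolding KJ_def by simp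
      have "(\<Sum>v\<in>words d D. x0 v * y v) = (\<Sum>l\<le>k. of_nat ((k - l) choose q) * (\<Sum>v\<in>words d D. delta (w l) v * y v))"
        unfolding x0_def sum_fun_apply fscale_apply sum_distrib_right sum_distrib_left mult.assoc by (rule sum.swap)
      also have "\<dots> = (\<Sum>l\<le>k. of_nat ((k - l) choose q) * y (w l))"
        by (rule sum.cong) (simp_all add: dl[OF W])
      finally show ?case using y0[OF \<open>x0 \<in> KJ\<close>] unfolding w_def by simp
    qed
    thus "y \<in> Yspace d D {}" unfolding Yspace_def using yf by simp
  qed
  hence "perp (words d D) (Yspace d D {}) \<subseteq> perp (words d D) (perp (words d D) KJ)" unfolding perp_def by blast
  also have "\<dots> = KJ" by (rule perp_perp[OF finite_words sub]) (simp add: KJ_def)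
  finally show ?thesis using x unfolding Kspace_def KJ_def by blast
qed

lemma quadratic_annihilator_ideal: "quadratic_annihilator \<subseteq> ideal_of Ispace"
proof
  fix g assume g: "g \<in> quadratic_annihilator"
  have gc: "g \<in> carrier TA" and g2: "\<And>w. w \<in> keys g \<Longrightarrow> length w = 2" and gg: "good 0 (lookup g)"
    using g unfolding quadratic_annihilator_def by auto
  have "homog d D g \<in> Ispace d D" for d D
  proof (cases "len d = 2")
    case False
    have "homog d D g = 0"
    proof
      fix w show "homog d D g w = 0 w"
        using g2[of w] length_words[of w d D] False unfolding homog_def
        by (cases "w \<in> words d D"; cases "lookup g w = 0") (simp_all add: in_keys_iff)
    qed
    thus ?thesis unfolding Ispace_def by (simp only: fs.span_zero)
  next
    case True
    have "good 0 (homog d D g)"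
    proof (rule goodI_words[OF homog_funs], goal_cases)
      case (1 s i j k l t)
      show ?case using good_swap[OF gg 1(1-3), of k l t] 1(4) words_swap[of s i k j l t] unfolding homog_def by simp
    next
      case (2 s i j k q t)
      have "s @ (i, l) # (j, k - l) # t \<in> words d D" if "l \<le> k" for l
        using 2(5) words_transfer[of 0 k l "k - l" s i j t] that by simp
      thus ?case using good_moment[OF gg 2(1-4), of k t] unfolding homog_def by simp
    qed
    thus ?thesis using True by (intro Ispace_gen[of 0] homog_funs) simp_all
  qed
  thus "g \<in> ideal_of Ispace" unfolding ideal_of_def using gc by blast
qed

text \<open>Sort a function that is good at \<open>p\<close> by the letters outside \<open>p\<close>
  and \<open>p + 1\<close>. It becomes a sum of products of a prefix, an element of the quadratic
  annihilator and a suffix.\<close>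

lemma Ispace_Idl:
  assumes J: "ideal J TA" and R: "quadratic_annihilator \<subseteq> J" and x: "x \<in> Ispace d D"
  shows "poly_of (words d D) x \<in> J"
proof -
  interpret J: ideal J TA by fact
  define KJ where "KJ = {x \<in> funs_on (words d D). poly_of (words d D) x \<in> J}"
  have Wl: "words d D \<subseteq> lists (V \<times> UNIV)" unfolding words_def by auto
  have sub: "fs.subspace KJ" unfolding KJ_def
    by (rule quotient_coordinates(1)[OF J finite_words Wl refl])
  have "Ispace d D \<subseteq> KJ"
  proof (rule Ispace_minimal[OF sub])
    fix p x assume p: "Suc p < len d" and xf: "x \<in> funs_on (words d D)" and xg: "good p x"
    define W where "W = words d D"
    have finW: "finite W" unfolding W_def by (rule finite_words)
    define ctx where "ctx = (\<lambda>w :: ('v \<times> nat) list. (take p w, drop (Suc (Suc p)) w))"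
    define mid where "mid = (\<lambda>w :: ('v \<times> nat) list. take 2 (drop p w))"
    have wsplit: "w = fst (ctx w) @ mid w @ snd (ctx w)" for w
      unfolding ctx_def mid_def by (simp add: append_take_drop_id[of 2 "drop p w", unfolded drop_drop] flip: append_assoc)
        (metis append.assoc append_take_drop_id drop_drop add_2_eq_Suc)
    define gc where "gc = (\<lambda>c. \<Sum>w\<in>{w\<in>W. ctx w = c}. single (mid w) (x w))"
    have "poly_of W x = (\<Sum>c\<in>ctx ` W. \<Sum>w\<in>{w\<in>W. ctx w = c}. single w (x w))"
      unfolding poly_of_def by (rule sum.group[symmetric]) (use finW in auto)
    also have "\<dots> = (\<Sum>c\<in>ctx ` W. single (fst c) 1 * gc c * single (snd c) 1)"
    proof (rule sum.cong[OF refl])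
      fix c
      have "(\<Sum>w\<in>{w\<in>W. ctx w = c}. single w (x w))
        = (\<Sum>w\<in>{w\<in>W. ctx w = c}. single (fst c @ mid w @ snd c) (x w))"
        by (rule sum.cong) (use wsplit in auto)
      thus "(\<Sum>w\<in>{w\<in>W. ctx w = c}. single w (x w)) = single (fst c) 1 * gc c * single (snd c) 1"
        unfolding gc_def by (simp add: sum_distrib_left sum_distrib_right mult_single plus_list_def)
    qed
    also have "\<dots> \<in> J"
    proof -
      have sJ: "(\<Sum>c\<in>A. h c) \<in> J" if "\<And>c. c \<in> A \<Longrightarrow> h c \<in> J" for A and h :: "_ \<Rightarrow> ('v \<times> nat) list \<Rightarrow>\<^sub>0 rat"
        using that
      proof (induction A rule: infinite_finite_induct)
        case (insert c A)
        thus ?case using additive_subgroup.a_closed[OF J.is_additive_subgroup, of "h c" "sum h A"] by simp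
      qed (use additive_subgroup.zero_closed[OF J.is_additive_subgroup] in simp_all)
      show ?thesis
      proof (rule sJ)
        fix c assume "c \<in> ctx ` W"
        then obtain w0 where w0: "w0 \<in> W" "c = ctx w0" by blast
        have lw: "length w0 = len d" using length_words w0(1) unfolding W_def by blast
        have ctxl: "fst c \<in> lists (V \<times> UNIV)" "snd c \<in> lists (V \<times> UNIV)" "length (fst c) = p"
          using w0 lw p unfolding ctx_def W_def words_def by (auto dest: in_set_takeD in_set_dropD)
        define N where "N = {w\<in>W. ctx w = c}"
        have finN: "finite N" unfolding N_def using finW by simp
        have midl: "length (mid w) = 2" "mid w \<in> lists (V \<times> UNIV)" if "w \<in> W" for w
        proof -
          have "length w = len d" "w \<in> lists (V \<times> UNIV)" using that length_words unfolding W_def words_def by auto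
          thus "length (mid w) = 2" "mid w \<in> lists (V \<times> UNIV)"
            unfolding mid_def using p by (auto dest: in_set_takeD in_set_dropD)
        qed
        \<comment> \<open>The coefficients of \<open>gc c\<close> are values of \<open>x\<close>
          with prefix and suffix frozen, so \<open>gc c\<close> inherits at position zero the
          relations of \<open>x\<close> at \<open>p\<close>.\<close>
        have lk: "lookup (gc c) z = (if length z = 2 then x (fst c @ z @ snd c) else 0)" for z
        proof -
          have "lookup (gc c) z = (\<Sum>w\<in>N. x w when mid w = z)"
            unfolding gc_def N_def lookup_sum lookup_single ..
          also have "\<dots> = (if length z = 2 then x (fst c @ z @ snd c) else 0)"
          proof (cases "length z = 2")
            case False
            have "(x w when mid w = z) = 0" if "w \<in> N" for w
            proof -
              have "mid w \<noteq> z" using midl(1)[of w] that False unfolding N_def by auto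
              thus ?thesis by simp
            qed
            thus ?thesis using False by simp
          next
            case True
            define v where "v = fst c @ z @ snd c"
            have cv: "ctx v = c" "mid v = z" unfolding ctx_def mid_def v_def using True ctxl(3) by auto
            have "(\<Sum>w\<in>N. x w when mid w = z) = (\<Sum>w\<in>N. x w when w = v)"
            proof (rule sum.cong[OF refl])
              fix w assume "w \<in> N"
              hence "w = fst c @ mid w @ snd c" using wsplit[of w] unfolding N_def by auto
              hence "mid w = z \<longleftrightarrow> w = v" unfolding v_def using cv(2) v_def by metis
              thus "(x w when mid w = z) = (x w when w = v)" by simp
            qed
            also have "\<dots> = (if v \<in> N then x v else 0)" using finN by (simp add: when_def)
            also have "\<dots> = x v" using funs_onD[OF xf, of v] cv(1) unfolding N_def W_def by auto
            finally show ?thesis using True unfolding v_def by simp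
          qed
          finally show ?thesis .
        qed
        have "gc c \<in> quadratic_annihilator"
          unfolding quadratic_annihilator_def mem_Collect_eq
        proof (intro conjI ballI)
          have "z \<in> lists (V \<times> UNIV)" if "z \<in> keys (gc c)" for z
          proof -
            have "x (fst c @ z @ snd c) \<noteq> 0" using that lk[of z] by (auto simp: in_keys_iff split: if_splits)
            hence "fst c @ z @ snd c \<in> words d D" using funs_onD[OF xf] by blast
            thus ?thesis unfolding words_def by simp
          qed
          thus "gc c \<in> carrier TA" by auto
          show "length z = 2" if "z \<in> keys (gc c)" for z
            using that lk[of z] by (auto simp: in_keys_iff split: if_splits)
          show "good 0 (lookup (gc c))"
          proof (rule goodI, goal_cases)
            case (1 s i j k l t)
            show ?case using good_swap[OF xg ctxl(3) 1(2,3), of k l "snd c"] 1(1) unfolding lk by simp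
          next
            case (2 s i j k q t)
            show ?case using good_moment[OF xg ctxl(3) 2(2-4), of k "snd c"] 2(1) unfolding lk by (cases "t = []") simp_all
          qed
        qed
        thus "single (fst c) 1 * gc c * single (snd c) 1 \<in> J"
          using R by (intro Idl_context[OF J _ ctxl(1,2)]) blast
      qed
    qed
    finally show "x \<in> KJ" unfolding KJ_def W_def using xf by simp
  qed
  thus ?thesis using x unfolding KJ_def by blast
qed

end

lemma poly_of_image: "finite W \<Longrightarrow> poly_of W ` funs_on W = {f. keys f \<subseteq> W}"
proof
  assume W: "finite W"
  show "poly_of W ` funs_on W \<subseteq> {f. keys f \<subseteq> W}" using keys_poly_of[OF W] by auto
  show "{f. keys f \<subseteq> W} \<subseteq> poly_of W ` funs_on W"
  proof
    fix f :: "'a \<Rightarrow>\<^sub>0 rat" assume "f \<in> {f. keys f \<subseteq> W}"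
    hence f: "lookup f w = 0" if "w \<notin> W" for w using that by (auto simp: subset_iff in_keys_iff)
    have "f = poly_of W (lookup f)"
      by (rule poly_mapping_eqI) (use f in \<open>auto simp: lookup_poly_of[OF W]\<close>)
    moreover have "lookup f \<in> funs_on W" unfolding funs_on_def using f by blast
    ultimately show "f \<in> poly_of W ` funs_on W" by blast
  qed
qed

section \<open>Dimensions of components, Poincare series and the pairing\<close>

definition weighted_len :: "('v \<Rightarrow> nat) \<Rightarrow> ('v \<Rightarrow>\<^sub>0 nat) \<Rightarrow> nat" where
  "weighted_len f d = (\<Sum>i\<in>keys d. lookup d i * f i)"

lemma weighted_len_superset:
  "finite A \<Longrightarrow> keys d \<subseteq> A \<Longrightarrow> weighted_len f d = (\<Sum>i\<in>A. lookup d i * f i)"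
  unfolding weighted_len_def by (rule sum.mono_neutral_left) (auto simp: in_keys_iff)

lemma weighted_len_add: "weighted_len f (d + e) = weighted_len f d + weighted_len f e"
proof -
  define A where "A = keys d \<union> keys e"
  have A: "finite A" "keys d \<subseteq> A" "keys e \<subseteq> A" "keys (d + e) \<subseteq> A"
    using keys_add[of d e] unfolding A_def by auto
  show ?thesis
    unfolding weighted_len_superset[OF A(1,2)] weighted_len_superset[OF A(1,3)] weighted_len_superset[OF A(1,4)]
    by (simp add: lookup_add sum.distrib distrib_right)
qed

lemma weighted_len_weight: "weighted_len f (weight w) = (\<Sum>x\<leftarrow>w. f (fst x))"
proof (induction w)
  case (Cons x w)
  have "weighted_len f (single (fst x) 1) = f (fst x)" by (simp add: weighted_len_def)
  thus ?case using Cons by (simp add: weight_Cons weighted_len_add)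
qed (simp add: weighted_len_def)

context coloured
begin

lemma component_dims:
  assumes J: "ideal J TA" and K: "K = {x \<in> funs_on (words d D). poly_of (words d D) x \<in> J}"
    and T: "T = {f. keys f \<subseteq> words d D}"
  shows "vectorspace.dim class_ring ((quotient_algebra TA J)\<lparr>carrier := (\<lambda>f. J +>\<^bsub>TA\<^esub> f) ` T\<rparr>) = card (words d D) - fs.dim K"
    and "vectorspace.dim class_ring (dual_space ((quotient_algebra TA J)\<lparr>carrier := (\<lambda>f. J +>\<^bsub>TA\<^esub> f) ` T\<rparr>)) = card (words d D) - fs.dim K"
    and "fs.dim K \<le> card (words d D)"
proof -
  have Wl: "words d D \<subseteq> lists (V \<times> UNIV)" unfolding words_def by auto
  obtain C and \<psi> :: "(('v \<times> nat) list \<Rightarrow> rat) \<Rightarrow> _" where c: "coordinates ((quotient_algebra TA J)\<lparr>carrier := (\<lambda>f. J +>\<^bsub>TA\<^esub> f) ` T\<rparr>) C \<psi>"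
    and card: "card C + fs.dim K = card (words d D)"
    using quotient_coordinates(2)[OF J finite_words Wl, of T] T K poly_of_image[OF finite_words, of d D] by auto
  show "vectorspace.dim class_ring ((quotient_algebra TA J)\<lparr>carrier := (\<lambda>f. J +>\<^bsub>TA\<^esub> f) ` T\<rparr>) = card (words d D) - fs.dim K"
    and "vectorspace.dim class_ring (dual_space ((quotient_algebra TA J)\<lparr>carrier := (\<lambda>f. J +>\<^bsub>TA\<^esub> f) ` T\<rparr>)) = card (words d D) - fs.dim K"
    and "fs.dim K \<le> card (words d D)"
    using coordinates.dim_eq[OF c] coordinates.dim_dual[OF c] card by simp_all
qed

lemma component_zero:
  assumes J: "ideal J TA" and T: "T = {f. keys f \<subseteq> {}}"
  shows "vectorspace.dim class_ring ((quotient_algebra TA J)\<lparr>carrier := (\<lambda>f. J +>\<^bsub>TA\<^esub> f) ` T\<rparr>) = 0"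
    and "vectorspace.dim class_ring (dual_space ((quotient_algebra TA J)\<lparr>carrier := (\<lambda>f. J +>\<^bsub>TA\<^esub> f) ` T\<rparr>)) = 0"
proof -
  obtain C and \<psi> :: "(('v \<times> nat) list \<Rightarrow> rat) \<Rightarrow> _" where c: "coordinates ((quotient_algebra TA J)\<lparr>carrier := (\<lambda>f. J +>\<^bsub>TA\<^esub> f) ` T\<rparr>) C \<psi>"
    and card: "card C = 0"
    using quotient_coordinates(2)[OF J finite.emptyI empty_subsetI, of T] T poly_of_image[OF finite.emptyI, where 'a = "('v \<times> nat) list"] by auto
  show "vectorspace.dim class_ring ((quotient_algebra TA J)\<lparr>carrier := (\<lambda>f. J +>\<^bsub>TA\<^esub> f) ` T\<rparr>) = 0"
    and "vectorspace.dim class_ring (dual_space ((quotient_algebra TA J)\<lparr>carrier := (\<lambda>f. J +>\<^bsub>TA\<^esub> f) ` T\<rparr>)) = 0"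
    using coordinates.dim_eq[OF c] coordinates.dim_dual[OF c] card by simp_all
qed

end

text \<open>In weight \<open>d\<close> only the degrees \<open>- (2 * D + M)\<close> occur. Their
  signs all equal \<open>(- 1) ^ M\<close>, and two steps in degree are one step in
  \<open>D\<close>, hence the composition with \<open>fps_X ^ 2\<close>.\<close>

lemma poincare_coefficients:
  assumes h: "\<And>D. vectorspace.dim class_ring (V d (- int (2 * D + M))) = h D"
    and z: "\<And>n. (\<And>D. n \<noteq> int (2 * D + M)) \<Longrightarrow> vectorspace.dim class_ring (V d (- n)) = 0"
  shows "poincare_series V d = fps_to_fls (fps_const ((- 1) ^ M) * fps_X ^ M * (Abs_fps (\<lambda>D. of_nat (h D)) oo fps_X ^ 2))"
proof (rule fls_eqI)
  fix n :: int
  have v: "(- 1) powi n * rat_of_nat (vectorspace.dim class_ring (V d (- n))) = 0" if "n < 0" for n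
    using z[of n] that by simp
  have "\<forall>\<^sub>\<infinity>k. (- 1) powi (- int k) * rat_of_nat (vectorspace.dim class_ring (V d (- (- int k)))) = 0"
    unfolding MOST_nat by (intro exI[of _ 0] allI impI v) simp
  hence "fls_nth (poincare_series V d) n = (- 1) powi n * of_nat (vectorspace.dim class_ring (V d (- n)))"
    unfolding poincare_series_def by (rule nth_Abs_fls)
  also have "\<dots> = fls_nth (fps_to_fls (fps_const ((- 1) ^ M) * fps_X ^ M * (Abs_fps (\<lambda>D. of_nat (h D)) oo fps_X ^ 2))) n"
  proof (cases "\<exists>D. n = int (2 * D + M)")
    case True
    then obtain D where n: "n = int (2 * D + M)" by blast
    have "(- 1 :: rat) powi n = (- 1) ^ M" unfolding n power_int_of_nat by (simp add: power_add power_mult)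
    thus ?thesis unfolding n h by (simp add: mult.assoc fps_X_power_mult_nth fps_nth_compose_X_power nat_add_distrib nat_mult_distrib)
  next
    case False
    have "\<not> 2 dvd (nat n - M)" if "n \<ge> 0" "M \<le> nat n"
    proof
      assume "2 dvd (nat n - M)"
      then obtain D where "nat n - M = 2 * D" by blast
      hence "n = int (2 * D + M)" using that by linarith
      thus False using False by blast
    qed
    hence "fls_nth (fps_to_fls (fps_const ((- 1 :: rat) ^ M) * fps_X ^ M * (Abs_fps (\<lambda>D. of_nat (h D)) oo fps_X ^ 2))) n = 0"
      by (auto simp: mult.assoc fps_X_power_mult_nth fps_nth_compose_X_power)
    thus ?thesis using z[of n] False by auto
  qed
  finally show "fls_nth (poincare_series V d) n = \<dots>" .
qed

lemma pairing_eq: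
  "pairing Q g f = (\<Sum>u\<in>keys g. lookup g u * ((- 1) ^ num_arrows Q (fst (hd u)) (fst (hd u))) * lookup f u)"
  unfolding pairing_def
proof (rule sum.cong[OF refl])
  fix u
  have "(\<Sum>w\<in>keys f. lookup g u * lookup f w * word_pairing Q u w)
    = (\<Sum>w\<in>keys f. if u = w then lookup g u * lookup f u * (- 1) ^ num_arrows Q (fst (hd u)) (fst (hd u)) else 0)"
    unfolding word_pairing_def by (rule sum.cong) auto
  also have "\<dots> = lookup g u * ((- 1) ^ num_arrows Q (fst (hd u)) (fst (hd u))) * lookup f u"
    by (simp add: not_in_keys_iff_lookup_eq_zero)
  finally show "(\<Sum>w\<in>keys f. lookup g u * lookup f w * word_pairing Q u w) = \<dots>" .
qed

lemma pairing_linear: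
  "pairing Q g (f + f') = pairing Q g f + pairing Q g f'" "pairing Q g (f - f') = pairing Q g f - pairing Q g f'"
  "pairing Q g 0 = 0" "pairing Q g (Poly_Mapping.map ((*) c) f) = c * pairing Q g f"
  unfolding pairing_eq
  by (simp_all add: lookup_add lookup_minus distrib_left right_diff_distrib sum.distrib sum_subtractf map_scale_eq_mult lookup_prepend(1)[where u = "[]", simplified] zero_list_def sum_distrib_left mult.left_commute[of c] mult.assoc)

lemma pairing_sum: "pairing Q g (\<Sum>i\<in>A. f i) = (\<Sum>i\<in>A. pairing Q g (f i))"
  by (induction A rule: infinite_finite_induct) (simp_all add: pairing_linear)

lemma pairing_single:
  "pairing Q g (single u c) = lookup g u * (- 1) ^ num_arrows Q (fst (hd u)) (fst (hd u)) * c"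
proof -
  have "pairing Q g (single u c)
    = (\<Sum>w\<in>keys g. if w = u then lookup g u * (- 1) ^ num_arrows Q (fst (hd u)) (fst (hd u)) * c else 0)"
    unfolding pairing_eq by (rule sum.cong) (auto simp: lookup_single when_def)
  thus ?thesis by (simp add: not_in_keys_iff_lookup_eq_zero)
qed

section \<open>Quivers\<close>

locale finite_symmetric_quiver =
  fixes Q :: "('v, 'e) pre_digraph"
  assumes fin: "fin_digraph Q" and sym: "symmetric_quiver Q"
begin

abbreviation m :: "'v \<Rightarrow> 'v \<Rightarrow> nat" where "m \<equiv> num_arrows Q"

lemma coloured_Q:
  assumes "\<And>i j. \<epsilon> i j = \<epsilon> j i" "\<And>i j. \<epsilon> i j * \<epsilon> i j = 1"
  shows "coloured (verts Q) m \<epsilon>"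
proof
  show "finite (verts Q)" by (rule fin_digraph.finite_verts[OF fin])
  show "m i j = m j i" if "i \<in> verts Q" "j \<in> verts Q" for i j using sym that unfolding symmetric_quiver_def by blast
qed (use assms in auto)

sublocale A: coloured "verts Q" m "\<lambda>i j. (- 1) ^ (m i i * m j j)"
  by (rule coloured_Q) (simp_all add: mult.commute flip: power_mult_distrib)

text \<open>The pairing contributes the sign \<open>(-1)\<^sup>m\<close> with \<open>m = m\<^sub>i\<^sub>i\<close> of the first letter, hence the functions
  annihilated by the relations satisfy this sign rule instead of that of \<open>A\<close>.\<close>

sublocale B: coloured "verts Q" m "\<lambda>i j. (- 1) ^ (m i i + m j j + m i i * m j j)"
  by (rule coloured_Q) (simp_all add: mult.commute add.commute flip: power_mult_distrib)

text \<open>Multiplication by this sign interchanges the two sign rules.\<close>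

fun sgn_word :: "'v list \<Rightarrow> rat" where
  "sgn_word [] = 1"
| "sgn_word (i # w) = (- 1) ^ (length w * m i i) * sgn_word w"

lemma sgn_word_sq: "sgn_word w * sgn_word w = 1"
proof (induction w)
  case (Cons i w)
  have "sgn_word (i # w) * sgn_word (i # w) = ((- 1) ^ (length w * m i i) * (- 1) ^ (length w * m i i)) * (sgn_word w * sgn_word w)"
    by (simp add: mult_ac)
  also have "\<dots> = 1" by (simp add: Cons flip: power_mult_distrib)
  finally show ?case .
qed simp

text \<open>Each letter is weighted by the number of letters after it; the exchange changes this
  number by one for \<open>i\<close> and for \<open>j\<close> and for no other letter.\<close>

lemma sgn_word_swap: "sgn_word (s @ i # j # t) = (- 1) ^ (m i i + m j j) * sgn_word (s @ j # i # t)"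
proof (induction s)
  case Nil
  have "(- 1 :: rat) ^ m i i * (- 1) ^ m i i = 1" "(- 1 :: rat) ^ m j j * (- 1) ^ m j j = 1" by (simp_all flip: power_mult_distrib)
  thus ?case by (simp add: power_add algebra_simps)
qed (simp add: mult.left_commute)

lemma B_good_of_A_good:
  assumes x: "A.good p x"
  shows "B.good p (\<lambda>w. sgn_word (map fst w) * x w)"
proof (rule B.goodI, goal_cases)
  case (1 s i j k l t)
  show ?case using A.good_swap[OF x 1, of k l t] sgn_word_swap[of "map fst s" i j "map fst t"]
    by (simp add: power_add)
next
  case (2 s i j k q t)
  have "(\<Sum>l\<le>k. of_nat ((k - l) choose q) * (sgn_word (map fst (s @ (i, l) # (j, k - l) # t)) * x (s @ (i, l) # (j, k - l) # t)))
    = sgn_word (map fst s @ i # j # map fst t) * (\<Sum>l\<le>k. of_nat ((k - l) choose q) * x (s @ (i, l) # (j, k - l) # t))"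
    by (simp add: sum_distrib_left mult.left_commute)
  thus ?case using A.good_moment[OF x 2, of k t] by simp
qed

lemma A_good_of_B_good:
  assumes x: "B.good p x"
  shows "A.good p (\<lambda>w. sgn_word (map fst w) * x w)"
proof (rule A.goodI, goal_cases)
  case (1 s i j k l t)
  have "(- 1 :: rat) ^ m i i * (- 1) ^ m i i = 1" "(- 1 :: rat) ^ m j j * (- 1) ^ m j j = 1" by (simp_all flip: power_mult_distrib)
  thus ?case using B.good_swap[OF x 1, of k l t] sgn_word_swap[of "map fst s" i j "map fst t"]
    by (simp add: power_add algebra_simps)
next
  case (2 s i j k q t)
  have "(\<Sum>l\<le>k. of_nat ((k - l) choose q) * (sgn_word (map fst (s @ (i, l) # (j, k - l) # t)) * x (s @ (i, l) # (j, k - l) # t)))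
    = sgn_word (map fst s @ i # j # map fst t) * (\<Sum>l\<le>k. of_nat ((k - l) choose q) * x (s @ (i, l) # (j, k - l) # t))"
    by (simp add: sum_distrib_left mult.left_commute)
  thus ?case using B.good_moment[OF x 2, of k t] by simp
qed

text \<open>Multiplication by \<open>sgn_word\<close> is an involution that exchanges the two
  solution spaces. The recursion for the sign rule \<open>B\<close> may thus be used with the
  dimensions of the algebra.\<close>

lemma HA_eq: "A.HA d D = B.HA d D"
proof -
  define \<phi> where "\<phi> = (\<lambda>(x :: ('v \<times> nat) list \<Rightarrow> rat) w. sgn_word (map fst w) * x w)"
  have inv: "\<phi> (\<phi> x) = x" for x unfolding \<phi>_def by (simp add: fun_eq_iff sgn_word_sq flip: mult.assoc)
  have fun': "\<phi> x \<in> funs_on W" if "x \<in> funs_on W" for x W using that unfolding \<phi>_def funs_on_def by auto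
  have to_B: "\<phi> x \<in> B.Yspace d D {}" if "x \<in> A.Yspace d D {}" for x
    using that fun'[of x] B_good_of_A_good unfolding A.Yspace_def B.Yspace_def \<phi>_def by auto
  have to_A: "\<phi> x \<in> A.Yspace d D {}" if "x \<in> B.Yspace d D {}" for x
    using that fun'[of x] A_good_of_B_good unfolding A.Yspace_def B.Yspace_def \<phi>_def by auto
  have "\<phi> ` A.Yspace d D {} = B.Yspace d D {}"
  proof (intro subset_antisym image_subsetI to_B subsetI)
    fix x assume "x \<in> B.Yspace d D {}"
    from imageI[OF to_A[OF this], of \<phi>] show "x \<in> \<phi> ` A.Yspace d D {}" unfolding inv .
  qed
  moreover have "fs.dim (\<phi> ` A.Yspace d D {}) = fs.dim (A.Yspace d D {})"
  proof (rule dim_inj_image[OF A.finite_words A.subspace_Yspace A.Yspace_funs])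
    have "\<phi> 0 = 0" unfolding \<phi>_def by (simp add: fun_eq_iff)
    thus "f = 0" if "\<phi> f = 0" for f using inv[of f] that by simp
  qed (simp_all add: \<phi>_def fun_eq_iff fscale_apply algebra_simps)
  ultimately show ?thesis unfolding A.HA_def B.HA_def by simp
qed

lemma relations_eq: "relations Q = A.quadratic_relations"
proof -
  have "(\<Sum>(k1, k2)\<in>{(k1, k2). k1 + k2 = k}. single [(i, k1), (j, k2)] (of_nat (k2 choose p) :: rat))
    = (\<Sum>l\<le>k. single [(i, l), (j, k - l)] (of_nat ((k - l) choose p)))" for i j :: 'v and k p
    by (rule sum.reindex_bij_witness[where i = "\<lambda>l. (l, k - l)" and j = fst]) auto
  thus ?thesis unfolding relations_def A.quadratic_relations_def by simp
qed

lemma A_relations_carrier: "relations Q \<subseteq> carrier A.TA"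
  unfolding relations_eq by (rule A.quadratic_relations_carrier)

lemma gens_eq: "quiver_tensors Q = A.TA" unfolding gens_def ..

lemma span_minimal:
  assumes R: "relations Q \<subseteq> N" and N: "N \<subseteq> carrier A.TA" "0 \<in> N" "\<And>f g. f \<in> N \<Longrightarrow> g \<in> N \<Longrightarrow> f + g \<in> N"
    "\<And>c f. f \<in> N \<Longrightarrow> Poly_Mapping.map ((*) c) f \<in> N"
  shows "relation_space Q \<subseteq> N"
  unfolding relation_space_def gens_eq
proof (rule LinearCombinations.module.span_is_subset[OF tensor_algebra_module R])
  show "LinearCombinations.submodule class_ring N A.TA"
    using N by (intro LinearCombinations.submodule.intro tensor_algebra_module) simp_all
qed

lemma relations_subset: "relations Q \<subseteq> relation_space Q" "relation_space Q \<subseteq> carrier A.TA"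
  unfolding relation_space_def gens_eq
  using LinearCombinations.module.in_own_span[OF tensor_algebra_module A_relations_carrier]
    LinearCombinations.module.span_is_subset2[OF tensor_algebra_module A_relations_carrier] by blast+

lemma relation_space_ideal:
  assumes J: "ideal J A.TA" and R: "relations Q \<subseteq> J"
  shows "relation_space Q \<subseteq> J"
proof -
  interpret J: ideal J A.TA by fact
  show ?thesis
  proof (rule span_minimal[OF R])
    show "J \<subseteq> carrier A.TA" by (rule J.a_subset)
    show "0 \<in> J" using additive_subgroup.zero_closed[OF J.is_additive_subgroup] by simp
    show "f + g \<in> J" if "f \<in> J" "g \<in> J" for f g
      using additive_subgroup.a_closed[OF J.is_additive_subgroup that] by simp
    show "Poly_Mapping.map ((*) c) f \<in> J" if "f \<in> J" for c f by (rule ideal_scale_closed[OF J that])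
  qed
qed

text \<open>The two words of a commutation relation start with different letters, so the pairing
  changes their relative sign by \<open>(- 1) ^ (m i i + m j j)\<close>. In a moment relation all
  words start with the same colour and the sign is a common factor.\<close>

lemma annihilator_eq: "annihilator Q = B.quadratic_annihilator"
proof (intro subset_antisym subsetI)
  fix g assume g: "g \<in> annihilator Q"
  have gc: "g \<in> carrier A.TA" "\<And>w. w \<in> keys g \<Longrightarrow> length w = 2"
    and p0: "\<And>f. f \<in> relations Q \<Longrightarrow> pairing Q g f = 0"
    using g relations_subset(1) unfolding annihilator_def tensor_square_def gens_eq by auto
  have l0: "lookup g (s @ a # b # t) = 0" if "s @ t \<noteq> []" for s a b t
    using gc(2)[of "s @ a # b # t"] that by (auto simp: in_keys_iff)
  have "B.good 0 (lookup g)"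
  proof (rule B.goodI, goal_cases)
    case (1 s i j k l t)
    show ?case
    proof (cases "t = []")
      case True
      have "single [(i, k), (j, l)] 1 - single [(j, l), (i, k)] ((- 1) ^ (m i i * m j j)) \<in> relations Q"
        using 1 unfolding relations_eq A.quadratic_relations_def by blast
      from p0[OF this] have e: "lookup g [(i, k), (j, l)] * (- 1) ^ m i i = lookup g [(j, l), (i, k)] * (- 1) ^ m j j * (- 1) ^ (m i i * m j j)"
        by (simp add: pairing_linear pairing_single)
      have "(- 1 :: rat) ^ m i i * (- 1) ^ m i i = 1" by (simp flip: power_mult_distrib)
      hence "lookup g [(i, k), (j, l)] = (lookup g [(i, k), (j, l)] * (- 1) ^ m i i) * (- 1) ^ m i i"
        by (simp add: mult.assoc)
      also have "\<dots> = (- 1) ^ (m i i + m j j + m i i * m j j) * lookup g [(j, l), (i, k)]"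
        unfolding e by (simp add: power_add mult_ac)
      finally show ?thesis using True 1 by simp
    qed (simp add: l0)
  next
    case (2 s i j k q t)
    show ?case
    proof (cases "t = []")
      case True
      have "(\<Sum>l\<le>k. single [(i, l), (j, k - l)] (of_nat ((k - l) choose q))) \<in> relations Q"
        using 2 unfolding relations_eq A.quadratic_relations_def by blast
      from p0[OF this] have "(- 1) ^ m i i * (\<Sum>l\<le>k. of_nat ((k - l) choose q) * lookup g [(i, l), (j, k - l)]) = 0"
        by (simp add: pairing_sum pairing_single sum_distrib_left mult_ac)
      thus ?thesis using True 2 by simp
    qed (simp add: l0)
  qed
  thus "g \<in> B.quadratic_annihilator" unfolding B.quadratic_annihilator_def using gc by blast
next
  fix g assume g: "g \<in> B.quadratic_annihilator"
  have gc: "g \<in> carrier A.TA" "\<And>w. w \<in> keys g \<Longrightarrow> length w = 2" and gg: "B.good 0 (lookup g)"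
    using g unfolding B.quadratic_annihilator_def by auto
  have "relation_space Q \<subseteq> {f \<in> carrier A.TA. pairing Q g f = 0}"
  proof (rule span_minimal)
    show "relations Q \<subseteq> {f \<in> carrier A.TA. pairing Q g f = 0}"
    proof
      fix f assume f: "f \<in> relations Q"
      then consider i j k l where "i \<in> verts Q" "j \<in> verts Q" "f = single [(i, k), (j, l)] 1 - single [(j, l), (i, k)] ((- 1) ^ (m i i * m j j))"
        | i j k q where "i \<in> verts Q" "j \<in> verts Q" "q < m i j" "f = (\<Sum>l\<le>k. single [(i, l), (j, k - l)] (of_nat ((k - l) choose q)))"
        unfolding relations_eq A.quadratic_relations_def by blast
      hence "pairing Q g f = 0"
      proof cases
        case 1
        have e: "(- 1 :: rat) ^ m i i * (- 1) ^ m i i = 1" by (simp flip: power_mult_distrib)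
        have "lookup g [(i, k), (j, l)] * (- 1) ^ m i i
          = ((- 1) ^ m i i * (- 1) ^ m i i) * ((- 1) ^ m j j * (- 1) ^ (m i i * m j j) * lookup g [(j, l), (i, k)])"
          using B.good_swap[OF gg, of "[]" i j k l "[]"] 1(1,2) by (simp add: power_add mult_ac)
        thus ?thesis unfolding 1(3) e by (simp add: pairing_linear pairing_single mult_ac)
      next
        case 2
        have "pairing Q g f = (- 1) ^ m i i * (\<Sum>l\<le>k. of_nat ((k - l) choose q) * lookup g [(i, l), (j, k - l)])"
          unfolding 2(4) by (simp add: pairing_sum pairing_single sum_distrib_left mult_ac)
        also have "\<dots> = 0" using B.good_moment[OF gg, of "[]" i j q k "[]"] 2(1-3) by simp
        finally show ?thesis .
      qed
      thus "f \<in> {f \<in> carrier A.TA. pairing Q g f = 0}" using f A_relations_carrier by blast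
    qed
    show "f + f' \<in> {f \<in> carrier A.TA. pairing Q g f = 0}" if "f \<in> {f \<in> carrier A.TA. pairing Q g f = 0}" "f' \<in> {f \<in> carrier A.TA. pairing Q g f = 0}" for f f'
    proof -
      interpret ring A.TA by (rule tensor_algebra_ring)
      show ?thesis using that a_closed[of f f'] by (simp add: pairing_linear)
    qed
    show "Poly_Mapping.map ((*) c) f \<in> {f \<in> carrier A.TA. pairing Q g f = 0}" if "f \<in> {f \<in> carrier A.TA. pairing Q g f = 0}" for c f
      using that keys_map_scale[of c f] by (auto simp: pairing_linear)
  qed (auto simp: pairing_linear)
  thus "g \<in> annihilator Q" unfolding annihilator_def tensor_square_def gens_eq using gc by blast
qed

text \<open>The part of the cohomological degree that depends on the weight alone.\<close>

definition M :: "('v \<Rightarrow>\<^sub>0 nat) \<Rightarrow> nat" where "M = weighted_len (\<lambda>i. m i i)"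

lemma M_add: "M (d + e) = M d + M e" unfolding M_def by (rule weighted_len_add)

lemma sum_deg:
  "(\<Sum>x\<leftarrow>w. deg_a Q x) = - int (2 * total w + M (weight w))"
  "(\<Sum>x\<leftarrow>w. deg_b Q x) = int (2 * total w + (M (weight w) + length w))"
  unfolding M_def weighted_len_weight by (induction w) (auto simp: deg_a_def deg_b_def)

lemma tensor_component_keys:
  "tensor_component Q \<delta> d n = {f. keys f \<subseteq> {w \<in> lists (verts Q \<times> UNIV). weight w = d \<and> (\<Sum>x\<leftarrow>w. \<delta> x) = n}}"
  unfolding tensor_component_def gens_eq by auto

lemma tensor_component_a:
  "tensor_component Q (deg_a Q) d (- int (2 * D + M d)) = {f. keys f \<subseteq> A.words d D}"
  "(\<And>D. n \<noteq> int (2 * D + M d)) \<Longrightarrow> tensor_component Q (deg_a Q) d (- n) = {f. keys f \<subseteq> {}}"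
proof -
  have "{w \<in> lists (verts Q \<times> UNIV). weight w = d \<and> (\<Sum>x\<leftarrow>w. deg_a Q x) = - int (2 * D + M d)} = A.words d D"
    unfolding sum_deg A.words_def by auto
  thus "tensor_component Q (deg_a Q) d (- int (2 * D + M d)) = {f. keys f \<subseteq> A.words d D}"
    unfolding tensor_component_keys by simp
  assume n: "\<And>D. n \<noteq> int (2 * D + M d)"
  have "{w \<in> lists (verts Q \<times> UNIV). weight w = d \<and> (\<Sum>x\<leftarrow>w. deg_a Q x) = - n} = {}"
  proof -
    have "\<not> (weight w = d \<and> (\<Sum>x\<leftarrow>w. deg_a Q x) = - n)" for w using n[of "total w"] by (auto simp: sum_deg)
    thus ?thesis by blast
  qed
  thus "tensor_component Q (deg_a Q) d (- n) = {f. keys f \<subseteq> {}}"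
    unfolding tensor_component_keys by (simp only:)
qed

lemma tensor_component_b:
  "tensor_component Q (deg_b Q) d (int (2 * D + (M d + len d))) = {f. keys f \<subseteq> A.words d D}"
  "(\<And>D. n \<noteq> int (2 * D + (M d + len d))) \<Longrightarrow> tensor_component Q (deg_b Q) d n = {f. keys f \<subseteq> {}}"
proof -
  have "{w \<in> lists (verts Q \<times> UNIV). weight w = d \<and> (\<Sum>x\<leftarrow>w. deg_b Q x) = int (2 * D + (M d + len d))} = A.words d D"
    unfolding sum_deg A.words_def by (auto simp: len_weight)
  thus "tensor_component Q (deg_b Q) d (int (2 * D + (M d + len d))) = {f. keys f \<subseteq> A.words d D}"
    unfolding tensor_component_keys by simp
  assume n: "\<And>D. n \<noteq> int (2 * D + (M d + len d))"
  have "{w \<in> lists (verts Q \<times> UNIV). weight w = d \<and> (\<Sum>x\<leftarrow>w. deg_b Q x) = n} = {}"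
  proof -
    have "\<not> (weight w = d \<and> (\<Sum>x\<leftarrow>w. deg_b Q x) = n)" for w
      using n[of "total w"] by (auto simp: sum_deg len_weight)
    thus ?thesis by blast
  qed
  thus "tensor_component Q (deg_b Q) d n = {f. keys f \<subseteq> {}}"
    unfolding tensor_component_keys by (simp only:)
qed

lemma poincare_quiver_algebra:
  "poincare_series (quiver_algebra_graded Q) d
    = fps_to_fls (fps_const ((- 1) ^ M d) * fps_X ^ M d * (Abs_fps (\<lambda>D. of_nat (A.HA d D)) oo fps_X ^ 2))"
proof (rule poincare_coefficients)
  interpret ring A.TA by (rule tensor_algebra_ring)
  have J: "ideal (Idl\<^bsub>A.TA\<^esub> (relation_space Q)) A.TA" by (rule genideal_ideal[OF relations_subset(2)])
  have R: "relations Q \<subseteq> Idl\<^bsub>A.TA\<^esub> (relation_space Q)"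
    using relations_subset genideal_self[OF relations_subset(2)] by blast
  have S: "relation_space Q \<subseteq> A.ideal_of A.Kspace"
    by (rule relation_space_ideal[OF A.ideal_ideal_of[OF A.stable_Kspace]])
      (use A.quadratic_relations_ideal relations_eq in simp)
  have "{x \<in> funs_on (A.words d D). poly_of (A.words d D) x \<in> Idl\<^bsub>A.TA\<^esub> (relation_space Q)} = A.Kspace d D" for D
    by (rule A.ideal_component[OF A.stable_Kspace S A.Kspace_Idl[OF J R[unfolded relations_eq]]])
  note K = this[symmetric]
  show "vectorspace.dim class_ring (quiver_algebra_graded Q d (- int (2 * D + M d))) = A.HA d D" for D
    unfolding quiver_algebra_graded_def quiver_algebra_def gens_eq A.component_dims(1)[OF J K tensor_component_a(1)]
    using dim_perp[OF A.finite_words A.subspace_Yspace A.Yspace_funs, of d D "{}"] unfolding A.Kspace_def A.HA_def by simp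
  show "vectorspace.dim class_ring (quiver_algebra_graded Q d (- n)) = 0" if "\<And>D. n \<noteq> int (2 * D + M d)" for n
    unfolding quiver_algebra_graded_def quiver_algebra_def gens_eq
    by (rule A.component_zero(1)[OF J tensor_component_a(2)[OF that]])
qed

text \<open>Generators of the dual have positive degree; the graded dual negates it, which gives
  nonnegative powers again. The shift by one per letter accounts for \<open>len d\<close>.\<close>

lemma poincare_koszul_dual:
  "poincare_series (graded_dual (koszul_dual_algebra_graded Q)) d
    = fps_to_fls (fps_const ((- 1) ^ (M d + len d)) * fps_X ^ (M d + len d) * (Abs_fps (\<lambda>D. of_int (B.HK d D)) oo fps_X ^ 2))"
proof -
  interpret ring A.TA by (rule tensor_algebra_ring)
  have c: "annihilator Q \<subseteq> carrier A.TA" unfolding annihilator_eq B.quadratic_annihilator_def by blast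
  have J: "ideal (Idl\<^bsub>A.TA\<^esub> (annihilator Q)) A.TA" by (rule genideal_ideal[OF c])
  have R: "B.quadratic_annihilator \<subseteq> Idl\<^bsub>A.TA\<^esub> (annihilator Q)"
    using genideal_self[OF c] unfolding annihilator_eq .
  have S: "annihilator Q \<subseteq> B.ideal_of B.Ispace"
    unfolding annihilator_eq by (rule B.quadratic_annihilator_ideal)
  have "{x \<in> funs_on (A.words d D). poly_of (A.words d D) x \<in> Idl\<^bsub>A.TA\<^esub> (annihilator Q)} = B.Ispace d D" for D
    by (rule B.ideal_component[OF B.stable_Ispace S B.Ispace_Idl[OF J R]])
  note K = this[symmetric]
  define h where "h = (\<lambda>D. card (A.words d D) - fs.dim (B.Ispace d D))"
  have h: "rat_of_int (B.HK d D) = of_nat (h D)" for D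
    unfolding h_def B.HK_def using A.component_dims(3)[OF J K refl, of D] by (simp add: of_nat_diff)
  have neg: "- (- n) = n" for n :: int by simp
  show ?thesis unfolding h
  proof (rule poincare_coefficients)
    show "vectorspace.dim class_ring (graded_dual (koszul_dual_algebra_graded Q) d (- int (2 * D + (M d + len d)))) = h D" for D
      unfolding graded_dual_def neg koszul_dual_algebra_graded_def koszul_dual_algebra_def gens_eq h_def
      by (rule A.component_dims(2)[OF J K tensor_component_b(1)])
    show "vectorspace.dim class_ring (graded_dual (koszul_dual_algebra_graded Q) d (- n)) = 0" if "\<And>D. n \<noteq> int (2 * D + (M d + len d))" for n
      unfolding graded_dual_def neg koszul_dual_algebra_graded_def koszul_dual_algebra_def gens_eq
      by (rule A.component_zero(2)[OF J tensor_component_b(2)[OF that]])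
  qed
qed

lemma ps_mult_eq_one:
  "ps_mult (poincare_series (quiver_algebra_graded Q))
     (ps_rescale fls_X_inv (poincare_series (graded_dual (koszul_dual_algebra_graded Q)))) = ps_one"
proof
  fix d :: "'v \<Rightarrow>\<^sub>0 nat"
  define a where "a = (\<lambda>d. Abs_fps (\<lambda>D. rat_of_nat (A.HA d D)))"
  define b where "b = (\<lambda>d. Abs_fps (\<lambda>D. rat_of_int (B.G d D)))"
  define \<Delta> where "\<Delta> = {(d1, d2). d1 + d2 = d}"
  have fin\<Delta>: "finite \<Delta>" unfolding \<Delta>_def by (rule finite_add_decompositions)
  have b: "fps_const ((- 1) ^ len e) * Abs_fps (\<lambda>D. rat_of_int (B.HK e D)) = b e" for e
    unfolding b_def B.G_def by (rule fps_ext) simp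
  \<comment> \<open>The rescaling removes the power \<open>fls_X ^ len e\<close> that stems from the
    degree shift, and the sign \<open>(- 1) ^ len e\<close> is absorbed into
    \<open>B.G\<close>.\<close>
  have K: "ps_rescale fls_X_inv (poincare_series (graded_dual (koszul_dual_algebra_graded Q))) e
    = fps_to_fls (fps_const ((- 1) ^ M e) * fps_X ^ M e * (b e oo fps_X ^ 2))" for e
  proof -
    have "fps_const ((- 1) ^ (M e + len e)) * fps_X ^ (M e + len e) * (Abs_fps (\<lambda>D. of_int (B.HK e D)) oo fps_X ^ 2)
      = fps_X ^ len e * (fps_const ((- 1) ^ M e) * fps_X ^ M e * (fps_const ((- 1 :: rat) ^ len e) * (Abs_fps (\<lambda>D. of_int (B.HK e D)) oo fps_X ^ 2)))"
      by (simp add: power_add mult_ac flip: fps_const_mult)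
    also have "fps_const ((- 1) ^ len e) * (Abs_fps (\<lambda>D. rat_of_int (B.HK e D)) oo fps_X ^ 2) = b e oo fps_X ^ 2"
      unfolding b[symmetric] by (simp add: fps_compose_mult_distrib)
    finally have "poincare_series (graded_dual (koszul_dual_algebra_graded Q)) e
      = fls_X ^ len e * fps_to_fls (fps_const ((- 1) ^ M e) * fps_X ^ M e * (b e oo fps_X ^ 2))"
      unfolding poincare_koszul_dual by (simp add: fls_times_fps_to_fls fps_to_fls_power)
    moreover have "fls_X_inv ^ len e * fls_X ^ len e = (1 :: rat fls)"
      unfolding fls_X_inv_power_times_conv_shift(1) fls_X_power_conv_shift_1 by simp
    ultimately show ?thesis unfolding ps_rescale_def len_def[symmetric] by (simp flip: mult.assoc)
  qed
  \<comment> \<open>\<open>M\<close> is additive, so the sign and the power of \<open>fps_X\<close>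
    are the same for all splittings of \<open>d\<close> and can be taken out of the sum.\<close>
  have prod: "poincare_series (quiver_algebra_graded Q) d1 * ps_rescale fls_X_inv (poincare_series (graded_dual (koszul_dual_algebra_graded Q))) d2
    = fps_to_fls (fps_const ((- 1) ^ M d) * fps_X ^ M d * ((a d1 * b d2) oo fps_X ^ 2))" if "(d1, d2) \<in> \<Delta>" for d1 d2
  proof -
    have d: "d = d1 + d2" using that unfolding \<Delta>_def by simp
    have "poincare_series (quiver_algebra_graded Q) d1 = fps_to_fls (fps_const ((- 1) ^ M d1) * fps_X ^ M d1 * (a d1 oo fps_X ^ 2))"
      unfolding a_def by (rule poincare_quiver_algebra)
    thus ?thesis unfolding K d M_add
      by (simp add: power_add fps_compose_mult_distrib mult_ac flip: fls_times_fps_to_fls fps_const_mult)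
  qed
  \<comment> \<open>Coefficientwise this is \<open>B.recursion\<close>, once \<open>HA_eq\<close>
    has brought both factors under the same sign rule.\<close>
  have "(\<Sum>(d1, d2)\<in>\<Delta>. a d1 * b d2) = (if d = 0 then 1 else 0)"
  proof (rule fps_ext)
    fix D
    have "fps_nth (\<Sum>(d1, d2)\<in>\<Delta>. a d1 * b d2) D = (\<Sum>(d1, d2)\<in>\<Delta>. \<Sum>i\<le>D. of_int (int (A.HA d1 i) * B.G d2 (D - i)))"
      unfolding fps_sum_nth by (rule sum.cong) (auto simp: fps_mult_nth a_def b_def atLeast0AtMost)
    also have "\<dots> = of_int (\<Sum>(e, i)\<in>\<Delta> \<times> {..D}. int (B.HA (fst e) i) * B.G (snd e) (D - i))"
      by (simp add: sum.cartesian_product HA_eq case_prod_beta)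
    also have "(\<Sum>(e, i)\<in>\<Delta> \<times> {..D}. int (B.HA (fst e) i) * B.G (snd e) (D - i))
      = (\<Sum>t\<in>splittings d D. int (B.HA (fst (fst t)) (snd (fst t))) * B.G (fst (snd t)) (snd (snd t)))"
      by (rule sum.reindex_bij_witness[where i = "\<lambda>t. ((fst (fst t), fst (snd t)), snd (fst t))"
            and j = "\<lambda>(e, i). ((fst e, i), (snd e, D - i))"]) (auto simp: splittings_def \<Delta>_def)
    also have "\<dots> = (if d = 0 \<and> D = 0 then 1 else 0)" by (rule B.recursion)
    finally show "fps_nth (\<Sum>(d1, d2)\<in>\<Delta>. a d1 * b d2) D = fps_nth (if d = 0 then 1 else 0) D" by simp
  qed
  note conv = this
  have lin: "(\<Sum>t\<in>S. fps_to_fls (c * (f t oo fps_X ^ 2))) = fps_to_fls (c * ((\<Sum>t\<in>S. f t) oo fps_X ^ 2))"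
    if "finite S" for S :: "(('v \<Rightarrow>\<^sub>0 nat) \<times> ('v \<Rightarrow>\<^sub>0 nat)) set" and c :: "rat fps" and f
    using that by (induction S) (simp_all add: fps_compose_add_distrib distrib_left)
  have "ps_mult (poincare_series (quiver_algebra_graded Q))
      (ps_rescale fls_X_inv (poincare_series (graded_dual (koszul_dual_algebra_graded Q)))) d
    = (\<Sum>t\<in>\<Delta>. fps_to_fls (fps_const ((- 1) ^ M d) * fps_X ^ M d * ((a (fst t) * b (snd t)) oo fps_X ^ 2)))"
    unfolding ps_mult_def \<Delta>_def[symmetric] by (rule sum.cong[OF refl]) (use prod in auto)
  also have "\<dots> = fps_to_fls (fps_const ((- 1) ^ M d) * fps_X ^ M d * ((if d = 0 then 1 else 0) oo fps_X ^ 2))"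
    unfolding lin[OF fin\<Delta>] using conv by (simp add: case_prod_beta)
  also have "\<dots> = ps_one d" unfolding ps_one_def by (simp add: M_def weighted_len_def)
  finally show "ps_mult (poincare_series (quiver_algebra_graded Q))
      (ps_rescale fls_X_inv (poincare_series (graded_dual (koszul_dual_algebra_graded Q)))) d = ps_one d" .
qed

end

theorem theorem6p1:
  fixes Q :: "('v, 'e) pre_digraph"
  assumes "fin_digraph Q" and "symmetric_quiver Q"
  shows "ps_mult (poincare_series (quiver_algebra_graded Q))
           (ps_rescale fls_X_inv (poincare_series (graded_dual (koszul_dual_algebra_graded Q))))
         = ps_one"
  by (rule finite_symmetric_quiver.ps_mult_eq_one) (rule finite_symmetric_quiver.intro[OF assms])

end
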